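(* Let $\mathcal H,\mathcal K$ be finite-dimensional complex Hilbert spaces with $d=\dim\mathcal H>1$, let $\Phi:B(\mathcal H)\to B(\mathcal K)$ be an entanglement-breaking channel, and let $\operatorname{ebr}(\Phi)$ denote its entanglement-breaking rank. If $\operatorname{ebr}(\Phi)\le N(d)$, then $\Phi$ is not phase retrievable. Moreover, if $\Phi(\rho)=\sum_{i=1}^{\operatorname{ebr}(\Phi)}A_i\rho A_i^*$ is a rank-one Kraus representation of $\Phi$, where $A_i=|u_i\rangle\langle v_i|$ for $1\le i\le\operatorname{ebr}(\Phi)$, then the equality $$\operatorname{rank}\Bigl(\sum_{i=1}^{\operatorname{ebr}(\Phi)}A_i^{T}\otimes A_i^{*}\Bigr)=\sum_{i=1}^{\operatorname{ebr}(\Phi)}\operatorname{rank}(A_i)^2=\operatorname{ebr}(\Phi)$$ holds whenever the families $\{|u_i\rangle\langle u_i|:1\le i\le\operatorname{ebr}(\Phi)\}$ and $\{|v_i\rangle\langle v_i|:1\le i\le\operatorname{ebr}(\Phi)\}$ are both linearly independent.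
   Context: A quantum channel is a completely positive trace preserving linear map; a Kraus representation is an expression $\Phi(\rho)=\sum_i A_i\rho A_i^*$ with finitely many $A_i\in B(\mathcal H,\mathcal K)$. $\Phi^*(X)=\sum_i A_i^*XA_i$ is the Hilbert–Schmidt adjoint. For a unit vector $x$, $\rho_x=|x\rangle\langle x|$. A POVM on $\mathcal K$ is a finite family of positive semidefinite operators summing to $I_{\mathcal K}$. Transposes are taken with respect to fixed orthonormal bases of $\mathcal H$ and $\mathcal K$ (operators identified with matrices). Entanglement breaking: a quantum channel $\Phi$ is entanglement breaking if it admits a Kraus representation all of whose Kraus operators have rank one; the smallest possible number of Kraus operators in such a rank-one representation is the entanglement-breaking rank $\operatorname{ebr}(\Phi)$. Phase retrievable: there exists a POVM $\{F_j\}_{j=1}^{N}$ on $\mathcal K$ such that, for all unit vectors $x,y\in\mathcal H$, $\operatorname{Tr}(\rho_x\Phi^*(F_j))=\operatorname{Tr}(\rho_y\Phi^*(F_j))$ for all $j$ implies $\rho_x=\rho_y$. Definition of $N(d)$ for an integer $d>1$: let $\alpha$ be the number of $1$'s in the binary expansion of $d-1$ and $D=2d-2$. Then $N(d)=2D-2\alpha+2$ if $d$ is odd and $\alpha\equiv 3\pmod 4$; $N(d)=2D-2\alpha+1$ if $d$ is odd and $\alpha\equiv 2\pmod 4$; and $N(d)=2D-2\alpha$ otherwise. *)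

theory Defs
  imports "HOL-Analysis.Analysis" "HOL-Library.Nonpos_Ints"
begin

text \<open>
  The Hilbert spaces are identified with \<open>complex ^ 'h\<close> and \<open>complex ^ 'k\<close> through the fixed
  orthonormal bases, so that an operator from the first to the second is a matrix of type
  \<open>complex ^ 'h ^ 'k\<close>. The library inner product on these types is only the real part of the
  Hermitian one (the norms agree), hence the following definition, which is conjugate-linear
  in the first argument.
\<close>

definition cinner :: "complex ^ 'n \<Rightarrow> complex ^ 'n \<Rightarrow> complex" where
  "cinner x y = (\<Sum>i\<in>UNIV. cnj (x $ i) * y $ i)"

definition adj :: "complex ^ 'n ^ 'm \<Rightarrow> complex ^ 'm ^ 'n" where
  "adj A = map_matrix cnj (transpose A)"

definition ketbra :: "complex ^ 'm \<Rightarrow> complex ^ 'n \<Rightarrow> complex ^ 'n ^ 'm" where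
  "ketbra u v = (\<chi> i j. u $ i * cnj (v $ j))"

lemma ketbra_apply: "ketbra u v *v x = cinner v x *s u"
  by (simp add: vec_eq_iff matrix_vector_mult_def ketbra_def cinner_def sum_distrib_right sum_distrib_left mult_ac)

lemma cinner_adj: "cinner x (A *v y) = cinner (adj A *v x) y"
proof -
  have "cinner x (A *v y) = (\<Sum>i\<in>UNIV. \<Sum>j\<in>UNIV. cnj (x $ i) * (A $ i $ j * y $ j))"
    by (simp add: cinner_def matrix_vector_mult_def sum_distrib_left)
  also have "\<dots> = (\<Sum>j\<in>UNIV. \<Sum>i\<in>UNIV. cnj (x $ i) * (A $ i $ j * y $ j))"
    by (rule sum.swap)
  also have "\<dots> = cinner (adj A *v x) y"
    by (simp add: cinner_def matrix_vector_mult_def adj_def transpose_def sum_distrib_right sum_distrib_left mult_ac)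
  finally show ?thesis .
qed

definition kron :: "complex ^ 'n ^ 'm \<Rightarrow> complex ^ 'q ^ 'p \<Rightarrow> complex ^ ('n \<times> 'q) ^ ('m \<times> 'p)" where
  "kron A B = (\<chi> r c. A $ fst r $ fst c * B $ snd r $ snd c)"

text \<open>Matrices as a complex vector space; the library only provides the real scalar multiplication.\<close>

definition cscale :: "complex \<Rightarrow> complex ^ 'n ^ 'm \<Rightarrow> complex ^ 'n ^ 'm" where
  "cscale c A = map_matrix ((*) c) A"

global_interpretation cmat: vector_space "cscale :: complex \<Rightarrow> complex ^ 'n ^ 'm \<Rightarrow> complex ^ 'n ^ 'm"
  by standard (simp_all add: cscale_def vec_eq_iff algebra_simps)

definition independent_family :: "'i set \<Rightarrow> ('i \<Rightarrow> complex ^ 'n ^ 'm) \<Rightarrow> bool" where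
  "independent_family I M \<longleftrightarrow> inj_on M I \<and> cmat.independent (M ` I)"

definition psd :: "complex ^ 'n ^ 'n \<Rightarrow> bool" where
  "psd A \<longleftrightarrow> (\<forall>x. cinner x (A *v x) \<in> \<real>\<^sub>\<ge>\<^sub>0)"

text \<open>
  \<open>psd_block n X\<close>: the \<open>n \<times> n\<close> block matrix with operator entries \<open>X i j\<close> (\<open>i, j < n\<close>) is
  positive semidefinite as an operator on the \<open>n\<close>-fold direct sum of \<open>complex ^ 'n\<close>. The size is
  a natural number, not a type, because complete positivity quantifies over it.
\<close>

definition psd_block :: "nat \<Rightarrow> (nat \<Rightarrow> nat \<Rightarrow> complex ^ 'n ^ 'n) \<Rightarrow> bool" where
  "psd_block n X \<longleftrightarrow>
     (\<forall>\<xi>. (\<Sum>i<n. \<Sum>j<n. cinner (\<xi> i) (X i j *v \<xi> j)) \<in> \<real>\<^sub>\<ge>\<^sub>0)"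

definition completely_positive :: "(complex ^ 'h ^ 'h \<Rightarrow> complex ^ 'k ^ 'k) \<Rightarrow> bool" where
  "completely_positive \<Phi> \<longleftrightarrow> (\<forall>n X. psd_block n X \<longrightarrow> psd_block n (\<lambda>i j. \<Phi> (X i j)))"

definition quantum_channel :: "(complex ^ 'h ^ 'h \<Rightarrow> complex ^ 'k ^ 'k) \<Rightarrow> bool" where
  "quantum_channel \<Phi> \<longleftrightarrow>
     Vector_Spaces.linear cscale cscale \<Phi> \<and> completely_positive \<Phi> \<and>
     (\<forall>X. trace (\<Phi> X) = trace X)"

definition kraus_rep ::
  "(complex ^ 'h ^ 'h \<Rightarrow> complex ^ 'k ^ 'k) \<Rightarrow> nat \<Rightarrow> (nat \<Rightarrow> complex ^ 'h ^ 'k) \<Rightarrow> bool" where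
  "kraus_rep \<Phi> r A \<longleftrightarrow> (\<forall>X. \<Phi> X = (\<Sum>i<r. A i ** X ** adj (A i)))"

definition rank_one_kraus_rep ::
  "(complex ^ 'h ^ 'h \<Rightarrow> complex ^ 'k ^ 'k) \<Rightarrow> nat \<Rightarrow> (nat \<Rightarrow> complex ^ 'h ^ 'k) \<Rightarrow> bool" where
  "rank_one_kraus_rep \<Phi> r A \<longleftrightarrow> kraus_rep \<Phi> r A \<and> (\<forall>i<r. rank (A i) = 1)"

definition entanglement_breaking :: "(complex ^ 'h ^ 'h \<Rightarrow> complex ^ 'k ^ 'k) \<Rightarrow> bool" where
  "entanglement_breaking \<Phi> \<longleftrightarrow> quantum_channel \<Phi> \<and> (\<exists>r A. rank_one_kraus_rep \<Phi> r A)"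

definition ebr :: "(complex ^ 'h ^ 'h \<Rightarrow> complex ^ 'k ^ 'k) \<Rightarrow> nat" where
  "ebr \<Phi> = (LEAST r. \<exists>A. rank_one_kraus_rep \<Phi> r A)"

text \<open>
  The adjoint for the Hilbert--Schmidt inner product \<open>trace (adj X ** Y)\<close>; the lemma
  \<open>hs_adjoint_kraus\<close> gives its Kraus form.
\<close>

definition hs_adjoint ::
  "(complex ^ 'h ^ 'h \<Rightarrow> complex ^ 'k ^ 'k) \<Rightarrow> complex ^ 'k ^ 'k \<Rightarrow> complex ^ 'h ^ 'h" where
  "hs_adjoint \<Phi> = (THE \<Psi>. \<forall>X Y. trace (adj (\<Phi> X) ** Y) = trace (adj X ** \<Psi> Y))"

lemma adj_mult: "adj (A ** B) = adj B ** adj A"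
  by (simp add: adj_def matrix_matrix_mult_def transpose_def vec_eq_iff mult.commute)

lemma adj_adj [simp]: "adj (adj A) = A"
  by (simp add: adj_def transpose_def vec_eq_iff)

lemma adj_sum: "adj (sum f I) = (\<Sum>i\<in>I. adj (f i))"
  by (simp add: adj_def transpose_def vec_eq_iff)

lemma trace_adj_eqD:
  assumes "\<And>X. trace (adj X ** Y) = trace (adj X ** Z)"
  shows "Y = Z"
proof -
  have "Y $ i $ j = Z $ i $ j" for i j
  proof -
    let ?E = "\<chi> a b. if a = i \<and> b = j then 1 else (0::complex)"
    have "trace (adj ?E ** W) = W $ i $ j" for W
    proof -
      have "(adj ?E ** W) $ b $ b = (if b = j then W $ i $ j else 0)" for b
        by (auto simp: adj_def transpose_def matrix_matrix_mult_def if_distrib[of cnj]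
            if_distrib[of "\<lambda>x. x * _"] cong: if_cong)
      then show ?thesis by (simp add: trace_def)
    qed
    with assms[of ?E] show ?thesis by simp
  qed
  then show ?thesis by (simp add: vec_eq_iff)
qed

lemma trace_sum: "trace (sum f I) = (\<Sum>i\<in>I. trace (f i))"
  unfolding trace_def by (simp add: sum.swap[of _ I])

lemma matrix_mult_sum_left: "(sum f I :: complex ^ 'n ^ 'm) ** B = (\<Sum>i\<in>I. f i ** B)"
  by (induction I rule: infinite_finite_induct)
     (auto simp: matrix_matrix_mult_def vec_eq_iff sum.distrib algebra_simps)

lemma matrix_mult_sum_right: "(B :: complex ^ 'n ^ 'm) ** sum f I = (\<Sum>i\<in>I. B ** f i)"
  by (induction I rule: infinite_finite_induct)
     (auto simp: matrix_matrix_mult_def vec_eq_iff sum.distrib algebra_simps)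

lemma hs_adjoint_kraus:
  assumes "kraus_rep \<Phi> r A"
  shows "hs_adjoint \<Phi> Y = (\<Sum>i<r. adj (A i) ** Y ** A i)"
proof -
  define \<Psi> where "\<Psi> = (\<lambda>Y. \<Sum>i<r. adj (A i) ** Y ** A i)"
  have *: "trace (adj (\<Phi> X) ** Y) = trace (adj X ** \<Psi> Y)" for X Y
  proof -
    have "trace (adj (\<Phi> X) ** Y) = (\<Sum>i<r. trace (A i ** (adj X ** adj (A i) ** Y)))"
      using assms by (simp add: kraus_rep_def adj_sum adj_mult matrix_mult_sum_left trace_sum
          matrix_mul_assoc)
    also have "\<dots> = (\<Sum>i<r. trace (adj X ** adj (A i) ** Y ** A i))"
      by (subst trace_mul_sym) simp
    also have "\<dots> = trace (adj X ** \<Psi> Y)"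
      by (simp add: \<Psi>_def matrix_mult_sum_right trace_sum matrix_mul_assoc)
    finally show ?thesis .
  qed
  have "hs_adjoint \<Phi> = \<Psi>"
    unfolding hs_adjoint_def
  proof (rule the_equality)
    show "\<forall>X Y. trace (adj (\<Phi> X) ** Y) = trace (adj X ** \<Psi> Y)"
      using * by blast
    fix \<Psi>' assume "\<forall>X Y. trace (adj (\<Phi> X) ** Y) = trace (adj X ** \<Psi>' Y)"
    then have "\<And>X Y. trace (adj X ** \<Psi>' Y) = trace (adj X ** \<Psi> Y)"
      using * by metis
    then show "\<Psi>' = \<Psi>"
      by (intro ext trace_adj_eqD)
  qed
  then show ?thesis by (simp add: \<Psi>_def)
qed

definition povm :: "nat \<Rightarrow> (nat \<Rightarrow> complex ^ 'k ^ 'k) \<Rightarrow> bool" where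
  "povm N F \<longleftrightarrow> (\<forall>j<N. psd (F j)) \<and> (\<Sum>j<N. F j) = mat 1"

definition phase_retrievable :: "(complex ^ 'h ^ 'h \<Rightarrow> complex ^ 'k ^ 'k) \<Rightarrow> bool" where
  "phase_retrievable \<Phi> \<longleftrightarrow>
     (\<exists>N F. povm N F \<and>
        (\<forall>x y. norm x = 1 \<longrightarrow> norm y = 1 \<longrightarrow>
           (\<forall>j<N. trace (ketbra x x ** hs_adjoint \<Phi> (F j)) =
                  trace (ketbra y y ** hs_adjoint \<Phi> (F j))) \<longrightarrow>
           ketbra x x = ketbra y y))"

definition binary_ones :: "nat \<Rightarrow> nat" where
  "binary_ones n = card {k. bit n k}"

text \<open>
  For \<open>d > 1\<close> the natural-number subtractions below do not truncate, since
  \<open>binary_ones (d - 1) \<le> d - 1\<close>.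
\<close>

definition N_bound :: "nat \<Rightarrow> nat" where
  "N_bound d =
     (let \<alpha> = binary_ones (d - 1); D = 2 * d - 2
      in if odd d \<and> \<alpha> mod 4 = 3 then 2 * D - 2 * \<alpha> + 2
         else if odd d \<and> \<alpha> mod 4 = 2 then 2 * D - 2 * \<alpha> + 1
         else 2 * D - 2 * \<alpha>)"

end

theory Submission
  imports Defs "HOL-Computational_Algebra.Formal_Power_Series" "HOL-Computational_Algebra.Polynomial"
begin

text \<open>
  Let the Kraus operators be \<open>ketbra (u i) (v i)\<close>. Polarization shows that \<open>\<Phi>\<close> is not phase
  retrievable if the real parts of the forms \<open>cinner (v i) x * cnj (cinner (v i) y)\<close> and the number
  \<open>Im (cinner x y)\<close> vanish for some nonzero \<open>x\<close> and \<open>y\<close>. With \<open>z = cnj y\<close> these are real parts of bilinear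
  forms \<open>L\<^sub>l (x, z)\<close> on a product of two spheres. If they have no common zero, then
  \<open>\<bar>\<Sum> L\<^sub>l\<^sup>2\<bar> < \<Sum> \<bar>L\<^sub>l\<bar>\<^sup>2\<close> everywhere, since \<open>x\<close> may be multiplied by a phase, and with Clifford matrices
  \<open>\<gamma>\<^sub>l\<close> the symbol \<open>C = \<Sum> L\<^sub>l \<gamma>\<^sub>l\<close> is elliptic.

  The classical obstruction to such a symbol lies in K-theory. It is replaced here by linear algebra:
  the Hermitian symbol \<open>\<Omega> = (\<Sum> \<bar>L\<^sub>l\<bar>\<^sup>2 - C\<^sup>* C) / 2\<close> defines a form on the polynomials of bidegree \<open>(k, k)\<close>,
  with a finite quadrature in place of the integral over the spheres. Let \<open>z\<^sub>k\<close> be its number of positive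
  squares. Multiplication by \<open>C\<close> shows that \<open>z\<^sub>k + z\<^sub>k\<^sub>+\<^sub>1\<close> is the dimension in degree \<open>k\<close>, and a Koszul complex
  shows that an alternating sum of \<open>2 z\<^sub>k\<close> and these dimensions vanishes. So \<open>z\<^sub>k\<close> agrees for large \<open>k\<close> with an
  explicit polynomial in \<open>k\<close>, which therefore has integer values at all \<open>k\<close>. Its value at \<open>k = 0\<close> is a central
  binomial coefficient up to sign and a power of 2, and is not an integer. If \<open>d\<close> is odd and \<open>\<alpha> mod 4 = 3\<close>, the
  value is an odd integer, but a quaternionic structure makes all \<open>z\<^sub>k\<close> even.
\<close>

subsection \<open>Hermitian forms on finite index sets\<close>

text \<open>The constants come from 2-adic valuations. For 2 m + 1 forms on the unit spheres of C^(n
  + 1) and C^(n' + 1) the value at k = 0 is 2^m / 2^(n + n' + 1) times the coefficient of t^n' in (1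
  + t)^n' (1 - t)^n. In general y is confined to the orthogonal complement of one Kraus vector, so n
  = d - 1 and n' = d - 2; the coefficient is not divisible by 2^\<alpha>, and m = 2 (d - 1) -
  \<alpha> makes the value nonintegral. In the quaternionic case both spheres are kept, n = n' = d -
  1, the coefficient is not divisible by 2^(\<alpha> + 1), and m = 2 (d - 1) + 1 - \<alpha>. The
  main obstacle is that multiplication by a conjugate coordinate maps polynomials to polynomials
  only up to an error that vanishes in high degree, so symbols multiply only asymptotically. What
  survives is integer data: an elliptic symbol gives a nondegenerate form in all large degrees, and
  along an elliptic path the number of positive squares cannot jump.\<close>

definition hform :: "'a set \<Rightarrow> ('a \<Rightarrow> 'a \<Rightarrow> complex) \<Rightarrow> ('a \<Rightarrow> complex) \<Rightarrow> ('a \<Rightarrow> complex) \<Rightarrow> complex" where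
  "hform I h u v = (\<Sum>a\<in>I. \<Sum>b\<in>I. cnj (u a) * h a b * v b)"

definition hermitian_on :: "'a set \<Rightarrow> ('a \<Rightarrow> 'a \<Rightarrow> complex) \<Rightarrow> bool" where
  "hermitian_on I h \<longleftrightarrow> (\<forall>a\<in>I. \<forall>b\<in>I. h b a = cnj (h a b))"

definition nondeg :: "'a set \<Rightarrow> ('a \<Rightarrow> 'a \<Rightarrow> complex) \<Rightarrow> bool" where
  "nondeg I h \<longleftrightarrow> (\<forall>v. (\<exists>a\<in>I. v a \<noteq> 0) \<longrightarrow> (\<exists>u. hform I h u v \<noteq> 0))"

definition lincomb :: "'i set \<Rightarrow> ('i \<Rightarrow> 'a \<Rightarrow> complex) \<Rightarrow> ('i \<Rightarrow> complex) \<Rightarrow> 'a \<Rightarrow> complex" where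
  "lincomb K v c = (\<lambda>a. \<Sum>i\<in>K. c i * v i a)"

text \<open>Says that the form is positive definite on a space of dimension k. Strict positivity on
  every nontrivial combination forces independence on I, so no dimension of a space of functions on
  I has to be mentioned.\<close>

definition positive_family :: "'a set \<Rightarrow> ('a \<Rightarrow> 'a \<Rightarrow> complex) \<Rightarrow> nat \<Rightarrow> bool" where
  "positive_family I h k \<longleftrightarrow> (\<exists>(K :: nat set) v. finite K \<and> card K = k \<and>
     (\<forall>c. (\<exists>i\<in>K. c i \<noteq> 0) \<longrightarrow> Re (hform I h (lincomb K v c) (lincomb K v c)) > 0))"

text \<open>The number \<open>k\<close> of positive squares of a nondegenerate form; it is unique by \<open>inertia_unique\<close>.\<close>

definition inertia :: "'a set \<Rightarrow> ('a \<Rightarrow> 'a \<Rightarrow> complex) \<Rightarrow> nat \<Rightarrow> bool" where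
  "inertia I h k \<longleftrightarrow> k \<le> card I \<and> positive_family I h k \<and> positive_family I (\<lambda>a b. - h a b) (card I - k)"

lemma cnj_mult_self: "cnj z * z = of_real ((cmod z)\<^sup>2)"
  by (metis complex_norm_square mult.commute)

lemma hform_cong:
  assumes "\<And>a. a \<in> I \<Longrightarrow> u a = u' a" "\<And>a. a \<in> I \<Longrightarrow> v a = v' a"
    "\<And>a b. a \<in> I \<Longrightarrow> b \<in> I \<Longrightarrow> h a b = h' a b"
  shows "hform I h u v = hform I h' u' v'"
  unfolding hform_def using assms by (intro sum.cong) auto

lemma hform_add_right: "hform I h u (\<lambda>a. v a + w a) = hform I h u v + hform I h u w"
  by (simp add: hform_def algebra_simps sum.distrib)

lemma hform_add_left: "hform I h (\<lambda>a. v a + w a) u = hform I h v u + hform I h w u"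
  by (simp add: hform_def algebra_simps sum.distrib)

lemma hform_diff_right: "hform I h u (\<lambda>a. v a - w a) = hform I h u v - hform I h u w"
  by (simp add: hform_def algebra_simps sum_subtractf)

lemma hform_scale_right: "hform I h u (\<lambda>a. c * v a) = c * hform I h u v"
  by (simp add: hform_def sum_distrib_left mult_ac)

lemma hform_scale_left: "hform I h (\<lambda>a. c * v a) u = cnj c * hform I h v u"
  by (simp add: hform_def sum_distrib_left mult_ac)

lemma hform_minus_right: "hform I h u (\<lambda>a. - v a) = - hform I h u v"
  by (simp add: hform_def sum_negf)

lemma hform_minus_left: "hform I h (\<lambda>a. - v a) u = - hform I h v u"
  by (simp add: hform_def sum_negf)

lemma hform_minus_form: "hform I (\<lambda>a b. - h a b) u v = - hform I h u v"
  by (simp add: hform_def sum_negf)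

lemma hform_lincomb_right: "hform I h u (lincomb K v c) = (\<Sum>i\<in>K. c i * hform I h u (v i))"
proof -
  have "hform I h u (lincomb K v c) = (\<Sum>a\<in>I. \<Sum>b\<in>I. \<Sum>i\<in>K. c i * (cnj (u a) * h a b * v i b))"
    by (simp add: hform_def lincomb_def sum_distrib_left mult_ac)
  also have "\<dots> = (\<Sum>i\<in>K. \<Sum>a\<in>I. \<Sum>b\<in>I. c i * (cnj (u a) * h a b * v i b))"
    by (simp only: sum.swap[of _ K I])
  finally show ?thesis
    by (simp add: hform_def sum_distrib_left)
qed

lemma hform_lincomb_left: "hform I h (lincomb K v c) u = (\<Sum>i\<in>K. cnj (c i) * hform I h (v i) u)"
proof -
  have "hform I h (lincomb K v c) u = (\<Sum>a\<in>I. \<Sum>b\<in>I. \<Sum>i\<in>K. cnj (c i) * (cnj (v i a) * h a b * u b))"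
    by (simp add: hform_def lincomb_def sum_distrib_left sum_distrib_right mult_ac)
  also have "\<dots> = (\<Sum>i\<in>K. \<Sum>a\<in>I. \<Sum>b\<in>I. cnj (c i) * (cnj (v i a) * h a b * u b))"
    by (simp only: sum.swap[of _ K I])
  finally show ?thesis
    by (simp add: hform_def sum_distrib_left)
qed

lemma hform_lincomb:
  "hform I h (lincomb K v c) (lincomb K v c) = (\<Sum>i\<in>K. \<Sum>j\<in>K. cnj (c i) * c j * hform I h (v i) (v j))"
  by (subst hform_lincomb_left) (simp add: hform_lincomb_right sum_distrib_left mult_ac)

lemma hform_cnj:
  assumes "hermitian_on I h"
  shows "hform I h v u = cnj (hform I h u v)"
proof -
  have "cnj (hform I h u v) = (\<Sum>a\<in>I. \<Sum>b\<in>I. u a * cnj (h a b) * cnj (v b))"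
    by (simp add: hform_def)
  also have "\<dots> = (\<Sum>a\<in>I. \<Sum>b\<in>I. u a * h b a * cnj (v b))"
  proof (intro sum.cong refl)
    fix a b assume "a \<in> I" "b \<in> I"
    then have "cnj (h a b) = h b a" using assms unfolding hermitian_on_def by metis
    then show "u a * cnj (h a b) * cnj (v b) = u a * h b a * cnj (v b)" by simp
  qed
  also have "\<dots> = (\<Sum>b\<in>I. \<Sum>a\<in>I. u a * h b a * cnj (v b))"
    by (rule sum.swap)
  finally show ?thesis by (simp add: hform_def mult_ac)
qed

text \<open>Gaussian elimination: an equation with a nonzero coefficient at \<open>b0\<close> is
  solved for that unknown, which is then eliminated from the other equations.\<close>

lemma linear_system_nontrivial:
  fixes c :: "'e \<Rightarrow> 'a \<Rightarrow> complex"
  assumes "finite E" "finite I" "card E < card I"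
  shows "\<exists>u. (\<exists>a\<in>I. u a \<noteq> 0) \<and> (\<forall>e\<in>E. (\<Sum>b\<in>I. c e b * u b) = 0)"
  using assms
proof (induction E arbitrary: I c rule: finite_induct)
  case empty
  then obtain a where "a \<in> I" by fastforce
  then show ?case by (intro exI[of _ "\<lambda>_. 1"]) auto
next
  case (insert e E)
  show ?case
  proof (cases "\<forall>b\<in>I. c e b = 0")
    case True
    with insert.IH[of I c] insert.prems insert.hyps show ?thesis by auto
  next
    case False
    then obtain b0 where b0: "b0 \<in> I" "c e b0 \<noteq> 0" by auto
    define J where "J = I - {b0}"
    have J: "finite J" "card E < card J"
      using insert b0 by (auto simp: J_def)
    obtain u where u: "\<exists>a\<in>J. u a \<noteq> 0"
      "\<forall>e'\<in>E. (\<Sum>b\<in>J. (c e' b - c e' b0 * c e b / c e b0) * u b) = 0"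
      using insert.IH[OF J, of "\<lambda>e' b. c e' b - c e' b0 * c e b / c e b0"] by auto
    define w where "w = (\<lambda>b. if b = b0 then - (\<Sum>b\<in>J. c e b * u b) / c e b0 else u b)"
    have split: "(\<Sum>b\<in>I. f b * w b) = f b0 * w b0 + (\<Sum>b\<in>J. f b * u b)" for f :: "'a \<Rightarrow> complex"
    proof -
      have "(\<Sum>b\<in>I. f b * w b) = f b0 * w b0 + (\<Sum>b\<in>J. f b * w b)"
        unfolding J_def using insert.prems b0 by (simp add: sum.remove)
      also have "(\<Sum>b\<in>J. f b * w b) = (\<Sum>b\<in>J. f b * u b)"
        by (intro sum.cong) (auto simp: w_def J_def)
      finally show ?thesis .
    qed
    have "(\<Sum>b\<in>I. c e b * w b) = 0"
      unfolding split using b0 by (simp add: w_def)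
    moreover have "(\<Sum>b\<in>I. c e' b * w b) = 0" if "e' \<in> E" for e'
    proof -
      have "0 = (\<Sum>b\<in>J. (c e' b - c e' b0 * c e b / c e b0) * u b)"
        using u(2) that by simp
      also have "\<dots> = (\<Sum>b\<in>J. c e' b * u b) - (\<Sum>b\<in>J. c e' b0 / c e b0 * (c e b * u b))"
        by (simp add: algebra_simps sum_subtractf)
      also have "(\<Sum>b\<in>J. c e' b0 / c e b0 * (c e b * u b)) = c e' b0 / c e b0 * (\<Sum>b\<in>J. c e b * u b)"
        by (simp add: sum_distrib_left)
      finally show ?thesis unfolding split by (simp add: w_def)
    qed
    moreover have "\<exists>a\<in>I. w a \<noteq> 0"
      using u(1) by (auto simp: w_def J_def)
    ultimately show ?thesis by blast
  qed
qed

text \<open>If the two families together had more than \<open>card I\<close> members, a linear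
  relation would produce a vector p = - q lying in both spaces, where the form would be positive and
  negative at once.\<close>

lemma positive_family_add_le:
  assumes "finite I" "positive_family I h k" "positive_family I (\<lambda>a b. - h a b) l"
  shows "k + l \<le> card I"
proof (rule ccontr)
  assume less: "\<not> k + l \<le> card I"
  obtain K :: "nat set" and v where K: "finite K" "card K = k"
    "\<And>c. \<exists>i\<in>K. c i \<noteq> 0 \<Longrightarrow> Re (hform I h (lincomb K v c) (lincomb K v c)) > 0"
    using assms(2) unfolding positive_family_def by blast
  obtain L :: "nat set" and w where L: "finite L" "card L = l"
    "\<And>c. \<exists>i\<in>L. c i \<noteq> 0 \<Longrightarrow> Re (hform I (\<lambda>a b. - h a b) (lincomb L w c) (lincomb L w c)) > 0"
    using assms(3) unfolding positive_family_def by blast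
  have card: "card I < card (K <+> L)"
    using K L less by (simp add: card_Plus)
  have fin: "finite (K <+> L)" using K L by simp
  obtain c :: "nat + nat \<Rightarrow> complex" where c: "\<exists>i\<in>K <+> L. c i \<noteq> 0"
    "\<forall>a\<in>I. (\<Sum>i\<in>K <+> L. (case i of Inl i \<Rightarrow> v i a | Inr i \<Rightarrow> w i a) * c i) = 0"
    using linear_system_nontrivial[OF assms(1) fin card, of "\<lambda>a i. case i of Inl i \<Rightarrow> v i a | Inr i \<Rightarrow> w i a"]
    by blast
  define p where "p = lincomb K v (\<lambda>i. c (Inl i))"
  define q where "q = lincomb L w (\<lambda>i. c (Inr i))"
  have pq: "p a = - q a" if "a \<in> I" for a
    using c(2) that K L by (simp add: sum.Plus p_def q_def lincomb_def mult.commute eq_neg_iff_add_eq_0)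
  have "hform I h p p = hform I h (\<lambda>a. - q a) (\<lambda>a. - q a)"
    by (intro hform_cong) (auto simp: pq)
  then have eq: "hform I h p p = hform I h q q"
    by (simp add: hform_minus_left hform_minus_right)
  have p: "Re (hform I h p p) > 0 \<or> (\<forall>i\<in>K. c (Inl i) = 0)"
    using K(3)[of "\<lambda>i. c (Inl i)"] unfolding p_def by blast
  have q: "Re (hform I h q q) < 0 \<or> (\<forall>i\<in>L. c (Inr i) = 0)"
    using L(3)[of "\<lambda>i. c (Inr i)"] unfolding q_def hform_minus_form by auto
  have p0: "hform I h p p = 0" if "\<forall>i\<in>K. c (Inl i) = 0"
    using that by (simp add: p_def hform_lincomb_left)
  have q0: "hform I h q q = 0" if "\<forall>i\<in>L. c (Inr i) = 0"
    using that by (simp add: q_def hform_lincomb_left)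
  have "\<not> ((\<forall>i\<in>K. c (Inl i) = 0) \<and> (\<forall>i\<in>L. c (Inr i) = 0))"
    using c(1) by auto
  with p q p0 q0 eq show False by auto
qed

lemma inertia_unique:
  assumes "finite I" "inertia I h k" "inertia I h l"
  shows "k = l"
proof -
  have "k + (card I - l) \<le> card I" "l + (card I - k) \<le> card I"
    using assms positive_family_add_le[of I h] unfolding inertia_def by blast+
  then show ?thesis using assms unfolding inertia_def by linarith
qed

lemma inertia_uminus: "inertia I h k \<Longrightarrow> inertia I (\<lambda>a b. - h a b) (card I - k)"
  by (simp add: inertia_def)

section \<open>Orthonormal families with signs and the law of inertia\<close>

definition orthofam :: "'a set \<Rightarrow> ('a \<Rightarrow> 'a \<Rightarrow> complex) \<Rightarrow> nat \<Rightarrow> (nat \<Rightarrow> 'a \<Rightarrow> complex) \<Rightarrow> (nat \<Rightarrow> real) \<Rightarrow> bool" where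
  "orthofam I h t v s \<longleftrightarrow> (\<forall>i<t. s i = 1 \<or> s i = -1) \<and>
     (\<forall>i<t. \<forall>j<t. hform I h (v i) (v j) = (if i = j then of_real (s i) else 0))"

lemma orthofam_positive_family:
  assumes "orthofam I h t v s" "K \<subseteq> {..<t}" "\<And>i. i \<in> K \<Longrightarrow> s i = 1"
  shows "positive_family I h (card K)"
  unfolding positive_family_def
proof (intro exI conjI allI impI)
  show fin: "finite K" using assms(2) finite_subset by blast
  show "card K = card K" ..
  fix c :: "nat \<Rightarrow> complex" assume c: "\<exists>i\<in>K. c i \<noteq> 0"
  have "hform I h (lincomb K v c) (lincomb K v c) = (\<Sum>i\<in>K. \<Sum>j\<in>K. cnj (c i) * c j * (if i = j then 1 else 0))"
    unfolding hform_lincomb using assms unfolding orthofam_def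
    by (intro sum.cong refl) (auto simp: subset_eq)
  also have "\<dots> = (\<Sum>i\<in>K. of_real ((cmod (c i))\<^sup>2))"
    using fin by (intro sum.cong refl) (auto simp: cnj_mult_self if_distrib cong: if_cong)
  finally have "Re (hform I h (lincomb K v c) (lincomb K v c)) = (\<Sum>i\<in>K. (cmod (c i))\<^sup>2)"
    by simp
  also have "\<dots> > 0"
    using c fin by (auto intro!: sum_pos2)
  finally show "Re (hform I h (lincomb K v c) (lincomb K v c)) > 0" .
qed

lemma orthofam_uminus: "orthofam I h t v s \<Longrightarrow> orthofam I (\<lambda>a b. - h a b) t v (\<lambda>i. - s i)"
  unfolding orthofam_def hform_minus_form by auto

lemma orthofam_card_le:
  assumes "finite I" "orthofam I h t v s"
  shows "t \<le> card I"
proof -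
  have "positive_family I h (card {i\<in>{..<t}. s i = 1})"
    by (rule orthofam_positive_family[OF assms(2)]) auto
  moreover have "positive_family I (\<lambda>a b. - h a b) (card {i\<in>{..<t}. s i = -1})"
    by (rule orthofam_positive_family[OF orthofam_uminus[OF assms(2)]]) auto
  ultimately have "card {i\<in>{..<t}. s i = 1} + card {i\<in>{..<t}. s i = -1} \<le> card I"
    by (rule positive_family_add_le[OF assms(1)])
  moreover have "card {i\<in>{..<t}. s i = 1} + card {i\<in>{..<t}. s i = -1}
      = card ({i\<in>{..<t}. s i = 1} \<union> {i\<in>{..<t}. s i = -1})"
    by (rule card_Un_disjoint[symmetric]) auto
  moreover have "{i\<in>{..<t}. s i = 1} \<union> {i\<in>{..<t}. s i = -1} = {..<t}"
    using assms(2) unfolding orthofam_def by auto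
  ultimately show ?thesis by simp
qed

lemma orthofam_inertia:
  assumes "finite I" "orthofam I h (card I) v s"
  shows "inertia I h (card {i. i < card I \<and> s i = 1})"
proof -
  define K where "K = {i. i < card I \<and> s i = 1}"
  have K: "K \<subseteq> {..<card I}" by (auto simp: K_def)
  then have le: "card K \<le> card I" using card_mono[OF _ K] by simp
  have "positive_family I h (card K)"
    by (rule orthofam_positive_family[OF assms(2) K]) (auto simp: K_def)
  moreover have "positive_family I (\<lambda>a b. - h a b) (card ({..<card I} - K))"
    using assms(2) by (intro orthofam_positive_family[OF orthofam_uminus[OF assms(2)]])
      (auto simp: K_def orthofam_def)
  moreover have "card ({..<card I} - K) = card I - card K"
    using K by (subst card_Diff_subset) (auto intro: finite_subset)
  ultimately show ?thesis using le unfolding inertia_def K_def by simp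
qed

text \<open>Fewer equations than unknowns give a u orthogonal to the family, and nondegeneracy gives
  a w that pairs with u. After projecting w, both lie in the orthogonal complement, where by
  polarization some vector is not isotropic; it is rescaled.\<close>

lemma orthofam_extend:
  assumes fin: "finite I" and herm: "hermitian_on I h" and nd: "nondeg I h"
    and fam: "orthofam I h t v s" and less: "t < card I"
  shows "\<exists>x r. (r = 1 \<or> r = -1) \<and> hform I h x x = of_real r \<and> (\<forall>i<t. hform I h (v i) x = 0)"
proof -
  have "card {..<t} < card I" using less by simp
  from linear_system_nontrivial[OF _ fin this, of "\<lambda>i b. \<Sum>a\<in>I. cnj (v i a) * h a b"]
  obtain u where u: "\<exists>a\<in>I. u a \<noteq> 0" "\<forall>i<t. (\<Sum>b\<in>I. (\<Sum>a\<in>I. cnj (v i a) * h a b) * u b) = 0"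
    by auto
  have uo: "hform I h (v i) u = 0" if "i < t" for i
  proof -
    have "hform I h (v i) u = (\<Sum>b\<in>I. (\<Sum>a\<in>I. cnj (v i a) * h a b) * u b)"
      unfolding hform_def by (subst sum.swap) (simp add: sum_distrib_right)
    with u that show ?thesis by simp
  qed
  obtain w where w: "hform I h w u \<noteq> 0" using nd u(1) unfolding nondeg_def by blast
  \<comment> \<open>Each sign is its own inverse, so these are the coefficients of the projection
    onto the family.\<close>
  define w' where "w' = (\<lambda>a. w a - lincomb {..<t} v (\<lambda>i. of_real (s i) * hform I h (v i) w) a)"
  have ss: "s i * s i = 1" if "i < t" for i
    using fam that unfolding orthofam_def by fastforce
  have w'o: "hform I h (v i) w' = 0" if i: "i < t" for i
  proof -
    have "hform I h (v i) w' = hform I h (v i) w - (\<Sum>j<t. of_real (s j) * hform I h (v j) w * hform I h (v i) (v j))"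
      unfolding w'_def hform_diff_right hform_lincomb_right ..
    also have "(\<Sum>j<t. of_real (s j) * hform I h (v j) w * hform I h (v i) (v j))
       = (\<Sum>j<t. if j = i then of_real (s i) * of_real (s i) * hform I h (v i) w else 0)"
      using fam i unfolding orthofam_def by (intro sum.cong) auto
    also have "\<dots> = hform I h (v i) w"
      using i ss[OF i] by (simp flip: of_real_mult)
    finally show ?thesis by simp
  qed
  have w'u: "hform I h w' u = hform I h w u"
  proof -
    have "hform I h u w' = hform I h u w - (\<Sum>j<t. of_real (s j) * hform I h (v j) w * hform I h u (v j))"
      unfolding w'_def hform_diff_right hform_lincomb_right ..
    also have "(\<Sum>j<t. of_real (s j) * hform I h (v j) w * hform I h u (v j)) = 0"
      using uo hform_cnj[OF herm, of u] by (intro sum.neutral) auto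
    finally show ?thesis using hform_cnj[OF herm, of w' u] hform_cnj[OF herm, of w u] by simp
  qed
  have "\<exists>x. hform I h x x \<noteq> 0 \<and> (\<forall>i<t. hform I h (v i) x = 0)"
  proof (rule ccontr)
    assume no: "\<not> ?thesis"
    have 1: "hform I h u u = 0" "hform I h w' w' = 0" using no uo w'o by blast+
    have o1: "\<forall>i<t. hform I h (v i) (\<lambda>a. u a + w' a) = 0"
      by (simp add: hform_add_right uo w'o)
    have "hform I h (\<lambda>a. u a + w' a) (\<lambda>a. u a + w' a) = 0"
      using no o1 by blast
    then have 2: "hform I h u w' + hform I h w' u = 0"
      using 1 by (simp add: hform_add_left hform_add_right)
    have o2: "\<forall>i<t. hform I h (v i) (\<lambda>a. u a + \<i> * w' a) = 0"
      by (simp add: hform_add_right hform_scale_right uo w'o)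
    have "hform I h (\<lambda>a. u a + \<i> * w' a) (\<lambda>a. u a + \<i> * w' a) = 0"
      using no o2 by blast
    then have 3: "\<i> * hform I h u w' - \<i> * hform I h w' u = 0"
      using 1 by (simp add: hform_add_left hform_add_right hform_scale_left hform_scale_right)
    then have "hform I h u w' = hform I h w' u" by simp
    with 2 w w'u show False by simp
  qed
  then obtain x where x: "hform I h x x \<noteq> 0" "\<forall>i<t. hform I h (v i) x = 0" by blast
  define q where "q = Re (hform I h x x)"
  have q: "hform I h x x = of_real q"
    using hform_cnj[OF herm, of x x] by (auto simp: q_def complex_eq_iff)
  have q0: "q \<noteq> 0" using x q by auto
  define k where "k = 1 / sqrt \<bar>q\<bar>"
  have "hform I h (\<lambda>a. of_real k * x a) (\<lambda>a. of_real k * x a) = of_real (k * k * q)"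
    by (simp add: hform_scale_left hform_scale_right q)
  moreover have "k * k * q = sgn q"
    using q0 by (simp add: k_def field_simps real_sgn_eq flip: real_sqrt_mult)
  moreover have "\<forall>i<t. hform I h (v i) (\<lambda>a. of_real k * x a) = 0"
    using x by (simp add: hform_scale_right)
  moreover have "sgn q = 1 \<or> sgn q = -1" using q0 by (simp add: sgn_if)
  ultimately show ?thesis by metis
qed

lemma orthofam_Suc:
  assumes "hermitian_on I h" "orthofam I h t v s" "r = 1 \<or> r = -1" "hform I h x x = of_real r"
    "\<forall>i<t. hform I h (v i) x = 0"
  shows "orthofam I h (Suc t) (v(t := x)) (s(t := r))"
proof -
  have "hform I h x (v i) = 0" if "i < t" for i
    using hform_cnj[OF assms(1), of x "v i"] assms(5) that by simp
  with assms(2-5) show ?thesis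
    unfolding orthofam_def by (auto simp: less_Suc_eq)
qed

lemma orthofam_complete:
  assumes fin: "finite I" and herm: "hermitian_on I h" and nd: "nondeg I h"
  shows "\<exists>v s. orthofam I h (card I) v s"
proof -
  have "t \<le> card I \<Longrightarrow> \<exists>v s. orthofam I h t v s" for t
  proof (induction t)
    case 0
    show ?case by (simp add: orthofam_def)
  next
    case (Suc t)
    then obtain v s where vs: "orthofam I h t v s" by auto
    with orthofam_extend[OF fin herm nd vs] Suc orthofam_Suc[OF herm vs]
    show ?case by (metis Suc_le_eq)
  qed
  then show ?thesis by blast
qed

lemma inertia_exists:
  assumes "finite I" "hermitian_on I h" "nondeg I h"
  shows "\<exists>k. inertia I h k"
  using orthofam_complete[OF assms] orthofam_inertia[OF assms(1)] by blast

text \<open>A quaternionic structure \<open>J\<close> pairs the vectors of a complete orthogonal family.\<close>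

lemma inertia_even:
  assumes fin: "finite I" and herm: "hermitian_on I h" and nd: "nondeg I h"
    and J: "\<And>u v. hform I h (J u) (J v) = cnj (hform I h u v)"
    and JJ: "\<And>u a. a \<in> I \<Longrightarrow> J (J u) a = - u a"
    and k: "inertia I h k"
  shows "even k"
proof -
  have JJl: "hform I h (J (J u)) w = - hform I h u w" for u w
  proof -
    have "hform I h (J (J u)) w = hform I h (\<lambda>a. - u a) w"
      by (intro hform_cong) (auto simp: JJ)
    then show ?thesis by (simp add: hform_minus_left)
  qed
  have ex: "\<exists>v s. orthofam I h (2 * t) v s \<and>
      (\<forall>i<t. v (2 * i + 1) = J (v (2 * i)) \<and> s (2 * i + 1) = s (2 * i))" if "2 * t < card I + 2" for t
    using that
  proof (induction t)
    case 0
    show ?case by (simp add: orthofam_def)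
  next
    case (Suc t)
    then obtain v s where vs: "orthofam I h (2 * t) v s"
      "\<And>i. i < t \<Longrightarrow> v (2 * i + 1) = J (v (2 * i)) \<and> s (2 * i + 1) = s (2 * i)"
      by auto
    have "2 * t < card I" using Suc.prems by simp
    from orthofam_extend[OF fin herm nd vs(1) this] obtain x r where
      x: "r = 1 \<or> r = -1" "hform I h x x = of_real r" "\<forall>i<2*t. hform I h (v i) x = 0"
      by blast
    define v' where "v' = v(2*t := x)"
    define s' where "s' = s(2*t := r)"
    have vs': "orthofam I h (Suc (2 * t)) v' s'"
      unfolding v'_def s'_def by (rule orthofam_Suc[OF herm vs(1) x])
    have JxJx: "hform I h (J x) (J x) = of_real r" using J x by simp
    \<comment> \<open>J is antiunitary for h with square -1, so x and J x are orthogonal: the value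
      equals its own negative.\<close>
    have "hform I h x (J x) = - hform I h (J (J x)) (J x)" by (simp add: JJl)
    also have "\<dots> = - cnj (hform I h (J x) x)" by (simp add: J)
    also have "\<dots> = - hform I h x (J x)" using hform_cnj[OF herm, of x "J x"] by simp
    finally have xJx: "hform I h x (J x) = 0"
      by (auto simp: complex_eq_iff)
    have "hform I h (v i) (J x) = 0" if "i < 2 * t" for i
    proof (cases "even i")
      case True
      then obtain j where j: "i = 2 * j" by auto
      have "hform I h (v i) (J x) = - hform I h (J (v (2 * j + 1))) (J x)"
        using vs(2)[of j] that j by (simp add: JJl)
      also have "\<dots> = - cnj (hform I h (v (2 * j + 1)) x)" by (simp add: J)
      finally show ?thesis using x(3) that j by simp
    next
      case False
      then obtain j where j: "i = 2 * j + 1" by (auto elim: oddE)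
      have "hform I h (v i) (J x) = hform I h (J (v (2 * j))) (J x)"
        using vs(2)[of j] that j by simp
      then show ?thesis using x(3) that j by (simp add: J)
    qed
    with xJx have "\<forall>i<Suc (2*t). hform I h (v' i) (J x) = 0"
      by (auto simp: v'_def less_Suc_eq)
    from orthofam_Suc[OF herm vs' x(1) JxJx this]
    have "orthofam I h (2 * Suc t) (v'(Suc (2*t) := J x)) (s'(Suc (2*t) := r))" by simp
    moreover have "\<forall>i<Suc t. (v'(Suc (2*t) := J x)) (2 * i + 1) = J ((v'(Suc (2*t) := J x)) (2 * i)) \<and>
      (s'(Suc (2*t) := r)) (2 * i + 1) = (s'(Suc (2*t) := r)) (2 * i)"
      using vs(2) by (auto simp: less_Suc_eq v'_def s'_def)
    ultimately show ?case by blast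
  qed
  \<comment> \<open>Rounded up on purpose: for odd \<open>card I\<close> the family would have one
    vector too many, so \<open>orthofam_card_le\<close> forces \<open>card I\<close> to be
    even.\<close>
  define t where "t = (card I + 1) div 2"
  have "2 * t < card I + 2" unfolding t_def by linarith
  from ex[OF this] obtain v s where vs: "orthofam I h (2 * t) v s"
    "\<forall>i<t. v (2 * i + 1) = J (v (2 * i)) \<and> s (2 * i + 1) = s (2 * i)" by blast
  have "2 * t \<le> card I" by (rule orthofam_card_le[OF fin vs(1)])
  then have ct: "card I = 2 * t" unfolding t_def by linarith
  with orthofam_inertia[OF fin] vs(1) have "inertia I h (card {i. i < card I \<and> s i = 1})" by metis
  then have "k = card {i. i < 2 * t \<and> s i = 1}" using inertia_unique[OF fin k] ct by simp
  also have "{i. i < 2 * t \<and> s i = 1} = (*) 2 ` {i. i < t \<and> s (2 * i) = 1} \<union>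
     (\<lambda>i. 2 * i + 1) ` {i. i < t \<and> s (2 * i) = 1}" (is "?L = ?A \<union> ?B")
  proof (intro equalityI subsetI)
    fix i assume i: "i \<in> ?L"
    show "i \<in> ?A \<union> ?B"
    proof (cases "even i")
      case True
      then show ?thesis using i by (auto elim!: evenE)
    next
      case False
      then obtain j where "i = 2 * j + 1" by (auto elim: oddE)
      then show ?thesis using i vs(2) by auto
    qed
  qed (use vs(2) in auto)
  also have "card (?A \<union> ?B) = card ?A + card ?B"
  proof (rule card_Un_disjoint)
    show "?A \<inter> ?B = {}" by (auto, presburger)
  qed auto
  also have "card ?A = card {i. i < t \<and> s (2 * i) = 1}"
    by (rule card_image) (auto simp: inj_on_def)
  also have "card ?B = card {i. i < t \<and> s (2 * i) = 1}"
    by (rule card_image) (auto simp: inj_on_def)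
  finally show ?thesis by simp
qed

text \<open>On the span of the positive vectors h is the standard inner product, and e is bounded
  there by a multiple of it through Cauchy-Schwarz. A small multiple of e therefore cannot destroy
  positivity.\<close>

lemma positive_family_perturb:
  assumes "finite I" and fam: "orthofam I h t v s" and K: "K \<subseteq> {..<t}" "\<And>i. i \<in> K \<Longrightarrow> s i = 1"
  shows "\<exists>\<delta>>0. \<forall>\<tau>. \<bar>\<tau>\<bar> < \<delta> \<longrightarrow> positive_family I (\<lambda>a b. h a b + of_real \<tau> * e a b) (card K)"
proof -
  have fK: "finite K" using K(1) finite_subset by blast
  define M where "M = (\<Sum>i\<in>K. \<Sum>j\<in>K. cmod (hform I e (v i) (v j)))"
  have M0: "M \<ge> 0" unfolding M_def by (intro sum_nonneg) auto
  have M: "cmod (hform I e (v i) (v j)) \<le> M" if "i \<in> K" "j \<in> K" for i j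
  proof -
    have "cmod (hform I e (v i) (v j)) \<le> (\<Sum>j\<in>K. cmod (hform I e (v i) (v j)))"
      using that fK by (intro member_le_sum) auto
    also have "\<dots> \<le> M" unfolding M_def using that fK
      by (intro member_le_sum[of i K "\<lambda>i. \<Sum>j\<in>K. cmod (hform I e (v i) (v j))"]) (auto intro: sum_nonneg)
    finally show ?thesis .
  qed
  \<comment> \<open>The perturbation is at most |\<tau>| * M * card K times the squared norm S of
    the coefficients; the added 1 makes the comparison strict and avoids division by 0.\<close>
  define \<delta> where "\<delta> = 1 / (M * card K + 1)"
  have den: "M * card K + 1 > 0" using M0 by (simp add: add_nonneg_pos)
  have "positive_family I (\<lambda>a b. h a b + of_real \<tau> * e a b) (card K)" if \<tau>: "\<bar>\<tau>\<bar> < \<delta>" for \<tau>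
    unfolding positive_family_def
  proof (intro exI conjI allI impI)
    show "finite K" "card K = card K" using fK by auto
    fix c :: "nat \<Rightarrow> complex" assume c: "\<exists>i\<in>K. c i \<noteq> 0"
    let ?u = "lincomb K v c"
    have 1: "hform I (\<lambda>a b. h a b + of_real \<tau> * e a b) ?u ?u = hform I h ?u ?u + of_real \<tau> * hform I e ?u ?u"
      by (simp add: hform_def algebra_simps sum.distrib sum_distrib_left)
    have "hform I h ?u ?u = (\<Sum>i\<in>K. \<Sum>j\<in>K. cnj (c i) * c j * (if i = j then 1 else 0))"
      unfolding hform_lincomb using fam K unfolding orthofam_def
      by (intro sum.cong refl) (auto simp: subset_eq)
    also have "\<dots> = (\<Sum>i\<in>K. of_real ((cmod (c i))\<^sup>2))"
      using fK by (intro sum.cong refl) (auto simp: cnj_mult_self if_distrib cong: if_cong)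
    finally have 2: "Re (hform I h ?u ?u) = (\<Sum>i\<in>K. (cmod (c i))\<^sup>2)" by simp
    define S where "S = (\<Sum>i\<in>K. (cmod (c i))\<^sup>2)"
    have S: "S > 0" unfolding S_def using c fK by (auto intro!: sum_pos2)
    have "cmod (hform I e ?u ?u) \<le> (\<Sum>i\<in>K. \<Sum>j\<in>K. cmod (c i) * cmod (c j) * M)"
      unfolding hform_lincomb using M
      by (intro order.trans[OF norm_sum] sum_mono order.trans[OF norm_sum])
        (auto simp: norm_mult intro!: mult_left_mono)
    also have "\<dots> = M * (\<Sum>i\<in>K. cmod (c i))\<^sup>2"
      by (simp add: power2_eq_square sum_product sum_distrib_left mult_ac)
    also have "(\<Sum>i\<in>K. cmod (c i))\<^sup>2 \<le> (\<Sum>i\<in>K. 1\<^sup>2) * (\<Sum>i\<in>K. (cmod (c i))\<^sup>2)"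
      using Cauchy_Schwarz_ineq_sum[of "\<lambda>_. 1" "\<lambda>i. cmod (c i)" K] by simp
    finally have 3: "cmod (hform I e ?u ?u) \<le> M * (card K * S)"
      using M0 by (simp add: S_def mult_left_mono)
    have "\<bar>\<tau> * Re (hform I e ?u ?u)\<bar> \<le> \<bar>\<tau>\<bar> * cmod (hform I e ?u ?u)"
      using abs_Re_le_cmod by (simp add: abs_mult mult_left_mono)
    also have "\<dots> \<le> \<bar>\<tau>\<bar> * (M * (card K * S))" using 3 by (simp add: mult_left_mono)
    also have "\<dots> \<le> \<delta> * (M * (card K * S))"
      using \<tau> M0 S by (intro mult_right_mono) auto
    also have "\<dots> = (M * card K / (M * card K + 1)) * S" by (simp add: \<delta>_def)
    also have "\<dots> < 1 * S" using S den by (intro mult_strict_right_mono) auto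
    finally have "Re (hform I h ?u ?u) + \<tau> * Re (hform I e ?u ?u) > 0"
      using 2 S_def by linarith
    then show "Re (hform I (\<lambda>a b. h a b + of_real \<tau> * e a b) ?u ?u) > 0" unfolding 1 by simp
  qed
  moreover have "\<delta> > 0" using den by (simp add: \<delta>_def)
  ultimately show ?thesis by blast
qed

text \<open>A complete orthogonal family splits into a positive and a negative part. Both parts
  survive a small perturbation, and their sizes add up to \<open>card I\<close>.\<close>

lemma inertia_perturb:
  assumes fin: "finite I" and herm: "hermitian_on I h" and nd: "nondeg I h" and k: "inertia I h k"
  shows "\<exists>\<delta>>0. \<forall>\<tau>. \<bar>\<tau>\<bar> < \<delta> \<longrightarrow> inertia I (\<lambda>a b. h a b + of_real \<tau> * e a b) k"
proof -
  obtain v s where vs: "orthofam I h (card I) v s"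
    using orthofam_complete[OF fin herm nd] by blast
  define K where "K = {i. i < card I \<and> s i = 1}"
  have kK: "k = card K"
    using inertia_unique[OF fin k orthofam_inertia[OF fin vs]] by (simp add: K_def)
  have K: "K \<subseteq> {..<card I}" by (auto simp: K_def)
  obtain \<delta>1 where \<delta>1: "\<delta>1 > 0" "\<And>\<tau>. \<bar>\<tau>\<bar> < \<delta>1 \<Longrightarrow> positive_family I (\<lambda>a b. h a b + of_real \<tau> * e a b) (card K)"
    using positive_family_perturb[OF fin vs K, of e] by (auto simp: K_def)
  have "card ({..<card I} - K) = card I - card K"
    using K by (subst card_Diff_subset) (auto intro: finite_subset)
  moreover obtain \<delta>2 where \<delta>2: "\<delta>2 > 0"
    "\<And>\<tau>. \<bar>\<tau>\<bar> < \<delta>2 \<Longrightarrow> positive_family I (\<lambda>a b. - h a b + of_real \<tau> * - e a b) (card ({..<card I} - K))"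
    using positive_family_perturb[OF fin orthofam_uminus[OF vs], of "{..<card I} - K" "\<lambda>a b. - e a b"] vs
    by (auto simp: K_def orthofam_def)
  ultimately have c: "card ({..<card I} - K) = card I - k" by (simp add: kK)
  have eq: "(\<lambda>a b. - h a b + of_real \<tau> * - e a b) = (\<lambda>a b. - (h a b + of_real \<tau> * e a b))" for \<tau>
    by (simp add: fun_eq_iff)
  have "inertia I (\<lambda>a b. h a b + of_real \<tau> * e a b) k" if "\<bar>\<tau>\<bar> < min \<delta>1 \<delta>2" for \<tau>
    using \<delta>1(2)[of \<tau>] \<delta>2(2)[of \<tau>] that k unfolding inertia_def c eq kK[symmetric] by simp
  moreover have "min \<delta>1 \<delta>2 > 0" using \<delta>1(1) \<delta>2(1) by simp
  ultimately show ?thesis by blast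
qed

text \<open>By \<open>inertia_perturb\<close> the number of positive squares is locally constant
  along the segment, and the parameter interval is connected.\<close>

lemma inertia_segment:
  fixes h0 h1 :: "'a \<Rightarrow> 'a \<Rightarrow> complex"
  defines "h \<equiv> \<lambda>t::real. \<lambda>a b. of_real (1 - t) * h0 a b + of_real t * h1 a b"
  assumes fin: "finite I" and herm: "hermitian_on I h0" "hermitian_on I h1"
    and nd: "\<And>t. 0 \<le> t \<Longrightarrow> t \<le> 1 \<Longrightarrow> nondeg I (h t)"
  shows "\<exists>k. inertia I h0 k \<and> inertia I h1 k"
proof -
  have hermt: "hermitian_on I (h t)" for t
    unfolding hermitian_on_def h_def
  proof (intro ballI)
    fix a b assume "a \<in> I" "b \<in> I"
    then have "h0 b a = cnj (h0 a b)" "h1 b a = cnj (h1 a b)"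
      using herm unfolding hermitian_on_def by blast+
    then show "of_real (1 - t) * h0 b a + of_real t * h1 b a
        = cnj (of_real (1 - t) * h0 a b + of_real t * h1 a b)"
      by (simp only: complex_cnj_add complex_cnj_mult complex_cnj_complex_of_real)
  qed
  have ex: "\<exists>k. inertia I (h t) k" if "t \<in> {0..1}" for t
    using inertia_exists[OF fin hermt nd] that by auto
  define k where "k t = (SOME k. inertia I (h t) k)" for t
  have k: "inertia I (h t) (k t)" if "t \<in> {0..1}" for t
    unfolding k_def using ex[OF that] by (rule someI_ex)
  have "k 0 = k 1"
  proof (rule connected_local_const[where f = k and A = "{0..1}" and a = 0 and b = 1])
    show "connected {0..1::real}" by simp
    show "\<forall>a\<in>{0..1}. \<forall>\<^sub>F b in at a within {0..1}. k a = k b"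
    proof
      fix a :: real assume a: "a \<in> {0..1}"
      obtain \<delta> where \<delta>: "\<delta> > 0"
        "\<And>\<tau>. \<bar>\<tau>\<bar> < \<delta> \<Longrightarrow> inertia I (\<lambda>x y. h a x y + of_real \<tau> * (h1 x y - h0 x y)) (k a)"
        using inertia_perturb[OF fin hermt nd k[OF a], of "\<lambda>x y. h1 x y - h0 x y"] a by auto
      have *: "k a = k b" if "dist b a < \<delta>" "b \<in> {0..1}" for b
      proof -
        have "(\<lambda>x y. h a x y + of_real (b - a) * (h1 x y - h0 x y)) = h b"
          by (simp add: h_def fun_eq_iff algebra_simps)
        with \<delta>(2)[of "b - a"] that have "inertia I (h b) (k a)" by (simp add: dist_real_def)
        with k[OF that(2)] show ?thesis using inertia_unique[OF fin] by blast
      qed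
      show "\<forall>\<^sub>F b in at a within {0..1}. k a = k b"
        unfolding eventually_at using \<delta>(1) * by blast
    qed
  qed auto
  moreover have "h 0 = h0" "h 1 = h1" by (auto simp: h_def)
  ultimately show ?thesis using k[of 0] k[of 1] by auto
qed

lemma positive_family_direct_sum:
  assumes fin: "finite I" "finite J" and disj: "I \<inter> J = {}"
    and zero: "\<And>a b. a \<in> I \<Longrightarrow> b \<in> J \<Longrightarrow> h a b = 0 \<and> h b a = 0"
    and "positive_family I h k" "positive_family J h l"
  shows "positive_family (I \<union> J) h (k + l)"
proof -
  obtain K :: "nat set" and v where K: "finite K" "card K = k"
    "\<And>c. \<exists>i\<in>K. c i \<noteq> 0 \<Longrightarrow> Re (hform I h (lincomb K v c) (lincomb K v c)) > 0"
    using assms(5) unfolding positive_family_def by blast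
  obtain L :: "nat set" and w where L: "finite L" "card L = l"
    "\<And>c. \<exists>i\<in>L. c i \<noteq> 0 \<Longrightarrow> Re (hform J h (lincomb L w c) (lincomb L w c)) > 0"
    using assms(6) unfolding positive_family_def by blast
  \<comment> \<open>Even numbers carry the family on I, odd numbers that on J; each vector is
    extended by 0.\<close>
  define KL where "KL = (*) 2 ` K \<union> (\<lambda>i. 2 * i + 1) ` L"
  define x where "x = (\<lambda>i a. if even i then (if a \<in> I then v (i div 2) a else 0)
                         else (if a \<in> J then w (i div 2) a else 0))"
  have inj: "inj_on ((*) 2) K" "inj_on (\<lambda>i. 2 * i + 1) L" by (auto simp: inj_on_def)
  have dj: "(*) 2 ` K \<inter> (\<lambda>i. 2 * i + 1) ` L = {}" by (auto, presburger)
  have "card KL = k + l" unfolding KL_def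
    using K L inj dj by (simp add: card_Un_disjoint card_image)
  moreover have "finite KL" using K L by (simp add: KL_def)
  moreover have "Re (hform (I \<union> J) h (lincomb KL x c) (lincomb KL x c)) > 0" if c: "\<exists>i\<in>KL. c i \<noteq> 0" for c
  proof -
    define p where "p = lincomb K v (\<lambda>i. c (2 * i))"
    define q where "q = lincomb L w (\<lambda>i. c (2 * i + 1))"
    have lc: "lincomb KL x c a = (if a \<in> I then p a else 0) + (if a \<in> J then q a else 0)" for a
    proof -
      have "lincomb KL x c a = (\<Sum>i\<in>(*) 2 ` K. c i * x i a) + (\<Sum>i\<in>(\<lambda>i. 2 * i + 1) ` L. c i * x i a)"
        unfolding lincomb_def KL_def using K L dj by (intro sum.union_disjoint) auto
      then show ?thesis using inj by (simp add: sum.reindex x_def p_def q_def lincomb_def)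
    qed
    have I: "lincomb KL x c a = p a" if "a \<in> I" for a using that disj by (auto simp: lc)
    have J: "lincomb KL x c a = q a" if "a \<in> J" for a using that disj by (auto simp: lc)
    let ?u = "lincomb KL x c"
    have "hform (I \<union> J) h ?u ?u = (\<Sum>a\<in>I. (\<Sum>b\<in>I. cnj (?u a) * h a b * ?u b) + (\<Sum>b\<in>J. cnj (?u a) * h a b * ?u b))
       + (\<Sum>a\<in>J. (\<Sum>b\<in>I. cnj (?u a) * h a b * ?u b) + (\<Sum>b\<in>J. cnj (?u a) * h a b * ?u b))"
      unfolding hform_def using fin disj by (simp add: sum.union_disjoint)
    also have "\<dots> = hform I h p p + hform J h q q"
      unfolding hform_def using zero by (simp add: I J)
    finally have eq: "hform (I \<union> J) h ?u ?u = hform I h p p + hform J h q q" .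
    have p: "Re (hform I h p p) > 0 \<or> (\<forall>i\<in>K. c (2 * i) = 0) \<and> hform I h p p = 0"
      using K(3)[of "\<lambda>i. c (2 * i)"] unfolding p_def by (cases "\<exists>i\<in>K. c (2 * i) \<noteq> 0") (auto simp: hform_lincomb_left)
    have q: "Re (hform J h q q) > 0 \<or> (\<forall>i\<in>L. c (2 * i + 1) = 0) \<and> hform J h q q = 0"
      using L(3)[of "\<lambda>i. c (2 * i + 1)"] unfolding q_def
      by (cases "\<exists>i\<in>L. c (2 * i + 1) \<noteq> 0") (auto simp: hform_lincomb_left)
    have "\<not> ((\<forall>i\<in>K. c (2 * i) = 0) \<and> (\<forall>i\<in>L. c (2 * i + 1) = 0))"
      using c by (auto simp: KL_def)
    with p q show ?thesis unfolding eq by auto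
  qed
  ultimately show ?thesis unfolding positive_family_def by blast
qed

lemma inertia_direct_sum:
  assumes "finite I" "finite J" "I \<inter> J = {}"
    and zero: "\<And>a b. a \<in> I \<Longrightarrow> b \<in> J \<Longrightarrow> h a b = 0 \<and> h b a = 0"
    and k: "inertia I h k" and l: "inertia J h l"
  shows "inertia (I \<union> J) h (k + l)"
proof -
  have "positive_family (I \<union> J) h (k + l)"
    using assms by (intro positive_family_direct_sum) (auto simp: inertia_def)
  moreover have "positive_family (I \<union> J) (\<lambda>a b. - h a b) ((card I - k) + (card J - l))"
    using assms by (intro positive_family_direct_sum) (auto simp: inertia_def)
  moreover have "card (I \<union> J) = card I + card J" using assms by (simp add: card_Un_disjoint)
  ultimately show ?thesis using k l unfolding inertia_def by simp
qed

lemma hform_reindex: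
  assumes "inj_on f I"
  shows "hform (f ` I) h u v = hform I (\<lambda>a b. h (f a) (f b)) (\<lambda>a. u (f a)) (\<lambda>a. v (f a))"
  unfolding hform_def using assms by (simp add: sum.reindex)

lemma positive_family_reindex:
  assumes inj: "inj_on f I" and "positive_family I (\<lambda>a b. h (f a) (f b)) k"
  shows "positive_family (f ` I) h k"
proof -
  obtain K :: "nat set" and v where K: "finite K" "card K = k"
    "\<And>c. \<exists>i\<in>K. c i \<noteq> 0 \<Longrightarrow> Re (hform I (\<lambda>a b. h (f a) (f b)) (lincomb K v c) (lincomb K v c)) > 0"
    using assms(2) unfolding positive_family_def by blast
  let ?v = "\<lambda>i a. v i (inv_into I f a)"
  have "hform (f ` I) h (lincomb K ?v c) (lincomb K ?v c) =
      hform I (\<lambda>a b. h (f a) (f b)) (lincomb K v c) (lincomb K v c)" for c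
    unfolding hform_reindex[OF inj] using inj by (intro hform_cong) (auto simp: lincomb_def)
  with K show ?thesis unfolding positive_family_def by metis
qed

lemma inertia_reindex:
  assumes "inj_on f I" "inertia I (\<lambda>a b. h (f a) (f b)) k"
  shows "inertia (f ` I) h k"
  using positive_family_reindex[OF assms(1), of h k] positive_family_reindex[OF assms(1), of "\<lambda>a b. - h a b" "card I - k"]
    assms card_image[OF assms(1)] unfolding inertia_def by simp

lemma inertia_cong:
  assumes "\<And>a b. a \<in> I \<Longrightarrow> b \<in> I \<Longrightarrow> h a b = h' a b" "inertia I h k"
  shows "inertia I h' k"
proof -
  have "hform I h u v = hform I h' u v" "hform I (\<lambda>a b. - h a b) u v = hform I (\<lambda>a b. - h' a b) u v" for u v
    using assms(1) by (auto intro!: hform_cong)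
  with assms(2) show ?thesis unfolding inertia_def positive_family_def by simp
qed

text \<open>Multiplying vectors by the signs s is a congruence that carries h to - h.\<close>

lemma positive_family_twist:
  assumes s: "\<And>a. a \<in> I \<Longrightarrow> s a = 1 \<or> s a = (-1::complex)"
    and pos: "positive_family I h k"
    and odd: "\<And>a b. a \<in> I \<Longrightarrow> b \<in> I \<Longrightarrow> s a * s b * h a b = - h a b"
  shows "positive_family I (\<lambda>a b. - h a b) k"
proof -
  obtain K :: "nat set" and v where K: "finite K" "card K = k"
    "\<And>c. \<exists>i\<in>K. c i \<noteq> 0 \<Longrightarrow> Re (hform I h (lincomb K v c) (lincomb K v c)) > 0"
    using pos unfolding positive_family_def by blast
  let ?v = "\<lambda>i a. s a * v i a"
  have lc: "lincomb K ?v c a = s a * lincomb K v c a" for a c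
    by (simp add: lincomb_def sum_distrib_left mult_ac)
  have "hform I (\<lambda>a b. - h a b) (lincomb K ?v c) (lincomb K ?v c) = hform I h (lincomb K v c) (lincomb K v c)" for c
    unfolding hform_def lc
  proof (intro sum.cong refl)
    fix a b assume ab: "a \<in> I" "b \<in> I"
    have cs: "cnj (s a) = s a" using s[OF ab(1)] by auto
    have eq: "s a * s b * - h a b = h a b" using odd[OF ab] by simp
    have "cnj (s a * lincomb K v c a) * - h a b * (s b * lincomb K v c b)
       = cnj (lincomb K v c a) * (s a * s b * - h a b) * lincomb K v c b"
      by (simp add: cs)
    then show "cnj (s a * lincomb K v c a) * - h a b * (s b * lincomb K v c b) =
      cnj (lincomb K v c a) * h a b * lincomb K v c b" unfolding eq .
  qed
  with K show ?thesis unfolding positive_family_def by metis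
qed

text \<open>A form that is odd for a grading is congruent to its negative, hence has as many
  positive as negative squares.\<close>

lemma inertia_odd_half:
  assumes fin: "finite I" and k: "inertia I h k"
    and s: "\<And>a. a \<in> I \<Longrightarrow> s a = 1 \<or> s a = (-1::complex)"
    and odd: "\<And>a b. a \<in> I \<Longrightarrow> b \<in> I \<Longrightarrow> s a * s b * h a b = - h a b"
  shows "2 * k = card I"
proof -
  have k': "k \<le> card I" "positive_family I h k" "positive_family I (\<lambda>a b. - h a b) (card I - k)"
    using k unfolding inertia_def by blast+
  have "positive_family I (\<lambda>a b. - h a b) k" by (rule positive_family_twist[OF s k'(2) odd])
  then have 1: "k + k \<le> card I" using positive_family_add_le[OF fin k'(2)] by blast
  have "positive_family I (\<lambda>a b. - (- h a b)) (card I - k)"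
  proof (rule positive_family_twist[OF s k'(3)])
    fix a b assume "a \<in> I" "b \<in> I"
    then have "s a * s b * h a b = - h a b" by (rule odd)
    then show "s a * s b * - h a b = - (- h a b)" by simp
  qed
  then have "(card I - k) + (card I - k) \<le> card I"
    using positive_family_add_le[OF fin _ k'(3)] by simp
  with 1 k'(1) show ?thesis by linarith
qed

lemma inertia_pos_def:
  assumes fin: "finite I" and herm: "hermitian_on I h"
    and pos: "\<And>v. \<exists>a\<in>I. v a \<noteq> 0 \<Longrightarrow> Re (hform I h v v) > 0"
  shows "inertia I h (card I)"
proof -
  have nd: "nondeg I h" unfolding nondeg_def using pos by (metis less_irrefl zero_complex.simps(1))
  obtain k where k: "inertia I h k" using inertia_exists[OF fin herm nd] by blast
  have "card I - k = 0"
  proof (rule ccontr)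
    assume ne: "card I - k \<noteq> 0"
    obtain K :: "nat set" and v where K: "finite K" "card K = card I - k"
      "\<And>c. \<exists>i\<in>K. c i \<noteq> 0 \<Longrightarrow> Re (hform I (\<lambda>a b. - h a b) (lincomb K v c) (lincomb K v c)) > 0"
      using k unfolding inertia_def positive_family_def by blast
    have "K \<noteq> {}" using K ne by auto
    then have "\<exists>i\<in>K. (\<lambda>_. 1::complex) i \<noteq> 0" by auto
    from K(3)[OF this] have neg: "Re (hform I h (lincomb K v (\<lambda>_. 1)) (lincomb K v (\<lambda>_. 1))) < 0"
      by (simp add: hform_minus_form)
    then have "hform I h (lincomb K v (\<lambda>_. 1)) (lincomb K v (\<lambda>_. 1)) \<noteq> 0" by auto
    then have "\<exists>a\<in>I. lincomb K v (\<lambda>_. 1) a \<noteq> 0" unfolding hform_def by (auto elim!: sum.not_neutral_contains_not_neutral)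
    from pos[OF this] neg show False by simp
  qed
  with k show ?thesis unfolding inertia_def by (metis diff_is_0_eq le_antisym)
qed

subsection \<open>Toeplitz quantization\<close>

text \<open>Squared norm of a monomial under the quadrature. As distinct monomials will be
  orthogonal, these numbers determine all inner products of polynomials.\<close>

definition weight :: "'p set \<Rightarrow> ('p \<Rightarrow> 'y) \<Rightarrow> ('b \<Rightarrow> 'y \<Rightarrow> complex) \<Rightarrow> 'b \<Rightarrow> real" where
  "weight Q q mon \<mu> = (\<Sum>p\<in>Q. (cmod (mon \<mu> (q p)))\<^sup>2)"

text \<open>
  \<open>Y\<close> carries coordinate functions \<open>X e\<close>, and \<open>mon \<mu>\<close> (\<open>\<mu> \<in> B k\<close>) are the monomials of degree \<open>k\<close>.
  At level \<open>N\<close> the inner product of two functions is their sum over the finite set of points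
  \<open>pt N p\<close> (\<open>p \<in> P N\<close>). The gap conditions say that the projection of \<open>cnj (X e)\<close> times a monomial
  to the span of the monomials has a small error.
\<close>

locale toeplitz =
  fixes Y :: "'y set" and Es :: "'e set" and X :: "'e \<Rightarrow> 'y \<Rightarrow> complex"
    and B :: "nat \<Rightarrow> 'b set" and mon :: "'b \<Rightarrow> 'y \<Rightarrow> complex" and up :: "'e \<Rightarrow> 'b \<Rightarrow> 'b"
    and P :: "nat \<Rightarrow> 'p set" and pt :: "nat \<Rightarrow> 'p \<Rightarrow> 'y"
  assumes finE: "finite Es" and finB: "finite (B k)" and finP: "finite (P N)"
    and pt: "p \<in> P N \<Longrightarrow> pt N p \<in> Y"
    and X_sum: "y \<in> Y \<Longrightarrow> (\<Sum>e\<in>Es. (cmod (X e y))\<^sup>2) = 1"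
    and up_in: "e \<in> Es \<Longrightarrow> \<mu> \<in> B k \<Longrightarrow> up e \<mu> \<in> B (Suc k)"
    and up_inj: "e \<in> Es \<Longrightarrow> inj_on (up e) (B k)"
    and mon_up: "e \<in> Es \<Longrightarrow> \<mu> \<in> B k \<Longrightarrow> y \<in> Y \<Longrightarrow> mon (up e \<mu>) y = X e y * mon \<mu> y"
    and orth: "\<forall>\<^sub>F N in sequentially. \<forall>\<mu>\<in>B (N + a). \<forall>\<nu>\<in>B (N + a). \<mu> \<noteq> \<nu> \<longrightarrow>
      (\<Sum>p\<in>P N. cnj (mon \<mu> (pt N p)) * mon \<nu> (pt N p)) = 0"
    and wpos: "\<forall>\<^sub>F N in sequentially. \<forall>\<mu>\<in>B (N + a). weight (P N) (pt N) mon \<mu> > 0"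
    and gap_up: "e \<in> Es \<Longrightarrow> \<epsilon> > 0 \<Longrightarrow> \<forall>\<^sub>F N in sequentially. \<forall>\<mu>\<in>B (N + a).
      weight (P N) (pt N) mon (up e (up e \<mu>)) * weight (P N) (pt N) mon \<mu> \<le> (weight (P N) (pt N) mon (up e \<mu>))\<^sup>2 +
      \<epsilon> * weight (P N) (pt N) mon (up e \<mu>) * weight (P N) (pt N) mon \<mu>"
    and gap_bottom: "e \<in> Es \<Longrightarrow> \<epsilon> > 0 \<Longrightarrow> \<forall>\<^sub>F N in sequentially. \<forall>\<mu>\<in>B (Suc (N + a)) - up e ` B (N + a).
      weight (P N) (pt N) mon (up e \<mu>) \<le> \<epsilon> * weight (P N) (pt N) mon \<mu>"
begin

abbreviation w :: "nat \<Rightarrow> 'b \<Rightarrow> real" where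
  "w N \<equiv> weight (P N) (pt N) mon"

definition ev :: "nat \<Rightarrow> ('b \<Rightarrow> complex) \<Rightarrow> 'y \<Rightarrow> complex" where
  "ev k u y = (\<Sum>\<mu>\<in>B k. u \<mu> * mon \<mu> y)"

definition nm :: "nat \<Rightarrow> ('y \<Rightarrow> complex) \<Rightarrow> real" where
  "nm N f = L2_set (\<lambda>p. cmod (f (pt N p))) (P N)"

text \<open>At such a level the monomials of degree k are an orthogonal basis, so norms of
  polynomials can be read off from coefficients.\<close>

definition good :: "nat \<Rightarrow> nat \<Rightarrow> bool" where
  "good N k \<longleftrightarrow> (\<forall>\<mu>\<in>B k. \<forall>\<nu>\<in>B k. \<mu> \<noteq> \<nu> \<longrightarrow> (\<Sum>p\<in>P N. cnj (mon \<mu> (pt N p)) * mon \<nu> (pt N p)) = 0) \<and>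
     (\<forall>\<mu>\<in>B k. w N \<mu> > 0)"

lemma eventually_good: "\<forall>\<^sub>F N in sequentially. good N (N + a)"
  using orth[of a] wpos[of a] by eventually_elim (simp add: good_def)

lemma inner_ev:
  assumes "good N k"
  shows "(\<Sum>p\<in>P N. cnj (ev k u (pt N p)) * ev k v (pt N p)) = (\<Sum>\<mu>\<in>B k. cnj (u \<mu>) * v \<mu> * of_real (w N \<mu>))"
proof -
  have "(\<Sum>p\<in>P N. cnj (ev k u (pt N p)) * ev k v (pt N p)) =
    (\<Sum>p\<in>P N. \<Sum>\<mu>\<in>B k. \<Sum>\<nu>\<in>B k. cnj (u \<mu>) * v \<nu> * (cnj (mon \<mu> (pt N p)) * mon \<nu> (pt N p)))"
    unfolding ev_def cnj_sum sum_product by (simp add: mult_ac)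
  also have "\<dots> = (\<Sum>\<mu>\<in>B k. \<Sum>\<nu>\<in>B k. cnj (u \<mu>) * v \<nu> * (\<Sum>p\<in>P N. cnj (mon \<mu> (pt N p)) * mon \<nu> (pt N p)))"
    by (simp only: sum.swap[of _ "B k" "P N"] sum_distrib_left)
  also have "\<dots> = (\<Sum>\<mu>\<in>B k. \<Sum>\<nu>\<in>B k. if \<nu> = \<mu> then cnj (u \<mu>) * v \<mu> * of_real (w N \<mu>) else 0)"
  proof (intro sum.cong refl)
    fix \<mu> \<nu> assume "\<mu> \<in> B k" "\<nu> \<in> B k"
    then show "cnj (u \<mu>) * v \<nu> * (\<Sum>p\<in>P N. cnj (mon \<mu> (pt N p)) * mon \<nu> (pt N p)) =
      (if \<nu> = \<mu> then cnj (u \<mu>) * v \<mu> * of_real (w N \<mu>) else 0)"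
      using assms by (auto simp: good_def weight_def cnj_mult_self)
  qed
  also have "\<dots> = (\<Sum>\<mu>\<in>B k. cnj (u \<mu>) * v \<mu> * of_real (w N \<mu>))"
    using finB by simp
  finally show ?thesis .
qed

lemma nm_ev:
  assumes "good N k"
  shows "(nm N (ev k u))\<^sup>2 = (\<Sum>\<mu>\<in>B k. (cmod (u \<mu>))\<^sup>2 * w N \<mu>)"
proof -
  have "complex_of_real ((nm N (ev k u))\<^sup>2) = (\<Sum>p\<in>P N. cnj (ev k u (pt N p)) * ev k u (pt N p))"
    by (simp add: nm_def L2_set_def sum_nonneg cnj_mult_self)
  also have "\<dots> = of_real (\<Sum>\<mu>\<in>B k. (cmod (u \<mu>))\<^sup>2 * w N \<mu>)"
    unfolding inner_ev[OF assms] by (simp add: cnj_mult_self)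
  finally show ?thesis by (simp only: of_real_eq_iff)
qed

lemma nm_nonneg: "nm N f \<ge> 0"
  by (simp add: nm_def)

lemma nm_triangle: "nm N (\<lambda>y. f y + g y) \<le> nm N f + nm N g"
proof -
  have "nm N (\<lambda>y. f y + g y) \<le> L2_set (\<lambda>p. cmod (f (pt N p)) + cmod (g (pt N p))) (P N)"
    unfolding nm_def by (intro L2_set_mono) (auto intro: norm_triangle_ineq)
  also have "\<dots> \<le> nm N f + nm N g" unfolding nm_def by (rule L2_set_triangle_ineq)
  finally show ?thesis .
qed

lemma nm_bounded_mult:
  assumes "\<And>y. y \<in> Y \<Longrightarrow> cmod (g y) \<le> C" "C \<ge> 0"
  shows "nm N (\<lambda>y. g y * f y) \<le> C * nm N f"
proof -
  have "nm N (\<lambda>y. g y * f y) \<le> L2_set (\<lambda>p. C * cmod (f (pt N p))) (P N)"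
    unfolding nm_def using assms pt by (intro L2_set_mono) (auto simp: norm_mult intro!: mult_right_mono)
  also have "\<dots> = C * nm N f" unfolding nm_def using assms by (simp add: L2_set_right_distrib)
  finally show ?thesis .
qed

lemma nm_cong:
  assumes "\<And>y. y \<in> Y \<Longrightarrow> f y = g y"
  shows "nm N f = nm N g"
  unfolding nm_def using assms pt by (intro L2_set_cong) auto

lemma ev_add: "ev k (\<lambda>\<mu>. u \<mu> + v \<mu>) y = ev k u y + ev k v y"
  by (simp add: ev_def algebra_simps sum.distrib)

lemma ev_scale: "ev k (\<lambda>\<mu>. c * u \<mu>) y = c * ev k u y"
  by (simp add: ev_def sum_distrib_left mult_ac)

lemma ev_sum: "ev k (\<lambda>\<mu>. \<Sum>i\<in>A. u i \<mu>) y = (\<Sum>i\<in>A. ev k (u i) y)"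
  by (simp add: ev_def sum_distrib_right sum.swap[of _ A])

text \<open>The degrees of all functions are relative to the level \<open>N\<close>.\<close>

definition approx :: "nat \<Rightarrow> nat \<Rightarrow> ('y \<Rightarrow> complex) \<Rightarrow> bool" where
  "approx a b g \<longleftrightarrow> (\<forall>\<epsilon>>0. \<forall>\<^sub>F N in sequentially. \<forall>u. \<exists>v.
     nm N (\<lambda>y. g y * ev (N + a) u y - ev (N + b) v y) \<le> \<epsilon> * nm N (ev (N + a) u))"

text \<open>Symbols whose multiplication operator sends degree N + a to degree N + b up to an error
  of small relative norm. The bound on g is carried along because the error of a product involves
  it.\<close>

definition qsym :: "nat \<Rightarrow> nat \<Rightarrow> ('y \<Rightarrow> complex) \<Rightarrow> bool" where
  "qsym a b g \<longleftrightarrow> approx a b g \<and> (\<exists>C. \<forall>y\<in>Y. cmod (g y) \<le> C)"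

lemma approx_exact:
  assumes "\<And>N u. \<exists>v. \<forall>y\<in>Y. g y * ev (N + a) u y = ev (N + b) v y"
  shows "approx a b g"
  unfolding approx_def
proof (intro allI impI always_eventually)
  fix \<epsilon> :: real and N u assume "\<epsilon> > 0"
  obtain v where v: "\<forall>y\<in>Y. g y * ev (N + a) u y = ev (N + b) v y"
    using assms by blast
  have "nm N (\<lambda>y. g y * ev (N + a) u y - ev (N + b) v y) = nm N (\<lambda>_. 0)"
    using v by (intro nm_cong) auto
  also have "\<dots> = 0" by (simp add: nm_def L2_set_def)
  finally show "\<exists>v. nm N (\<lambda>y. g y * ev (N + a) u y - ev (N + b) v y) \<le> \<epsilon> * nm N (ev (N + a) u)"
    using \<open>\<epsilon> > 0\<close> nm_nonneg by (intro exI[of _ v]) simp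
qed

lemma qsym_const: "qsym a a (\<lambda>_. c)"
proof -
  have "approx a a (\<lambda>_. c)"
  proof (rule approx_exact)
    fix N u
    show "\<exists>v. \<forall>y\<in>Y. c * ev (N + a) u y = ev (N + a) v y"
      by (rule exI[of _ "\<lambda>\<mu>. c * u \<mu>"]) (simp add: ev_scale)
  qed
  then show ?thesis unfolding qsym_def by blast
qed

lemma qsym_add:
  assumes "qsym a b g" "qsym a b h"
  shows "qsym a b (\<lambda>y. g y + h y)"
proof -
  obtain C1 C2 where C: "\<forall>y\<in>Y. cmod (g y) \<le> C1" "\<forall>y\<in>Y. cmod (h y) \<le> C2"
    using assms unfolding qsym_def by blast
  have "cmod (g y + h y) \<le> C1 + C2" if "y \<in> Y" for y
    using C that by (intro norm_triangle_le add_mono) auto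
  moreover have "approx a b (\<lambda>y. g y + h y)"
    unfolding approx_def
  proof (intro allI impI)
    fix \<epsilon> :: real assume "\<epsilon> > 0"
    then have e: "\<epsilon> / 2 > 0" by simp
    have "\<forall>\<^sub>F N in sequentially. \<forall>u. \<exists>v.
      nm N (\<lambda>y. g y * ev (N + a) u y - ev (N + b) v y) \<le> \<epsilon> / 2 * nm N (ev (N + a) u)"
      using assms(1) e unfolding qsym_def approx_def by blast
    moreover have "\<forall>\<^sub>F N in sequentially. \<forall>u. \<exists>v.
      nm N (\<lambda>y. h y * ev (N + a) u y - ev (N + b) v y) \<le> \<epsilon> / 2 * nm N (ev (N + a) u)"
      using assms(2) e unfolding qsym_def approx_def by blast
    ultimately show "\<forall>\<^sub>F N in sequentially. \<forall>u. \<exists>v.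
      nm N (\<lambda>y. (g y + h y) * ev (N + a) u y - ev (N + b) v y) \<le> \<epsilon> * nm N (ev (N + a) u)"
    proof eventually_elim
      case (elim N)
      show ?case
      proof
        fix u
        obtain v1 where v1:
          "nm N (\<lambda>y. g y * ev (N + a) u y - ev (N + b) v1 y) \<le> \<epsilon> / 2 * nm N (ev (N + a) u)"
          using elim(1) by blast
        obtain v2 where v2:
          "nm N (\<lambda>y. h y * ev (N + a) u y - ev (N + b) v2 y) \<le> \<epsilon> / 2 * nm N (ev (N + a) u)"
          using elim(2) by blast
        note v = v1 v2
        have "(g y + h y) * ev (N + a) u y - ev (N + b) (\<lambda>\<mu>. v1 \<mu> + v2 \<mu>) y
          = (g y * ev (N + a) u y - ev (N + b) v1 y) + (h y * ev (N + a) u y - ev (N + b) v2 y)" for y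
          unfolding ev_add by (simp add: distrib_right)
        then have "nm N (\<lambda>y. (g y + h y) * ev (N + a) u y - ev (N + b) (\<lambda>\<mu>. v1 \<mu> + v2 \<mu>) y)
          = nm N (\<lambda>y. (g y * ev (N + a) u y - ev (N + b) v1 y) + (h y * ev (N + a) u y - ev (N + b) v2 y))"
          by (simp only:)
        also have "\<dots> \<le> \<epsilon> / 2 * nm N (ev (N + a) u) + \<epsilon> / 2 * nm N (ev (N + a) u)"
          by (rule order.trans[OF nm_triangle]) (intro add_mono v)
        finally show "\<exists>v. nm N (\<lambda>y. (g y + h y) * ev (N + a) u y - ev (N + b) v y) \<le> \<epsilon> * nm N (ev (N + a) u)"
          by (intro exI[of _ "\<lambda>\<mu>. v1 \<mu> + v2 \<mu>"]) simp
      qed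
    qed
  qed
  ultimately show ?thesis unfolding qsym_def by blast
qed

text \<open>Replace h * u by a polynomial \<open>v1\<close> and then g * \<open>v1\<close> by a
  polynomial \<open>v2\<close>. The first error is enlarged at most by the bound G of g; the second
  is relative to \<open>v1\<close>, whose norm is at most H + 1 times that of u.\<close>

lemma qsym_mult:
  assumes "qsym b c g" "qsym a b h"
  shows "qsym a c (\<lambda>y. g y * h y)"
proof -
  obtain C1 C2 where C: "\<forall>y\<in>Y. cmod (g y) \<le> C1" "\<forall>y\<in>Y. cmod (h y) \<le> C2"
    using assms unfolding qsym_def by blast
  define G where "G = \<bar>C1\<bar> + 1"
  define H where "H = \<bar>C2\<bar> + 1"
  have GH: "G > 0" "H > 0" by (auto simp: G_def H_def add_nonneg_pos)
  have g: "cmod (g y) \<le> G" and h: "cmod (h y) \<le> H" if "y \<in> Y" for y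
    using C that unfolding G_def H_def by force+
  have "cmod (g y * h y) \<le> G * H" if "y \<in> Y" for y
    using g[OF that] h[OF that] GH by (auto simp: norm_mult intro!: mult_mono)
  moreover have "approx a c (\<lambda>y. g y * h y)"
    unfolding approx_def
  proof (intro allI impI)
    fix \<epsilon> :: real assume "\<epsilon> > 0"
    \<comment> \<open>The cap 1 bounds the norm of \<open>v1\<close> independently of \<epsilon>;
      each half of \<epsilon> then pays for one of the two errors.\<close>
    define \<epsilon>1 where "\<epsilon>1 = min 1 (\<epsilon> / (2 * G))"
    define \<epsilon>2 where "\<epsilon>2 = \<epsilon> / (2 * (H + 1))"
    have e: "\<epsilon>1 > 0" "\<epsilon>2 > 0" using \<open>\<epsilon> > 0\<close> GH by (auto simp: \<epsilon>1_def \<epsilon>2_def)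
    have "\<forall>\<^sub>F N in sequentially. \<forall>u. \<exists>v.
      nm N (\<lambda>y. h y * ev (N + a) u y - ev (N + b) v y) \<le> \<epsilon>1 * nm N (ev (N + a) u)"
      using assms(2) e unfolding qsym_def approx_def by blast
    moreover have "\<forall>\<^sub>F N in sequentially. \<forall>u. \<exists>v.
      nm N (\<lambda>y. g y * ev (N + b) u y - ev (N + c) v y) \<le> \<epsilon>2 * nm N (ev (N + b) u)"
      using assms(1) e unfolding qsym_def approx_def by blast
    ultimately show "\<forall>\<^sub>F N in sequentially. \<forall>u. \<exists>v.
      nm N (\<lambda>y. (g y * h y) * ev (N + a) u y - ev (N + c) v y) \<le> \<epsilon> * nm N (ev (N + a) u)"
    proof eventually_elim
      case (elim N)
      show ?case
      proof
        fix u
        obtain v1 where v1: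
          "nm N (\<lambda>y. h y * ev (N + a) u y - ev (N + b) v1 y) \<le> \<epsilon>1 * nm N (ev (N + a) u)"
          using elim(1) by metis
        obtain v2 where v2:
          "nm N (\<lambda>y. g y * ev (N + b) v1 y - ev (N + c) v2 y) \<le> \<epsilon>2 * nm N (ev (N + b) v1)"
          using elim(2) by metis
        let ?n = "nm N (ev (N + a) u)"
        have "nm N (ev (N + b) v1) =
          nm N (\<lambda>y. h y * ev (N + a) u y + (-1) * (h y * ev (N + a) u y - ev (N + b) v1 y))"
          by simp
        also have "\<dots> \<le> nm N (\<lambda>y. h y * ev (N + a) u y) + 1 * nm N (\<lambda>y. h y * ev (N + a) u y - ev (N + b) v1 y)"
          by (rule order.trans[OF nm_triangle]) (intro add_mono nm_bounded_mult order.refl, auto)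
        also have "\<dots> \<le> H * ?n + 1 * ?n"
        proof (intro add_mono nm_bounded_mult)
          have "\<epsilon>1 * ?n \<le> 1 * ?n" by (intro mult_right_mono nm_nonneg) (simp add: \<epsilon>1_def)
          then show "1 * nm N (\<lambda>y. h y * ev (N + a) u y - ev (N + b) v1 y) \<le> 1 * ?n"
            using v1 by simp
        qed (use h GH in auto)
        finally have n1: "nm N (ev (N + b) v1) \<le> (H + 1) * ?n" by (simp add: algebra_simps)
        have "nm N (\<lambda>y. (g y * h y) * ev (N + a) u y - ev (N + c) v2 y)
          = nm N (\<lambda>y. g y * (h y * ev (N + a) u y - ev (N + b) v1 y) + (g y * ev (N + b) v1 y - ev (N + c) v2 y))"
          by (simp add: algebra_simps)
        also have "\<dots> \<le> G * nm N (\<lambda>y. h y * ev (N + a) u y - ev (N + b) v1 y) + \<epsilon>2 * nm N (ev (N + b) v1)"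
          using g GH by (intro order.trans[OF nm_triangle] add_mono nm_bounded_mult v2) auto
        also have "\<dots> \<le> G * (\<epsilon>1 * ?n) + \<epsilon>2 * ((H + 1) * ?n)"
          using GH e by (intro add_mono mult_left_mono v1 n1) auto
        also have "\<dots> = (G * \<epsilon>1 + \<epsilon>2 * (H + 1)) * ?n" by (simp add: algebra_simps)
        also have "\<dots> \<le> \<epsilon> * ?n"
        proof (intro mult_right_mono nm_nonneg)
          have "G * \<epsilon>1 \<le> G * (\<epsilon> / (2 * G))" using GH by (intro mult_left_mono) (auto simp: \<epsilon>1_def)
          then have "G * \<epsilon>1 \<le> \<epsilon> / 2" using GH by simp
          moreover have "\<epsilon>2 * (H + 1) = \<epsilon> / 2" using GH by (simp add: \<epsilon>2_def field_simps)
          ultimately show "G * \<epsilon>1 + \<epsilon>2 * (H + 1) \<le> \<epsilon>" by simp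
        qed
        finally show "\<exists>v. nm N (\<lambda>y. (g y * h y) * ev (N + a) u y - ev (N + c) v y) \<le> \<epsilon> * ?n" by blast
      qed
    qed
  qed
  ultimately show ?thesis unfolding qsym_def by blast
qed

lemma qsym_scale: "qsym a b g \<Longrightarrow> qsym a b (\<lambda>y. c * g y)"
  by (rule qsym_mult[OF qsym_const])

lemma qsym_uminus: "qsym a b g \<Longrightarrow> qsym a b (\<lambda>y. - g y)"
  using qsym_scale[of a b g "-1"] by simp

lemma qsym_diff: "qsym a b g \<Longrightarrow> qsym a b h \<Longrightarrow> qsym a b (\<lambda>y. g y - h y)"
  using qsym_add[OF _ qsym_uminus] by fastforce

lemma qsym_zero: "qsym a b (\<lambda>_. 0)"
proof -
  have "approx a b (\<lambda>_. 0)"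
  proof (rule approx_exact)
    fix N u
    show "\<exists>v. \<forall>y\<in>Y. 0 * ev (N + a) u y = ev (N + b) v y"
      by (rule exI[of _ "\<lambda>_. 0"]) (simp add: ev_def)
  qed
  then show ?thesis unfolding qsym_def by auto
qed

lemma qsym_sum: "(\<And>i. i \<in> A \<Longrightarrow> qsym a b (g i)) \<Longrightarrow> qsym a b (\<lambda>y. \<Sum>i\<in>A. g i y)"
  by (induction A rule: infinite_finite_induct) (auto intro: qsym_zero qsym_add)

lemma X_bound:
  assumes "e \<in> Es" "y \<in> Y"
  shows "cmod (X e y) \<le> 1"
proof -
  have "(cmod (X e y))\<^sup>2 \<le> 1"
    using member_le_sum[of e Es "\<lambda>e. (cmod (X e y))\<^sup>2"] X_sum[OF assms(2)] finE assms(1) by simp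
  then show ?thesis using power2_le_imp_le[of "cmod (X e y)" 1] by simp
qed

definition push :: "'e \<Rightarrow> nat \<Rightarrow> ('b \<Rightarrow> complex) \<Rightarrow> 'b \<Rightarrow> complex" where
  "push e k u \<kappa> = (if \<kappa> \<in> up e ` B k then u (inv_into (B k) (up e) \<kappa>) else 0)"

lemma sum_push:
  assumes "e \<in> Es" "\<And>\<kappa>. \<kappa> \<in> B (Suc k) \<Longrightarrow> \<kappa> \<notin> up e ` B k \<Longrightarrow> g \<kappa> = 0"
  shows "(\<Sum>\<kappa>\<in>B (Suc k). g \<kappa>) = (\<Sum>\<mu>\<in>B k. g (up e \<mu>))"
proof -
  have "(\<Sum>\<kappa>\<in>B (Suc k). g \<kappa>) = (\<Sum>\<kappa>\<in>up e ` B k. g \<kappa>)"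
    using assms up_in[OF assms(1)] finB by (intro sum.mono_neutral_right) auto
  then show ?thesis using up_inj[OF assms(1)] by (simp add: sum.reindex)
qed

lemma push_up: "e \<in> Es \<Longrightarrow> \<mu> \<in> B k \<Longrightarrow> push e k u (up e \<mu>) = u \<mu>"
  using up_inj by (simp add: push_def)

lemma sum_push':
  assumes "e \<in> Es" "\<And>\<kappa>. f 0 \<kappa> = 0"
  shows "(\<Sum>\<kappa>\<in>B (Suc k). f (push e k u \<kappa>) \<kappa>) = (\<Sum>\<mu>\<in>B k. f (u \<mu>) (up e \<mu>))"
proof -
  have "(\<Sum>\<kappa>\<in>B (Suc k). f (push e k u \<kappa>) \<kappa>) = (\<Sum>\<mu>\<in>B k. f (push e k u (up e \<mu>)) (up e \<mu>))"
    using assms by (intro sum_push) (auto simp: push_def)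
  also have "\<dots> = (\<Sum>\<mu>\<in>B k. f (u \<mu>) (up e \<mu>))"
    using assms by (intro sum.cong refl) (simp add: push_up)
  finally show ?thesis .
qed

lemma ev_push:
  assumes "e \<in> Es" "y \<in> Y"
  shows "ev (Suc k) (push e k u) y = X e y * ev k u y"
proof -
  have "ev (Suc k) (push e k u) y = (\<Sum>\<mu>\<in>B k. push e k u (up e \<mu>) * mon (up e \<mu>) y)"
    unfolding ev_def using assms by (intro sum_push) (auto simp: push_def)
  also have "\<dots> = X e y * ev k u y"
    using assms by (simp add: ev_def sum_distrib_left push_up mon_up mult_ac)
  finally show ?thesis .
qed

lemma qsym_X:
  assumes e: "e \<in> Es"
  shows "qsym a (Suc a) (X e)"
proof -
  have "approx a (Suc a) (X e)"
  proof (rule approx_exact)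
    fix N u
    show "\<exists>v. \<forall>y\<in>Y. X e y * ev (N + a) u y = ev (N + Suc a) v y"
      by (rule exI[of _ "push e (N + a) u"]) (simp add: ev_push[OF e])
  qed
  then show ?thesis unfolding qsym_def using X_bound[OF e] by blast
qed

text \<open>The polynomial v is the orthogonal projection of cnj (X e) * f to degree k, so the
  squared error is the squared norm of X e * f minus that of v. In monomial weights, an index in the
  image of \<open>up e\<close> contributes the gap between consecutive weight ratios, any other
  index its full raised weight.\<close>

lemma projection_error:
  assumes e: "e \<in> Es" and g0: "good N k" and g1: "good N (Suc k)" and g2: "good N (Suc (Suc k))"
    and up: "\<forall>\<mu>\<in>B k. w N (up e (up e \<mu>)) * w N \<mu> \<le> (w N (up e \<mu>))\<^sup>2 + \<epsilon> * w N (up e \<mu>) * w N \<mu>"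
    and bottom: "\<forall>\<mu>\<in>B (Suc k) - up e ` B k. w N (up e \<mu>) \<le> \<epsilon> * w N \<mu>"
  shows "\<exists>v. (nm N (\<lambda>y. cnj (X e y) * ev (Suc k) u y - ev k v y))\<^sup>2 \<le> \<epsilon> * (nm N (ev (Suc k) u))\<^sup>2"
proof -
  \<comment> \<open>Pairing cnj (X e) * f with the monomial at \<nu> is pairing f with the monomial
    at \<open>up e \<nu>\<close>; dividing by the weight of \<nu> gives the coefficient of the
    projection.\<close>
  define v where "v \<nu> = u (up e \<nu>) * of_real (w N (up e \<nu>) / w N \<nu>)" for \<nu>
  \<comment> \<open>Both the squared norm of the projection and its pairing with the projected
    function.\<close>
  define Q where "Q = (\<Sum>\<nu>\<in>B k. (cmod (u (up e \<nu>)))\<^sup>2 * ((w N (up e \<nu>))\<^sup>2 / w N \<nu>))"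
  let ?f = "\<lambda>p. ev (Suc k) u (pt N p)" and ?g = "\<lambda>p. ev k v (pt N p)" and ?x = "\<lambda>p. X e (pt N p)"
  have wp: "w N \<nu> > 0" if "\<nu> \<in> B k" for \<nu> using g0 that by (simp add: good_def)
  have "(nm N (ev (Suc (Suc k)) (push e (Suc k) u)))\<^sup>2 = (\<Sum>\<kappa>\<in>B (Suc (Suc k)). (cmod (push e (Suc k) u \<kappa>))\<^sup>2 * w N \<kappa>)"
    by (rule nm_ev[OF g2])
  also have "\<dots> = (\<Sum>\<mu>\<in>B (Suc k). (cmod (u \<mu>))\<^sup>2 * w N (up e \<mu>))"
    by (rule sum_push'[OF e, where f = "\<lambda>z \<kappa>. (cmod z)\<^sup>2 * w N \<kappa>"]) simp
  also have "nm N (ev (Suc (Suc k)) (push e (Suc k) u)) = nm N (\<lambda>y. X e y * ev (Suc k) u y)"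
    using ev_push[OF e] by (intro nm_cong) auto
  finally have 1: "(\<Sum>p\<in>P N. (cmod (?x p * ?f p))\<^sup>2) = (\<Sum>\<mu>\<in>B (Suc k). (cmod (u \<mu>))\<^sup>2 * w N (up e \<mu>))"
    by (simp add: nm_def L2_set_def sum_nonneg)
  have "(\<Sum>p\<in>P N. cnj (?x p * ?g p) * ?f p) = (\<Sum>p\<in>P N. cnj (ev (Suc k) (push e k v) (pt N p)) * ?f p)"
    using ev_push[OF e] pt by (intro sum.cong) auto
  also have "\<dots> = (\<Sum>\<mu>\<in>B (Suc k). cnj (push e k v \<mu>) * u \<mu> * of_real (w N \<mu>))"
    by (rule inner_ev[OF g1])
  also have "\<dots> = (\<Sum>\<nu>\<in>B k. cnj (v \<nu>) * u (up e \<nu>) * of_real (w N (up e \<nu>)))"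
    by (rule sum_push'[OF e, where f = "\<lambda>z \<kappa>. cnj z * u \<kappa> * of_real (w N \<kappa>)"]) simp
  also have "\<dots> = of_real Q"
    unfolding Q_def v_def of_real_sum
  proof (intro sum.cong refl)
    fix \<nu>
    have "cnj (u (up e \<nu>) * of_real (w N (up e \<nu>) / w N \<nu>)) * u (up e \<nu>) * of_real (w N (up e \<nu>))
      = (cnj (u (up e \<nu>)) * u (up e \<nu>)) * of_real ((w N (up e \<nu>))\<^sup>2 / w N \<nu>)"
      by (simp add: power2_eq_square)
    then show "cnj (u (up e \<nu>) * of_real (w N (up e \<nu>) / w N \<nu>)) * u (up e \<nu>) * of_real (w N (up e \<nu>))
      = of_real ((cmod (u (up e \<nu>)))\<^sup>2 * ((w N (up e \<nu>))\<^sup>2 / w N \<nu>))"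
      by (simp add: cnj_mult_self)
  qed
  finally have 2: "(\<Sum>p\<in>P N. cnj (?x p * ?g p) * ?f p) = of_real Q" .
  have "(nm N (ev k v))\<^sup>2 = (\<Sum>\<nu>\<in>B k. (cmod (v \<nu>))\<^sup>2 * w N \<nu>)" by (rule nm_ev[OF g0])
  also have "\<dots> = Q"
    unfolding Q_def
  proof (intro sum.cong refl)
    fix \<nu> assume "\<nu> \<in> B k"
    then show "(cmod (v \<nu>))\<^sup>2 * w N \<nu> = (cmod (u (up e \<nu>)))\<^sup>2 * ((w N (up e \<nu>))\<^sup>2 / w N \<nu>)"
      using wp[of \<nu>] by (simp add: v_def norm_mult norm_divide power_mult_distrib power_divide)
        (simp add: power2_eq_square)
  qed
  finally have 3: "(\<Sum>p\<in>P N. (cmod (?g p))\<^sup>2) = Q"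
    by (simp add: nm_def L2_set_def sum_nonneg)
  have "(nm N (\<lambda>y. cnj (X e y) * ev (Suc k) u y - ev k v y))\<^sup>2 = (\<Sum>p\<in>P N. (cmod (cnj (?x p) * ?f p - ?g p))\<^sup>2)"
    by (simp add: nm_def L2_set_def sum_nonneg)
  also have "\<dots> = (\<Sum>p\<in>P N. (cmod (?x p * ?f p))\<^sup>2 - 2 * Re (cnj (?x p * ?g p) * ?f p) + (cmod (?g p))\<^sup>2)"
  proof (intro sum.cong refl)
    fix p
    have sq: "(cmod (a - b))\<^sup>2 = (cmod a)\<^sup>2 - 2 * Re (cnj b * a) + (cmod b)\<^sup>2" for a b :: complex
      unfolding cmod_power2 by (simp add: power2_eq_square algebra_simps)
    have "(cmod (cnj (?x p) * ?f p))\<^sup>2 = (cmod (?x p * ?f p))\<^sup>2" by (simp add: norm_mult)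
    with sq[of "cnj (?x p) * ?f p" "?g p"]
    show "(cmod (cnj (?x p) * ?f p - ?g p))\<^sup>2 =
      (cmod (?x p * ?f p))\<^sup>2 - 2 * Re (cnj (?x p * ?g p) * ?f p) + (cmod (?g p))\<^sup>2"
      by (simp add: mult_ac)
  qed
  also have "\<dots> = (\<Sum>p\<in>P N. (cmod (?x p * ?f p))\<^sup>2) - 2 * Re (\<Sum>p\<in>P N. cnj (?x p * ?g p) * ?f p) + (\<Sum>p\<in>P N. (cmod (?g p))\<^sup>2)"
    by (simp add: sum.distrib sum_subtractf sum_distrib_left)
  also have "\<dots> = (\<Sum>\<mu>\<in>B (Suc k). (cmod (u \<mu>))\<^sup>2 * w N (up e \<mu>)) - Q"
    unfolding 1 2 3 by simp
  also have "(\<Sum>\<mu>\<in>B (Suc k). (cmod (u \<mu>))\<^sup>2 * w N (up e \<mu>)) =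
     (\<Sum>\<mu>\<in>B (Suc k) - up e ` B k. (cmod (u \<mu>))\<^sup>2 * w N (up e \<mu>)) + (\<Sum>\<mu>\<in>up e ` B k. (cmod (u \<mu>))\<^sup>2 * w N (up e \<mu>))"
    using up_in[OF e] finB by (intro sum.subset_diff) auto
  also have "(\<Sum>\<mu>\<in>up e ` B k. (cmod (u \<mu>))\<^sup>2 * w N (up e \<mu>)) = (\<Sum>\<nu>\<in>B k. (cmod (u (up e \<nu>)))\<^sup>2 * w N (up e (up e \<nu>)))"
    using up_inj[OF e] by (simp add: sum.reindex)
  also have "\<dots> \<le> (\<Sum>\<nu>\<in>B k. (cmod (u (up e \<nu>)))\<^sup>2 * ((w N (up e \<nu>))\<^sup>2 / w N \<nu> + \<epsilon> * w N (up e \<nu>)))"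
  proof (intro sum_mono mult_left_mono)
    fix \<nu> assume "\<nu> \<in> B k"
    then show "w N (up e (up e \<nu>)) \<le> (w N (up e \<nu>))\<^sup>2 / w N \<nu> + \<epsilon> * w N (up e \<nu>)"
      using up wp[of \<nu>] by (simp add: field_simps)
  qed auto
  also have "\<dots> = Q + \<epsilon> * (\<Sum>\<nu>\<in>B k. (cmod (u (up e \<nu>)))\<^sup>2 * w N (up e \<nu>))"
    by (simp add: Q_def algebra_simps sum.distrib sum_distrib_left)
  also have "(\<Sum>\<mu>\<in>B (Suc k) - up e ` B k. (cmod (u \<mu>))\<^sup>2 * w N (up e \<mu>)) \<le>
     (\<Sum>\<mu>\<in>B (Suc k) - up e ` B k. (cmod (u \<mu>))\<^sup>2 * (\<epsilon> * w N \<mu>))"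
    using bottom by (intro sum_mono mult_left_mono) auto
  also have "\<dots> = \<epsilon> * (\<Sum>\<mu>\<in>B (Suc k) - up e ` B k. (cmod (u \<mu>))\<^sup>2 * w N \<mu>)"
    by (simp add: sum_distrib_left mult_ac)
  finally have "(nm N (\<lambda>y. cnj (X e y) * ev (Suc k) u y - ev k v y))\<^sup>2 \<le>
      \<epsilon> * ((\<Sum>\<mu>\<in>B (Suc k) - up e ` B k. (cmod (u \<mu>))\<^sup>2 * w N \<mu>) + (\<Sum>\<nu>\<in>B k. (cmod (u (up e \<nu>)))\<^sup>2 * w N (up e \<nu>)))"
    by (simp add: algebra_simps)
  also have "(\<Sum>\<nu>\<in>B k. (cmod (u (up e \<nu>)))\<^sup>2 * w N (up e \<nu>)) = (\<Sum>\<mu>\<in>up e ` B k. (cmod (u \<mu>))\<^sup>2 * w N \<mu>)"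
    using up_inj[OF e] by (simp add: sum.reindex)
  also have "(\<Sum>\<mu>\<in>B (Suc k) - up e ` B k. (cmod (u \<mu>))\<^sup>2 * w N \<mu>) + \<dots> = (\<Sum>\<mu>\<in>B (Suc k). (cmod (u \<mu>))\<^sup>2 * w N \<mu>)"
    using up_in[OF e] finB by (intro sum.subset_diff[symmetric]) auto
  also have "\<dots> = (nm N (ev (Suc k) u))\<^sup>2" by (rule nm_ev[OF g1, symmetric])
  finally show ?thesis by blast
qed

lemma qsym_cnj_X:
  assumes e: "e \<in> Es"
  shows "qsym (Suc a) a (\<lambda>y. cnj (X e y))"
proof -
  have "approx (Suc a) a (\<lambda>y. cnj (X e y))"
    unfolding approx_def
  proof (intro allI impI)
    fix \<epsilon> :: real assume "\<epsilon> > 0"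
    then have e2: "\<epsilon>\<^sup>2 > 0" by simp
    have "\<forall>\<^sub>F N in sequentially. good N (N + a)" "\<forall>\<^sub>F N in sequentially. good N (Suc (N + a))"
      "\<forall>\<^sub>F N in sequentially. good N (Suc (Suc (N + a)))"
      using eventually_good[of a] eventually_good[of "Suc a"] eventually_good[of "Suc (Suc a)"] by simp_all
    with gap_up[OF e e2, of a] gap_bottom[OF e e2, of a]
    show "\<forall>\<^sub>F N in sequentially. \<forall>u. \<exists>v. nm N (\<lambda>y. cnj (X e y) * ev (N + Suc a) u y - ev (N + a) v y)
      \<le> \<epsilon> * nm N (ev (N + Suc a) u)"
    proof eventually_elim
      case (elim N)
      show ?case
      proof
        fix u
        obtain v where "(nm N (\<lambda>y. cnj (X e y) * ev (Suc (N + a)) u y - ev (N + a) v y))\<^sup>2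
          \<le> \<epsilon>\<^sup>2 * (nm N (ev (Suc (N + a)) u))\<^sup>2"
          using projection_error[OF e elim(3-5) elim(1,2)] by blast
        then have "nm N (\<lambda>y. cnj (X e y) * ev (Suc (N + a)) u y - ev (N + a) v y) \<le> \<epsilon> * nm N (ev (Suc (N + a)) u)"
          using \<open>\<epsilon> > 0\<close> nm_nonneg by (simp add: power2_le_iff_abs_le flip: power_mult_distrib)
        then show "\<exists>v. nm N (\<lambda>y. cnj (X e y) * ev (N + Suc a) u y - ev (N + a) v y)
          \<le> \<epsilon> * nm N (ev (N + Suc a) u)" by auto
      qed
    qed
  qed
  then show ?thesis unfolding qsym_def using X_bound[OF e] by (metis complex_mod_cnj)
qed

section \<open>Toeplitz forms with matrix symbols\<close>

definition ix :: "nat \<Rightarrow> 'i set \<Rightarrow> ('i \<Rightarrow> nat) \<Rightarrow> ('i \<times> 'b) set" where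
  "ix N Is dg = Sigma Is (\<lambda>\<iota>. B (N + dg \<iota>))"

text \<open>The Toeplitz form of D in the monomial basis: multiplication by D compressed to
  polynomials, with the quadrature as inner product.\<close>

definition fm :: "nat \<Rightarrow> ('i \<Rightarrow> 'i \<Rightarrow> 'y \<Rightarrow> complex) \<Rightarrow> 'i \<times> 'b \<Rightarrow> 'i \<times> 'b \<Rightarrow> complex" where
  "fm N D a b = (\<Sum>p\<in>P N. cnj (mon (snd a) (pt N p)) * D (fst a) (fst b) (pt N p) * mon (snd b) (pt N p))"

definition fld :: "nat \<Rightarrow> ('i \<Rightarrow> nat) \<Rightarrow> ('i \<times> 'b \<Rightarrow> complex) \<Rightarrow> 'i \<Rightarrow> 'y \<Rightarrow> complex" where
  "fld N dg u \<iota> y = ev (N + dg \<iota>) (\<lambda>\<mu>. u (\<iota>, \<mu>)) y"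

definition symb :: "'i set \<Rightarrow> ('i \<Rightarrow> nat) \<Rightarrow> ('i \<Rightarrow> 'i \<Rightarrow> 'y \<Rightarrow> complex) \<Rightarrow> bool" where
  "symb Is dg D \<longleftrightarrow> finite Is \<and> (\<forall>\<iota>\<in>Is. \<forall>\<kappa>\<in>Is. qsym (dg \<kappa>) (dg \<iota>) (D \<iota> \<kappa>)) \<and>
     (\<forall>y\<in>Y. \<forall>\<iota>\<in>Is. \<forall>\<kappa>\<in>Is. D \<kappa> \<iota> y = cnj (D \<iota> \<kappa> y))"

text \<open>One constant c for all points of Y: pointwise invertibility would not give the estimate
  in norm on which \<open>nondeg_segment\<close> rests.\<close>

definition elliptic :: "real \<Rightarrow> 'i set \<Rightarrow> ('i \<Rightarrow> 'i \<Rightarrow> 'y \<Rightarrow> complex) \<Rightarrow> bool" where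
  "elliptic c Is D \<longleftrightarrow> (\<forall>y\<in>Y. \<forall>v. c * (\<Sum>\<iota>\<in>Is. (cmod (v \<iota>))\<^sup>2) \<le> (\<Sum>\<iota>\<in>Is. (cmod (\<Sum>\<kappa>\<in>Is. D \<iota> \<kappa> y * v \<kappa>))\<^sup>2))"

lemma sum_ix:
  assumes "finite Is"
  shows "(\<Sum>a\<in>ix N Is dg. g a) = (\<Sum>\<iota>\<in>Is. \<Sum>\<mu>\<in>B (N + dg \<iota>). g (\<iota>, \<mu>))"
  unfolding ix_def using assms finB by (simp add: sum.Sigma)

lemma finite_ix: "finite Is \<Longrightarrow> finite (ix N Is dg)"
  using finB by (auto simp: ix_def)

lemma hermitian_fm:
  assumes "symb Is dg D"
  shows "hermitian_on (ix N Is dg) (fm N D)"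
  unfolding hermitian_on_def
proof (intro ballI)
  fix a b assume "a \<in> ix N Is dg" "b \<in> ix N Is dg"
  then have ab: "fst a \<in> Is" "fst b \<in> Is" by (auto simp: ix_def)
  have "D (fst b) (fst a) (pt N p) = cnj (D (fst a) (fst b) (pt N p))" if "p \<in> P N" for p
    using assms ab pt[OF that] unfolding symb_def by blast
  then show "fm N D b a = cnj (fm N D a b)"
    unfolding fm_def by (simp add: mult_ac)
qed

lemma hform_fm:
  assumes "finite Is"
  shows "hform (ix N Is dg) (fm N D) u v =
    (\<Sum>p\<in>P N. \<Sum>\<iota>\<in>Is. cnj (fld N dg u \<iota> (pt N p)) * (\<Sum>\<kappa>\<in>Is. D \<iota> \<kappa> (pt N p) * fld N dg v \<kappa> (pt N p)))"
proof -
  let ?A = "ix N Is dg"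
  let ?t = "\<lambda>p a b. cnj (u a) * cnj (mon (snd a) (pt N p)) * D (fst a) (fst b) (pt N p) * v b * mon (snd b) (pt N p)"
  have "hform ?A (fm N D) u v = (\<Sum>a\<in>?A. \<Sum>b\<in>?A. \<Sum>p\<in>P N. ?t p a b)"
    by (simp add: hform_def fm_def sum_distrib_left sum_distrib_right mult_ac)
  also have "\<dots> = (\<Sum>p\<in>P N. \<Sum>a\<in>?A. \<Sum>b\<in>?A. ?t p a b)"
    by (simp only: sum.swap[of _ "P N" ?A])
  also have "\<dots> = (\<Sum>p\<in>P N. \<Sum>\<iota>\<in>Is. \<Sum>\<mu>\<in>B (N + dg \<iota>). \<Sum>\<kappa>\<in>Is. \<Sum>\<nu>\<in>B (N + dg \<kappa>). ?t p (\<iota>, \<mu>) (\<kappa>, \<nu>))"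
    unfolding sum_ix[OF assms] by simp
  also have "\<dots> = (\<Sum>p\<in>P N. \<Sum>\<iota>\<in>Is. \<Sum>\<mu>\<in>B (N + dg \<iota>).
      cnj (u (\<iota>, \<mu>) * mon \<mu> (pt N p)) * (\<Sum>\<kappa>\<in>Is. D \<iota> \<kappa> (pt N p) * fld N dg v \<kappa> (pt N p)))"
    by (simp add: fld_def ev_def sum_distrib_left mult_ac)
  also have "\<dots> = (\<Sum>p\<in>P N. \<Sum>\<iota>\<in>Is. cnj (fld N dg u \<iota> (pt N p)) * (\<Sum>\<kappa>\<in>Is. D \<iota> \<kappa> (pt N p) * fld N dg v \<kappa> (pt N p)))"
    unfolding fld_def[of N dg u] ev_def cnj_sum sum_distrib_right ..
  finally show ?thesis .
qed

end

lemma L2_set_sum_le: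
  assumes "finite I"
  shows "L2_set (\<lambda>p. \<Sum>i\<in>I. f i p) A \<le> (\<Sum>i\<in>I. L2_set (f i) A)"
  using assms
proof (induction I rule: finite_induct)
  case empty
  show ?case by (simp add: L2_set_def)
next
  case (insert i I)
  then show ?case
    using order.trans[OF L2_set_triangle_ineq[of "f i" "\<lambda>p. \<Sum>i\<in>I. f i p" A]] by simp
qed

text \<open>Two copies of an index set; the second copy is shifted by one degree.\<close>

definition double :: "bool list set \<Rightarrow> bool list set" where
  "double Is = Cons False ` Is \<union> Cons True ` Is"

fun double_degree :: "(bool list \<Rightarrow> nat) \<Rightarrow> bool list \<Rightarrow> nat" where
  "double_degree dg [] = dg []"
| "double_degree dg (b # as) = (if b then Suc (dg as) else dg as)"

text \<open>The Hermitian block matrix with D0 and D1 on the diagonal, Q below it and the adjoint of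
  Q above it; the head of an index names the block.\<close>

fun block :: "(bool list \<Rightarrow> bool list \<Rightarrow> 'y \<Rightarrow> complex) \<Rightarrow> (bool list \<Rightarrow> bool list \<Rightarrow> 'y \<Rightarrow> complex) \<Rightarrow>
    (bool list \<Rightarrow> bool list \<Rightarrow> 'y \<Rightarrow> complex) \<Rightarrow> bool list \<Rightarrow> bool list \<Rightarrow> 'y \<Rightarrow> complex" where
  "block D0 Q D1 (a # as) (b # bs) =
     (if a then (if b then D1 as bs else Q as bs) else (if b then (\<lambda>y. cnj (Q bs as y)) else D0 as bs))"
| "block D0 Q D1 _ _ = (\<lambda>_. 0)"

lemma sum_double:
  assumes "finite Is"
  shows "(\<Sum>\<iota>\<in>double Is. f \<iota>) = (\<Sum>as\<in>Is. f (False # as)) + (\<Sum>as\<in>Is. f (True # as))"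
proof -
  have "(\<Sum>\<iota>\<in>double Is. f \<iota>) = (\<Sum>\<iota>\<in>Cons False ` Is. f \<iota>) + (\<Sum>\<iota>\<in>Cons True ` Is. f \<iota>)"
    unfolding double_def using assms by (intro sum.union_disjoint) auto
  then show ?thesis by (simp add: sum.reindex)
qed

context toeplitz
begin

lemma nm_sum_le:
  assumes "finite I"
  shows "nm N (\<lambda>y. \<Sum>i\<in>I. f i y) \<le> (\<Sum>i\<in>I. nm N (f i))"
proof -
  have "nm N (\<lambda>y. \<Sum>i\<in>I. f i y) \<le> L2_set (\<lambda>p. \<Sum>i\<in>I. cmod (f i (pt N p))) (P N)"
    unfolding nm_def by (intro L2_set_mono) (auto intro: norm_sum)
  also have "\<dots> \<le> (\<Sum>i\<in>I. nm N (f i))" unfolding nm_def by (rule L2_set_sum_le[OF assms])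
  finally show ?thesis .
qed

lemma nm_scale: "nm N (\<lambda>y. c * f y) = cmod c * nm N f"
  by (simp add: nm_def norm_mult L2_set_right_distrib)

definition tot :: "nat \<Rightarrow> 'i set \<Rightarrow> ('i \<Rightarrow> 'y \<Rightarrow> complex) \<Rightarrow> real" where
  "tot N Is \<psi> = L2_set (\<lambda>(p, \<iota>). cmod (\<psi> \<iota> (pt N p))) (P N \<times> Is)"

lemma tot_square: "(tot N Is \<psi>)\<^sup>2 = (\<Sum>p\<in>P N. \<Sum>\<iota>\<in>Is. (cmod (\<psi> \<iota> (pt N p)))\<^sup>2)"
  by (simp add: tot_def L2_set_def sum_nonneg split_beta sum.cartesian_product)

lemma tot_square': "(tot N Is \<psi>)\<^sup>2 = (\<Sum>\<iota>\<in>Is. (nm N (\<psi> \<iota>))\<^sup>2)"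
  unfolding tot_square nm_def by (subst sum.swap) (simp add: L2_set_def sum_nonneg)

lemma tot_nonneg: "tot N Is \<psi> \<ge> 0"
  by (simp add: tot_def)

lemma nm_le_tot:
  assumes "finite Is" "\<iota> \<in> Is"
  shows "nm N (\<psi> \<iota>) \<le> tot N Is \<psi>"
proof -
  have "(nm N (\<psi> \<iota>))\<^sup>2 \<le> (tot N Is \<psi>)\<^sup>2"
    unfolding tot_square' using assms member_le_sum[of \<iota> Is "\<lambda>\<iota>. (nm N (\<psi> \<iota>))\<^sup>2"] by simp
  then show ?thesis using power2_le_imp_le tot_nonneg by blast
qed

lemma tot_le_sum:
  assumes "finite Is"
  shows "tot N Is \<psi> \<le> (\<Sum>\<iota>\<in>Is. nm N (\<psi> \<iota>))"
proof -
  have "tot N Is \<psi> = sqrt ((tot N Is \<psi>)\<^sup>2)" using tot_nonneg[of N Is \<psi>] by simp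
  also have "\<dots> = L2_set (\<lambda>\<iota>. nm N (\<psi> \<iota>)) Is" unfolding tot_square' L2_set_def ..
  also have "\<dots> \<le> (\<Sum>\<iota>\<in>Is. nm N (\<psi> \<iota>))" by (rule L2_set_le_sum) (simp add: nm_nonneg)
  finally show ?thesis .
qed

lemma tot_Cauchy_Schwarz:
  "cmod (\<Sum>p\<in>P N. \<Sum>\<iota>\<in>Is. cnj (\<phi> \<iota> (pt N p)) * \<psi> \<iota> (pt N p)) \<le> tot N Is \<phi> * tot N Is \<psi>"
proof -
  have "cmod (\<Sum>p\<in>P N. \<Sum>\<iota>\<in>Is. cnj (\<phi> \<iota> (pt N p)) * \<psi> \<iota> (pt N p))
    \<le> (\<Sum>p\<in>P N. \<Sum>\<iota>\<in>Is. cmod (\<phi> \<iota> (pt N p)) * cmod (\<psi> \<iota> (pt N p)))"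
    by (intro order.trans[OF norm_sum] sum_mono) (auto simp: norm_mult intro!: order.trans[OF norm_sum] sum_mono)
  also have "\<dots> = (\<Sum>(p, \<iota>)\<in>P N \<times> Is. \<bar>cmod (\<phi> \<iota> (pt N p))\<bar> * \<bar>cmod (\<psi> \<iota> (pt N p))\<bar>)"
    by (simp add: sum.cartesian_product)
  also have "\<dots> \<le> tot N Is \<phi> * tot N Is \<psi>"
    unfolding tot_def
    using L2_set_mult_ineq[of "\<lambda>(p, \<iota>). cmod (\<phi> \<iota> (pt N p))" "\<lambda>(p, \<iota>). cmod (\<psi> \<iota> (pt N p))" "P N \<times> Is"]
    by (simp add: split_beta)
  finally show ?thesis .
qed

lemma tot_fld:
  assumes "finite Is" "\<And>\<iota>. \<iota> \<in> Is \<Longrightarrow> good N (N + dg \<iota>)"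
  shows "(tot N Is (fld N dg v))\<^sup>2 = (\<Sum>a\<in>ix N Is dg. (cmod (v a))\<^sup>2 * w N (snd a))"
  unfolding tot_square' fld_def sum_ix[OF assms(1)] using assms(2)
  by (intro sum.cong refl) (simp add: nm_ev)

lemma tot_fld_pos:
  assumes "finite Is" "\<And>\<iota>. \<iota> \<in> Is \<Longrightarrow> good N (N + dg \<iota>)" "\<exists>a\<in>ix N Is dg. v a \<noteq> 0"
  shows "tot N Is (fld N dg v) > 0"
proof -
  obtain a where a: "a \<in> ix N Is dg" "v a \<noteq> 0" using assms(3) by blast
  have pos: "w N (snd a) > 0" if "a \<in> ix N Is dg" for a
    using assms(2) that unfolding ix_def good_def by auto
  have "(\<Sum>a\<in>ix N Is dg. (cmod (v a))\<^sup>2 * w N (snd a)) > 0"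
  proof (rule sum_pos2[OF finite_ix[OF assms(1)] a(1)])
    show "0 < (cmod (v a))\<^sup>2 * w N (snd a)" using a pos by simp
    show "0 \<le> (cmod (v b))\<^sup>2 * w N (snd b)" if "b \<in> ix N Is dg" for b
      using pos[OF that] by simp
  qed
  then have "(tot N Is (fld N dg v))\<^sup>2 > 0" by (simp add: tot_fld assms(1,2))
  then show ?thesis using tot_nonneg[of N Is "fld N dg v"] by (simp add: less_le)
qed

text \<open>For a nonzero polynomial vector \<psi> the function D \<psi> has norm at least sqrt c
  times that of \<psi>, and up to a smaller error it is a polynomial vector \<phi>. The form at
  \<phi> and \<psi> is then nonzero. Approximating D0 and D1 separately makes the bound on N
  independent of t.\<close>

lemma nondeg_segment:
  assumes s0: "symb Is dg D0" and s1: "symb Is dg D1" and c: "c > 0"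
    and ell: "\<And>t. 0 \<le> t \<Longrightarrow> t \<le> 1 \<Longrightarrow>
      elliptic c Is (\<lambda>\<iota> \<kappa> y. of_real (1 - t) * D0 \<iota> \<kappa> y + of_real t * D1 \<iota> \<kappa> y)"
  shows "\<forall>\<^sub>F N in sequentially. \<forall>t. 0 \<le> t \<longrightarrow> t \<le> 1 \<longrightarrow>
    nondeg (ix N Is dg) (fm N (\<lambda>\<iota> \<kappa> y. of_real (1 - t) * D0 \<iota> \<kappa> y + of_real t * D1 \<iota> \<kappa> y))"
proof -
  have fin: "finite Is" using s0 by (simp add: symb_def)
  define n where "n = real (card Is)"
  \<comment> \<open>A matrix of n * n entries, each with relative error \<epsilon>, must stay below
    sqrt c in total.\<close>
  define \<epsilon> where "\<epsilon> = sqrt c / (2 * (n * n + 1))"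
  have n: "n \<ge> 0" by (simp add: n_def)
  have den: "n * n + 1 > 0" using n by (simp add: add_nonneg_pos)
  have \<epsilon>: "\<epsilon> > 0" using c den by (simp add: \<epsilon>_def)
  have \<epsilon>n: "n * n * \<epsilon> < sqrt c"
  proof -
    have "n * n * \<epsilon> = (n * n / (n * n + 1)) * (sqrt c / 2)" by (simp add: \<epsilon>_def)
    also have "\<dots> \<le> 1 * (sqrt c / 2)" using c den by (intro mult_right_mono) auto
    finally show ?thesis using real_sqrt_gt_zero[OF c] by linarith
  qed
  have "\<forall>\<^sub>F N in sequentially. \<forall>\<kappa>\<in>Is. \<forall>\<iota>\<in>Is. \<forall>u. \<exists>v. nm N (\<lambda>y. D0 \<iota> \<kappa> y * ev (N + dg \<kappa>) u y - ev (N + dg \<iota>) v y)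
    \<le> \<epsilon> * nm N (ev (N + dg \<kappa>) u)"
    using s0 \<epsilon> fin unfolding symb_def qsym_def approx_def by (intro eventually_ball_finite ballI) auto
  moreover have "\<forall>\<^sub>F N in sequentially. \<forall>\<kappa>\<in>Is. \<forall>\<iota>\<in>Is. \<forall>u. \<exists>v. nm N (\<lambda>y. D1 \<iota> \<kappa> y * ev (N + dg \<kappa>) u y - ev (N + dg \<iota>) v y)
    \<le> \<epsilon> * nm N (ev (N + dg \<kappa>) u)"
    using s1 \<epsilon> fin unfolding symb_def qsym_def approx_def by (intro eventually_ball_finite ballI) auto
  moreover have "\<forall>\<^sub>F N in sequentially. \<forall>\<iota>\<in>Is. good N (N + dg \<iota>)"
    using fin eventually_good by (intro eventually_ball_finite ballI) auto
  ultimately show ?thesis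
  proof eventually_elim
    case (elim N)
    show ?case
    proof (intro allI impI)
      fix t :: real assume t: "0 \<le> t" "t \<le> 1"
      define D where "D = (\<lambda>\<iota> \<kappa> y. of_real (1 - t) * D0 \<iota> \<kappa> y + of_real t * D1 \<iota> \<kappa> y)"
      show "nondeg (ix N Is dg) (fm N (\<lambda>\<iota> \<kappa> y. of_real (1 - t) * D0 \<iota> \<kappa> y + of_real t * D1 \<iota> \<kappa> y))"
        unfolding nondeg_def D_def[symmetric]
      proof (intro allI impI)
        fix v :: "'a \<times> 'b \<Rightarrow> complex" assume v: "\<exists>a\<in>ix N Is dg. v a \<noteq> 0"
        define \<psi> where "\<psi> = fld N dg v"
        define S where "S = tot N Is \<psi>"
        have S: "S > 0" unfolding S_def \<psi>_def by (rule tot_fld_pos) (use fin elim(3) v in auto)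
        define \<zeta> where "\<zeta> = (\<lambda>\<iota> y. \<Sum>\<kappa>\<in>Is. D \<iota> \<kappa> y * \<psi> \<kappa> y)"
        have \<psi>: "\<psi> \<kappa> = ev (N + dg \<kappa>) (\<lambda>\<mu>. v (\<kappa>, \<mu>))" for \<kappa> by (simp add: \<psi>_def fld_def fun_eq_iff)
        have "\<exists>u. nm N (\<lambda>y. D \<iota> \<kappa> y * \<psi> \<kappa> y - ev (N + dg \<iota>) u y) \<le> \<epsilon> * S" if \<iota>\<kappa>: "\<iota> \<in> Is" "\<kappa> \<in> Is" for \<iota> \<kappa>
        proof -
          obtain u0 where u0: "nm N (\<lambda>y. D0 \<iota> \<kappa> y * \<psi> \<kappa> y - ev (N + dg \<iota>) u0 y) \<le> \<epsilon> * nm N (\<psi> \<kappa>)"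
            using elim(1) \<iota>\<kappa> unfolding \<psi> by blast
          obtain u1 where u1: "nm N (\<lambda>y. D1 \<iota> \<kappa> y * \<psi> \<kappa> y - ev (N + dg \<iota>) u1 y) \<le> \<epsilon> * nm N (\<psi> \<kappa>)"
            using elim(2) \<iota>\<kappa> unfolding \<psi> by blast
          let ?u = "\<lambda>\<mu>. of_real (1 - t) * u0 \<mu> + of_real t * u1 \<mu>"
          have "D \<iota> \<kappa> y * \<psi> \<kappa> y - ev (N + dg \<iota>) ?u y = of_real (1 - t) * (D0 \<iota> \<kappa> y * \<psi> \<kappa> y - ev (N + dg \<iota>) u0 y)
             + of_real t * (D1 \<iota> \<kappa> y * \<psi> \<kappa> y - ev (N + dg \<iota>) u1 y)" for y
            unfolding ev_add ev_scale D_def by (simp only: distrib_right right_diff_distrib mult.assoc) simp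
          then have "nm N (\<lambda>y. D \<iota> \<kappa> y * \<psi> \<kappa> y - ev (N + dg \<iota>) ?u y) =
             nm N (\<lambda>y. of_real (1 - t) * (D0 \<iota> \<kappa> y * \<psi> \<kappa> y - ev (N + dg \<iota>) u0 y)
             + of_real t * (D1 \<iota> \<kappa> y * \<psi> \<kappa> y - ev (N + dg \<iota>) u1 y))"
            by (simp only:)
          also have "\<dots> \<le> cmod (of_real (1 - t)) * nm N (\<lambda>y. D0 \<iota> \<kappa> y * \<psi> \<kappa> y - ev (N + dg \<iota>) u0 y)
             + cmod (of_real t) * nm N (\<lambda>y. D1 \<iota> \<kappa> y * \<psi> \<kappa> y - ev (N + dg \<iota>) u1 y)"
            by (rule order.trans[OF nm_triangle]) (simp only: nm_scale order.refl)
          also have "\<dots> \<le> (1 - t) * (\<epsilon> * nm N (\<psi> \<kappa>)) + t * (\<epsilon> * nm N (\<psi> \<kappa>))"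
            unfolding norm_of_real using t u0 u1 by (intro add_mono mult_mono) (auto simp: nm_nonneg)
          also have "\<dots> = \<epsilon> * nm N (\<psi> \<kappa>)" by (simp add: algebra_simps)
          also have "\<dots> \<le> \<epsilon> * S"
            unfolding S_def using \<epsilon> nm_le_tot[OF fin \<iota>\<kappa>(2)] by (intro mult_left_mono) auto
          finally show ?thesis by blast
        qed
        then obtain U where U: "\<And>\<iota> \<kappa>. \<iota> \<in> Is \<Longrightarrow> \<kappa> \<in> Is \<Longrightarrow> nm N (\<lambda>y. D \<iota> \<kappa> y * \<psi> \<kappa> y - ev (N + dg \<iota>) (U \<iota> \<kappa>) y) \<le> \<epsilon> * S"
          by metis
        define u where "u = (\<lambda>(\<iota>, \<mu>). \<Sum>\<kappa>\<in>Is. U \<iota> \<kappa> \<mu>)"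
        define \<phi> where "\<phi> = fld N dg u"
        define e where "e = (\<lambda>\<iota> y. \<zeta> \<iota> y - \<phi> \<iota> y)"
        have \<phi>: "\<phi> \<iota> y = (\<Sum>\<kappa>\<in>Is. ev (N + dg \<iota>) (U \<iota> \<kappa>) y)" for \<iota> y
          by (simp add: \<phi>_def fld_def u_def ev_sum)
        have "nm N (e \<iota>) \<le> n * (\<epsilon> * S)" if "\<iota> \<in> Is" for \<iota>
        proof -
          have "nm N (e \<iota>) = nm N (\<lambda>y. \<Sum>\<kappa>\<in>Is. D \<iota> \<kappa> y * \<psi> \<kappa> y - ev (N + dg \<iota>) (U \<iota> \<kappa>) y)"
            by (simp add: e_def \<zeta>_def \<phi> sum_subtractf)
          also have "\<dots> \<le> (\<Sum>\<kappa>\<in>Is. nm N (\<lambda>y. D \<iota> \<kappa> y * \<psi> \<kappa> y - ev (N + dg \<iota>) (U \<iota> \<kappa>) y))"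
            by (rule nm_sum_le[OF fin])
          also have "\<dots> \<le> (\<Sum>\<kappa>\<in>Is. \<epsilon> * S)" using U that by (intro sum_mono) auto
          finally show ?thesis by (simp add: n_def)
        qed
        then have "(\<Sum>\<iota>\<in>Is. nm N (e \<iota>)) \<le> (\<Sum>\<iota>\<in>Is. n * (\<epsilon> * S))" by (intro sum_mono) auto
        then have "tot N Is e \<le> n * n * \<epsilon> * S"
          using tot_le_sum[OF fin, of N e] by (simp add: n_def mult_ac)
        also have "\<dots> < sqrt c * S" using \<epsilon>n S by (intro mult_strict_right_mono) auto
        finally have e: "tot N Is e < sqrt c * S" .
        have "c * (tot N Is \<psi>)\<^sup>2 \<le> (tot N Is \<zeta>)\<^sup>2"
          unfolding tot_square sum_distrib_left[of _ _ "P N"]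
        proof (rule sum_mono)
          fix p assume "p \<in> P N"
          then have "pt N p \<in> Y" by (rule pt)
          from ell[OF t, unfolded elliptic_def, rule_format, OF this, of "\<lambda>\<iota>. \<psi> \<iota> (pt N p)"]
          show "c * (\<Sum>\<iota>\<in>Is. (cmod (\<psi> \<iota> (pt N p)))\<^sup>2) \<le> (\<Sum>\<iota>\<in>Is. (cmod (\<zeta> \<iota> (pt N p)))\<^sup>2)"
            unfolding \<zeta>_def D_def .
        qed
        then have "(sqrt c * S)\<^sup>2 \<le> (tot N Is \<zeta>)\<^sup>2" using c by (simp add: power_mult_distrib S_def)
        then have \<zeta>S: "sqrt c * S \<le> tot N Is \<zeta>" using power2_le_imp_le tot_nonneg by blast
        have "hform (ix N Is dg) (fm N D) u v = (\<Sum>p\<in>P N. \<Sum>\<iota>\<in>Is. cnj (\<phi> \<iota> (pt N p)) * \<zeta> \<iota> (pt N p))"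
          unfolding hform_fm[OF fin] \<phi>_def \<zeta>_def \<psi>_def ..
        also have "\<dots> = (\<Sum>p\<in>P N. \<Sum>\<iota>\<in>Is. cnj (\<zeta> \<iota> (pt N p)) * \<zeta> \<iota> (pt N p)) - (\<Sum>p\<in>P N. \<Sum>\<iota>\<in>Is. cnj (e \<iota> (pt N p)) * \<zeta> \<iota> (pt N p))"
          by (simp add: e_def algebra_simps flip: sum_subtractf)
        also have "(\<Sum>p\<in>P N. \<Sum>\<iota>\<in>Is. cnj (\<zeta> \<iota> (pt N p)) * \<zeta> \<iota> (pt N p)) = of_real ((tot N Is \<zeta>)\<^sup>2)"
          by (simp add: tot_square cnj_mult_self)
        finally have hform: "hform (ix N Is dg) (fm N D) u v =
          of_real ((tot N Is \<zeta>)\<^sup>2) - (\<Sum>p\<in>P N. \<Sum>\<iota>\<in>Is. cnj (e \<iota> (pt N p)) * \<zeta> \<iota> (pt N p))" .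
        have "cmod (\<Sum>p\<in>P N. \<Sum>\<iota>\<in>Is. cnj (e \<iota> (pt N p)) * \<zeta> \<iota> (pt N p)) \<le> tot N Is e * tot N Is \<zeta>"
          by (rule tot_Cauchy_Schwarz)
        also have "\<dots> < tot N Is \<zeta> * tot N Is \<zeta>"
        proof (rule mult_strict_right_mono)
          show "tot N Is e < tot N Is \<zeta>" using e \<zeta>S by simp
          show "0 < tot N Is \<zeta>" using \<zeta>S S c by (smt (verit) mult_pos_pos real_sqrt_gt_zero)
        qed
        finally have "cmod (\<Sum>p\<in>P N. \<Sum>\<iota>\<in>Is. cnj (e \<iota> (pt N p)) * \<zeta> \<iota> (pt N p)) < cmod (of_real ((tot N Is \<zeta>)\<^sup>2))"
          by (simp only: norm_of_real) (simp add: power2_eq_square)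
        then have "hform (ix N Is dg) (fm N D) u v \<noteq> 0" unfolding hform by auto
        then show "\<exists>u. hform (ix N Is dg) (fm N D) u v \<noteq> 0" by blast
      qed
    qed
  qed
qed

lemma fm_segment:
  "fm N (\<lambda>\<iota> \<kappa> y. of_real (1 - t) * D0 \<iota> \<kappa> y + of_real t * D1 \<iota> \<kappa> y) =
   (\<lambda>a b. of_real (1 - t) * fm N D0 a b + of_real t * fm N D1 a b)"
  by (simp add: fm_def fun_eq_iff sum_distrib_left algebra_simps sum.distrib sum_subtractf)

text \<open>Homotopy invariance: for a single large N the forms are nondegenerate for all t at once,
  so \<open>inertia_segment\<close> applies at that N.\<close>

theorem inertia_constant:
  assumes s0: "symb Is dg D0" and s1: "symb Is dg D1" and c: "c > 0"
    and ell: "\<And>t. 0 \<le> t \<Longrightarrow> t \<le> 1 \<Longrightarrow>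
      elliptic c Is (\<lambda>\<iota> \<kappa> y. of_real (1 - t) * D0 \<iota> \<kappa> y + of_real t * D1 \<iota> \<kappa> y)"
  shows "\<forall>\<^sub>F N in sequentially. \<exists>k. inertia (ix N Is dg) (fm N D0) k \<and> inertia (ix N Is dg) (fm N D1) k"
proof -
  have "\<forall>\<^sub>F N in sequentially. \<forall>t. 0 \<le> t \<longrightarrow> t \<le> 1 \<longrightarrow>
    nondeg (ix N Is dg) (fm N (\<lambda>\<iota> \<kappa> y. of_real (1 - t) * D0 \<iota> \<kappa> y + of_real t * D1 \<iota> \<kappa> y))"
    by (rule nondeg_segment[OF s0 s1 c]) (rule ell)
  then show ?thesis
  proof eventually_elim
  case (elim N)
  show ?case
  proof (rule inertia_segment)
    show "finite (ix N Is dg)" using s0 finite_ix by (auto simp: symb_def)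
    show "hermitian_on (ix N Is dg) (fm N D0)" "hermitian_on (ix N Is dg) (fm N D1)"
      using s0 s1 by (simp_all add: hermitian_fm)
    show "nondeg (ix N Is dg) (\<lambda>a b. of_real (1 - t) * fm N D0 a b + of_real t * fm N D1 a b)"
      if "0 \<le> t" "t \<le> 1" for t
      using elim that unfolding fm_segment by blast
  qed
  qed
qed

lemma symb_block:
  assumes s0: "symb Is dg D0" and s1: "symb Is (\<lambda>\<iota>. Suc (dg \<iota>)) D1"
    and Q: "\<And>\<iota> \<kappa>. \<iota> \<in> Is \<Longrightarrow> \<kappa> \<in> Is \<Longrightarrow> qsym (dg \<kappa>) (Suc (dg \<iota>)) (Q \<iota> \<kappa>)"
    and Q': "\<And>\<iota> \<kappa>. \<iota> \<in> Is \<Longrightarrow> \<kappa> \<in> Is \<Longrightarrow> qsym (Suc (dg \<kappa>)) (dg \<iota>) (\<lambda>y. cnj (Q \<kappa> \<iota> y))"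
  shows "symb (double Is) (double_degree dg) (block D0 Q D1)"
proof -
  have fin: "finite (double Is)" using s0 by (auto simp: symb_def double_def)
  have q: "qsym (double_degree dg \<kappa>) (double_degree dg \<iota>) (block D0 Q D1 \<iota> \<kappa>)" if \<iota>\<kappa>: "\<iota> \<in> double Is" "\<kappa> \<in> double Is" for \<iota> \<kappa>
  proof -
    obtain a as where i: "\<iota> = a # as" "as \<in> Is" using \<iota>\<kappa> by (auto simp: double_def)
    obtain b bs where k: "\<kappa> = b # bs" "bs \<in> Is" using \<iota>\<kappa> by (auto simp: double_def)
    have "qsym (dg bs) (dg as) (D0 as bs)" "qsym (Suc (dg bs)) (Suc (dg as)) (D1 as bs)"
      using s0 s1 i k unfolding symb_def by blast+
    then show ?thesis
      using Q[of as bs] Q'[of as bs] i k by (cases a; cases b) auto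
  qed
  have h: "block D0 Q D1 \<kappa> \<iota> y = cnj (block D0 Q D1 \<iota> \<kappa> y)" if y: "y \<in> Y" and \<iota>\<kappa>: "\<iota> \<in> double Is" "\<kappa> \<in> double Is" for \<iota> \<kappa> y
  proof -
    obtain a as where i: "\<iota> = a # as" "as \<in> Is" using \<iota>\<kappa> by (auto simp: double_def)
    obtain b bs where k: "\<kappa> = b # bs" "bs \<in> Is" using \<iota>\<kappa> by (auto simp: double_def)
    have 1: "D0 bs as y = cnj (D0 as bs y)" "D1 bs as y = cnj (D1 as bs y)"
      using s0 s1 i k y unfolding symb_def by blast+
    show ?thesis unfolding i k using 1 by (cases a; cases b) auto
  qed
  show ?thesis unfolding symb_def using fin q h by blast
qed

lemma ix_double:
  "ix N (double Is) (double_degree dg) = (\<lambda>(as, \<mu>). (False # as, \<mu>)) ` ix N Is dg \<union>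
     (\<lambda>(as, \<mu>). (True # as, \<mu>)) ` ix N Is (\<lambda>\<iota>. Suc (dg \<iota>))"
  by (auto simp: ix_def double_def image_iff)

lemma inertia_block:
  assumes fin: "finite Is" and k: "inertia (ix N Is dg) (fm N D0) k"
    and l: "inertia (ix N Is (\<lambda>\<iota>. Suc (dg \<iota>))) (fm N D1) l"
  shows "inertia (ix N (double Is) (double_degree dg)) (fm N (block D0 (\<lambda>_ _ _. 0) D1)) (k + l)"
  unfolding ix_double
proof (rule inertia_direct_sum)
  let ?f = "\<lambda>b. \<lambda>(as, \<mu>). (b # as, \<mu>)"
  show "inertia (?f False ` ix N Is dg) (fm N (block D0 (\<lambda>_ _ _. 0) D1)) k"
  proof (rule inertia_reindex)
    show "inj_on (?f False) (ix N Is dg)" by (auto simp: inj_on_def)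
    show "inertia (ix N Is dg) (\<lambda>a b. fm N (block D0 (\<lambda>_ _ _. 0) D1) (?f False a) (?f False b)) k"
      by (rule inertia_cong[OF _ k]) (auto simp: fm_def split_beta)
  qed
  show "inertia (?f True ` ix N Is (\<lambda>\<iota>. Suc (dg \<iota>))) (fm N (block D0 (\<lambda>_ _ _. 0) D1)) l"
  proof (rule inertia_reindex)
    show "inj_on (?f True) (ix N Is (\<lambda>\<iota>. Suc (dg \<iota>)))" by (auto simp: inj_on_def)
    show "inertia (ix N Is (\<lambda>\<iota>. Suc (dg \<iota>))) (\<lambda>a b. fm N (block D0 (\<lambda>_ _ _. 0) D1) (?f True a) (?f True b)) l"
      by (rule inertia_cong[OF _ l]) (auto simp: fm_def split_beta)
  qed
qed (use finite_ix[OF fin] in \<open>auto simp: fm_def\<close>)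

lemma card_ix: "finite Is \<Longrightarrow> card (ix N Is dg) = (\<Sum>\<iota>\<in>Is. card (B (N + dg \<iota>)))"
  unfolding ix_def using finB by simp

end

subsection \<open>Norm identities for doubled symbols\<close>

definition act :: "'i set \<Rightarrow> ('i \<Rightarrow> 'i \<Rightarrow> complex) \<Rightarrow> ('i \<Rightarrow> complex) \<Rightarrow> 'i \<Rightarrow> complex" where
  "act Is K v \<iota> = (\<Sum>\<kappa>\<in>Is. K \<iota> \<kappa> * v \<kappa>)"

definition inn :: "'i set \<Rightarrow> ('i \<Rightarrow> complex) \<Rightarrow> ('i \<Rightarrow> complex) \<Rightarrow> complex" where
  "inn Is u v = (\<Sum>\<iota>\<in>Is. cnj (u \<iota>) * v \<iota>)"

definition n2 :: "'i set \<Rightarrow> ('i \<Rightarrow> complex) \<Rightarrow> real" where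
  "n2 Is v = (\<Sum>\<iota>\<in>Is. (cmod (v \<iota>))\<^sup>2)"

lemma n2_nonneg: "n2 Is v \<ge> 0"
  by (simp add: n2_def sum_nonneg)

lemma inn_self: "inn Is v v = of_real (n2 Is v)"
  by (simp add: inn_def n2_def cnj_mult_self)

lemma inn_cong: "(\<And>\<iota>. \<iota> \<in> Is \<Longrightarrow> u \<iota> = u' \<iota>) \<Longrightarrow> (\<And>\<iota>. \<iota> \<in> Is \<Longrightarrow> v \<iota> = v' \<iota>) \<Longrightarrow> inn Is u v = inn Is u' v'"
  by (simp add: inn_def)

lemma n2_cong: "(\<And>\<iota>. \<iota> \<in> Is \<Longrightarrow> u \<iota> = u' \<iota>) \<Longrightarrow> n2 Is u = n2 Is u'"
  by (simp add: n2_def)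

lemma act_cong: "(\<And>\<iota>. \<iota> \<in> Is \<Longrightarrow> u \<iota> = u' \<iota>) \<Longrightarrow> act Is K u = act Is K u'"
  by (simp add: act_def fun_eq_iff)

lemma inn_add_right: "inn Is u (\<lambda>\<iota>. v \<iota> + w \<iota>) = inn Is u v + inn Is u w"
  by (simp add: inn_def algebra_simps sum.distrib)

lemma inn_add_left: "inn Is (\<lambda>\<iota>. v \<iota> + w \<iota>) u = inn Is v u + inn Is w u"
  by (simp add: inn_def algebra_simps sum.distrib)

lemma inn_scale_right: "inn Is u (\<lambda>\<iota>. c * v \<iota>) = c * inn Is u v"
  by (simp add: inn_def sum_distrib_left mult_ac)

lemma inn_scale_left: "inn Is (\<lambda>\<iota>. c * v \<iota>) u = cnj c * inn Is v u"
  by (simp add: inn_def sum_distrib_left mult_ac)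

lemma inn_commute: "inn Is v u = cnj (inn Is u v)"
  by (simp add: inn_def mult_ac)

lemma inn_act: "inn Is u (act Is K v) = inn Is (act Is (\<lambda>\<iota> \<kappa>. cnj (K \<kappa> \<iota>)) u) v"
proof -
  have "inn Is u (act Is K v) = (\<Sum>\<iota>\<in>Is. \<Sum>\<kappa>\<in>Is. cnj (u \<iota>) * K \<iota> \<kappa> * v \<kappa>)"
    by (simp add: inn_def act_def sum_distrib_left mult_ac)
  also have "\<dots> = (\<Sum>\<kappa>\<in>Is. \<Sum>\<iota>\<in>Is. cnj (u \<iota>) * K \<iota> \<kappa> * v \<kappa>)" by (rule sum.swap)
  also have "\<dots> = inn Is (act Is (\<lambda>\<iota> \<kappa>. cnj (K \<kappa> \<iota>)) u) v"
    unfolding inn_def act_def cnj_sum sum_distrib_right by (simp add: mult_ac)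
  finally show ?thesis .
qed

lemma act_act: "act Is K (act Is K' v) \<iota> = (\<Sum>\<kappa>\<in>Is. (\<Sum>\<gamma>\<in>Is. K \<iota> \<gamma> * K' \<gamma> \<kappa>) * v \<kappa>)"
proof -
  have "act Is K (act Is K' v) \<iota> = (\<Sum>\<gamma>\<in>Is. \<Sum>\<kappa>\<in>Is. K \<iota> \<gamma> * K' \<gamma> \<kappa> * v \<kappa>)"
    by (simp add: act_def sum_distrib_left mult_ac)
  also have "\<dots> = (\<Sum>\<kappa>\<in>Is. \<Sum>\<gamma>\<in>Is. K \<iota> \<gamma> * K' \<gamma> \<kappa> * v \<kappa>)" by (rule sum.swap)
  finally show ?thesis by (simp add: sum_distrib_right)
qed

lemma act_delta:
  assumes "finite Is" "\<iota> \<in> Is"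
  shows "act Is (\<lambda>\<iota> \<kappa>. if \<iota> = \<kappa> then c else 0) v \<iota> = c * v \<iota>"
  using assms by (simp add: act_def if_distrib[of "\<lambda>x. x * _"] cong: if_cong)

lemma n2_add: "n2 Is (\<lambda>\<iota>. u \<iota> + v \<iota>) = n2 Is u + n2 Is v + 2 * Re (inn Is u v)"
proof -
  have "of_real (n2 Is (\<lambda>\<iota>. u \<iota> + v \<iota>)) = inn Is u u + inn Is v v + (inn Is u v + cnj (inn Is u v))"
    unfolding inn_self[symmetric] inn_add_left inn_add_right by (simp flip: inn_commute)
  also have "\<dots> = of_real (n2 Is u + n2 Is v + 2 * Re (inn Is u v))"
    by (simp add: inn_self complex_add_cnj)
  finally show ?thesis by (simp only: of_real_eq_iff)
qed

lemma n2_scale: "n2 Is (\<lambda>\<iota>. c * v \<iota>) = (cmod c)\<^sup>2 * n2 Is v"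
  by (simp add: n2_def norm_mult power_mult_distrib sum_distrib_left)

lemma inn_Cauchy_Schwarz: "(cmod (inn Is u v))\<^sup>2 \<le> n2 Is u * n2 Is v"
proof -
  have "cmod (inn Is u v) \<le> (\<Sum>\<iota>\<in>Is. cmod (u \<iota>) * cmod (v \<iota>))"
    unfolding inn_def by (rule order.trans[OF norm_sum]) (simp add: norm_mult)
  then have "(cmod (inn Is u v))\<^sup>2 \<le> (\<Sum>\<iota>\<in>Is. cmod (u \<iota>) * cmod (v \<iota>))\<^sup>2"
    by (intro power_mono) auto
  also have "\<dots> \<le> n2 Is u * n2 Is v" unfolding n2_def by (rule Cauchy_Schwarz_ineq_sum)
  finally show ?thesis .
qed

text \<open>The cross terms are twice the real part of the pairing of (Q D0 + D1 Q) v0 with v1,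
  which vanishes by anticommutation. So the coupling only increases the norm.\<close>

lemma n2_block:
  assumes fin: "finite Is"
    and herm: "\<And>\<iota> \<kappa>. \<iota> \<in> Is \<Longrightarrow> \<kappa> \<in> Is \<Longrightarrow> D1 \<kappa> \<iota> y = cnj (D1 \<iota> \<kappa> y)"
    and anti: "\<And>v \<iota>. \<iota> \<in> Is \<Longrightarrow> act Is (\<lambda>\<iota> \<kappa>. Q \<iota> \<kappa> y) (act Is (\<lambda>\<iota> \<kappa>. D0 \<iota> \<kappa> y) v) \<iota> +
        act Is (\<lambda>\<iota> \<kappa>. D1 \<iota> \<kappa> y) (act Is (\<lambda>\<iota> \<kappa>. Q \<iota> \<kappa> y) v) \<iota> = 0"
  shows "n2 (double Is) (act (double Is) (\<lambda>\<iota> \<kappa>. block D0 Q D1 \<iota> \<kappa> y) v) =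
    n2 Is (act Is (\<lambda>\<iota> \<kappa>. D0 \<iota> \<kappa> y) (\<lambda>\<iota>. v (False # \<iota>))) + n2 Is (act Is (\<lambda>\<iota> \<kappa>. Q \<iota> \<kappa> y) (\<lambda>\<iota>. v (False # \<iota>))) +
    n2 Is (act Is (\<lambda>\<iota> \<kappa>. cnj (Q \<kappa> \<iota> y)) (\<lambda>\<iota>. v (True # \<iota>))) + n2 Is (act Is (\<lambda>\<iota> \<kappa>. D1 \<iota> \<kappa> y) (\<lambda>\<iota>. v (True # \<iota>)))"
proof -
  define v0 where "v0 = (\<lambda>\<iota>. v (False # \<iota>))"
  define v1 where "v1 = (\<lambda>\<iota>. v (True # \<iota>))"
  let ?D0 = "\<lambda>\<iota> \<kappa>. D0 \<iota> \<kappa> y" and ?D1 = "\<lambda>\<iota> \<kappa>. D1 \<iota> \<kappa> y" and ?Q = "\<lambda>\<iota> \<kappa>. Q \<iota> \<kappa> y" and ?Qa = "\<lambda>\<iota> \<kappa>. cnj (Q \<kappa> \<iota> y)"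
  have "n2 (double Is) (act (double Is) (\<lambda>\<iota> \<kappa>. block D0 Q D1 \<iota> \<kappa> y) v) =
     n2 Is (\<lambda>\<iota>. act Is ?D0 v0 \<iota> + act Is ?Qa v1 \<iota>) + n2 Is (\<lambda>\<iota>. act Is ?Q v0 \<iota> + act Is ?D1 v1 \<iota>)"
    unfolding n2_def act_def sum_double[OF fin] by (simp add: v0_def v1_def)
  also have "\<dots> = n2 Is (act Is ?D0 v0) + n2 Is (act Is ?Q v0) + n2 Is (act Is ?Qa v1) + n2 Is (act Is ?D1 v1)
     + 2 * Re (inn Is (act Is ?D0 v0) (act Is ?Qa v1) + inn Is (act Is ?Q v0) (act Is ?D1 v1))"
    by (simp add: n2_add)
  also have "inn Is (act Is ?D0 v0) (act Is ?Qa v1) = inn Is (act Is ?Q (act Is ?D0 v0)) v1"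
    unfolding inn_act by simp
  also have "inn Is (act Is ?Q v0) (act Is ?D1 v1) = inn Is (act Is (\<lambda>\<iota> \<kappa>. cnj (D1 \<kappa> \<iota> y)) (act Is ?Q v0)) v1"
    by (rule inn_act)
  also have "\<dots> = inn Is (act Is ?D1 (act Is ?Q v0)) v1"
  proof (rule inn_cong)
    fix \<iota> assume "\<iota> \<in> Is"
    then show "act Is (\<lambda>\<iota> \<kappa>. cnj (D1 \<kappa> \<iota> y)) (act Is ?Q v0) \<iota> = act Is ?D1 (act Is ?Q v0) \<iota>"
      unfolding act_def[of Is _ "act Is ?Q v0"]
    proof (intro sum.cong refl)
      fix \<kappa> assume "\<kappa> \<in> Is"
      then have "D1 \<iota> \<kappa> y = cnj (D1 \<kappa> \<iota> y)" using herm \<open>\<iota> \<in> Is\<close> by blast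
      then show "cnj (D1 \<kappa> \<iota> y) * act Is ?Q v0 \<kappa> = D1 \<iota> \<kappa> y * act Is ?Q v0 \<kappa>" by (simp only:)
    qed
  qed simp
  also have "inn Is (act Is ?Q (act Is ?D0 v0)) v1 + inn Is (act Is ?D1 (act Is ?Q v0)) v1 = 0"
    unfolding inn_add_left[symmetric] by (simp add: inn_def anti)
  finally show ?thesis by (simp add: v0_def v1_def)
qed

lemma n2_double: "finite Is \<Longrightarrow> n2 (double Is) v = n2 Is (\<lambda>\<iota>. v (False # \<iota>)) + n2 Is (\<lambda>\<iota>. v (True # \<iota>))"
  by (simp add: n2_def sum_double)

lemma block_affine:
  "s * block D0 Q D1 \<iota> \<kappa> y + t * block D0' Q' D1' \<iota> \<kappa> y =
   block (\<lambda>\<iota> \<kappa> y. s * D0 \<iota> \<kappa> y + t * D0' \<iota> \<kappa> y) (\<lambda>\<iota> \<kappa> y. cnj s * Q \<iota> \<kappa> y + cnj t * Q' \<iota> \<kappa> y)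
     (\<lambda>\<iota> \<kappa> y. s * D1 \<iota> \<kappa> y + t * D1' \<iota> \<kappa> y) \<iota> \<kappa> y" if "cnj s = s" "cnj t = t"
  using that by (cases "(D0, Q, D1, \<iota>, \<kappa>)" rule: block.cases) auto

subsection \<open>The Clifford symbol\<close>

text \<open>
  \<open>C\<close> is a matrix with \<open>C\<^sup>2 = la\<close> and \<open>C C\<^sup>* + C\<^sup>* C = 2 l\<close>; then \<open>Om = (l - C\<^sup>* C) / 2\<close>
  anticommutes with \<open>C\<close> and \<open>Om\<^sup>2 = (l\<^sup>2 - \<bar>la\<bar>\<^sup>2) / 4\<close>.
\<close>

locale clifford_symbol =
  fixes S :: "'i set" and C :: "'i \<Rightarrow> 'i \<Rightarrow> complex" and la :: complex and l :: real
  assumes fin: "finite S"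
    and CC: "a \<in> S \<Longrightarrow> b \<in> S \<Longrightarrow> (\<Sum>c\<in>S. C a c * C c b) = (if a = b then la else 0)"
    and CCa: "a \<in> S \<Longrightarrow> b \<in> S \<Longrightarrow> (\<Sum>c\<in>S. C a c * cnj (C b c)) + (\<Sum>c\<in>S. cnj (C c a) * C c b) =
       (if a = b then of_real (2 * l) else 0)"
    and ell: "cmod la < l"
begin

definition Ca :: "'i \<Rightarrow> 'i \<Rightarrow> complex" where
  "Ca a b = cnj (C b a)"

definition Om :: "'i \<Rightarrow> 'i \<Rightarrow> complex" where
  "Om a b = ((if a = b then of_real l else 0) - (\<Sum>c\<in>S. cnj (C c a) * C c b)) / 2"

text \<open>The possible eigenvalues of \<open>Om\<close> are \<open>om\<close> and
  \<open>- om\<close>; that \<open>om\<close> is positive is the ellipticity of C.\<close>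

definition om :: real where
  "om = sqrt ((l\<^sup>2 - (cmod la)\<^sup>2) / 4)"

lemma om_square: "om\<^sup>2 = (l\<^sup>2 - (cmod la)\<^sup>2) / 4"
proof -
  have "(cmod la)\<^sup>2 \<le> l\<^sup>2" using ell by (intro power_mono) auto
  then show ?thesis by (simp add: om_def)
qed

lemma l_pos: "l > 0"
  using ell norm_ge_zero[of la] by linarith

lemma om_pos: "om > 0"
proof -
  have "(cmod la)\<^sup>2 < l\<^sup>2" using ell by (intro power_strict_mono) auto
  then show ?thesis by (simp add: om_def)
qed

lemma om_le: "2 * om \<le> l"
proof -
  have "(2 * om)\<^sup>2 \<le> l\<^sup>2" by (simp add: power_mult_distrib om_square)
  then show ?thesis by (rule power2_le_imp_le) (simp add: l_pos less_imp_le)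
qed

lemma C_C: "a \<in> S \<Longrightarrow> act S C (act S C v) a = la * v a"
  unfolding act_act using fin CC by (simp add: if_distrib[of "\<lambda>x. x * _"] cong: if_cong)

lemma C_Ca: "a \<in> S \<Longrightarrow> act S C (act S Ca v) a + act S Ca (act S C v) a = of_real (2 * l) * v a"
proof -
  assume a: "a \<in> S"
  have "act S C (act S Ca v) a + act S Ca (act S C v) a =
    (\<Sum>b\<in>S. ((\<Sum>c\<in>S. C a c * cnj (C b c)) + (\<Sum>c\<in>S. cnj (C c a) * C c b)) * v b)"
    unfolding act_act Ca_def by (simp add: algebra_simps sum.distrib)
  also have "\<dots> = (\<Sum>b\<in>S. (if a = b then of_real (2 * l) else 0) * v b)"
    using CCa[OF a] by (intro sum.cong refl) simp
  also have "\<dots> = of_real (2 * l) * v a"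
    using fin a by (simp add: if_distrib[of "\<lambda>x. x * _"] cong: if_cong)
  finally show ?thesis .
qed

lemma Om_act: "a \<in> S \<Longrightarrow> act S Om v a = (of_real l * v a - act S Ca (act S C v) a) / 2"
proof -
  assume a: "a \<in> S"
  have "act S Om v a = (\<Sum>b\<in>S. ((if a = b then of_real l else 0) * v b - (\<Sum>c\<in>S. cnj (C c a) * C c b) * v b) / 2)"
    by (simp add: act_def Om_def algebra_simps)
  also have "\<dots> = ((\<Sum>b\<in>S. (if a = b then of_real l else 0) * v b) - (\<Sum>b\<in>S. (\<Sum>c\<in>S. cnj (C c a) * C c b) * v b)) / 2"
    by (simp add: sum_subtractf flip: sum_divide_distrib)
  also have "(\<Sum>b\<in>S. (if a = b then of_real l else 0) * v b) = of_real l * v a"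
    using fin a by (simp add: if_distrib[of "\<lambda>x. x * _"] cong: if_cong)
  finally show ?thesis by (simp add: act_act Ca_def)
qed

text \<open>In operator terms C Om + Om C = l C - (C Ca + Ca C) C / 2, and the bracket is 2
  l.\<close>

lemma C_Om: "a \<in> S \<Longrightarrow> act S C (act S Om v) a + act S Om (act S C v) a = 0"
proof -
  assume a: "a \<in> S"
  have "act S C (act S Om v) a = act S C (\<lambda>a. (of_real l * v a - act S Ca (act S C v) a) / 2) a"
    using Om_act by (intro fun_cong[OF act_cong]) auto
  also have "\<dots> = (of_real l * act S C v a - act S C (act S Ca (act S C v)) a) / 2"
    unfolding act_def[of S C] by (simp add: algebra_simps sum_subtractf sum_distrib_left sum_divide_distrib diff_divide_distrib)
  finally have 1: "act S C (act S Om v) a = (of_real l * act S C v a - act S C (act S Ca (act S C v)) a) / 2" .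
  have 2: "act S Om (act S C v) a = (of_real l * act S C v a - act S Ca (act S C (act S C v)) a) / 2"
    by (rule Om_act[OF a])
  have 3: "act S C (act S Ca (act S C v)) a + act S Ca (act S C (act S C v)) a = of_real (2 * l) * act S C v a"
    by (rule C_Ca[OF a])
  have "act S C (act S Om v) a + act S Om (act S C v) a =
    (2 * of_real l * act S C v a - (act S C (act S Ca (act S C v)) a + act S Ca (act S C (act S C v)) a)) / 2"
    unfolding 1 2 by (simp add: field_simps)
  then show ?thesis unfolding 3 by simp
qed

lemma n2_C_Ca: "n2 S (act S C v) + n2 S (act S Ca v) = 2 * l * n2 S v"
proof -
  have Caa: "(\<lambda>\<iota> \<kappa>. cnj (Ca \<kappa> \<iota>)) = C" by (simp add: Ca_def fun_eq_iff)
  have Ca: "(\<lambda>\<iota> \<kappa>. cnj (C \<kappa> \<iota>)) = Ca" by (simp add: Ca_def fun_eq_iff)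
  have "inn S (act S C v) (act S C v) = inn S (act S Ca (act S C v)) v"
    unfolding inn_act Ca ..
  moreover have "inn S (act S Ca v) (act S Ca v) = inn S (act S C (act S Ca v)) v"
    unfolding inn_act Caa ..
  ultimately have "of_real (n2 S (act S C v) + n2 S (act S Ca v)) =
      inn S (\<lambda>a. act S C (act S Ca v) a + act S Ca (act S C v) a) v"
    by (simp add: inn_add_left inn_self[symmetric])
  also have "\<dots> = inn S (\<lambda>a. of_real (2 * l) * v a) v" by (intro inn_cong C_Ca) auto
  also have "\<dots> = of_real (2 * l * n2 S v)"
    unfolding inn_scale_left by (simp add: inn_self)
  finally show ?thesis by (simp only: of_real_eq_iff)
qed

definition sp :: "('i \<Rightarrow> complex) \<Rightarrow> real" where
  "sp v = (l * n2 S v - n2 S (act S C v)) / 2"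

lemma inn_Om: "inn S v (act S Om v) = of_real (sp v)"
proof -
  have Ca: "(\<lambda>\<iota> \<kappa>. cnj (Ca \<kappa> \<iota>)) = C" by (simp add: Ca_def fun_eq_iff)
  have "inn S v (act S Om v) = inn S v (\<lambda>a. of_real (l / 2) * v a + of_real (- 1 / 2) * act S Ca (act S C v) a)"
    by (intro inn_cong) (auto simp: Om_act field_simps)
  also have "\<dots> = of_real (l / 2) * inn S v v + of_real (- 1 / 2) * inn S v (act S Ca (act S C v))"
    unfolding inn_add_right inn_scale_right ..
  also have "inn S v (act S Ca (act S C v)) = inn S (act S C v) (act S C v)"
    unfolding inn_act[of S v Ca] Ca ..
  finally show ?thesis by (simp add: inn_self sp_def field_simps)
qed

text \<open>The norm of Ca C v is found from the relation for C Ca + Ca C at the vector C v, because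
  C C v = la v. In the expansion the terms in C v then cancel.\<close>

lemma n2_Om: "n2 S (act S Om v) = om\<^sup>2 * n2 S v"
proof -
  let ?w = "act S C v"
  have 1: "n2 S (act S C ?w) = (cmod la)\<^sup>2 * n2 S v"
    using n2_cong[of S "act S C ?w" "\<lambda>a. la * v a"] C_C n2_scale by metis
  have 2: "n2 S (act S Ca ?w) = 2 * l * n2 S ?w - (cmod la)\<^sup>2 * n2 S v"
    using n2_C_Ca[of ?w] unfolding 1 by linarith
  have Ca: "(\<lambda>\<iota> \<kappa>. cnj (Ca \<kappa> \<iota>)) = C" by (simp add: Ca_def fun_eq_iff)
  have 3: "inn S v (act S Ca ?w) = of_real (n2 S ?w)"
    unfolding inn_act[of S v Ca] Ca inn_self ..
  have "n2 S (act S Om v) = n2 S (\<lambda>a. of_real (l / 2) * v a + of_real (- 1 / 2) * act S Ca ?w a)"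
    by (intro n2_cong) (auto simp: Om_act field_simps)
  also have "\<dots> = (l / 2)\<^sup>2 * n2 S v + (1 / 2)\<^sup>2 * n2 S (act S Ca ?w) - l / 2 * n2 S ?w"
    unfolding n2_add n2_scale inn_scale_left inn_scale_right 3 by (simp add: norm_divide power2_eq_square)
  also have "\<dots> = om\<^sup>2 * n2 S v" unfolding 2 om_square by (simp add: field_simps power2_eq_square)
  finally show ?thesis .
qed

lemma abs_sp_le: "\<bar>sp v\<bar> \<le> om * n2 S v"
proof -
  have "(cmod (inn S v (act S Om v)))\<^sup>2 \<le> n2 S v * (om\<^sup>2 * n2 S v)"
    using inn_Cauchy_Schwarz[of S v "act S Om v"] unfolding n2_Om .
  then have "(sp v)\<^sup>2 \<le> (om * n2 S v)\<^sup>2"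
    unfolding inn_Om by (simp add: power2_eq_square mult_ac)
  then show ?thesis using om_pos n2_nonneg[of S v] by (simp add: abs_le_square_iff[symmetric] abs_mult)
qed

lemma n2_shifted_Om:
  "n2 S (\<lambda>a. of_real s * act S Om v a + of_real t * v a) = s\<^sup>2 * om\<^sup>2 * n2 S v + t\<^sup>2 * n2 S v + 2 * s * t * sp v"
proof -
  have "inn S (act S Om v) v = of_real (sp v)"
    using inn_commute[of S "act S Om v" v] by (simp add: inn_Om)
  then show ?thesis
    unfolding n2_add n2_scale inn_scale_left inn_scale_right by (simp add: n2_Om algebra_simps)
qed

text \<open>The right side is affine in q with negative slope, so it is smallest at q = om * n.
  There it is ((1 - t) om + t)^2 n plus (l - 2 om) n, and 2 om \<le> l.\<close>

lemma path_bound: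
  assumes t: "0 \<le> t" "t \<le> 1" and q: "\<bar>q\<bar> \<le> om * n" and n: "n \<ge> 0"
  shows "(min 1 om)\<^sup>2 * n \<le> (1 - t)\<^sup>2 * om\<^sup>2 * n + t\<^sup>2 * n + 2 * (1 - t) * t * q + (l * n - 2 * q)"
proof -
  have "2 * (1 - (1 - t) * t) * q \<le> 2 * (1 - (1 - t) * t) * (om * n)"
  proof (rule mult_left_mono)
    have "(1 - t) * t \<le> 1 * 1" using t by (intro mult_mono) auto
    then show "0 \<le> 2 * (1 - (1 - t) * t)" by simp
  qed (use q in auto)
  then have "(1 - t)\<^sup>2 * om\<^sup>2 * n + t\<^sup>2 * n + 2 * (1 - t) * t * q + (l * n - 2 * q) \<ge>
     ((1 - t) * om + t)\<^sup>2 * n + (l - 2 * om) * n"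
    by (simp add: algebra_simps power2_eq_square)
  moreover have "(l - 2 * om) * n \<ge> 0" using om_le n by simp
  moreover have "(min 1 om)\<^sup>2 * n \<le> ((1 - t) * om + t)\<^sup>2 * n"
  proof (intro mult_right_mono power_mono n)
    have "min 1 om = (1 - t) * min 1 om + t * min 1 om" by (simp add: algebra_simps)
    also have "\<dots> \<le> (1 - t) * om + t * 1" using t by (intro add_mono mult_left_mono) auto
    finally show "min 1 om \<le> (1 - t) * om + t" by simp
    show "0 \<le> min 1 om" using om_pos by simp
  qed
  ultimately show ?thesis by linarith
qed

text \<open>Here q is \<open>sp v\<close>, the value of Om at v. On the way from Om to 1 the
  diagonal term may become small where q is negative, but there the squared norm of C v, which is l
  n - 2 q, is large.\<close>

lemma path_bound_lower:
  assumes "0 \<le> t" "t \<le> 1"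
  shows "(min 1 om)\<^sup>2 * n2 S v \<le> n2 S (\<lambda>a. of_real (1 - t) * act S Om v a + of_real t * v a) + n2 S (act S C v)"
  unfolding n2_shifted_Om using path_bound[OF assms abs_sp_le[of v] n2_nonneg] by (simp add: sp_def field_simps)

text \<open>The mirror image: Om moves to -1, and by \<open>n2_C_Ca\<close> the squared norm of Ca v
  is l n + 2 q, so \<open>path_bound\<close> is applied to - q.\<close>

lemma path_bound_upper:
  assumes "0 \<le> t" "t \<le> 1"
  shows "(min 1 om)\<^sup>2 * n2 S v \<le> n2 S (\<lambda>a. of_real (1 - t) * act S Om v a + of_real (- t) * v a) + n2 S (act S Ca v)"
proof -
  have "\<bar>- sp v\<bar> \<le> om * n2 S v" using abs_sp_le by simp
  from path_bound[OF assms this n2_nonneg]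
  show ?thesis unfolding n2_shifted_Om using n2_C_Ca[of v] by (simp add: sp_def field_simps)
qed

end

lemma act_affine_left:
  "act Is (\<lambda>\<iota> \<kappa>. s * K \<iota> \<kappa> + t * K' \<iota> \<kappa>) v \<iota> = s * act Is K v \<iota> + t * act Is K' v \<iota>"
  by (simp add: act_def algebra_simps sum.distrib sum_distrib_left)

lemma act_affine_right:
  "act Is K (\<lambda>\<iota>. s * u \<iota> + t * v \<iota>) \<iota> = s * act Is K u \<iota> + t * act Is K v \<iota>"
  by (simp add: act_def algebra_simps sum.distrib sum_distrib_left)

lemma act_scale_left: "act Is (\<lambda>\<iota> \<kappa>. s * K \<iota> \<kappa>) v \<iota> = s * act Is K v \<iota>"
  by (simp add: act_def sum_distrib_left mult_ac)

lemma act_scale_right: "act Is K (\<lambda>\<iota>. s * v \<iota>) \<iota> = s * act Is K v \<iota>"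
  by (simp add: act_def sum_distrib_left mult_ac)

lemma act_uminus_left: "act Is (\<lambda>\<iota> \<kappa>. - K \<iota> \<kappa>) v \<iota> = - act Is K v \<iota>"
  by (simp add: act_def sum_negf)

lemma convex_same: "of_real (1 - t) * x + of_real t * x = (x :: complex)"
  by (simp add: algebra_simps)

context toeplitz
begin

section \<open>Inertia of coupled blocks\<close>

lemma elliptic_n2: "elliptic c Is D \<longleftrightarrow> (\<forall>y\<in>Y. \<forall>v. c * n2 Is v \<le> n2 Is (act Is (\<lambda>\<iota> \<kappa>. D \<iota> \<kappa> y) v))"
  by (simp add: elliptic_def n2_def act_def)

lemma symb_uminus: "symb Is dg D \<Longrightarrow> symb Is dg (\<lambda>\<iota> \<kappa> y. - D \<iota> \<kappa> y)"
  unfolding symb_def using qsym_uminus by (metis complex_cnj_minus)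

definition scalar_symbol :: "complex \<Rightarrow> 'i \<Rightarrow> 'i \<Rightarrow> 'y \<Rightarrow> complex" where
  "scalar_symbol c \<iota> \<kappa> y = (if \<iota> = \<kappa> then c else 0)"

lemma symb_scalar_symbol: "finite Is \<Longrightarrow> cnj c = c \<Longrightarrow> symb Is dg (scalar_symbol c)"
  unfolding symb_def scalar_symbol_def using qsym_const[of _ c] qsym_zero by auto

lemma fm_uminus: "fm N (\<lambda>\<iota> \<kappa> y. - D \<iota> \<kappa> y) = (\<lambda>a b. - fm N D a b)"
  by (simp add: fm_def fun_eq_iff sum_negf)

lemma fm_scalar_symbol_minus: "fm N (scalar_symbol (-1)) = (\<lambda>a b. - fm N (scalar_symbol 1) a b)"
  by (auto simp: fm_def scalar_symbol_def fun_eq_iff sum_negf)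

lemma inertia_scalar_symbol_one:
  assumes fin: "finite Is" and good: "\<And>\<iota>. \<iota> \<in> Is \<Longrightarrow> good N (N + dg \<iota>)"
  shows "inertia (ix N Is dg) (fm N (scalar_symbol 1)) (card (ix N Is dg))"
proof (rule inertia_pos_def[OF finite_ix[OF fin] hermitian_fm[OF symb_scalar_symbol[OF fin]]])
  fix v :: "'a \<times> 'b \<Rightarrow> complex" assume v: "\<exists>a\<in>ix N Is dg. v a \<noteq> 0"
  have "hform (ix N Is dg) (fm N (scalar_symbol 1)) v v = (\<Sum>p\<in>P N. \<Sum>\<iota>\<in>Is. cnj (fld N dg v \<iota> (pt N p)) * fld N dg v \<iota> (pt N p))"
    unfolding hform_fm[OF fin] scalar_symbol_def using fin
    by (intro sum.cong refl) (simp add: if_distrib[of "\<lambda>x. x * _"] cong: if_cong)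
  also have "\<dots> = of_real ((tot N Is (fld N dg v))\<^sup>2)"
    by (simp add: tot_square cnj_mult_self)
  finally have "Re (hform (ix N Is dg) (fm N (scalar_symbol 1)) v v) = (tot N Is (fld N dg v))\<^sup>2" by simp
  then show "Re (hform (ix N Is dg) (fm N (scalar_symbol 1)) v v) > 0"
    using tot_fld_pos[of Is N dg v] fin good v by simp
qed simp

lemma eventually_good_ball: "finite Is \<Longrightarrow> \<forall>\<^sub>F N in sequentially. \<forall>\<iota>\<in>Is. good N (N + dg \<iota>)"
  using eventually_good by (intro eventually_ball_finite ballI) auto

lemma eventually_inertia:
  assumes "symb Is dg D" "c > 0" "elliptic c Is D"
  shows "\<forall>\<^sub>F N in sequentially. \<exists>k. inertia (ix N Is dg) (fm N D) k"
proof -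
  have "\<forall>\<^sub>F N in sequentially. \<exists>k. inertia (ix N Is dg) (fm N D) k \<and> inertia (ix N Is dg) (fm N D) k"
    by (rule inertia_constant[OF assms(1) assms(1) assms(2)]) (simp only: convex_same assms(3))
  then show ?thesis by eventually_elim auto
qed

lemma card_ix_double:
  assumes "finite Is"
  shows "card (ix N (double Is) (double_degree dg)) = card (ix N Is dg) + card (ix N Is (\<lambda>\<iota>. Suc (dg \<iota>)))"
proof -
  have "finite (double Is)" using assms by (simp add: double_def)
  then show ?thesis using assms by (simp add: card_ix sum_double)
qed

text \<open>Scale the coupling Q from 0 to 1. Anticommutation makes the squared norms add up, so the
  diagonal part alone keeps the whole path elliptic, and the inertia is that of the direct
  sum.\<close>

lemma inertia_double_coupling:
  assumes s0: "symb Is dg D0" and s1: "symb Is (\<lambda>\<iota>. Suc (dg \<iota>)) D1"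
    and Q: "\<And>\<iota> \<kappa>. \<iota> \<in> Is \<Longrightarrow> \<kappa> \<in> Is \<Longrightarrow> qsym (dg \<kappa>) (Suc (dg \<iota>)) (Q \<iota> \<kappa>)"
    and Q': "\<And>\<iota> \<kappa>. \<iota> \<in> Is \<Longrightarrow> \<kappa> \<in> Is \<Longrightarrow> qsym (Suc (dg \<kappa>)) (dg \<iota>) (\<lambda>y. cnj (Q \<kappa> \<iota> y))"
    and c: "c > 0" and e0: "elliptic c Is D0" and e1: "elliptic c Is D1"
    and anti: "\<And>v \<iota> y. y \<in> Y \<Longrightarrow> \<iota> \<in> Is \<Longrightarrow> act Is (\<lambda>\<iota> \<kappa>. Q \<iota> \<kappa> y) (act Is (\<lambda>\<iota> \<kappa>. D0 \<iota> \<kappa> y) v) \<iota> +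
        act Is (\<lambda>\<iota> \<kappa>. D1 \<iota> \<kappa> y) (act Is (\<lambda>\<iota> \<kappa>. Q \<iota> \<kappa> y) v) \<iota> = 0"
  shows "\<forall>\<^sub>F N in sequentially. \<exists>k l. inertia (ix N Is dg) (fm N D0) k \<and>
    inertia (ix N Is (\<lambda>\<iota>. Suc (dg \<iota>))) (fm N D1) l \<and>
    inertia (ix N (double Is) (double_degree dg)) (fm N (block D0 Q D1)) (k + l)"
proof -
  have fin: "finite Is" using s0 by (simp add: symb_def)
  have herm1: "D1 \<kappa> \<iota> y = cnj (D1 \<iota> \<kappa> y)" if "y \<in> Y" "\<iota> \<in> Is" "\<kappa> \<in> Is" for \<iota> \<kappa> y
    using s1 that unfolding symb_def by blast
  have "\<forall>\<^sub>F N in sequentially. \<exists>k. inertia (ix N (double Is) (double_degree dg)) (fm N (block D0 (\<lambda>_ _ _. 0) D1)) k \<and>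
    inertia (ix N (double Is) (double_degree dg)) (fm N (block D0 Q D1)) k"
  proof (rule inertia_constant[OF _ _ c])
    show "symb (double Is) (double_degree dg) (block D0 (\<lambda>_ _ _. 0) D1)"
      by (rule symb_block[OF s0 s1]) (simp_all add: qsym_zero)
    show "symb (double Is) (double_degree dg) (block D0 Q D1)"
      by (rule symb_block[OF s0 s1 Q Q'])
    fix t :: real assume t: "0 \<le> t" "t \<le> 1"
    have eq: "(\<lambda>\<iota> \<kappa> y. of_real (1 - t) * block D0 (\<lambda>_ _ _. 0) D1 \<iota> \<kappa> y + of_real t * block D0 Q D1 \<iota> \<kappa> y) =
       block D0 (\<lambda>\<iota> \<kappa> y. of_real t * Q \<iota> \<kappa> y) D1"
    proof (intro ext)
      fix \<iota> \<kappa> y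
      have r: "cnj (of_real (1 - t)) = of_real (1 - t)" "cnj (of_real t) = of_real t" by auto
      show "of_real (1 - t) * block D0 (\<lambda>_ _ _. 0) D1 \<iota> \<kappa> y + of_real t * block D0 Q D1 \<iota> \<kappa> y =
        block D0 (\<lambda>\<iota> \<kappa> y. of_real t * Q \<iota> \<kappa> y) D1 \<iota> \<kappa> y"
        unfolding block_affine[OF r] convex_same by simp
    qed
    show "elliptic c (double Is) (\<lambda>\<iota> \<kappa> y. of_real (1 - t) * block D0 (\<lambda>_ _ _. 0) D1 \<iota> \<kappa> y + of_real t * block D0 Q D1 \<iota> \<kappa> y)"
      unfolding eq elliptic_n2
    proof (intro ballI allI)
      fix y and v :: "bool list \<Rightarrow> complex" assume y: "y \<in> Y"
      have "c * n2 Is (\<lambda>\<iota>. v (False # \<iota>)) \<le> n2 Is (act Is (\<lambda>\<iota> \<kappa>. D0 \<iota> \<kappa> y) (\<lambda>\<iota>. v (False # \<iota>)))"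
        "c * n2 Is (\<lambda>\<iota>. v (True # \<iota>)) \<le> n2 Is (act Is (\<lambda>\<iota> \<kappa>. D1 \<iota> \<kappa> y) (\<lambda>\<iota>. v (True # \<iota>)))"
        using e0 e1 y unfolding elliptic_n2 by blast+
      then have "c * n2 (double Is) v \<le> n2 Is (act Is (\<lambda>\<iota> \<kappa>. D0 \<iota> \<kappa> y) (\<lambda>\<iota>. v (False # \<iota>))) +
          n2 Is (act Is (\<lambda>\<iota> \<kappa>. D1 \<iota> \<kappa> y) (\<lambda>\<iota>. v (True # \<iota>)))"
        by (simp add: n2_double[OF fin] algebra_simps)
      also have "\<dots> \<le> n2 (double Is) (act (double Is) (\<lambda>\<iota> \<kappa>. block D0 (\<lambda>\<iota> \<kappa> y. of_real t * Q \<iota> \<kappa> y) D1 \<iota> \<kappa> y) v)"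
      proof (subst n2_block[OF fin])
        show "act Is (\<lambda>\<iota> \<kappa>. of_real t * Q \<iota> \<kappa> y) (act Is (\<lambda>\<iota> \<kappa>. D0 \<iota> \<kappa> y) v) \<iota> +
          act Is (\<lambda>\<iota> \<kappa>. D1 \<iota> \<kappa> y) (act Is (\<lambda>\<iota> \<kappa>. of_real t * Q \<iota> \<kappa> y) v) \<iota> = 0" if \<iota>: "\<iota> \<in> Is" for v \<iota>
        proof -
          have "act Is (\<lambda>\<iota> \<kappa>. of_real t * Q \<iota> \<kappa> y) v = (\<lambda>\<iota>. of_real t * act Is (\<lambda>\<iota> \<kappa>. Q \<iota> \<kappa> y) v \<iota>)"
            by (simp add: act_scale_left fun_eq_iff)
          then show ?thesis
            using anti[OF y \<iota>, of v] by (simp add: act_scale_left act_scale_right flip: distrib_left)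
        qed
        show "D1 \<kappa> \<iota> y = cnj (D1 \<iota> \<kappa> y)" if "\<iota> \<in> Is" "\<kappa> \<in> Is" for \<iota> \<kappa>
          using herm1[OF y that] .
      qed (simp add: n2_nonneg)
      finally show "c * n2 (double Is) v \<le> n2 (double Is) (act (double Is) (\<lambda>\<iota> \<kappa>. block D0 (\<lambda>\<iota> \<kappa> y. of_real t * Q \<iota> \<kappa> y) D1 \<iota> \<kappa> y) v)" .
    qed
  qed
  with eventually_inertia[OF s0 c e0] eventually_inertia[OF s1 c e1]
  show ?thesis
  proof eventually_elim
    case (elim N)
    then obtain k l j where k: "inertia (ix N Is dg) (fm N D0) k"
      and l: "inertia (ix N Is (\<lambda>\<iota>. Suc (dg \<iota>))) (fm N D1) l"
      and j: "inertia (ix N (double Is) (double_degree dg)) (fm N (block D0 (\<lambda>_ _ _. 0) D1)) j"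
        "inertia (ix N (double Is) (double_degree dg)) (fm N (block D0 Q D1)) j" by blast
    have "finite (double Is)" using fin by (simp add: double_def)
    from inertia_unique[OF finite_ix[OF this] j(1) inertia_block[OF fin k l]] j(2) k l
    show ?case by blast
  qed
qed

end

locale toeplitz_clifford = toeplitz Y Es X B mon up P pt
  for Y :: "'y set" and Es :: "'e set" and X :: "'e \<Rightarrow> 'y \<Rightarrow> complex"
    and B :: "nat \<Rightarrow> 'b set" and mon :: "'b \<Rightarrow> 'y \<Rightarrow> complex" and up :: "'e \<Rightarrow> 'b \<Rightarrow> 'b"
    and P :: "nat \<Rightarrow> 'p set" and pt :: "nat \<Rightarrow> 'p \<Rightarrow> 'y" +
  fixes S :: "bool list set" and C :: "bool list \<Rightarrow> bool list \<Rightarrow> 'y \<Rightarrow> complex"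
    and la :: "'y \<Rightarrow> complex" and l :: "'y \<Rightarrow> real" and c0 :: real
  assumes cliff: "y \<in> Y \<Longrightarrow> clifford_symbol S (\<lambda>a b. C a b y) (la y) (l y)"
    and qC: "s \<in> S \<Longrightarrow> t \<in> S \<Longrightarrow> qsym a (Suc a) (C s t)"
    and qCa: "s \<in> S \<Longrightarrow> t \<in> S \<Longrightarrow> qsym (Suc a) a (\<lambda>y. cnj (C s t y))"
    and ql: "qsym a a (\<lambda>y. of_real (l y))"
    and c0: "c0 > 0" and bound: "y \<in> Y \<Longrightarrow> c0 \<le> (l y)\<^sup>2 - (cmod (la y))\<^sup>2"
    and finS: "finite S"
begin

definition OmS :: "bool list \<Rightarrow> bool list \<Rightarrow> 'y \<Rightarrow> complex" where
  "OmS a b y = ((if a = b then of_real (l y) else 0) - (\<Sum>c\<in>S. cnj (C c a y) * C c b y)) / 2"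

text \<open>A lower bound on all of Y for the square of \<open>min 1 om\<close>: the square of
  \<open>om\<close> is a quarter of the difference bounded below by \<open>c0\<close>, and 1 belongs
  to the constant symbols at the end of the path.\<close>

definition c1 :: real where "c1 = min 1 (c0 / 4)"

lemma c1_pos: "c1 > 0"
  using c0 by (simp add: c1_def)

lemma c1_le_om: "y \<in> Y \<Longrightarrow> c1 \<le> (min 1 (clifford_symbol.om (la y) (l y)))\<^sup>2"
proof -
  assume y: "y \<in> Y"
  interpret clifford_symbol S "\<lambda>a b. C a b y" "la y" "l y" by (rule cliff[OF y])
  have "c0 / 4 \<le> om\<^sup>2" using bound[OF y] by (simp add: om_square)
  then show ?thesis using om_pos by (auto simp: c1_def min_def)
qed

lemma OmS_Om:
  assumes "y \<in> Y"
  shows "(\<lambda>a b. OmS a b y) = clifford_symbol.Om S (\<lambda>a b. C a b y) (l y)"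
proof -
  interpret clifford_symbol S "\<lambda>a b. C a b y" "la y" "l y" by (rule cliff[OF assms])
  show ?thesis by (simp add: fun_eq_iff OmS_def Om_def)
qed

lemma symb_OmS: "symb S (\<lambda>_. a) OmS"
  unfolding symb_def
proof (intro conjI ballI finS)
  fix s t assume st: "s \<in> S" "t \<in> S"
  have "qsym a a (\<lambda>y. (1 / 2) * ((if s = t then of_real (l y) else 0) - (\<Sum>c\<in>S. cnj (C c s y) * C c t y)))"
  proof (intro qsym_scale qsym_diff qsym_sum qsym_mult[OF qCa qC])
    show "qsym a a (\<lambda>y. if s = t then of_real (l y) else 0)"
      using ql qsym_zero by (cases "s = t") auto
  qed (use st in auto)
  then show "qsym a a (OmS s t)" by (simp add: OmS_def[abs_def])
qed (simp add: OmS_def mult_ac)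

lemma elliptic_OmS: "elliptic c1 S OmS"
  unfolding elliptic_n2
proof (intro ballI allI)
  fix y v assume y: "y \<in> Y"
  interpret clifford_symbol S "\<lambda>a b. C a b y" "la y" "l y" by (rule cliff[OF y])
  have "c1 \<le> (min 1 om)\<^sup>2" by (rule c1_le_om[OF y])
  also have "\<dots> \<le> om\<^sup>2" using om_pos by (intro power_mono) auto
  finally show "c1 * n2 S v \<le> n2 S (act S (\<lambda>\<iota> \<kappa>. OmS \<iota> \<kappa> y) v)"
    unfolding OmS_Om[OF y] n2_Om by (intro mult_right_mono n2_nonneg)
qed

text \<open>
  The forms \<open>Om\<close> in degrees \<open>a\<close> and \<open>a + 1\<close> together have as many positive squares as the
  space of degree \<open>a\<close> has dimensions: rotate \<open>diag (Om, Om)\<close> into \<open>diag (1, -1)\<close> through the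
  off-diagonal term \<open>C\<close>, which anticommutes with both.
\<close>

lemma inertia_consecutive:
  "\<forall>\<^sub>F N in sequentially. \<exists>k k'. inertia (ix N S (\<lambda>_. a)) (fm N OmS) k \<and>
     inertia (ix N S (\<lambda>_. Suc a)) (fm N OmS) k' \<and> k + k' = card (ix N S (\<lambda>_. a))"
proof -
  let ?one = "scalar_symbol 1" and ?mone = "scalar_symbol (-1)"
  \<comment> \<open>The coupling C may be added to diag (Om, Om) because it anticommutes with
    Om.\<close>
  have A: "\<forall>\<^sub>F N in sequentially. \<exists>k k'. inertia (ix N S (\<lambda>_. a)) (fm N OmS) k \<and>
     inertia (ix N S (\<lambda>_. Suc a)) (fm N OmS) k' \<and>
     inertia (ix N (double S) (double_degree (\<lambda>_. a))) (fm N (block OmS C OmS)) (k + k')"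
  proof (rule inertia_double_coupling[OF symb_OmS symb_OmS _ _ c1_pos elliptic_OmS elliptic_OmS])
    fix v \<iota> y assume "y \<in> Y" "\<iota> \<in> S"
    then interpret clifford_symbol S "\<lambda>a b. C a b y" "la y" "l y" by (intro cliff)
    show "act S (\<lambda>\<iota> \<kappa>. C \<iota> \<kappa> y) (act S (\<lambda>\<iota> \<kappa>. OmS \<iota> \<kappa> y) v) \<iota> + act S (\<lambda>\<iota> \<kappa>. OmS \<iota> \<kappa> y) (act S (\<lambda>\<iota> \<kappa>. C \<iota> \<kappa> y) v) \<iota> = 0"
      unfolding OmS_Om[OF \<open>y \<in> Y\<close>] by (rule C_Om[OF \<open>\<iota> \<in> S\<close>])
  qed (use qC qCa in auto)
  have delta: "act S (\<lambda>\<iota> \<kappa>. scalar_symbol c \<iota> \<kappa> y) v \<iota> = c * v \<iota>" if "\<iota> \<in> S" for c \<iota> v y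
    using act_delta[OF finS that] unfolding scalar_symbol_def .
  have s1: "symb S dg ?one" and s2: "symb S dg ?mone" for dg
    by (auto intro: symb_scalar_symbol finS)
  \<comment> \<open>It may also be added to diag (1, -1), as C 1 + (-1) C = 0.\<close>
  have Cc: "\<forall>\<^sub>F N in sequentially. \<exists>k k'. inertia (ix N S (\<lambda>_. a)) (fm N ?one) k \<and>
     inertia (ix N S (\<lambda>_. Suc a)) (fm N ?mone) k' \<and>
     inertia (ix N (double S) (double_degree (\<lambda>_. a))) (fm N (block ?one C ?mone)) (k + k')"
  proof (rule inertia_double_coupling[OF s1 s2 _ _ zero_less_one])
    show "elliptic 1 S ?one" "elliptic 1 S ?mone"
      unfolding elliptic_n2 using delta by (auto simp: n2_def)
    fix v \<iota> y assume "y \<in> Y" and \<iota>: "\<iota> \<in> S"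
    have "act S (\<lambda>\<iota> \<kappa>. C \<iota> \<kappa> y) (act S (\<lambda>\<iota> \<kappa>. scalar_symbol 1 \<iota> \<kappa> y) v) \<iota> = act S (\<lambda>\<iota> \<kappa>. C \<iota> \<kappa> y) v \<iota>"
      using delta by (intro fun_cong[OF act_cong]) auto
    then show "act S (\<lambda>\<iota> \<kappa>. C \<iota> \<kappa> y) (act S (\<lambda>\<iota> \<kappa>. scalar_symbol 1 \<iota> \<kappa> y) v) \<iota> +
      act S (\<lambda>\<iota> \<kappa>. scalar_symbol (-1) \<iota> \<kappa> y) (act S (\<lambda>\<iota> \<kappa>. C \<iota> \<kappa> y) v) \<iota> = 0"
      by (simp add: delta[OF \<iota>])
  qed (use qC qCa in auto)
  \<comment> \<open>With the coupling present the two diagonals are joined by an elliptic path;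
    \<open>path_bound_lower\<close> and \<open>path_bound_upper\<close> bound its two
    components.\<close>
  have Bb: "\<forall>\<^sub>F N in sequentially. \<exists>k. inertia (ix N (double S) (double_degree (\<lambda>_. a))) (fm N (block OmS C OmS)) k \<and>
     inertia (ix N (double S) (double_degree (\<lambda>_. a))) (fm N (block ?one C ?mone)) k"
  proof (rule inertia_constant[OF _ _ c1_pos])
    show "symb (double S) (double_degree (\<lambda>_. a)) (block OmS C OmS)"
      by (rule symb_block[OF symb_OmS symb_OmS]) (simp_all add: qC qCa)
    show "symb (double S) (double_degree (\<lambda>_. a)) (block ?one C ?mone)"
      by (rule symb_block[OF s1 s2]) (simp_all add: qC qCa)
    fix t :: real assume t: "0 \<le> t" "t \<le> 1"
    let ?D0 = "\<lambda>\<iota> \<kappa> y. of_real (1 - t) * OmS \<iota> \<kappa> y + of_real t * scalar_symbol 1 \<iota> \<kappa> y"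
    let ?D1 = "\<lambda>\<iota> \<kappa> y. of_real (1 - t) * OmS \<iota> \<kappa> y + of_real t * scalar_symbol (-1) \<iota> \<kappa> y"
    have eq: "(\<lambda>\<iota> \<kappa> y. of_real (1 - t) * block OmS C OmS \<iota> \<kappa> y + of_real t * block ?one C ?mone \<iota> \<kappa> y) = block ?D0 C ?D1"
    proof (intro ext)
      fix \<iota> \<kappa> y
      have r: "cnj (of_real (1 - t)) = of_real (1 - t)" "cnj (of_real t) = of_real t" by auto
      show "of_real (1 - t) * block OmS C OmS \<iota> \<kappa> y + of_real t * block ?one C ?mone \<iota> \<kappa> y = block ?D0 C ?D1 \<iota> \<kappa> y"
        unfolding block_affine[OF r] r convex_same ..
    qed
    show "elliptic c1 (double S) (\<lambda>\<iota> \<kappa> y. of_real (1 - t) * block OmS C OmS \<iota> \<kappa> y + of_real t * block ?one C ?mone \<iota> \<kappa> y)"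
      unfolding eq elliptic_n2
    proof (intro ballI allI)
      fix y and v :: "bool list \<Rightarrow> complex" assume y: "y \<in> Y"
      interpret clifford_symbol S "\<lambda>a b. C a b y" "la y" "l y" by (rule cliff[OF y])
      have a0: "act S (\<lambda>\<iota> \<kappa>. ?D0 \<iota> \<kappa> y) u \<iota> = of_real (1 - t) * act S Om u \<iota> + of_real t * u \<iota>" if "\<iota> \<in> S" for u \<iota>
        unfolding act_affine_left OmS_Om[OF y] delta[OF that] by simp
      have a1: "act S (\<lambda>\<iota> \<kappa>. ?D1 \<iota> \<kappa> y) u \<iota> = of_real (1 - t) * act S Om u \<iota> + of_real (- t) * u \<iota>" if "\<iota> \<in> S" for u \<iota>
        unfolding act_affine_left OmS_Om[OF y] delta[OF that] by simp
      let ?v0 = "\<lambda>\<iota>. v (False # \<iota>)" and ?v1 = "\<lambda>\<iota>. v (True # \<iota>)"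
      have Caeq: "(\<lambda>\<iota> \<kappa>. cnj (C \<kappa> \<iota> y)) = Ca" by (simp add: Ca_def fun_eq_iff)
      have n: "n2 (double S) (act (double S) (\<lambda>\<iota> \<kappa>. block ?D0 C ?D1 \<iota> \<kappa> y) v) =
        n2 S (act S (\<lambda>\<iota> \<kappa>. ?D0 \<iota> \<kappa> y) ?v0) + n2 S (act S (\<lambda>\<iota> \<kappa>. C \<iota> \<kappa> y) ?v0) +
        n2 S (act S (\<lambda>\<iota> \<kappa>. cnj (C \<kappa> \<iota> y)) ?v1) + n2 S (act S (\<lambda>\<iota> \<kappa>. ?D1 \<iota> \<kappa> y) ?v1)"
      proof (rule n2_block[OF finS])
        fix \<iota> \<kappa> assume "\<iota> \<in> S" "\<kappa> \<in> S"
        have 1: "OmS \<kappa> \<iota> y = cnj (OmS \<iota> \<kappa> y)" by (simp add: OmS_def mult_ac)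
        have 2: "scalar_symbol (-1) \<kappa> \<iota> y = cnj (scalar_symbol (-1) \<iota> \<kappa> y)" by (simp add: scalar_symbol_def)
        show "?D1 \<kappa> \<iota> y = cnj (?D1 \<iota> \<kappa> y)"
          unfolding 1 2 by simp
      next
        fix u \<iota> assume \<iota>: "\<iota> \<in> S"
        have "act S (\<lambda>\<iota> \<kappa>. C \<iota> \<kappa> y) (act S (\<lambda>\<iota> \<kappa>. ?D0 \<iota> \<kappa> y) u) \<iota> =
          act S (\<lambda>\<iota> \<kappa>. C \<iota> \<kappa> y) (\<lambda>\<iota>. of_real (1 - t) * act S Om u \<iota> + of_real t * u \<iota>) \<iota>"
          using a0 by (intro fun_cong[OF act_cong]) auto
        then have "act S (\<lambda>\<iota> \<kappa>. C \<iota> \<kappa> y) (act S (\<lambda>\<iota> \<kappa>. ?D0 \<iota> \<kappa> y) u) \<iota> + act S (\<lambda>\<iota> \<kappa>. ?D1 \<iota> \<kappa> y) (act S (\<lambda>\<iota> \<kappa>. C \<iota> \<kappa> y) u) \<iota>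
          = of_real (1 - t) * (act S (\<lambda>\<iota> \<kappa>. C \<iota> \<kappa> y) (act S Om u) \<iota> + act S Om (act S (\<lambda>\<iota> \<kappa>. C \<iota> \<kappa> y) u) \<iota>)"
          unfolding act_affine_right a1[OF \<iota>] by (simp add: algebra_simps)
        then show "act S (\<lambda>\<iota> \<kappa>. C \<iota> \<kappa> y) (act S (\<lambda>\<iota> \<kappa>. ?D0 \<iota> \<kappa> y) u) \<iota> + act S (\<lambda>\<iota> \<kappa>. ?D1 \<iota> \<kappa> y) (act S (\<lambda>\<iota> \<kappa>. C \<iota> \<kappa> y) u) \<iota> = 0"
          unfolding C_Om[OF \<iota>] by simp
      qed
      have 0: "n2 S (act S (\<lambda>\<iota> \<kappa>. ?D0 \<iota> \<kappa> y) ?v0) = n2 S (\<lambda>\<iota>. of_real (1 - t) * act S Om ?v0 \<iota> + of_real t * ?v0 \<iota>)"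
        by (rule n2_cong) (rule a0)
      have 1: "n2 S (act S (\<lambda>\<iota> \<kappa>. ?D1 \<iota> \<kappa> y) ?v1) = n2 S (\<lambda>\<iota>. of_real (1 - t) * act S Om ?v1 \<iota> + of_real (- t) * ?v1 \<iota>)"
        by (rule n2_cong) (rule a1)
      have "c1 * n2 (double S) v \<le> (min 1 om)\<^sup>2 * n2 (double S) v"
        by (intro mult_right_mono n2_nonneg c1_le_om[OF y])
      also have "\<dots> \<le> n2 (double S) (act (double S) (\<lambda>\<iota> \<kappa>. block ?D0 C ?D1 \<iota> \<kappa> y) v)"
        unfolding n 0 1 n2_double[OF finS, of v] Caeq distrib_left
        using path_bound_lower[OF t, of ?v0] path_bound_upper[OF t, of ?v1] by linarith
      finally show "c1 * n2 (double S) v \<le> n2 (double S) (act (double S) (\<lambda>\<iota> \<kappa>. block ?D0 C ?D1 \<iota> \<kappa> y) v)" .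
    qed
  qed
  show ?thesis
    using A Bb Cc eventually_good_ball[OF finS, of "\<lambda>_. a"] eventually_good_ball[OF finS, of "\<lambda>_. Suc a"]
  proof eventually_elim
    case (elim N)
    have fd: "finite (double S)" using finS by (simp add: double_def)
    obtain k k' where k: "inertia (ix N S (\<lambda>_. a)) (fm N OmS) k" "inertia (ix N S (\<lambda>_. Suc a)) (fm N OmS) k'"
      "inertia (ix N (double S) (double_degree (\<lambda>_. a))) (fm N (block OmS C OmS)) (k + k')" using elim(1) by blast
    obtain j where j: "inertia (ix N (double S) (double_degree (\<lambda>_. a))) (fm N (block OmS C OmS)) j"
      "inertia (ix N (double S) (double_degree (\<lambda>_. a))) (fm N (block ?one C ?mone)) j" using elim(2) by blast
    obtain m m' where m: "inertia (ix N S (\<lambda>_. a)) (fm N ?one) m" "inertia (ix N S (\<lambda>_. Suc a)) (fm N ?mone) m'"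
      "inertia (ix N (double S) (double_degree (\<lambda>_. a))) (fm N (block ?one C ?mone)) (m + m')" using elim(3) by blast
    \<comment> \<open>The common inertia is computed at the end of the path, where \<open>m\<close>
      is the full dimension in degree a and \<open>m'\<close> is 0.\<close>
    have 1: "k + k' = j" "j = m + m'"
      using inertia_unique[OF finite_ix[OF fd]] k(3) j m(3) by blast+
    have 2: "m = card (ix N S (\<lambda>_. a))"
      by (rule inertia_unique[OF finite_ix[OF finS] m(1) inertia_scalar_symbol_one[OF finS]]) (use elim(4) in auto)
    have "inertia (ix N S (\<lambda>_. Suc a)) (\<lambda>a b. - fm N ?one a b) (card (ix N S (\<lambda>_. Suc a)) - card (ix N S (\<lambda>_. Suc a)))"
      by (rule inertia_uminus[OF inertia_scalar_symbol_one[OF finS]]) (use elim(5) in auto)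
    then have "inertia (ix N S (\<lambda>_. Suc a)) (fm N ?mone) 0" by (simp add: fm_scalar_symbol_minus)
    then have 3: "m' = 0" using inertia_unique[OF finite_ix[OF finS] m(2)] by blast
    show ?case using k 1 2 3 by auto
  qed
qed

end

subsection \<open>The Koszul complex\<close>

text \<open>The leading bits of an index, one for each coordinate in the list, name a basis element
  of an exterior algebra, and the tail is an index of S. Each generator present raises the degree by
  one.\<close>

fun koszul_degree :: "nat \<Rightarrow> 'e list \<Rightarrow> bool list \<Rightarrow> nat" where
  "koszul_degree a [] = (\<lambda>_. a)"
| "koszul_degree a (e # es) = double_degree (koszul_degree a es)"

fun koszul_index :: "bool list set \<Rightarrow> 'e list \<Rightarrow> bool list set" where
  "koszul_index S [] = S"
| "koszul_index S (e # es) = double (koszul_index S es)"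

text \<open>The parity of the exterior degree.\<close>

fun koszul_sign :: "'e list \<Rightarrow> bool list \<Rightarrow> complex" where
  "koszul_sign (e # es) (b # bs) = (if b then - koszul_sign es bs else koszul_sign es bs)"
| "koszul_sign _ _ = 1"

lemma koszul_degree_Suc: "(\<lambda>\<iota>. Suc (koszul_degree a es \<iota>)) = koszul_degree (Suc a) es"
proof (induction es)
  case (Cons e es)
  have "Suc (double_degree (koszul_degree a es) \<iota>) = double_degree (\<lambda>\<iota>. Suc (koszul_degree a es \<iota>)) \<iota>" for \<iota>
    by (cases \<iota>) auto
  then show ?case using Cons by simp
qed simp

lemma finite_koszul_index: "finite S \<Longrightarrow> finite (koszul_index S es)"
  by (induction es) (auto simp: double_def)

lemma koszul_sign_cases: "koszul_sign es \<iota> = 1 \<or> koszul_sign es \<iota> = -1"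
  by (induction es \<iota> rule: koszul_sign.induct) auto

context toeplitz
begin

text \<open>Exterior multiplication by the vector of coordinates plus its adjoint, together with D
  twisted by the parity. The minus sign in the second block makes the scalar coupling
  \<open>X e\<close> anticommute with the rest.\<close>

fun koszul :: "(bool list \<Rightarrow> bool list \<Rightarrow> 'y \<Rightarrow> complex) \<Rightarrow> 'e list \<Rightarrow> bool list \<Rightarrow> bool list \<Rightarrow> 'y \<Rightarrow> complex" where
  "koszul D [] = D"
| "koszul D (e # es) = block (koszul D es) (\<lambda>\<iota> \<kappa> y. if \<iota> = \<kappa> then X e y else 0) (\<lambda>\<iota> \<kappa> y. - koszul D es \<iota> \<kappa> y)"

lemma qsym_kcoupling:
  assumes "e \<in> Es"
  shows "qsym (dg \<kappa>) (Suc (dg \<iota>)) (\<lambda>y. if \<iota> = \<kappa> then X e y else 0)"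
    "qsym (Suc (dg \<kappa>)) (dg \<iota>) (\<lambda>y. cnj (if \<kappa> = \<iota> then X e y else 0))"
  using qsym_X[OF assms] qsym_cnj_X[OF assms] qsym_zero by (cases "\<iota> = \<kappa>"; auto)+

lemma symb_koszul:
  assumes "finite S" "\<And>a. symb S (\<lambda>_. a) D" "set es \<subseteq> Es"
  shows "symb (koszul_index S es) (koszul_degree a es) (koszul D es)"
  using assms(3)
proof (induction es arbitrary: a)
  case Nil
  then show ?case using assms by simp
next
  case (Cons e es)
  have e: "e \<in> Es" and es: "set es \<subseteq> Es" using Cons.prems by auto
  show ?case
    unfolding koszul_index.simps koszul_degree.simps koszul.simps
  proof (rule symb_block)
    show "symb (koszul_index S es) (koszul_degree a es) (koszul D es)" by (rule Cons.IH[OF es])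
    show "symb (koszul_index S es) (\<lambda>\<iota>. Suc (koszul_degree a es \<iota>)) (\<lambda>\<iota> \<kappa> y. - koszul D es \<iota> \<kappa> y)"
      unfolding koszul_degree_Suc by (rule symb_uminus[OF Cons.IH[OF es]])
  qed (rule qsym_kcoupling[OF e])+
qed

text \<open>By \<open>n2_block\<close> each generator e adds the squared modulus of
  \<open>X e\<close> to the lower bound. For the full list of coordinates these sum to 1, so the
  symbol is elliptic even for D = 0.\<close>

lemma n2_koszul:
  assumes "finite S" "\<And>\<iota> \<kappa>. \<iota> \<in> S \<Longrightarrow> \<kappa> \<in> S \<Longrightarrow> D \<kappa> \<iota> y = cnj (D \<iota> \<kappa> y)"
    "\<And>v. \<beta> * n2 S v \<le> n2 S (act S (\<lambda>\<iota> \<kappa>. D \<iota> \<kappa> y) v)"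
  shows "(\<beta> + (\<Sum>e\<leftarrow>es. (cmod (X e y))\<^sup>2)) * n2 (koszul_index S es) v \<le> n2 (koszul_index S es) (act (koszul_index S es) (\<lambda>\<iota> \<kappa>. koszul D es \<iota> \<kappa> y) v)"
    (is ?A)
    and "\<iota> \<in> koszul_index S es \<Longrightarrow> \<kappa> \<in> koszul_index S es \<Longrightarrow> koszul D es \<kappa> \<iota> y = cnj (koszul D es \<iota> \<kappa> y)" (is "PROP ?B")
proof -
  have "(\<forall>v. (\<beta> + (\<Sum>e\<leftarrow>es. (cmod (X e y))\<^sup>2)) * n2 (koszul_index S es) v \<le> n2 (koszul_index S es) (act (koszul_index S es) (\<lambda>\<iota> \<kappa>. koszul D es \<iota> \<kappa> y) v)) \<and>
    (\<forall>\<iota>\<in>koszul_index S es. \<forall>\<kappa>\<in>koszul_index S es. koszul D es \<kappa> \<iota> y = cnj (koszul D es \<iota> \<kappa> y))"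
  proof (induction es)
    case Nil
    have 1: "\<forall>v. (\<beta> + (\<Sum>e\<leftarrow>[]. (cmod (X e y))\<^sup>2)) * n2 S v \<le> n2 S (act S (\<lambda>\<iota> \<kappa>. D \<iota> \<kappa> y) v)"
      using assms(3) by simp
    show ?case unfolding koszul_index.simps koszul.simps using 1 assms(2) by blast
  next
    case (Cons e es)
    let ?I = "koszul_index S es" and ?D = "koszul D es" and ?Q = "\<lambda>\<iota> \<kappa> y. if \<iota> = \<kappa> then X e y else 0"
    let ?b = "\<beta> + (\<Sum>e\<leftarrow>es. (cmod (X e y))\<^sup>2)"
    have fin: "finite ?I" by (rule finite_koszul_index[OF assms(1)])
    have IH: "?b * n2 ?I v \<le> n2 ?I (act ?I (\<lambda>\<iota> \<kappa>. ?D \<iota> \<kappa> y) v)" for v using Cons.IH by blast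
    have h: "?D \<kappa> \<iota> y = cnj (?D \<iota> \<kappa> y)" if "\<iota> \<in> ?I" "\<kappa> \<in> ?I" for \<iota> \<kappa> using Cons.IH that by blast
    have Q: "act ?I (\<lambda>\<iota> \<kappa>. ?Q \<iota> \<kappa> y) v \<iota> = X e y * v \<iota>" if "\<iota> \<in> ?I" for v \<iota>
      by (rule act_delta[OF fin that])
    have Qa: "act ?I (\<lambda>\<iota> \<kappa>. cnj (?Q \<kappa> \<iota> y)) v \<iota> = cnj (X e y) * v \<iota>" if "\<iota> \<in> ?I" for v \<iota>
    proof -
      have eq: "(\<lambda>\<iota> (\<kappa> :: bool list). cnj (?Q \<kappa> \<iota> y)) = (\<lambda>\<iota> \<kappa>. if \<iota> = \<kappa> then cnj (X e y) else 0)" by (auto simp: fun_eq_iff)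
      show ?thesis unfolding eq by (rule act_delta[OF fin that])
    qed
    have "(\<beta> + (\<Sum>e\<leftarrow>e # es. (cmod (X e y))\<^sup>2)) * n2 (double ?I) v
       \<le> n2 (double ?I) (act (double ?I) (\<lambda>\<iota> \<kappa>. block ?D ?Q (\<lambda>\<iota> \<kappa> y. - ?D \<iota> \<kappa> y) \<iota> \<kappa> y) v)" for v
    proof (subst n2_block[OF fin])
      show "- ?D \<kappa> \<iota> y = cnj (- ?D \<iota> \<kappa> y)" if "\<iota> \<in> ?I" "\<kappa> \<in> ?I" for \<iota> \<kappa>
        using h[OF that] by simp
      show "act ?I (\<lambda>\<iota> \<kappa>. ?Q \<iota> \<kappa> y) (act ?I (\<lambda>\<iota> \<kappa>. ?D \<iota> \<kappa> y) v) \<iota> +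
        act ?I (\<lambda>\<iota> \<kappa>. - ?D \<iota> \<kappa> y) (act ?I (\<lambda>\<iota> \<kappa>. ?Q \<iota> \<kappa> y) v) \<iota> = 0" if \<iota>: "\<iota> \<in> ?I" for v \<iota>
      proof -
        have "act ?I (\<lambda>\<iota> \<kappa>. ?D \<iota> \<kappa> y) (act ?I (\<lambda>\<iota> \<kappa>. ?Q \<iota> \<kappa> y) v) \<iota> = act ?I (\<lambda>\<iota> \<kappa>. ?D \<iota> \<kappa> y) (\<lambda>\<iota>. X e y * v \<iota>) \<iota>"
          using Q by (intro fun_cong[OF act_cong]) auto
        then show ?thesis unfolding Q[OF \<iota>] act_uminus_left by (simp add: act_scale_right)
      qed
      let ?v0 = "\<lambda>\<iota>. v (False # \<iota>)" and ?v1 = "\<lambda>\<iota>. v (True # \<iota>)"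
      have 1: "n2 ?I (act ?I (\<lambda>\<iota> \<kappa>. ?Q \<iota> \<kappa> y) ?v0) = (cmod (X e y))\<^sup>2 * n2 ?I ?v0"
        unfolding n2_scale[symmetric] by (rule n2_cong) (rule Q)
      have "n2 ?I (act ?I (\<lambda>\<iota> \<kappa>. cnj (?Q \<kappa> \<iota> y)) ?v1) = (cmod (cnj (X e y)))\<^sup>2 * n2 ?I ?v1"
        unfolding n2_scale[symmetric] by (rule n2_cong) (rule Qa)
      then have 2: "n2 ?I (act ?I (\<lambda>\<iota> \<kappa>. cnj (?Q \<kappa> \<iota> y)) ?v1) = (cmod (X e y))\<^sup>2 * n2 ?I ?v1" by simp
      have 3: "n2 ?I (act ?I (\<lambda>\<iota> \<kappa>. - ?D \<iota> \<kappa> y) ?v1) = n2 ?I (act ?I (\<lambda>\<iota> \<kappa>. ?D \<iota> \<kappa> y) ?v1)"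
        unfolding n2_def act_uminus_left by simp
      show "(\<beta> + (\<Sum>e\<leftarrow>e # es. (cmod (X e y))\<^sup>2)) * n2 (double ?I) v \<le>
        n2 ?I (act ?I (\<lambda>\<iota> \<kappa>. ?D \<iota> \<kappa> y) ?v0) + n2 ?I (act ?I (\<lambda>\<iota> \<kappa>. ?Q \<iota> \<kappa> y) ?v0) +
        n2 ?I (act ?I (\<lambda>\<iota> \<kappa>. cnj (?Q \<kappa> \<iota> y)) ?v1) + n2 ?I (act ?I (\<lambda>\<iota> \<kappa>. - ?D \<iota> \<kappa> y) ?v1)"
        unfolding 1 2 3 n2_double[OF fin, of v] using IH[of ?v0] IH[of ?v1] by (simp add: algebra_simps)
    qed
    moreover have "koszul D (e # es) \<kappa> \<iota> y = cnj (koszul D (e # es) \<iota> \<kappa> y)" if i: "\<iota> \<in> double ?I" and k: "\<kappa> \<in> double ?I" for \<iota> \<kappa>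
    proof -
      obtain a as where \<iota>: "\<iota> = a # as" "as \<in> ?I" using i by (auto simp: double_def)
      obtain b bs where \<kappa>: "\<kappa> = b # bs" "bs \<in> ?I" using k by (auto simp: double_def)
      show ?thesis unfolding \<iota> \<kappa> using h[OF \<iota>(2) \<kappa>(2)] by (cases a; cases b) auto
    qed
    ultimately show ?case unfolding koszul_index.simps koszul.simps by blast
  qed
  then show ?A "PROP ?B" by blast+
qed

lemma koszul_affine:
  "of_real (1 - t) * koszul D es \<iota> \<kappa> y + of_real t * koszul D' es \<iota> \<kappa> y =
    koszul (\<lambda>\<iota> \<kappa> y. of_real (1 - t) * D \<iota> \<kappa> y + of_real t * D' \<iota> \<kappa> y) es \<iota> \<kappa> y"
proof (induction es arbitrary: \<iota> \<kappa> y)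
  case (Cons e es)
  have r: "cnj (of_real (1 - t)) = of_real (1 - t)" "cnj (of_real t) = of_real t" by auto
  have eq: "(\<lambda>\<iota> \<kappa> y. of_real (1 - t) * - koszul D es \<iota> \<kappa> y + of_real t * - koszul D' es \<iota> \<kappa> y) =
      (\<lambda>\<iota> \<kappa> y. - (of_real (1 - t) * koszul D es \<iota> \<kappa> y + of_real t * koszul D' es \<iota> \<kappa> y))"
    by (simp add: fun_eq_iff algebra_simps)
  show ?case
    unfolding koszul.simps block_affine[OF r] r convex_same eq Cons.IH ..
qed simp

text \<open>Without D the symbol only creates or removes one generator, so it is odd for the
  parity.\<close>

lemma koszul_sign_koszul_zero: "koszul_sign es a * koszul_sign es b * koszul (\<lambda>_ _ _. 0) es a b y = - koszul (\<lambda>_ _ _. 0) es a b y"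
proof (induction es arbitrary: a b)
  case (Cons e es)
  have sq: "koszul_sign es as * koszul_sign es as = 1" for as
    using koszul_sign_cases[of es as] by auto
  have z: "koszul (\<lambda>_ _ _. 0) es cs cs y = 0" for cs
  proof -
    have "koszul (\<lambda>_ _ _. 0) es cs cs y = - koszul (\<lambda>_ _ _. 0) es cs cs y"
      using Cons.IH[of cs cs] unfolding sq by simp
    then show ?thesis by (simp add: complex_eq_iff)
  qed
  show ?case
  proof (cases a)
    case a: (Cons a' as)
    show ?thesis
    proof (cases b)
      case b: (Cons b' bs)
      show ?thesis unfolding a b
        by (cases a'; cases b'; cases "as = bs") (simp_all add: Cons.IH sq z)
    qed (simp add: a)
  qed simp
qed simp

end

context toeplitz_clifford
begin

lemma OmS_hermitian: "OmS \<kappa> \<iota> y = cnj (OmS \<iota> \<kappa> y)"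
  by (simp add: OmS_def mult_ac)

lemma elliptic_koszul: "elliptic c1 (koszul_index S es) (koszul OmS es)"
  unfolding elliptic_n2
proof (intro ballI allI)
  fix y v assume y: "y \<in> Y"
  have "c1 * n2 (koszul_index S es) v \<le> (c1 + (\<Sum>e\<leftarrow>es. (cmod (X e y))\<^sup>2)) * n2 (koszul_index S es) v"
    by (intro mult_right_mono n2_nonneg) (auto intro!: sum_list_nonneg)
  also have "\<dots> \<le> n2 (koszul_index S es) (act (koszul_index S es) (\<lambda>\<iota> \<kappa>. koszul OmS es \<iota> \<kappa> y) v)"
  proof (rule n2_koszul(1)[OF finS OmS_hermitian])
    show "c1 * n2 S v \<le> n2 S (act S (\<lambda>\<iota> \<kappa>. OmS \<iota> \<kappa> y) v)" for v
      using elliptic_OmS y unfolding elliptic_n2 by blast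
  qed
  finally show "c1 * n2 (koszul_index S es) v \<le> n2 (koszul_index S es) (act (koszul_index S es) (\<lambda>\<iota> \<kappa>. koszul OmS es \<iota> \<kappa> y) v)" .
qed

section \<open>Signatures of the Koszul symbols\<close>

definition ino :: "nat \<Rightarrow> nat \<Rightarrow> 'e list \<Rightarrow> nat" where
  "ino N a es = (THE k. inertia (ix N (koszul_index S es) (koszul_degree a es)) (fm N (koszul OmS es)) k)"

definition dimk :: "nat \<Rightarrow> nat \<Rightarrow> 'e list \<Rightarrow> nat" where
  "dimk N a es = card (ix N (koszul_index S es) (koszul_degree a es))"

definition sg :: "nat \<Rightarrow> nat \<Rightarrow> 'e list \<Rightarrow> int" where
  "sg N a es = 2 * int (ino N a es) - int (dimk N a es)"

lemma ino_eqI: "inertia (ix N (koszul_index S es) (koszul_degree a es)) (fm N (koszul OmS es)) k \<Longrightarrow> ino N a es = k"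
  unfolding ino_def using inertia_unique[OF finite_ix[OF finite_koszul_index[OF finS]]] by blast

lemma symb_koszul_OmS: "set es \<subseteq> Es \<Longrightarrow> symb (koszul_index S es) (koszul_degree a es) (koszul OmS es)"
  by (rule symb_koszul[OF finS symb_OmS])

text \<open>The coupled block has the inertia of diag (K, -K) with the second copy one degree
  higher, and negating K negates the signature.\<close>

lemma sg_Cons:
  assumes es: "set (e # es) \<subseteq> Es"
  shows "\<forall>\<^sub>F N in sequentially. sg N a (e # es) = sg N a es - sg N (Suc a) es"
proof -
  have fin: "finite (koszul_index S es)" by (rule finite_koszul_index[OF finS])
  let ?Q = "\<lambda>\<iota> \<kappa> y. if \<iota> = \<kappa> then X e y else 0"
  have e: "e \<in> Es" "set es \<subseteq> Es" using es by auto
  have s1: "symb (koszul_index S es) (\<lambda>\<iota>. Suc (koszul_degree a es \<iota>)) (\<lambda>\<iota> \<kappa> y. - koszul OmS es \<iota> \<kappa> y)"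
    unfolding koszul_degree_Suc by (rule symb_uminus[OF symb_koszul_OmS[OF e(2)]])
  have e1: "elliptic c1 (koszul_index S es) (\<lambda>\<iota> \<kappa> y. - koszul OmS es \<iota> \<kappa> y)"
    using elliptic_koszul[of es] unfolding elliptic_n2 n2_def act_uminus_left by simp
  have "\<forall>\<^sub>F N in sequentially. \<exists>k l. inertia (ix N (koszul_index S es) (koszul_degree a es)) (fm N (koszul OmS es)) k \<and>
    inertia (ix N (koszul_index S es) (\<lambda>\<iota>. Suc (koszul_degree a es \<iota>))) (fm N (\<lambda>\<iota> \<kappa> y. - koszul OmS es \<iota> \<kappa> y)) l \<and>
    inertia (ix N (double (koszul_index S es)) (double_degree (koszul_degree a es))) (fm N (block (koszul OmS es) ?Q (\<lambda>\<iota> \<kappa> y. - koszul OmS es \<iota> \<kappa> y))) (k + l)"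
  proof (rule inertia_double_coupling[OF symb_koszul_OmS[OF e(2)] s1 _ _ c1_pos elliptic_koszul e1])
    fix v \<iota> y assume \<iota>: "\<iota> \<in> koszul_index S es"
    have Q: "act (koszul_index S es) (\<lambda>\<iota> \<kappa>. ?Q \<iota> \<kappa> y) v \<iota> = X e y * v \<iota>" if "\<iota> \<in> koszul_index S es" for v \<iota>
      by (rule act_delta[OF fin that])
    have "act (koszul_index S es) (\<lambda>\<iota> \<kappa>. koszul OmS es \<iota> \<kappa> y) (act (koszul_index S es) (\<lambda>\<iota> \<kappa>. ?Q \<iota> \<kappa> y) v) \<iota> =
      act (koszul_index S es) (\<lambda>\<iota> \<kappa>. koszul OmS es \<iota> \<kappa> y) (\<lambda>\<iota>. X e y * v \<iota>) \<iota>"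
      using Q by (intro fun_cong[OF act_cong]) auto
    then show "act (koszul_index S es) (\<lambda>\<iota> \<kappa>. ?Q \<iota> \<kappa> y) (act (koszul_index S es) (\<lambda>\<iota> \<kappa>. koszul OmS es \<iota> \<kappa> y) v) \<iota> +
      act (koszul_index S es) (\<lambda>\<iota> \<kappa>. - koszul OmS es \<iota> \<kappa> y) (act (koszul_index S es) (\<lambda>\<iota> \<kappa>. ?Q \<iota> \<kappa> y) v) \<iota> = 0"
      unfolding Q[OF \<iota>] act_uminus_left by (simp add: act_scale_right)
  qed (rule qsym_kcoupling[OF e(1)])+
  moreover have "\<forall>\<^sub>F N in sequentially. \<exists>k. inertia (ix N (koszul_index S es) (koszul_degree (Suc a) es)) (fm N (koszul OmS es)) k"
    by (rule eventually_inertia[OF symb_koszul_OmS[OF e(2)] c1_pos elliptic_koszul])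
  ultimately show ?thesis
  proof eventually_elim
    case (elim N)
    obtain k l where k: "inertia (ix N (koszul_index S es) (koszul_degree a es)) (fm N (koszul OmS es)) k"
      and l: "inertia (ix N (koszul_index S es) (koszul_degree (Suc a) es)) (fm N (\<lambda>\<iota> \<kappa> y. - koszul OmS es \<iota> \<kappa> y)) l"
      and kl: "inertia (ix N (koszul_index S (e # es)) (koszul_degree a (e # es))) (fm N (koszul OmS (e # es))) (k + l)"
      using elim(1) by (auto simp: koszul_degree_Suc)
    obtain k' where k': "inertia (ix N (koszul_index S es) (koszul_degree (Suc a) es)) (fm N (koszul OmS es)) k'"
      using elim(2) by blast
    have "inertia (ix N (koszul_index S es) (koszul_degree (Suc a) es)) (fm N (\<lambda>\<iota> \<kappa> y. - koszul OmS es \<iota> \<kappa> y)) (dimk N (Suc a) es - k')"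
      unfolding fm_uminus dimk_def by (rule inertia_uminus[OF k'])
    then have l': "l = dimk N (Suc a) es - k'"
      using inertia_unique[OF finite_ix[OF fin] l] by blast
    have le: "k' \<le> dimk N (Suc a) es" using k' by (simp add: inertia_def dimk_def)
    have "dimk N a (e # es) = dimk N a es + dimk N (Suc a) es"
      using card_ix_double[OF fin, of N "koszul_degree a es"] by (simp add: dimk_def koszul_degree_Suc)
    then show ?case
      using ino_eqI[OF k] ino_eqI[OF k'] ino_eqI[OF kl] l' le by (simp add: sg_def of_nat_diff)
  qed
qed

text \<open>With all coordinates present, Om can be scaled down to 0 without losing ellipticity. The
  remaining symbol is odd for the parity, so positive and negative squares balance.\<close>

lemma sg_full:
  assumes es: "set es = Es" "distinct es"
  shows "\<forall>\<^sub>F N in sequentially. sg N a es = 0"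
proof -
  let ?I = "koszul_index S es" and ?Z = "\<lambda>_ _ _. 0 :: complex"
  have fin: "finite ?I" by (rule finite_koszul_index[OF finS])
  have sZ: "symb S (\<lambda>_. a) ?Z" for a
    using finS qsym_zero by (simp add: symb_def)
  have "\<forall>\<^sub>F N in sequentially. \<exists>k. inertia (ix N ?I (koszul_degree a es)) (fm N (koszul OmS es)) k \<and>
     inertia (ix N ?I (koszul_degree a es)) (fm N (koszul ?Z es)) k"
  proof (rule inertia_constant[OF _ _ zero_less_one])
    show "symb ?I (koszul_degree a es) (koszul OmS es)" using es by (intro symb_koszul_OmS) auto
    show "symb ?I (koszul_degree a es) (koszul ?Z es)" using es by (intro symb_koszul[OF finS sZ]) auto
    fix t :: real
    show "elliptic 1 ?I (\<lambda>\<iota> \<kappa> y. of_real (1 - t) * koszul OmS es \<iota> \<kappa> y + of_real t * koszul ?Z es \<iota> \<kappa> y)"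
      unfolding koszul_affine elliptic_n2
    proof (intro ballI allI)
      fix y v assume y: "y \<in> Y"
      have "(\<Sum>e\<leftarrow>es. (cmod (X e y))\<^sup>2) = 1"
        using es X_sum[OF y] by (simp add: sum_list_distinct_conv_sum_set)
      moreover have "(0 + (\<Sum>e\<leftarrow>es. (cmod (X e y))\<^sup>2)) * n2 ?I v \<le> n2 ?I (act ?I (\<lambda>\<iota> \<kappa>. koszul (\<lambda>\<iota> \<kappa> y. of_real (1 - t) * OmS \<iota> \<kappa> y + of_real t * 0) es \<iota> \<kappa> y) v)"
      proof (rule n2_koszul(1)[OF finS])
        show "of_real (1 - t) * OmS \<kappa> \<iota> y + of_real t * 0 = cnj (of_real (1 - t) * OmS \<iota> \<kappa> y + of_real t * 0)" for \<iota> \<kappa>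
          using OmS_hermitian[of \<kappa> \<iota> y] by simp
      qed (simp add: n2_nonneg)
      ultimately show "1 * n2 ?I v \<le> n2 ?I (act ?I (\<lambda>\<iota> \<kappa>. koszul (\<lambda>\<iota> \<kappa> y. of_real (1 - t) * OmS \<iota> \<kappa> y + of_real t * 0) es \<iota> \<kappa> y) v)"
        by simp
    qed
  qed
  then show ?thesis
  proof eventually_elim
    case (elim N)
    then obtain k where k: "inertia (ix N ?I (koszul_degree a es)) (fm N (koszul OmS es)) k"
      "inertia (ix N ?I (koszul_degree a es)) (fm N (koszul ?Z es)) k" by blast
    have "2 * k = card (ix N ?I (koszul_degree a es))"
    proof (rule inertia_odd_half[OF finite_ix[OF fin] k(2)])
      show "koszul_sign es (fst b) = 1 \<or> koszul_sign es (fst b) = -1" for b :: "bool list \<times> 'b" by (rule koszul_sign_cases)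
      show "koszul_sign es (fst b) * koszul_sign es (fst c) * fm N (koszul ?Z es) b c = - fm N (koszul ?Z es) b c" for b c
      proof -
        have "koszul_sign es (fst b) * koszul_sign es (fst c) * fm N (koszul ?Z es) b c =
          (\<Sum>p\<in>P N. cnj (mon (snd b) (pt N p)) * (koszul_sign es (fst b) * koszul_sign es (fst c) * koszul ?Z es (fst b) (fst c) (pt N p)) * mon (snd c) (pt N p))"
          by (simp add: fm_def sum_distrib_left mult_ac)
        also have "\<dots> = - fm N (koszul ?Z es) b c"
          unfolding koszul_sign_koszul_zero by (simp add: fm_def sum_negf)
        finally show ?thesis .
      qed
    qed
    then show ?case using ino_eqI[OF k(1)] by (simp add: sg_def dimk_def)
  qed
qed

text \<open>Each generator takes one finite difference in the degree, so the list takes as many as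
  its length.\<close>

lemma sg_iterate:
  assumes "set es \<subseteq> Es"
  shows "\<forall>\<^sub>F N in sequentially. sg N a es = (\<Sum>i\<le>length es. (-1)^i * int (length es choose i) * sg N (a + i) [])"
  using assms
proof (induction es arbitrary: a)
  case Nil
  show ?case by simp
next
  case (Cons e es)
  have es: "set es \<subseteq> Es" using Cons.prems by auto
  show ?case
    using sg_Cons[OF Cons.prems, of a] Cons.IH[OF es, of a] Cons.IH[OF es, of "Suc a"]
  proof eventually_elim
    case (elim N)
    let ?n = "length es" and ?s = "\<lambda>i. sg N (a + i) []"
    have "(\<Sum>i\<le>Suc ?n. (-1)^i * int (Suc ?n choose i) * ?s i) =
      ?s 0 + (\<Sum>i\<le>?n. (-1)^Suc i * (int (?n choose i) + int (?n choose Suc i)) * ?s (Suc i))"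
      by (subst sum.atMost_Suc_shift) simp
    also have "\<dots> = (?s 0 + (\<Sum>i\<le>?n. (-1)^Suc i * int (?n choose Suc i) * ?s (Suc i))) -
       (\<Sum>i\<le>?n. (-1)^i * int (?n choose i) * ?s (Suc i))"
      by (simp add: algebra_simps sum.distrib sum_negf sum_subtractf)
    also have "?s 0 + (\<Sum>i\<le>?n. (-1)^Suc i * int (?n choose Suc i) * ?s (Suc i)) =
       (\<Sum>i\<le>Suc ?n. (-1)^i * int (?n choose i) * ?s i)"
      by (subst sum.atMost_Suc_shift) simp
    also have "\<dots> = (\<Sum>i\<le>?n. (-1)^i * int (?n choose i) * ?s i)" by simp
    finally show ?case using elim by simp
  qed
qed

text \<open>
  All estimates hold only for large \<open>N\<close>, with a bound that depends on the degrees. Hence \<open>W\<close> is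
  chosen first, and the index is controlled only on a window of \<open>W\<close> degrees above \<open>N\<close>.
\<close>

theorem window:
  assumes "card Es = s"
  shows "\<exists>N z. (\<forall>a\<le>W. inertia (ix N S (\<lambda>_. a)) (fm N OmS) (z a) \<and> nondeg (ix N S (\<lambda>_. a)) (fm N OmS) \<and>
      z a + z (Suc a) = card S * card (B (N + a))) \<and>
      (\<Sum>i\<le>s. (-1)^i * int (s choose i) * (2 * int (z i) - int (card S * card (B (N + i))))) = 0"
proof -
  obtain es where es: "set es = Es" "distinct es" using finite_distinct_list[OF finE] by blast
  have len: "length es = s" using es assms distinct_card by fastforce
  have card: "card (ix N S (\<lambda>_. a)) = card S * card (B (N + a))" for N a
    using card_ix[OF finS] by simp
  have nd: "\<forall>\<^sub>F N in sequentially. nondeg (ix N S (\<lambda>_. a)) (fm N OmS)" for a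
  proof -
    have "\<forall>\<^sub>F N in sequentially. \<forall>t. 0 \<le> t \<longrightarrow> t \<le> (1::real) \<longrightarrow>
      nondeg (ix N S (\<lambda>_. a)) (fm N (\<lambda>\<iota> \<kappa> y. of_real (1 - t) * OmS \<iota> \<kappa> y + of_real t * OmS \<iota> \<kappa> y))"
      by (rule nondeg_segment[OF symb_OmS symb_OmS c1_pos]) (simp only: convex_same elliptic_OmS)
    then show ?thesis unfolding convex_same by eventually_elim (metis zero_le_one order.refl)
  qed
  have "\<forall>\<^sub>F N in sequentially. \<forall>a\<in>{..W}. nondeg (ix N S (\<lambda>_. a)) (fm N OmS) \<and>
    (\<exists>k k'. inertia (ix N S (\<lambda>_. a)) (fm N OmS) k \<and>
      inertia (ix N S (\<lambda>_. Suc a)) (fm N OmS) k' \<and> k + k' = card (ix N S (\<lambda>_. a)))"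
    using nd inertia_consecutive by (intro eventually_ball_finite ballI eventually_conj) auto
  moreover have "\<forall>\<^sub>F N in sequentially. sg N 0 es = 0" by (rule sg_full[OF es])
  moreover have "\<forall>\<^sub>F N in sequentially. sg N 0 es = (\<Sum>i\<le>length es. (-1)^i * int (length es choose i) * sg N (0 + i) [])"
    by (rule sg_iterate) (simp add: es)
  ultimately have "\<forall>\<^sub>F N in sequentially. (\<forall>a\<in>{..W}. nondeg (ix N S (\<lambda>_. a)) (fm N OmS) \<and>
    (\<exists>k k'. inertia (ix N S (\<lambda>_. a)) (fm N OmS) k \<and>
      inertia (ix N S (\<lambda>_. Suc a)) (fm N OmS) k' \<and> k + k' = card (ix N S (\<lambda>_. a)))) \<and>
    (\<Sum>i\<le>s. (-1)^i * int (s choose i) * sg N i []) = 0"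
    by eventually_elim (simp add: len)
  then obtain N where N: "\<forall>a\<in>{..W}. nondeg (ix N S (\<lambda>_. a)) (fm N OmS) \<and>
    (\<exists>k k'. inertia (ix N S (\<lambda>_. a)) (fm N OmS) k \<and>
      inertia (ix N S (\<lambda>_. Suc a)) (fm N OmS) k' \<and> k + k' = card (ix N S (\<lambda>_. a)))"
    "(\<Sum>i\<le>s. (-1)^i * int (s choose i) * sg N i []) = 0"
    using eventually_happens'[OF sequentially_bot] by blast
  have sg: "sg N i [] = 2 * int (ino N i []) - int (card S * card (B (N + i)))" for i
    by (simp add: sg_def dimk_def card)
  have ino: "ino N a [] = k" if "inertia (ix N S (\<lambda>_. a)) (fm N OmS) k" for a k
    by (rule ino_eqI) (simp add: that)
  have "inertia (ix N S (\<lambda>_. a)) (fm N OmS) (ino N a []) \<and> nondeg (ix N S (\<lambda>_. a)) (fm N OmS) \<and>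
      ino N a [] + ino N (Suc a) [] = card S * card (B (N + a))" if aW: "a \<le> W" for a
  proof -
    have "a \<in> {..W}" using aW by simp
    from bspec[OF N(1) this] obtain k k' where k: "inertia (ix N S (\<lambda>_. a)) (fm N OmS) k"
      "inertia (ix N S (\<lambda>_. Suc a)) (fm N OmS) k'" "k + k' = card (ix N S (\<lambda>_. a))"
      by blast
    then show ?thesis using ino[OF k(1)] ino[OF k(2)] N(1) aW by (auto simp: card)
  qed
  with N(2) show ?thesis unfolding sg by (intro exI[of _ N] exI[of _ "\<lambda>a. ino N a []"]) blast
qed

end

subsection \<open>Finite quadrature on the complex unit sphere\<close>

definition multi_indices :: "nat \<Rightarrow> nat \<Rightarrow> nat list set" where
  "multi_indices d k = {\<alpha>. length \<alpha> = d \<and> sum_list \<alpha> = k}"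

definition monom_val :: "nat list \<Rightarrow> (nat \<Rightarrow> complex) \<Rightarrow> complex" where
  "monom_val \<alpha> x = (\<Prod>i<length \<alpha>. x i ^ (\<alpha> ! i))"

definition raise :: "nat \<Rightarrow> nat list \<Rightarrow> nat list" where
  "raise i \<alpha> = \<alpha>[i := Suc (\<alpha> ! i)]"

lemma finite_multi_indices: "finite (multi_indices d k)"
proof (rule finite_subset)
  show "multi_indices d k \<subseteq> {\<alpha>. set \<alpha> \<subseteq> {..k} \<and> length \<alpha> = d}"
    by (auto simp: multi_indices_def dest: member_le_sum_list)
  show "finite {\<alpha>. set \<alpha> \<subseteq> {..k} \<and> length \<alpha> = d}" by (rule finite_lists_length_eq) simp
qed

lemma card_multi_indices: "card (multi_indices (Suc n) k) = (k + n) choose n"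
  using card_length_sum_list[of "Suc n" k] binomial_symmetric[of k "k + n"] by (simp add: multi_indices_def)

lemma raise_multi_indices: "\<alpha> \<in> multi_indices d k \<Longrightarrow> i < d \<Longrightarrow> raise i \<alpha> \<in> multi_indices d (Suc k)"
  by (auto simp: multi_indices_def raise_def sum_list_update)

lemma length_raise [simp]: "length (raise i \<alpha>) = length \<alpha>"
  by (simp add: raise_def)

lemma raise_inj: "length \<alpha> = length \<beta> \<Longrightarrow> raise i \<alpha> = raise i \<beta> \<Longrightarrow> \<alpha> = \<beta>"
proof (rule nth_equalityI)
  fix j assume len: "length \<alpha> = length \<beta>" and eq: "raise i \<alpha> = raise i \<beta>" and j: "j < length \<alpha>"
  have "raise i \<alpha> ! j = raise i \<beta> ! j" using eq by simp
  then show "\<alpha> ! j = \<beta> ! j" using len j by (cases "j = i") (simp_all add: raise_def)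
qed

lemma monom_val_raise:
  assumes "i < length \<alpha>"
  shows "monom_val (raise i \<alpha>) x = x i * monom_val \<alpha> x"
proof -
  have 1: "monom_val \<gamma> x = x i ^ (\<gamma> ! i) * (\<Prod>j\<in>{..<length \<alpha>} - {i}. x j ^ (\<gamma> ! j))" if "length \<gamma> = length \<alpha>" for \<gamma>
    unfolding monom_val_def using assms that by (simp add: prod.remove)
  have "(\<Prod>j\<in>{..<length \<alpha>} - {i}. x j ^ (raise i \<alpha> ! j)) = (\<Prod>j\<in>{..<length \<alpha>} - {i}. x j ^ (\<alpha> ! j))"
    by (intro prod.cong) (auto simp: raise_def)
  moreover have "raise i \<alpha> ! i = Suc (\<alpha> ! i)" using assms by (simp add: raise_def)
  ultimately show ?thesis unfolding 1[OF length_raise] 1[OF refl] by simp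
qed

lemma multi_indices_Suc: "multi_indices (Suc d) M = (\<Union>b\<in>{..M}. Cons b ` multi_indices d (M - b))"
proof (intro equalityI subsetI)
  fix \<alpha> assume "\<alpha> \<in> multi_indices (Suc d) M"
  then obtain b \<beta> where "\<alpha> = b # \<beta>" "length \<beta> = d" "b + sum_list \<beta> = M"
    by (cases \<alpha>) (auto simp: multi_indices_def)
  then show "\<alpha> \<in> (\<Union>b\<in>{..M}. Cons b ` multi_indices d (M - b))"
    by (intro UN_I[of b]) (auto simp: multi_indices_def)
qed (auto simp: multi_indices_def)

lemma sum_multi_indices_Suc:
  fixes f :: "nat list \<Rightarrow> 'a::comm_monoid_add"
  shows "(\<Sum>\<beta>\<in>multi_indices (Suc d) M. f \<beta>) = (\<Sum>b\<le>M. \<Sum>\<beta>\<in>multi_indices d (M - b). f (b # \<beta>))"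
  unfolding multi_indices_Suc using finite_multi_indices
  by (subst sum.UNION_disjoint) (auto simp: sum.reindex inj_on_def)

lemma multi_indices_1: "multi_indices 1 M = {[M]}"
  by (auto simp: multi_indices_def length_Suc_conv)

text \<open>Negating the upper arguments turns the sum into a Vandermonde convolution of binomials
  with negative upper argument.\<close>

lemma sum_choose_mult_choose:
  "(\<Sum>b\<le>M. (b + a choose a) * (M - b + c choose c)) = (M + (a + c + 1) choose (a + c + 1))"
proof -
  have neg: "real (k + j choose j) = (-1) ^ k * ((- (real j + 1)) gchoose k)" for k j
  proof -
    have "real (k + j choose j) = real (k + j choose k)"
      using binomial_symmetric[of j "k + j"] by simp
    also have "\<dots> = ((real j + real k) gchoose k)"
      by (simp add: binomial_gbinomial add.commute)
    also have "\<dots> = (-1) ^ k * ((- (real j + 1)) gchoose k)"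
      using gbinomial_minus[of "real j + 1" k] by (simp add: algebra_simps flip: power_add mult_2)
    finally show ?thesis .
  qed
  have "real (\<Sum>b\<le>M. (b + a choose a) * (M - b + c choose c)) =
    (\<Sum>b\<le>M. ((-1) ^ b * ((- (real a + 1)) gchoose b)) * ((-1) ^ (M - b) * ((- (real c + 1)) gchoose (M - b))))"
    unfolding of_nat_sum of_nat_mult neg ..
  also have "\<dots> = (\<Sum>b\<le>M. (-1) ^ M * (((- (real a + 1)) gchoose b) * ((- (real c + 1)) gchoose (M - b))))"
    by (intro sum.cong refl) (simp add: mult_ac flip: power_add)
  also have "\<dots> = (-1) ^ M * ((- (real a + 1) + - (real c + 1)) gchoose M)"
    using gbinomial_Vandermonde[of "- (real a + 1)" "- (real c + 1)" M]
    by (simp add: atMost_atLeast0 flip: sum_distrib_left)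
  also have "- (real a + 1) + - (real c + 1) = - (real (a + c + 1) + 1)" by simp
  also have "(-1) ^ M * (- (real (a + c + 1) + 1) gchoose M) = real (M + (a + c + 1) choose (a + c + 1))"
    unfolding neg ..
  finally show ?thesis by (simp only: of_nat_eq_iff)
qed

lemma sum_prod_choose:
  assumes "length \<alpha> = Suc n"
  shows "(\<Sum>\<beta>\<in>multi_indices (Suc n) M. \<Prod>i<Suc n. (\<beta> ! i + \<alpha> ! i) choose (\<alpha> ! i)) = (M + (sum_list \<alpha> + n)) choose (sum_list \<alpha> + n)"
  using assms
proof (induction n arbitrary: \<alpha> M)
  case 0
  then obtain a where "\<alpha> = [a]" by (auto simp: length_Suc_conv)
  then show ?case by (simp add: multi_indices_1[simplified])
next
  case (Suc n)
  then obtain a \<alpha>' where \<alpha>: "\<alpha> = a # \<alpha>'" "length \<alpha>' = Suc n" by (auto simp: length_Suc_conv)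
  have "(\<Sum>\<beta>\<in>multi_indices (Suc (Suc n)) M. \<Prod>i<Suc (Suc n). (\<beta> ! i + \<alpha> ! i) choose (\<alpha> ! i)) =
    (\<Sum>b\<le>M. \<Sum>\<beta>\<in>multi_indices (Suc n) (M - b). ((b + a) choose a) * (\<Prod>i<Suc n. (\<beta> ! i + \<alpha>' ! i) choose (\<alpha>' ! i)))"
    unfolding sum_multi_indices_Suc[where d = "Suc n"] prod.lessThan_Suc_shift[where n = "Suc n"] \<alpha> by simp
  also have "\<dots> = (\<Sum>b\<le>M. ((b + a) choose a) * ((M - b + (sum_list \<alpha>' + n)) choose (sum_list \<alpha>' + n)))"
    by (simp only: sum_distrib_left[symmetric] Suc.IH[OF \<alpha>(2)])
  also have "\<dots> = (M + (a + (sum_list \<alpha>' + n) + 1)) choose (a + (sum_list \<alpha>' + n) + 1)"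
    by (rule sum_choose_mult_choose)
  finally show ?case by (simp add: \<alpha> algebra_simps)
qed

text \<open>The moment of order \<alpha> of the lattice points \<beta> of a simplex. The quadrature
  points will have the squared moduli \<beta> / M, so these are squared norms of monomials up to
  scaling.\<close>

definition gsum :: "nat \<Rightarrow> nat list \<Rightarrow> nat \<Rightarrow> real" where
  "gsum n \<alpha> M = (\<Sum>\<beta>\<in>multi_indices (Suc n) M. \<Prod>i<Suc n. real (\<beta> ! i) ^ (\<alpha> ! i))"

lemma power_le_choose: "real b ^ a \<le> fact a * real ((b + a) choose a)" and choose_le_power: "fact a * real ((b + a) choose a) \<le> real (b + a) ^ a"
proof -
  have eq: "fact a * real ((b + a) choose a) = (\<Prod>i<a. real b + real (Suc i))"
  proof (induction a)
    case (Suc a)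
    have "real (Suc a) * real (Suc (b + a) choose Suc a) = real (Suc (b + a)) * real ((b + a) choose a)"
      by (simp only: of_nat_mult[symmetric] Suc_times_binomial_eq mult.commute)
    then have "fact (Suc a) * real ((b + Suc a) choose Suc a) = (fact a * real ((b + a) choose a)) * real (Suc (b + a))"
      by (simp add: mult_ac del: of_nat_Suc)
    then show ?case using Suc by simp
  qed simp
  show "real b ^ a \<le> fact a * real ((b + a) choose a)"
    unfolding eq using prod_mono[of "{..<a}" "\<lambda>_. real b" "\<lambda>i. real b + real (Suc i)"] by simp
  show "fact a * real ((b + a) choose a) \<le> real (b + a) ^ a"
    unfolding eq using prod_mono[of "{..<a}" "\<lambda>i. real b + real (Suc i)" "\<lambda>_. real (b + a)"] by simp
qed


definition fa :: "nat list \<Rightarrow> real" where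
  "fa \<alpha> = (\<Prod>i<length \<alpha>. fact (\<alpha> ! i))"

lemma fa_pos: "fa \<alpha> > 0"
  by (simp add: fa_def prod_pos)

lemma gsum_upper:
  assumes "length \<alpha> = Suc n"
  shows "gsum n \<alpha> M \<le> fa \<alpha> * real ((M + (sum_list \<alpha> + n)) choose (sum_list \<alpha> + n))"
proof -
  have "gsum n \<alpha> M \<le> (\<Sum>\<beta>\<in>multi_indices (Suc n) M. \<Prod>i<Suc n. fact (\<alpha> ! i) * real ((\<beta> ! i + \<alpha> ! i) choose (\<alpha> ! i)))"
    unfolding gsum_def by (intro sum_mono prod_mono) (simp add: power_le_choose)
  also have "\<dots> = fa \<alpha> * real (\<Sum>\<beta>\<in>multi_indices (Suc n) M. \<Prod>i<Suc n. (\<beta> ! i + \<alpha> ! i) choose (\<alpha> ! i))"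
    using assms by (simp add: fa_def prod.distrib sum_distrib_left del: prod.lessThan_Suc)
  finally show ?thesis unfolding sum_prod_choose[OF assms] .
qed

text \<open>Shifting by \<alpha> embeds the lattice points of total M - |\<alpha>| into those of
  total M, and each shifted power dominates the rising factorial summed in
  \<open>sum_prod_choose\<close>.\<close>

lemma gsum_lower:
  assumes "length \<alpha> = Suc n" "sum_list \<alpha> \<le> M"
  shows "fa \<alpha> * real ((M + n) choose (sum_list \<alpha> + n)) \<le> gsum n \<alpha> M"
proof -
  let ?f = "\<lambda>\<beta>. map2 (+) \<beta> \<alpha>" and ?A = "multi_indices (Suc n) (M - sum_list \<alpha>)"
  have sl: "sum_list (map2 (+) \<beta> \<alpha>) = sum_list \<beta> + sum_list \<alpha>" if "length \<beta> = length \<alpha>" for \<beta> :: "nat list"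
    using that by (induction \<beta> \<alpha> rule: list_induct2) auto
  have inj: "inj_on ?f ?A"
  proof (rule inj_onI)
    fix \<beta> \<gamma> assume b: "\<beta> \<in> ?A" "\<gamma> \<in> ?A" "?f \<beta> = ?f \<gamma>"
    have l: "length \<beta> = Suc n" "length \<gamma> = Suc n" using b by (auto simp: multi_indices_def)
    show "\<beta> = \<gamma>"
    proof (rule nth_equalityI)
      fix i assume "i < length \<beta>"
      moreover from this have "?f \<beta> ! i = ?f \<gamma> ! i" using b(3) by simp
      ultimately show "\<beta> ! i = \<gamma> ! i" using l assms(1) by simp
    qed (use l in simp)
  qed
  have sub: "?f ` ?A \<subseteq> multi_indices (Suc n) M"
    using assms by (auto simp: multi_indices_def sl)
  have "fa \<alpha> * real ((M + n) choose (sum_list \<alpha> + n)) =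
      fa \<alpha> * real (\<Sum>\<beta>\<in>?A. \<Prod>i<Suc n. (\<beta> ! i + \<alpha> ! i) choose (\<alpha> ! i))"
    unfolding sum_prod_choose[OF assms(1)] using assms(2) by simp
  also have "\<dots> = (\<Sum>\<beta>\<in>?A. \<Prod>i<Suc n. fact (\<alpha> ! i) * real ((\<beta> ! i + \<alpha> ! i) choose (\<alpha> ! i)))"
    using assms by (simp add: fa_def prod.distrib sum_distrib_left del: prod.lessThan_Suc)
  also have "\<dots> \<le> (\<Sum>\<beta>\<in>?A. \<Prod>i<Suc n. real (\<beta> ! i + \<alpha> ! i) ^ (\<alpha> ! i))"
    by (intro sum_mono prod_mono) (simp only: choose_le_power, simp)
  also have "\<dots> = (\<Sum>\<beta>\<in>?A. \<Prod>i<Suc n. real (?f \<beta> ! i) ^ (\<alpha> ! i))"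
    using assms(1) by (intro sum.cong prod.cong refl) (auto simp: multi_indices_def)
  also have "\<dots> = (\<Sum>\<beta>\<in>?f ` ?A. \<Prod>i<Suc n. real (\<beta> ! i) ^ (\<alpha> ! i))"
    by (simp add: sum.reindex[OF inj] del: prod.lessThan_Suc)
  also have "\<dots> \<le> gsum n \<alpha> M"
    unfolding gsum_def using sub finite_multi_indices
    by (intro sum_mono2) (auto intro!: prod_nonneg simp del: prod.lessThan_Suc)
  finally show ?thesis .
qed

lemma choose_asymp: "(\<lambda>M. real ((M + j) choose k) / real M ^ k) \<longlonglongrightarrow> 1 / fact k"
proof -
  have ev: "\<forall>\<^sub>F M in sequentially. (\<Prod>i<k. 1 + (real j - real i) / real M) / fact k = real ((M + j) choose k) / real M ^ k"
    using eventually_gt_at_top[of 0]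
  proof eventually_elim
    case (elim M)
    have "real ((M + j) choose k) / real M ^ k = (\<Prod>i<k. real (M + j) - real i) / fact k / (\<Prod>i<k. real M)"
      by (simp add: binomial_gbinomial gbinomial_prod_rev lessThan_atLeast0)
    also have "\<dots> = (\<Prod>i<k. (real (M + j) - real i) / real M) / fact k"
      by (simp only: prod_dividef) simp
    also have "(\<Prod>i<k. (real (M + j) - real i) / real M) = (\<Prod>i<k. 1 + (real j - real i) / real M)"
      using elim by (intro prod.cong refl) (simp add: field_simps)
    finally show ?case by simp
  qed
  have "(\<lambda>M. (\<Prod>i<k. 1 + (real j - real i) / real M) / fact k) \<longlonglongrightarrow> (\<Prod>i<k. 1 + 0) / fact k"
    by (intro tendsto_intros lim_const_over_n) simp
  then have "(\<lambda>M. (\<Prod>i<k. 1 + (real j - real i) / real M) / fact k) \<longlonglongrightarrow> 1 / fact k" by simp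
  then show ?thesis using ev by (rule Lim_transform_eventually)
qed

text \<open>The limit is a Dirichlet integral over the simplex, caught between two binomial bounds
  with the same leading term.\<close>

lemma gsum_asymp:
  assumes "length \<alpha> = Suc n"
  shows "(\<lambda>M. gsum n \<alpha> M / real M ^ (sum_list \<alpha> + n)) \<longlonglongrightarrow> fa \<alpha> / fact (sum_list \<alpha> + n)"
proof (rule tendsto_sandwich)
  let ?k = "sum_list \<alpha> + n"
  show "\<forall>\<^sub>F M in sequentially. fa \<alpha> * (real ((M + n) choose ?k) / real M ^ ?k) \<le> gsum n \<alpha> M / real M ^ ?k"
    using eventually_ge_at_top[of "sum_list \<alpha>"]
    by eventually_elim (use gsum_lower[OF assms] in \<open>simp add: divide_right_mono\<close>)
  show "\<forall>\<^sub>F M in sequentially. gsum n \<alpha> M / real M ^ ?k \<le> fa \<alpha> * (real ((M + ?k) choose ?k) / real M ^ ?k)"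
    using gsum_upper[OF assms] by (simp add: divide_right_mono)
  have "(\<lambda>M. fa \<alpha> * (real ((M + j) choose ?k) / real M ^ ?k)) \<longlonglongrightarrow> fa \<alpha> * (1 / fact ?k)" for j
    by (intro tendsto_intros choose_asymp)
  then show "(\<lambda>M. fa \<alpha> * (real ((M + n) choose ?k) / real M ^ ?k)) \<longlonglongrightarrow> fa \<alpha> / fact ?k"
    "(\<lambda>M. fa \<alpha> * (real ((M + ?k) choose ?k) / real M ^ ?k)) \<longlonglongrightarrow> fa \<alpha> / fact ?k" by simp_all
qed

lemma fa_raise:
  assumes "i < length \<alpha>"
  shows "fa (raise i \<alpha>) = real (Suc (\<alpha> ! i)) * fa \<alpha>"
proof -
  have 1: "fa \<gamma> = fact (\<gamma> ! i) * (\<Prod>j\<in>{..<length \<alpha>} - {i}. fact (\<gamma> ! j))" if "length \<gamma> = length \<alpha>" for \<gamma>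
    unfolding fa_def using assms that by (simp add: prod.remove)
  have "(\<Prod>j\<in>{..<length \<alpha>} - {i}. fact (raise i \<alpha> ! j) :: real) = (\<Prod>j\<in>{..<length \<alpha>} - {i}. fact (\<alpha> ! j))"
    by (intro prod.cong) (auto simp: raise_def)
  moreover have "raise i \<alpha> ! i = Suc (\<alpha> ! i)" using assms by (simp add: raise_def)
  ultimately show ?thesis unfolding 1[OF length_raise] 1[OF refl] by simp
qed

lemma sum_list_raise: "i < length \<alpha> \<Longrightarrow> sum_list (raise i \<alpha>) = Suc (sum_list \<alpha>)"
  by (simp add: raise_def sum_list_update)

text \<open>The limits are the ratios of squared norms of consecutive monomials on the complex unit
  sphere; the quadrature only has to reproduce them approximately.\<close>

lemma gsum_ratio:
  assumes \<alpha>: "length \<alpha> = Suc n" "i < Suc n"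
  shows "(\<lambda>M. gsum n (raise i \<alpha>) M / (real M * gsum n \<alpha> M)) \<longlonglongrightarrow> real (Suc (\<alpha> ! i)) / real (sum_list \<alpha> + Suc n)"
proof -
  let ?k = "sum_list \<alpha> + n"
  have sl: "sum_list (raise i \<alpha>) + n = Suc ?k" using \<alpha> by (simp add: sum_list_raise)
  have "(\<lambda>M. (gsum n (raise i \<alpha>) M / real M ^ Suc ?k) / (gsum n \<alpha> M / real M ^ ?k)) \<longlonglongrightarrow>
     (fa (raise i \<alpha>) / fact (Suc ?k)) / (fa \<alpha> / fact ?k)"
  proof (rule tendsto_divide)
    show "(\<lambda>M. gsum n (raise i \<alpha>) M / real M ^ Suc ?k) \<longlonglongrightarrow> fa (raise i \<alpha>) / fact (Suc ?k)"
      using gsum_asymp[of "raise i \<alpha>" n] \<alpha> unfolding sl by simp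
    show "(\<lambda>M. gsum n \<alpha> M / real M ^ ?k) \<longlonglongrightarrow> fa \<alpha> / fact ?k" by (rule gsum_asymp[OF \<alpha>(1)])
    show "fa \<alpha> / fact ?k \<noteq> 0" using fa_pos[of \<alpha>] by simp
  qed
  moreover have "(fa (raise i \<alpha>) / fact (Suc ?k)) / (fa \<alpha> / fact ?k) = real (Suc (\<alpha> ! i)) / real (sum_list \<alpha> + Suc n)"
  proof -
    have "fa (raise i \<alpha>) = real (Suc (\<alpha> ! i)) * fa \<alpha>" using \<alpha> by (simp add: fa_raise)
    moreover have "(fact (Suc ?k) :: real) = real (sum_list \<alpha> + Suc n) * fact ?k" by (simp add: algebra_simps)
    moreover have "(s * A / (k * F)) / (A / F) = s / k" if "A \<noteq> 0" "F \<noteq> 0" for s A k F :: real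
      using that by simp
    ultimately show ?thesis using fa_pos[of \<alpha>] by (simp del: fact_Suc of_nat_Suc of_nat_add)
  qed
  moreover have "\<forall>\<^sub>F M in sequentially. (gsum n (raise i \<alpha>) M / real M ^ Suc ?k) / (gsum n \<alpha> M / real M ^ ?k)
     = gsum n (raise i \<alpha>) M / (real M * gsum n \<alpha> M)"
    using eventually_gt_at_top[of 0] by eventually_elim simp
  ultimately show ?thesis using Lim_transform_eventually by fastforce
qed

section \<open>Quadrature points with lattice moduli and roots of unity as phases\<close>

lemma sum_roots_of_unity:
  assumes "0 < T" "\<not> int T dvd m"
  shows "(\<Sum>k<T. cis (2 * pi * real k * real_of_int m / real T)) = 0"
proof -
  define c where "c = cis (2 * pi * real_of_int m / real T)"
  have "(\<Sum>k<T. cis (2 * pi * real k * real_of_int m / real T)) = (\<Sum>k<T. c ^ k)"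
  proof (intro sum.cong refl)
    fix k
    have "c ^ k = cis (real k * (2 * pi * real_of_int m / real T))" unfolding c_def by (rule Complex.DeMoivre)
    also have "real k * (2 * pi * real_of_int m / real T) = 2 * pi * real k * real_of_int m / real T" by simp
    finally show "cis (2 * pi * real k * real_of_int m / real T) = c ^ k" ..
  qed
  moreover have "c \<noteq> 1"
  proof
    assume "c = 1"
    then have "cos (2 * pi * real_of_int m / real T) = 1" by (simp add: c_def complex_eq_iff)
    then obtain j :: int where "2 * pi * real_of_int m / real T = real_of_int j * 2 * pi"
      using cos_one_2pi_int by blast
    then have "real_of_int m = real_of_int (j * int T)" using assms(1) by (simp add: field_simps)
    then have "m = j * int T" by (simp only: of_int_eq_iff)
    then show False using assms(2) by simp
  qed
  moreover have "c ^ T = 1"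
  proof -
    have "c ^ T = cis (2 * pi * real_of_int m)" using assms(1) by (simp add: c_def Complex.DeMoivre)
    then show ?thesis by (simp add: cis_multiple_2pi)
  qed
  ultimately show ?thesis by (simp add: geometric_sum)
qed

definition qI :: "nat \<Rightarrow> nat \<Rightarrow> nat \<Rightarrow> (nat list \<times> (nat \<Rightarrow> nat)) set" where
  "qI d M T = multi_indices d M \<times> (PiE {..<d} (\<lambda>_. {..<T}))"

definition qpt :: "nat \<Rightarrow> nat \<Rightarrow> nat \<Rightarrow> nat list \<times> (nat \<Rightarrow> nat) \<Rightarrow> nat \<Rightarrow> complex" where
  "qpt d M T p i = (if i < d then of_real (sqrt (real (fst p ! i) / real M)) * cis (2 * pi * real (snd p i) / real T) else 0)"

lemma finite_qI: "finite (qI d M T)"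
  unfolding qI_def by (intro finite_cartesian_product finite_multi_indices finite_PiE) auto

lemma qpt_sphere:
  assumes "p \<in> qI d M T" "M > 0"
  shows "(\<Sum>i<d. (cmod (qpt d M T p i))\<^sup>2) = 1"
proof -
  have "(\<Sum>i<d. (cmod (qpt d M T p i))\<^sup>2) = (\<Sum>i<d. real (fst p ! i) / real M)"
    by (intro sum.cong) (auto simp: qpt_def norm_mult power_mult_distrib)
  also have "\<dots> = real (\<Sum>i<d. fst p ! i) / real M" by (simp add: sum_divide_distrib)
  also have "(\<Sum>i<d. fst p ! i) = M"
    using assms by (auto simp: qI_def multi_indices_def sum_list_sum_nth lessThan_atLeast0)
  finally show ?thesis using assms by simp
qed

lemma sum_qI:
  assumes "length \<alpha> = d" "length \<alpha>' = d"
  shows "(\<Sum>p\<in>qI d M T. cnj (monom_val \<alpha> (qpt d M T p)) * monom_val \<alpha>' (qpt d M T p)) =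
    (\<Sum>\<beta>\<in>multi_indices d M. \<Prod>i<d. of_real (sqrt (real (\<beta> ! i) / real M) ^ (\<alpha> ! i + \<alpha>' ! i))) *
    (\<Prod>i<d. \<Sum>k<T. cis (2 * pi * real k * real_of_int (int (\<alpha>' ! i) - int (\<alpha> ! i)) / real T))"
proof -
  let ?r = "\<lambda>\<beta> i. complex_of_real (sqrt (real (\<beta> ! i) / real M) ^ (\<alpha> ! i + \<alpha>' ! i))"
  let ?c = "\<lambda>i k. cis (2 * pi * real k * real_of_int (int (\<alpha>' ! i) - int (\<alpha> ! i)) / real T)"
  have trm: "cnj (of_real r * cis \<theta>) ^ a * (of_real r * cis \<theta>) ^ b = of_real (r ^ (a + b)) * cis (\<theta> * real_of_int (int b - int a))"
    for r \<theta> and a b :: nat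
  proof -
    have "cnj (of_real r * cis \<theta>) ^ a * (of_real r * cis \<theta>) ^ b = of_real (r ^ (a + b)) * (cis (- \<theta>) ^ a * cis \<theta> ^ b)"
      by (simp add: power_mult_distrib power_add cis_cnj)
    also have "cis (- \<theta>) ^ a * cis \<theta> ^ b = cis (\<theta> * real_of_int (int b - int a))"
      by (simp add: Complex.DeMoivre cis_mult algebra_simps)
    finally show ?thesis .
  qed
  have "(\<Sum>p\<in>qI d M T. cnj (monom_val \<alpha> (qpt d M T p)) * monom_val \<alpha>' (qpt d M T p)) =
    (\<Sum>p\<in>qI d M T. (\<Prod>i<d. ?r (fst p) i) * (\<Prod>i<d. ?c i (snd p i)))"
  proof (intro sum.cong refl)
    fix p assume "p \<in> qI d M T"
    have "cnj (monom_val \<alpha> (qpt d M T p)) * monom_val \<alpha>' (qpt d M T p) =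
      (\<Prod>i<d. cnj (qpt d M T p i) ^ (\<alpha> ! i) * qpt d M T p i ^ (\<alpha>' ! i))"
      using assms by (simp add: monom_val_def prod.distrib)
    also have "\<dots> = (\<Prod>i<d. ?r (fst p) i * ?c i (snd p i))"
    proof (intro prod.cong refl)
      fix i assume "i \<in> {..<d}"
      then have "qpt d M T p i = of_real (sqrt (real (fst p ! i) / real M)) * cis (2 * pi * real (snd p i) / real T)"
        by (simp add: qpt_def)
      then show "cnj (qpt d M T p i) ^ (\<alpha> ! i) * qpt d M T p i ^ (\<alpha>' ! i) = ?r (fst p) i * ?c i (snd p i)"
        by (simp only: trm) (simp add: mult_ac)
    qed
    finally show "cnj (monom_val \<alpha> (qpt d M T p)) * monom_val \<alpha>' (qpt d M T p) = (\<Prod>i<d. ?r (fst p) i) * (\<Prod>i<d. ?c i (snd p i))"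
      by (simp add: prod.distrib)
  qed
  also have "\<dots> = (\<Sum>\<beta>\<in>multi_indices d M. \<Sum>\<kappa>\<in>PiE {..<d} (\<lambda>_. {..<T}). (\<Prod>i<d. ?r \<beta> i) * (\<Prod>i<d. ?c i (\<kappa> i)))"
    unfolding qI_def by (simp add: sum.cartesian_product split_beta)
  also have "\<dots> = (\<Sum>\<beta>\<in>multi_indices d M. \<Prod>i<d. ?r \<beta> i) * (\<Sum>\<kappa>\<in>PiE {..<d} (\<lambda>_. {..<T}). \<Prod>i<d. ?c i (\<kappa> i))"
    by (simp add: sum_product)
  also have "(\<Sum>\<kappa>\<in>PiE {..<d} (\<lambda>_. {..<T}). \<Prod>i<d. ?c i (\<kappa> i)) = (\<Prod>i<d. \<Sum>k<T. ?c i k)"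
    by (rule prod_sum_PiE[symmetric]) auto
  finally show ?thesis .
qed

text \<open>Some coordinate has different exponents in \<alpha> and \<alpha>'. They differ by less
  than T, so the sum over the T phases of that coordinate vanishes.\<close>

lemma orth_qI:
  assumes "length \<alpha> = d" "length \<alpha>' = d" "\<alpha> \<noteq> \<alpha>'" "sum_list \<alpha> < T" "sum_list \<alpha>' < T"
  shows "(\<Sum>p\<in>qI d M T. cnj (monom_val \<alpha> (qpt d M T p)) * monom_val \<alpha>' (qpt d M T p)) = 0"
proof -
  obtain i where i: "i < d" "\<alpha> ! i \<noteq> \<alpha>' ! i" using assms(1-3) by (metis nth_equalityI)
  have le: "\<alpha> ! i < T" "\<alpha>' ! i < T"
    using assms i elem_le_sum_list[of i \<alpha>] elem_le_sum_list[of i \<alpha>'] by auto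
  have "\<not> int T dvd int (\<alpha>' ! i) - int (\<alpha> ! i)"
    using i(2) le by (auto dest: zdvd_imp_le simp: zdvd_not_zless dvd_diff_commute)
      (smt (verit) dvd_imp_le_int of_nat_0_le_iff of_nat_less_iff of_nat_eq_iff)
  then have "(\<Sum>k<T. cis (2 * pi * real k * real_of_int (int (\<alpha>' ! i) - int (\<alpha> ! i)) / real T)) = 0"
    using le by (intro sum_roots_of_unity) auto
  then have "(\<Prod>i<d. \<Sum>k<T. cis (2 * pi * real k * real_of_int (int (\<alpha>' ! i) - int (\<alpha> ! i)) / real T)) = 0"
    using i(1) by (intro prod_zero) auto
  then show ?thesis unfolding sum_qI[OF assms(1,2)] by simp
qed

lemma weight_qI:
  assumes "length \<alpha> = Suc n" "M > 0"
  shows "weight (qI (Suc n) M T) (qpt (Suc n) M T) monom_val \<alpha> = real T ^ Suc n * (gsum n \<alpha> M / real M ^ sum_list \<alpha>)"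
proof -
  have "complex_of_real (weight (qI (Suc n) M T) (qpt (Suc n) M T) monom_val \<alpha>) =
    (\<Sum>p\<in>qI (Suc n) M T. cnj (monom_val \<alpha> (qpt (Suc n) M T p)) * monom_val \<alpha> (qpt (Suc n) M T p))"
    by (simp add: weight_def cnj_mult_self)
  also have "\<dots> = (\<Sum>\<beta>\<in>multi_indices (Suc n) M. \<Prod>i<Suc n. of_real (sqrt (real (\<beta> ! i) / real M) ^ (\<alpha> ! i + \<alpha> ! i))) * of_nat T ^ Suc n"
    unfolding sum_qI[OF assms(1) assms(1)] by (simp del: prod.lessThan_Suc power_Suc)
  also have "(\<Sum>\<beta>\<in>multi_indices (Suc n) M. \<Prod>i<Suc n. complex_of_real (sqrt (real (\<beta> ! i) / real M) ^ (\<alpha> ! i + \<alpha> ! i))) =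
     of_real (gsum n \<alpha> M / real M ^ sum_list \<alpha>)"
  proof -
    have "(\<Prod>i<Suc n. sqrt (real (\<beta> ! i) / real M) ^ (\<alpha> ! i + \<alpha> ! i)) =
      (\<Prod>i<Suc n. real (\<beta> ! i) ^ (\<alpha> ! i)) / real M ^ sum_list \<alpha>" for \<beta>
    proof -
      have "(\<Prod>i<Suc n. sqrt (real (\<beta> ! i) / real M) ^ (\<alpha> ! i + \<alpha> ! i)) = (\<Prod>i<Suc n. real (\<beta> ! i) ^ (\<alpha> ! i) / real M ^ (\<alpha> ! i))"
        by (intro prod.cong refl) (simp add: power_add power_divide flip: power_mult_distrib)
      also have "\<dots> = (\<Prod>i<Suc n. real (\<beta> ! i) ^ (\<alpha> ! i)) / real M ^ (\<Sum>i<Suc n. \<alpha> ! i)"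
        by (simp only: prod_dividef power_sum)
      also have "(\<Sum>i<Suc n. \<alpha> ! i) = sum_list \<alpha>"
        using assms(1) by (simp add: sum_list_sum_nth lessThan_atLeast0 del: sum.lessThan_Suc)
      finally show ?thesis .
    qed
    then show ?thesis
      by (simp only: of_real_prod[symmetric] of_real_sum[symmetric] gsum_def sum_divide_distrib)
  qed
  finally have "complex_of_real (weight (qI (Suc n) M T) (qpt (Suc n) M T) monom_val \<alpha>) =
     of_real (real T ^ Suc n * (gsum n \<alpha> M / real M ^ sum_list \<alpha>))" by simp
  then show ?thesis by (simp only: of_real_eq_iff)
qed

lemma gsum_pos:
  assumes "length \<alpha> = Suc n" "sum_list \<alpha> \<le> M"
  shows "gsum n \<alpha> M > 0"
proof -
  have "0 < fa \<alpha> * real ((M + n) choose (sum_list \<alpha> + n))"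
    using fa_pos[of \<alpha>] assms by (simp add: zero_less_binomial_iff)
  then show ?thesis using gsum_lower[OF assms] by linarith
qed

text \<open>Complex conjugation of the quadrature points, by negating the phases modulo T. The
  restriction keeps the phase function in the extensional product \<open>PiE\<close>.\<close>

definition qconj :: "nat \<Rightarrow> nat \<Rightarrow> nat list \<times> (nat \<Rightarrow> nat) \<Rightarrow> nat list \<times> (nat \<Rightarrow> nat)" where
  "qconj d T p = (fst p, \<lambda>i\<in>{..<d}. (T - snd p i) mod T)"

lemma qI_snd:
  assumes "p \<in> qI d M T"
  shows "i < d \<Longrightarrow> snd p i < T" "i \<ge> d \<Longrightarrow> snd p i = undefined" "fst p \<in> multi_indices d M"
proof -
  have p: "snd p \<in> PiE {..<d} (\<lambda>_. {..<T})" "fst p \<in> multi_indices d M"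
    using assms by (simp_all add: qI_def mem_Times_iff)
  show "i < d \<Longrightarrow> snd p i < T" using PiE_mem[OF p(1), of i] by simp
  show "i \<ge> d \<Longrightarrow> snd p i = undefined" using PiE_arb[OF p(1), of i] by simp
  show "fst p \<in> multi_indices d M" by (rule p)
qed

lemma qconj_bij: "bij_betw (qconj d T) (qI d M T) (qI d M T)"
proof -
  have inv: "(T - (T - k) mod T) mod T = k" if "k < T" for k
  proof (cases "k = 0")
    case False
    then have "(T - k) mod T = T - k" using that by simp
    then show ?thesis using that by simp
  qed simp
  have 1: "qconj d T (qconj d T p) = p" if p: "p \<in> qI d M T" for p
  proof -
    have "snd (qconj d T (qconj d T p)) i = snd p i" for i
    proof (cases "i < d")
      case True
      then show ?thesis using inv[OF qI_snd(1)[OF p True]] by (simp add: qconj_def)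
    next
      case False
      then show ?thesis using qI_snd(2)[OF p, of i] by (simp add: qconj_def)
    qed
    then show ?thesis by (intro prod_eqI) (auto simp: qconj_def)
  qed
  have 2: "qconj d T p \<in> qI d M T" if p: "p \<in> qI d M T" for p
  proof -
    have "(\<lambda>i\<in>{..<d}. (T - snd p i) mod T) \<in> PiE {..<d} (\<lambda>_. {..<T})"
    proof (rule restrict_PiE_iff[THEN iffD2], rule ballI)
      fix i assume "i \<in> {..<d}"
      then have "snd p i < T" using qI_snd(1)[OF p] by simp
      then show "(T - snd p i) mod T \<in> {..<T}" by simp
    qed
    then show ?thesis using qI_snd(3)[OF p] by (simp add: qI_def qconj_def)
  qed
  show ?thesis
    by (rule bij_betw_byWitness[where f' = "qconj d T"]) (use 1 2 in auto)
qed

lemma qpt_qconj: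
  assumes "p \<in> qI d M T"
  shows "qpt d M T (qconj d T p) i = cnj (qpt d M T p i)"
proof (cases "i < d")
  case True
  define k where "k = snd p i"
  have k: "k < T" using qI_snd(1)[OF assms True] by (simp add: k_def)
  have "cis (2 * pi * real ((T - k) mod T) / real T) = cnj (cis (2 * pi * real k / real T))"
  proof (cases "k = 0")
    case False
    then have "(T - k) mod T = T - k" using k by simp
    moreover have "2 * pi * real (T - k) / real T = 2 * pi * 1 + - (2 * pi * real k / real T)"
      using k by (simp add: of_nat_diff diff_divide_distrib right_diff_distrib)
    ultimately have "cis (2 * pi * real ((T - k) mod T) / real T) = cis (2 * pi * 1 + - (2 * pi * real k / real T))"
      by (simp only:)
    also have "\<dots> = cis (2 * pi * 1) * cis (- (2 * pi * real k / real T))" by (simp only: cis_mult)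
    also have "\<dots> = cnj (cis (2 * pi * real k / real T))" by (simp add: cis_cnj)
    finally show ?thesis .
  qed simp
  then show ?thesis using True by (simp add: qpt_def qconj_def k_def)
qed (simp add: qpt_def)

theorem sphere_quadrature:
  assumes "\<epsilon> > 0"
  shows "\<exists>(I :: (nat list \<times> (nat \<Rightarrow> nat)) set) x \<tau>. finite I \<and>
    (\<forall>p\<in>I. (\<Sum>i<Suc n. (cmod (x p i))\<^sup>2) = 1) \<and>
    (\<forall>\<alpha> \<alpha>'. length \<alpha> = Suc n \<longrightarrow> length \<alpha>' = Suc n \<longrightarrow> sum_list \<alpha> \<le> K \<longrightarrow> sum_list \<alpha>' \<le> K \<longrightarrow> \<alpha> \<noteq> \<alpha>' \<longrightarrow>
      (\<Sum>p\<in>I. cnj (monom_val \<alpha> (x p)) * monom_val \<alpha>' (x p)) = 0) \<and>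
    (\<forall>\<alpha>. length \<alpha> = Suc n \<longrightarrow> sum_list \<alpha> \<le> K \<longrightarrow> weight I x monom_val \<alpha> > 0) \<and>
    (\<forall>\<alpha> i. length \<alpha> = Suc n \<longrightarrow> sum_list \<alpha> \<le> K \<longrightarrow> i < Suc n \<longrightarrow>
      \<bar>weight I x monom_val (raise i \<alpha>) / weight I x monom_val \<alpha> - real (Suc (\<alpha> ! i)) / real (sum_list \<alpha> + Suc n)\<bar> \<le> \<epsilon>) \<and>
    bij_betw \<tau> I I \<and> (\<forall>p\<in>I. \<forall>i. x (\<tau> p) i = cnj (x p i))"
proof -
  \<comment> \<open>Exponents up to K differ by less than K + 1, so this many phases separate
    them.\<close>
  define T where "T = Suc K"
  \<comment> \<open>Only finitely many ratios are involved, so one M can serve all of them.\<close>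
  define A where "A = (\<Union>k\<le>K. multi_indices (Suc n) k) \<times> {..<Suc n}"
  have finA: "finite A" unfolding A_def by (intro finite_cartesian_product finite_UN_I finite_multi_indices) auto
  have "\<forall>\<^sub>F M in sequentially. \<forall>(\<alpha>, i)\<in>A. \<bar>gsum n (raise i \<alpha>) M / (real M * gsum n \<alpha> M) -
      real (Suc (\<alpha> ! i)) / real (sum_list \<alpha> + Suc n)\<bar> < \<epsilon>"
  proof (intro eventually_ball_finite[OF finA] ballI, clarify)
    fix \<alpha> i assume "(\<alpha>, i) \<in> A"
    then have "length \<alpha> = Suc n" "i < Suc n" by (auto simp: A_def multi_indices_def)
    from tendstoD[OF gsum_ratio[OF this] assms]
    show "\<forall>\<^sub>F M in sequentially. \<bar>gsum n (raise i \<alpha>) M / (real M * gsum n \<alpha> M) -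
      real (Suc (\<alpha> ! i)) / real (sum_list \<alpha> + Suc n)\<bar> < \<epsilon>"
      by (simp add: dist_real_def)
  qed
  with eventually_gt_at_top[of 0] eventually_ge_at_top[of "Suc K"]
  have "\<forall>\<^sub>F M in sequentially. M > 0 \<and> M \<ge> Suc K \<and> (\<forall>(\<alpha>, i)\<in>A. \<bar>gsum n (raise i \<alpha>) M / (real M * gsum n \<alpha> M) -
      real (Suc (\<alpha> ! i)) / real (sum_list \<alpha> + Suc n)\<bar> < \<epsilon>)"
    by eventually_elim auto
  then obtain M where M: "M > 0" "M \<ge> Suc K" and rat: "\<forall>(\<alpha>, i)\<in>A. \<bar>gsum n (raise i \<alpha>) M / (real M * gsum n \<alpha> M) -
      real (Suc (\<alpha> ! i)) / real (sum_list \<alpha> + Suc n)\<bar> < \<epsilon>"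
    using eventually_happens'[OF sequentially_bot] by blast
  let ?I = "qI (Suc n) M T" and ?x = "qpt (Suc n) M T"
  have T: "T > 0" by (simp add: T_def)
  show ?thesis
  proof (intro exI[of _ ?I] exI[of _ ?x] exI[of _ "qconj (Suc n) T"] conjI allI impI ballI)
    show "finite ?I" by (rule finite_qI)
    show "(\<Sum>i<Suc n. (cmod (?x p i))\<^sup>2) = 1" if "p \<in> ?I" for p by (rule qpt_sphere[OF that M(1)])
    show "(\<Sum>p\<in>?I. cnj (monom_val \<alpha> (?x p)) * monom_val \<alpha>' (?x p)) = 0"
      if "length \<alpha> = Suc n" "length \<alpha>' = Suc n" "sum_list \<alpha> \<le> K" "sum_list \<alpha>' \<le> K" "\<alpha> \<noteq> \<alpha>'" for \<alpha> \<alpha>'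
      using that by (intro orth_qI) (auto simp: T_def)
    show "weight ?I ?x monom_val \<alpha> > 0" if "length \<alpha> = Suc n" "sum_list \<alpha> \<le> K" for \<alpha>
      unfolding weight_qI[OF that(1) M(1)] using gsum_pos[OF that(1)] that M T by simp
    show "\<bar>weight ?I ?x monom_val (raise i \<alpha>) / weight ?I ?x monom_val \<alpha> - real (Suc (\<alpha> ! i)) / real (sum_list \<alpha> + Suc n)\<bar> \<le> \<epsilon>"
      if \<alpha>: "length \<alpha> = Suc n" "sum_list \<alpha> \<le> K" "i < Suc n" for \<alpha> i
    proof -
      have "weight ?I ?x monom_val (raise i \<alpha>) / weight ?I ?x monom_val \<alpha> = gsum n (raise i \<alpha>) M / (real M * gsum n \<alpha> M)"
      proof -
        have "weight ?I ?x monom_val (raise i \<alpha>) = real T ^ Suc n * (gsum n (raise i \<alpha>) M / real M ^ Suc (sum_list \<alpha>))"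
          using weight_qI[of "raise i \<alpha>" n M T] \<alpha> M(1) by (simp add: sum_list_raise del: power_Suc)
        moreover have "real T ^ Suc n \<noteq> 0" "real M ^ sum_list \<alpha> \<noteq> 0" using T M(1) by simp_all
        ultimately show ?thesis
          using \<alpha> M(1) weight_qI[of \<alpha> n M T] by (simp del: power_Suc) (simp add: mult_ac)
      qed
      moreover have "(\<alpha>, i) \<in> A" using \<alpha> by (auto simp: A_def multi_indices_def)
      ultimately show ?thesis using rat by fastforce
    qed
    show "bij_betw (qconj (Suc n) T) ?I ?I" by (rule qconj_bij)
    show "?x (qconj (Suc n) T p) i = cnj (?x p i)" if "p \<in> ?I" for p i by (rule qpt_qconj[OF that])
  qed
qed

subsection \<open>Clifford matrices\<close>

definition bit_lists :: "nat \<Rightarrow> bool list set" where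
  "bit_lists m = {bs. length bs = m}"

lemma bit_lists_0: "bit_lists 0 = {[]}"
  by (auto simp: bit_lists_def)

lemma bit_lists_Suc: "bit_lists (Suc m) = double (bit_lists m)"
  by (auto simp: bit_lists_def double_def length_Suc_conv image_iff)

lemma finite_bit_lists: "finite (bit_lists m)"
  by (induction m) (auto simp: bit_lists_0 bit_lists_Suc double_def)

lemma card_bit_lists: "card (bit_lists m) = 2 ^ m"
proof (induction m)
  case (Suc m)
  have "card (bit_lists (Suc m)) = (\<Sum>b\<in>double (bit_lists m). 1)" by (simp add: bit_lists_Suc)
  then show ?case unfolding sum_double[OF finite_bit_lists] using Suc by simp
qed (simp add: bit_lists_0)

fun tensor :: "(bool \<Rightarrow> bool \<Rightarrow> complex) \<Rightarrow> (bool list \<Rightarrow> bool list \<Rightarrow> complex) \<Rightarrow> bool list \<Rightarrow> bool list \<Rightarrow> complex" where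
  "tensor p g (a # as) (b # bs) = p a b * g as bs"
| "tensor p g _ _ = 0"

definition kdelta :: "'i \<Rightarrow> 'i \<Rightarrow> complex" where
  "kdelta a b = (if a = b then 1 else 0)"

definition pauli_x :: "bool \<Rightarrow> bool \<Rightarrow> complex" where "pauli_x a b = (if a \<noteq> b then 1 else 0)"
definition pauli_y :: "bool \<Rightarrow> bool \<Rightarrow> complex" where "pauli_y a b = (if a \<noteq> b then (if a then \<i> else - \<i>) else 0)"
definition pauli_z :: "bool \<Rightarrow> bool \<Rightarrow> complex" where "pauli_z a b = (if a = b then (if a then -1 else 1) else 0)"

text \<open>The standard recursion for 2 m + 1 anticommuting Hermitian involutions of size 2^m: one
  more bit yields two more matrices.\<close>

fun gamma_mat :: "nat \<Rightarrow> nat \<Rightarrow> bool list \<Rightarrow> bool list \<Rightarrow> complex" where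
  "gamma_mat 0 l = kdelta"
| "gamma_mat (Suc m) l = (if l < 2 * m + 1 then tensor pauli_x (gamma_mat m l) else if l = 2 * m + 1 then tensor pauli_y kdelta else tensor pauli_z kdelta)"

text \<open>The antiunitary map \<open>v \<mapsto> conj_mat m \<sqdot> cnj v\<close> commutes with the Clifford matrices up to the sign \<open>(-1)^m\<close>.\<close>

fun conj_mat :: "nat \<Rightarrow> bool list \<Rightarrow> bool list \<Rightarrow> complex" where
  "conj_mat 0 = kdelta"
| "conj_mat (Suc m) = tensor (if even m then pauli_y else pauli_z) (conj_mat m)"

definition pcomp :: "(bool \<Rightarrow> bool \<Rightarrow> complex) \<Rightarrow> (bool \<Rightarrow> bool \<Rightarrow> complex) \<Rightarrow> bool \<Rightarrow> bool \<Rightarrow> complex" where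
  "pcomp p q a b = p a False * q False b + p a True * q True b"

lemma tensor_comp:
  assumes "a \<in> bit_lists (Suc m)" "b \<in> bit_lists (Suc m)"
  shows "(\<Sum>c\<in>bit_lists (Suc m). tensor p g a c * tensor q h c b) = tensor (pcomp p q) (\<lambda>as bs. \<Sum>cs\<in>bit_lists m. g as cs * h cs bs) a b"
proof -
  obtain a' as where a: "a = a' # as" "as \<in> bit_lists m" using assms(1) by (auto simp: bit_lists_Suc double_def)
  obtain b' bs where b: "b = b' # bs" "bs \<in> bit_lists m" using assms(2) by (auto simp: bit_lists_Suc double_def)
  show ?thesis unfolding bit_lists_Suc sum_double[OF finite_bit_lists] a b pcomp_def
    by (simp add: sum_distrib_left sum_distrib_right algebra_simps sum.distrib)
qed

lemma tensor_cnj: "cnj (tensor p g a b) = tensor (\<lambda>a b. cnj (p a b)) (\<lambda>a b. cnj (g a b)) a b"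
  by (cases "(p, g, a, b)" rule: tensor.cases) auto

lemma kdelta_comp:
  assumes "a \<in> bit_lists m" "b \<in> bit_lists m"
  shows "(\<Sum>c\<in>bit_lists m. kdelta a c * g c b) = g a b" "(\<Sum>c\<in>bit_lists m. g a c * kdelta c b) = g a b"
  using assms finite_bit_lists by (simp_all add: kdelta_def if_distrib[of "\<lambda>x. x * _"] if_distrib[of "\<lambda>x. _ * x"] cong: if_cong)

lemma tensor_cong:
  assumes "a \<in> bit_lists (Suc m)" "b \<in> bit_lists (Suc m)" "\<And>a b. a \<in> bit_lists m \<Longrightarrow> b \<in> bit_lists m \<Longrightarrow> g a b = g' a b"
  shows "tensor p g a b = tensor p g' a b"
  using assms by (auto simp: bit_lists_Suc double_def)

lemma tensor_kdelta: "a \<in> bit_lists (Suc m) \<Longrightarrow> b \<in> bit_lists (Suc m) \<Longrightarrow> tensor (\<lambda>a b. if a = b then c else 0) kdelta a b = c * kdelta a b"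
  by (auto simp: bit_lists_Suc double_def kdelta_def split: if_splits)

lemma tensor_scale_right: "tensor p (\<lambda>a b. c * g a b) a b = c * tensor p g a b"
  by (cases "(p, g, a, b)" rule: tensor.cases) auto

lemma tensor_scale_left: "tensor (\<lambda>a b. c * p a b) g a b = c * tensor p g a b"
  by (cases "(p, g, a, b)" rule: tensor.cases) auto

lemma tensor_uminus_left: "tensor (\<lambda>a b. - p a b) g a b = - tensor p g a b"
  by (cases "(p, g, a, b)" rule: tensor.cases) auto

lemma tensor_add_right: "tensor p (\<lambda>a b. g a b + h a b) a b = tensor p g a b + tensor p h a b"
  by (cases "(p, g, a, b)" rule: tensor.cases) (auto simp: algebra_simps)

lemma gamma_mat_hermitian: "gamma_mat m l b a = cnj (gamma_mat m l a b)"
proof (induction m arbitrary: l a b)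
  case 0
  then show ?case by (simp add: kdelta_def)
next
  case (Suc m)
  show ?case
  proof (cases a; cases b)
    fix a' as b' bs assume ab: "a = a' # as" "b = b' # bs"
    show ?thesis unfolding ab using Suc.IH[of l bs as]
      by (auto simp: pauli_x_def pauli_y_def pauli_z_def kdelta_def)
  qed auto
qed

lemma pauli_comp:
  "pcomp pauli_x pauli_x = (\<lambda>a b. if a = b then 1 else 0)" "pcomp pauli_y pauli_y = (\<lambda>a b. if a = b then 1 else 0)"
  "pcomp pauli_z pauli_z = (\<lambda>a b. if a = b then 1 else 0)"
  "pcomp pauli_y pauli_x = (\<lambda>a b. - 1 * pcomp pauli_x pauli_y a b)" "pcomp pauli_z pauli_x = (\<lambda>a b. - 1 * pcomp pauli_x pauli_z a b)"
  "pcomp pauli_z pauli_y = (\<lambda>a b. - 1 * pcomp pauli_y pauli_z a b)"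
  by (auto simp: fun_eq_iff pcomp_def pauli_x_def pauli_y_def pauli_z_def)

text \<open>Old matrices share the factor \<open>pauli_x\<close>, whose square is 1; the two new
  ones anticommute with it and with each other through their Pauli factors.\<close>

lemma gamma_mat_anticommute:
  assumes "l < 2 * m + 1" "k < 2 * m + 1" "a \<in> bit_lists m" "b \<in> bit_lists m"
  shows "(\<Sum>c\<in>bit_lists m. gamma_mat m l a c * gamma_mat m k c b) + (\<Sum>c\<in>bit_lists m. gamma_mat m k a c * gamma_mat m l c b) = (if l = k then 2 * kdelta a b else 0)"
  using assms
proof (induction m arbitrary: l k a b)
  case 0
  then show ?case by (auto simp: bit_lists_0 kdelta_def)
next
  case (Suc m)
  note ab = Suc.prems(3,4)
  have dd: "tensor p (\<lambda>as bs. \<Sum>cs\<in>bit_lists m. kdelta as cs * g cs bs) a b = tensor p g a b"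
    "tensor p (\<lambda>as bs. \<Sum>cs\<in>bit_lists m. g as cs * kdelta cs bs) a b = tensor p g a b" for p g
    by (rule tensor_cong[OF ab], simp add: kdelta_comp)+
  have "l < 2 * m + 1 \<or> l = 2 * m + 1 \<or> l = 2 * m + 2" "k < 2 * m + 1 \<or> k = 2 * m + 1 \<or> k = 2 * m + 2"
    using Suc.prems(1,2) by auto
  then consider "l < 2 * m + 1" "k < 2 * m + 1" | "l < 2 * m + 1" "k = 2 * m + 1" | "l < 2 * m + 1" "k = 2 * m + 2"
    | "l = 2 * m + 1" "k < 2 * m + 1" | "l = 2 * m + 1" "k = 2 * m + 1" | "l = 2 * m + 1" "k = 2 * m + 2"
    | "l = 2 * m + 2" "k < 2 * m + 1" | "l = 2 * m + 2" "k = 2 * m + 1" | "l = 2 * m + 2" "k = 2 * m + 2"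
    by blast
  then show ?case
  proof cases
    case 1
    have "(\<Sum>c\<in>bit_lists (Suc m). gamma_mat (Suc m) l a c * gamma_mat (Suc m) k c b) + (\<Sum>c\<in>bit_lists (Suc m). gamma_mat (Suc m) k a c * gamma_mat (Suc m) l c b)
      = tensor (pcomp pauli_x pauli_x) (\<lambda>as bs. (\<Sum>cs\<in>bit_lists m. gamma_mat m l as cs * gamma_mat m k cs bs) + (\<Sum>cs\<in>bit_lists m. gamma_mat m k as cs * gamma_mat m l cs bs)) a b"
      using 1 by (simp add: tensor_comp[OF ab] tensor_add_right)
    also have "\<dots> = tensor (pcomp pauli_x pauli_x) (\<lambda>as bs. (if l = k then 2 else 0) * kdelta as bs) a b"
      using Suc.IH[OF 1] by (intro tensor_cong[OF ab]) simp
    finally show ?thesis unfolding tensor_scale_right pauli_comp tensor_kdelta[OF ab] by simp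
  qed (simp_all add: tensor_comp[OF ab] dd pauli_comp tensor_scale_left tensor_uminus_left tensor_kdelta[OF ab])
qed

text \<open>\<open>pauli_y\<close> times its conjugate is -1 and \<open>pauli_z\<close> times its
  conjugate is 1, so the sign flips exactly at the steps from even m. This gives the period
  4.\<close>

lemma conj_mat_square:
  assumes "a \<in> bit_lists m" "b \<in> bit_lists m"
  shows "(\<Sum>c\<in>bit_lists m. conj_mat m a c * cnj (conj_mat m c b)) = (if m mod 4 \<in> {0, 3} then 1 else -1) * kdelta a b"
  using assms
proof (induction m arbitrary: a b)
  case 0
  then show ?case by (auto simp: bit_lists_0 kdelta_def)
next
  case (Suc m)
  note ab = Suc.prems
  let ?p = "if even m then pauli_y else pauli_z"
  have p: "pcomp ?p (\<lambda>a b. cnj (?p a b)) = (\<lambda>a b. if a = b then (if even m then - 1 else 1) else 0)"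
    by (auto simp: fun_eq_iff pcomp_def pauli_y_def pauli_z_def)
  have "(\<Sum>c\<in>bit_lists (Suc m). conj_mat (Suc m) a c * cnj (conj_mat (Suc m) c b)) =
    tensor (pcomp ?p (\<lambda>a b. cnj (?p a b))) (\<lambda>as bs. \<Sum>cs\<in>bit_lists m. conj_mat m as cs * cnj (conj_mat m cs bs)) a b"
    by (simp only: conj_mat.simps tensor_cnj tensor_comp[OF ab])
  also have "\<dots> = tensor (pcomp ?p (\<lambda>a b. cnj (?p a b))) (\<lambda>as bs. (if m mod 4 \<in> {0, 3} then 1 else -1) * kdelta as bs) a b"
    using Suc.IH by (intro tensor_cong[OF ab])
  also have "\<dots> = (if m mod 4 \<in> {0, 3} then 1 else -1) * (if even m then - 1 else 1) * kdelta a b"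
    unfolding tensor_scale_right p tensor_kdelta[OF ab] by simp
  also have "(if m mod 4 \<in> {0, 3} then 1 else -1) * (if even m then - 1 else 1) = ((if Suc m mod 4 \<in> {0, 3} then 1 else -1) :: complex)"
  proof -
    consider "m mod 4 = 0" | "m mod 4 = 1" | "m mod 4 = 2" | "m mod 4 = 3" by linarith
    then show ?thesis
    proof cases
      case 1 then have "Suc m mod 4 = 1" "even m" by presburger+
      then show ?thesis using 1 by simp
    next
      case 2 then have "Suc m mod 4 = 2" "odd m" by presburger+
      then show ?thesis using 2 by simp
    next
      case 3 then have "Suc m mod 4 = 3" "even m" by presburger+
      then show ?thesis using 3 by simp
    next
      case 4 then have "Suc m mod 4 = 0" "odd m" by presburger+
      then show ?thesis using 4 by simp
    qed
  qed
  finally show ?case .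
qed

lemma conj_mat_unitary:
  assumes "a \<in> bit_lists m" "b \<in> bit_lists m"
  shows "(\<Sum>c\<in>bit_lists m. cnj (conj_mat m c a) * conj_mat m c b) = kdelta a b"
  using assms
proof (induction m arbitrary: a b)
  case 0
  then show ?case by (auto simp: bit_lists_0 kdelta_def)
next
  case (Suc m)
  obtain a' as where a: "a = a' # as" "as \<in> bit_lists m" using Suc.prems(1) by (auto simp: bit_lists_Suc double_def)
  obtain b' bs where b: "b = b' # bs" "bs \<in> bit_lists m" using Suc.prems(2) by (auto simp: bit_lists_Suc double_def)
  let ?p = "if even m then pauli_y else pauli_z"
  have "(\<Sum>c\<in>bit_lists (Suc m). cnj (conj_mat (Suc m) c a) * conj_mat (Suc m) c b) =
    (cnj (?p False a') * ?p False b' + cnj (?p True a') * ?p True b') * (\<Sum>cs\<in>bit_lists m. cnj (conj_mat m cs as) * conj_mat m cs bs)"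
    unfolding bit_lists_Suc sum_double[OF finite_bit_lists] a b by (simp add: sum_distrib_left algebra_simps)
  also have "cnj (?p False a') * ?p False b' + cnj (?p True a') * ?p True b' = kdelta a' b'"
    by (auto simp: pauli_y_def pauli_z_def kdelta_def)
  also have "(\<Sum>cs\<in>bit_lists m. cnj (conj_mat m cs as) * conj_mat m cs bs) = kdelta as bs" by (rule Suc.IH[OF a(2) b(2)])
  finally show ?case by (simp add: a b kdelta_def)
qed

text \<open>Both possible new factors anticommute with \<open>pauli_x\<close>, so one more bit
  reverses the sign for the old matrices. Alternating \<open>pauli_y\<close> and
  \<open>pauli_z\<close> gives the two new matrices that same sign.\<close>

lemma conj_mat_gamma_mat:
  assumes "l < 2 * m + 1" "a \<in> bit_lists m" "b \<in> bit_lists m"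
  shows "(\<Sum>c\<in>bit_lists m. conj_mat m a c * cnj (gamma_mat m l c b)) = (-1) ^ m * (\<Sum>c\<in>bit_lists m. gamma_mat m l a c * conj_mat m c b)"
  using assms
proof (induction m arbitrary: l a b)
  case 0
  then show ?case by (auto simp: bit_lists_0 kdelta_def)
next
  case (Suc m)
  note ab = Suc.prems(2,3)
  let ?p = "if even m then pauli_y else pauli_z"
  have dd: "tensor p (\<lambda>as bs. \<Sum>cs\<in>bit_lists m. kdelta as cs * g cs bs) a b = tensor p g a b"
    "tensor p (\<lambda>as bs. \<Sum>cs\<in>bit_lists m. g as cs * kdelta cs bs) a b = tensor p g a b" for p g
    by (rule tensor_cong[OF ab], simp add: kdelta_comp)+
  have cdl: "(\<lambda>a b. cnj (kdelta a b)) = kdelta" by (auto simp: fun_eq_iff kdelta_def)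
  have q: "pcomp ?p (\<lambda>a b. cnj (pauli_x a b)) = (\<lambda>a b. - ((-1) ^ m * (-1) ^ m) * pcomp pauli_x ?p a b)"
    "pcomp ?p (\<lambda>a b. cnj (pauli_y a b)) = (\<lambda>a b. (-1) ^ Suc m * pcomp pauli_y ?p a b)"
    "pcomp ?p (\<lambda>a b. cnj (pauli_z a b)) = (\<lambda>a b. (-1) ^ Suc m * pcomp pauli_z ?p a b)"
    by (auto simp: fun_eq_iff pcomp_def pauli_x_def pauli_y_def pauli_z_def)
  have "l < 2 * m + 1 \<or> l = 2 * m + 1 \<or> l = 2 * m + 2" using Suc.prems(1) by auto
  then consider "l < 2 * m + 1" | "l = 2 * m + 1" | "l = 2 * m + 2" by blast
  then show ?case
  proof cases
    case 1
    have "(\<Sum>c\<in>bit_lists (Suc m). conj_mat (Suc m) a c * cnj (gamma_mat (Suc m) l c b)) =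
      tensor (pcomp ?p (\<lambda>a b. cnj (pauli_x a b))) (\<lambda>as bs. \<Sum>cs\<in>bit_lists m. conj_mat m as cs * cnj (gamma_mat m l cs bs)) a b"
      using 1 by (simp add: tensor_cnj tensor_comp[OF ab])
    also have "\<dots> = tensor (pcomp ?p (\<lambda>a b. cnj (pauli_x a b))) (\<lambda>as bs. (-1) ^ m * (\<Sum>cs\<in>bit_lists m. gamma_mat m l as cs * conj_mat m cs bs)) a b"
      using Suc.IH[OF 1] by (intro tensor_cong[OF ab])
    also have "\<dots> = (-1) ^ Suc m * tensor (pcomp pauli_x ?p) (\<lambda>as bs. \<Sum>cs\<in>bit_lists m. gamma_mat m l as cs * conj_mat m cs bs) a b"
      unfolding q tensor_scale_right tensor_scale_left by (simp flip: power_add mult_2)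
    also have "\<dots> = (-1) ^ Suc m * (\<Sum>c\<in>bit_lists (Suc m). gamma_mat (Suc m) l a c * conj_mat (Suc m) c b)"
      using 1 by (simp add: tensor_comp[OF ab])
    finally show ?thesis .
  next
    case 2
    then show ?thesis by (simp add: tensor_cnj tensor_comp[OF ab] cdl dd q tensor_scale_left del: power_Suc)
  next
    case 3
    then show ?thesis by (simp add: tensor_cnj tensor_comp[OF ab] cdl dd q tensor_scale_left del: power_Suc)
  qed
qed

subsection \<open>The product of two spheres\<close>

text \<open>Points are functions on all of \<open>nat\<close>, constrained in the first n + 1
  coordinates; \<open>forms_bound\<close> truncates the rest to recover compactness.\<close>

definition usphere :: "nat \<Rightarrow> (nat \<Rightarrow> complex) set" where
  "usphere n = {x. (\<Sum>i<Suc n. (cmod (x i))\<^sup>2) = 1}"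

text \<open>The Segre coordinates: on a product of unit spheres their squared moduli sum to 1, and
  each of them raises the bidegree by (1, 1).\<close>

definition coord :: "nat \<times> nat \<Rightarrow> (nat \<Rightarrow> complex) \<times> (nat \<Rightarrow> complex) \<Rightarrow> complex" where
  "coord e y = fst y (fst e) * snd y (snd e)"

definition bimonomial :: "nat list \<times> nat list \<Rightarrow> (nat \<Rightarrow> complex) \<times> (nat \<Rightarrow> complex) \<Rightarrow> complex" where
  "bimonomial \<mu> y = monom_val (fst \<mu>) (fst y) * monom_val (snd \<mu>) (snd y)"

definition biraise :: "nat \<times> nat \<Rightarrow> nat list \<times> nat list \<Rightarrow> nat list \<times> nat list" where
  "biraise e \<mu> = (raise (fst e) (fst \<mu>), raise (snd e) (snd \<mu>))"

definition quadrature :: "nat \<Rightarrow> nat \<Rightarrow> real \<Rightarrow> 'p set \<Rightarrow> ('p \<Rightarrow> nat \<Rightarrow> complex) \<Rightarrow> bool" where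
  "quadrature n K \<epsilon> I x \<longleftrightarrow> finite I \<and> (\<forall>p\<in>I. x p \<in> usphere n) \<and>
    (\<forall>\<alpha> \<alpha>'. length \<alpha> = Suc n \<longrightarrow> length \<alpha>' = Suc n \<longrightarrow> sum_list \<alpha> \<le> K \<longrightarrow> sum_list \<alpha>' \<le> K \<longrightarrow> \<alpha> \<noteq> \<alpha>' \<longrightarrow>
      (\<Sum>p\<in>I. cnj (monom_val \<alpha> (x p)) * monom_val \<alpha>' (x p)) = 0) \<and>
    (\<forall>\<alpha>. length \<alpha> = Suc n \<longrightarrow> sum_list \<alpha> \<le> K \<longrightarrow> weight I x monom_val \<alpha> > 0) \<and>
    (\<forall>\<alpha> i. length \<alpha> = Suc n \<longrightarrow> sum_list \<alpha> \<le> K \<longrightarrow> i < Suc n \<longrightarrow>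
      \<bar>weight I x monom_val (raise i \<alpha>) / weight I x monom_val \<alpha> - real (Suc (\<alpha> ! i)) / real (sum_list \<alpha> + Suc n)\<bar> \<le> \<epsilon>)"

lemma weight_product:
  "weight (I \<times> I') (\<lambda>p. (x (fst p), x' (snd p))) bimonomial \<mu> = weight I x monom_val (fst \<mu>) * weight I' x' monom_val (snd \<mu>)"
  by (simp add: weight_def bimonomial_def norm_mult power_mult_distrib sum_product sum.cartesian_product split_beta)

text \<open>In the ratios a = A1 / A and b = B1 / B and their successors the claim is a2 * b2 \<le>
  a * b + \<epsilon>. The error \<eta> a + \<eta> b + \<eta>^2 is at most 5 \<eta>, as the ratios
  are at most 2.\<close>

lemma gap_real:
  fixes A :: real
  assumes pos: "A > 0" "B > 0" "A1 > 0" "B1 > 0" "A2 \<ge> 0" "B2 \<ge> 0"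
    and a: "A2 / A1 \<le> A1 / A + \<eta>" and b: "B2 / B1 \<le> B1 / B + \<eta>"
    and le: "A1 / A \<le> 2" "B1 / B \<le> 2" and \<eta>: "0 \<le> \<eta>" "\<eta> \<le> 1" "5 * \<eta> \<le> \<epsilon>"
  shows "(A2 * B2) * (A * B) \<le> (A1 * B1)\<^sup>2 + \<epsilon> * (A1 * B1) * (A * B)"
proof -
  define a where "a = A1 / A"
  define b where "b = B1 / B"
  define a2 where "a2 = A2 / A1"
  define b2 where "b2 = B2 / B1"
  have ab: "a > 0" "b > 0" "a \<le> 2" "b \<le> 2" "a2 \<le> a + \<eta>" "b2 \<le> b + \<eta>" "a2 \<ge> 0" "b2 \<ge> 0"
    using assms by (simp_all add: a_def b_def a2_def b2_def)
  have "a2 * b2 \<le> (a + \<eta>) * (b + \<eta>)" using ab \<eta> by (intro mult_mono) auto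
  also have "\<dots> = a * b + \<eta> * a + \<eta> * b + \<eta> * \<eta>" by (simp add: algebra_simps)
  also have "\<dots> \<le> a * b + \<eta> * 2 + \<eta> * 2 + \<eta> * 1"
    using ab \<eta> by (intro add_mono mult_left_mono) auto
  also have "\<dots> \<le> a * b + \<epsilon>" using \<eta> by simp
  finally have *: "a2 * b2 \<le> a * b + \<epsilon>" .
  have eq: "A1 = a * A" "B1 = b * B" "A2 = a2 * (a * A)" "B2 = b2 * (b * B)"
    using pos by (simp_all add: a_def b_def a2_def b2_def)
  have "(A2 * B2) * (A * B) = (a2 * b2) * (a * b * (A * B)\<^sup>2)"
    unfolding eq by (simp add: power2_eq_square)
  also have "\<dots> \<le> (a * b + \<epsilon>) * (a * b * (A * B)\<^sup>2)"
    using * ab by (intro mult_right_mono) auto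
  also have "\<dots> = (A1 * B1)\<^sup>2 + \<epsilon> * (A1 * B1) * (A * B)"
    unfolding eq by (simp add: algebra_simps power2_eq_square)
  finally show ?thesis .
qed

text \<open>The exact ratio (\<alpha>_i + 1) / (|\<alpha>| + n + 1) grows by at most 1 / (N + 1)
  when \<alpha> is raised, and each of the two compared ratios carries a quadrature error of that
  size; hence the 3. For \<alpha>_i = 0 the exact ratio itself is that small.\<close>

lemma quadrature_ratio:
  assumes q: "quadrature n (2 * N) (1 / real (Suc N)) I x"
    and \<alpha>: "\<alpha> \<in> multi_indices (Suc n) (N + a)" "i < Suc n" and N: "Suc a \<le> N"
  shows "weight I x monom_val \<alpha> > 0" "weight I x monom_val (raise i \<alpha>) > 0"
    "weight I x monom_val (raise i \<alpha>) / weight I x monom_val \<alpha> \<le> 2"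
    "weight I x monom_val (raise i (raise i \<alpha>)) / weight I x monom_val (raise i \<alpha>) \<le> weight I x monom_val (raise i \<alpha>) / weight I x monom_val \<alpha> + 3 / real (Suc N)"
    "\<alpha> ! i = 0 \<Longrightarrow> weight I x monom_val (raise i \<alpha>) / weight I x monom_val \<alpha> \<le> 2 / real (Suc N)"
proof -
  let ?W = "weight I x monom_val" and ?d = "1 / real (Suc N)" and ?K = "N + a + Suc n"
  have l: "length \<alpha> = Suc n" "sum_list \<alpha> = N + a" using \<alpha> by (auto simp: multi_indices_def)
  have l': "length (raise i \<alpha>) = Suc n" "sum_list (raise i \<alpha>) = Suc (N + a)"
    using l \<alpha> by (simp_all add: sum_list_raise)
  show "?W \<alpha> > 0" "?W (raise i \<alpha>) > 0"
    using q l l' N unfolding quadrature_def by auto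
  have 1: "\<bar>?W (raise i \<alpha>) / ?W \<alpha> - real (Suc (\<alpha> ! i)) / real ?K\<bar> \<le> ?d"
    using q l \<alpha>(2) N unfolding quadrature_def by (metis add_le_cancel_left le_SucI Suc_leD mult_2)
  have 2: "\<bar>?W (raise i (raise i \<alpha>)) / ?W (raise i \<alpha>) - real (Suc (raise i \<alpha> ! i)) / real (Suc (N + a) + Suc n)\<bar> \<le> ?d"
    using q l' \<alpha>(2) N unfolding quadrature_def by (metis add_Suc_right add_le_cancel_left mult_2)
  have ai: "\<alpha> ! i \<le> N + a" using elem_le_sum_list[of i \<alpha>] l \<alpha> by simp
  have u: "raise i \<alpha> ! i = Suc (\<alpha> ! i)" using l \<alpha> by (simp add: raise_def)
  have d1: "?d \<le> 1" by simp
  have K: "1 / real ?K \<le> ?d" by (simp add: frac_le)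
  have "real (Suc (\<alpha> ! i)) / real ?K \<le> 1" using ai by simp
  then show "?W (raise i \<alpha>) / ?W \<alpha> \<le> 2" using 1 d1 by linarith
  have "real (Suc (Suc (\<alpha> ! i))) / real (Suc (N + a) + Suc n) \<le> real (Suc (Suc (\<alpha> ! i))) / real ?K"
    by (intro divide_left_mono) auto
  also have "\<dots> = real (Suc (\<alpha> ! i)) / real ?K + 1 / real ?K" by (simp add: add_divide_distrib)
  finally have "real (Suc (raise i \<alpha> ! i)) / real (Suc (N + a) + Suc n) \<le> real (Suc (\<alpha> ! i)) / real ?K + ?d"
    unfolding u using K by linarith
  moreover have "3 / real (Suc N) = ?d + ?d + ?d" by simp
  ultimately show "?W (raise i (raise i \<alpha>)) / ?W (raise i \<alpha>) \<le> ?W (raise i \<alpha>) / ?W \<alpha> + 3 / real (Suc N)"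
    using 1 2 by linarith
  assume "\<alpha> ! i = 0"
  then have "real (Suc (\<alpha> ! i)) / real ?K \<le> ?d" using K by simp
  moreover have "2 / real (Suc N) = ?d + ?d" by simp
  ultimately show "?W (raise i \<alpha>) / ?W \<alpha> \<le> 2 / real (Suc N)" using 1 by linarith
qed

lemma raise_pred:
  assumes "i < length \<alpha>" "\<alpha> ! i \<noteq> 0"
  shows "raise i (\<alpha>[i := \<alpha> ! i - 1]) = \<alpha>"
  using assms by (simp add: raise_def)

text \<open>Level N keeps monomials orthogonal up to degree 2 N with ratio error 1 / (N + 1), so
  every degree N + a with fixed a is covered once N is large.\<close>

locale two_spheres =
  fixes n n' :: nat and I :: "nat \<Rightarrow> 'p set" and x :: "nat \<Rightarrow> 'p \<Rightarrow> nat \<Rightarrow> complex"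
    and I' :: "nat \<Rightarrow> 'q set" and x' :: "nat \<Rightarrow> 'q \<Rightarrow> nat \<Rightarrow> complex"
  assumes quad: "quadrature n (2 * N) (1 / real (Suc N)) (I N) (x N)"
    and quad': "quadrature n' (2 * N) (1 / real (Suc N)) (I' N) (x' N)"
begin

abbreviation "YY \<equiv> usphere n \<times> usphere n'"
abbreviation "EE \<equiv> {..<Suc n} \<times> {..<Suc n'}"
abbreviation "BB \<equiv> \<lambda>k. multi_indices (Suc n) k \<times> multi_indices (Suc n') k"
abbreviation "PP \<equiv> \<lambda>N. I N \<times> I' N"
abbreviation "pp \<equiv> \<lambda>N p. (x N (fst p), x' N (snd p))"

lemma eventually_small: "c > 0 \<Longrightarrow> \<forall>\<^sub>F N in sequentially. C / real (Suc N) \<le> c"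
proof -
  assume c: "c > 0"
  have "(\<lambda>N. C * inverse (real (Suc N))) \<longlonglongrightarrow> C * 0"
    by (intro tendsto_intros LIMSEQ_inverse_real_of_nat)
  then have "\<forall>\<^sub>F N in sequentially. C * inverse (real (Suc N)) < c"
    using c by (intro order_tendstoD) auto
  then show ?thesis by eventually_elim (simp add: field_simps)
qed

sublocale toeplitz YY EE coord BB bimonomial biraise PP pp
proof
  show "finite EE" by simp
  show "finite (BB k)" for k by (simp add: finite_multi_indices)
  show "finite (PP N)" for N using quad quad' by (simp add: quadrature_def)
  show "pp N p \<in> YY" if "p \<in> PP N" for p N using that quad[of N] quad'[of N] by (auto simp: quadrature_def)
  show "(\<Sum>e\<in>EE. (cmod (coord e y))\<^sup>2) = 1" if "y \<in> YY" for y
  proof -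
    have "(\<Sum>e\<in>EE. (cmod (coord e y))\<^sup>2) = (\<Sum>i<Suc n. (cmod (fst y i))\<^sup>2) * (\<Sum>k<Suc n'. (cmod (snd y k))\<^sup>2)"
      unfolding coord_def norm_mult power_mult_distrib sum_product sum.cartesian_product by (rule sum.cong) auto
    then show ?thesis using that by (auto simp: usphere_def simp del: sum.lessThan_Suc)
  qed
  show "biraise e \<mu> \<in> BB (Suc k)" if "e \<in> EE" "\<mu> \<in> BB k" for e \<mu> k
    using that raise_multi_indices by (auto simp: biraise_def)
  show "inj_on (biraise e) (BB k)" if "e \<in> EE" for e k
  proof (rule inj_onI)
    fix \<mu> \<nu> assume "\<mu> \<in> BB k" "\<nu> \<in> BB k" "biraise e \<mu> = biraise e \<nu>"
    then show "\<mu> = \<nu>" using raise_inj by (auto simp: biraise_def multi_indices_def prod_eq_iff)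
  qed
  show "bimonomial (biraise e \<mu>) y = coord e y * bimonomial \<mu> y" if "e \<in> EE" "\<mu> \<in> BB k" "y \<in> YY" for e \<mu> k y
    using that by (auto simp: bimonomial_def biraise_def coord_def multi_indices_def monom_val_raise)
  show "\<forall>\<^sub>F N in sequentially. \<forall>\<mu>\<in>BB (N + a). \<forall>\<nu>\<in>BB (N + a). \<mu> \<noteq> \<nu> \<longrightarrow>
      (\<Sum>p\<in>PP N. cnj (bimonomial \<mu> (pp N p)) * bimonomial \<nu> (pp N p)) = 0" for a
    using eventually_ge_at_top[of a]
  proof eventually_elim
    case (elim N)
    show ?case
    proof (intro ballI impI)
      fix \<mu> \<nu> assume \<mu>: "\<mu> \<in> BB (N + a)" and \<nu>: "\<nu> \<in> BB (N + a)" and ne: "\<mu> \<noteq> \<nu>"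
      have "(\<Sum>p\<in>PP N. cnj (bimonomial \<mu> (pp N p)) * bimonomial \<nu> (pp N p)) =
        (\<Sum>p\<in>I N. cnj (monom_val (fst \<mu>) (x N p)) * monom_val (fst \<nu>) (x N p)) *
        (\<Sum>p\<in>I' N. cnj (monom_val (snd \<mu>) (x' N p)) * monom_val (snd \<nu>) (x' N p))"
        by (simp add: bimonomial_def sum_product sum.cartesian_product split_beta mult_ac)
      also have "\<dots> = 0"
      proof (cases "fst \<mu> = fst \<nu>")
        case False
        then have "(\<Sum>p\<in>I N. cnj (monom_val (fst \<mu>) (x N p)) * monom_val (fst \<nu>) (x N p)) = 0"
          using quad[of N] \<mu> \<nu> elim unfolding quadrature_def multi_indices_def by auto
        then show ?thesis by simp
      next
        case True
        then have "snd \<mu> \<noteq> snd \<nu>" using ne by (simp add: prod_eq_iff)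
        then have "(\<Sum>p\<in>I' N. cnj (monom_val (snd \<mu>) (x' N p)) * monom_val (snd \<nu>) (x' N p)) = 0"
          using quad'[of N] \<mu> \<nu> elim unfolding quadrature_def multi_indices_def by auto
        then show ?thesis by simp
      qed
      finally show "(\<Sum>p\<in>PP N. cnj (bimonomial \<mu> (pp N p)) * bimonomial \<nu> (pp N p)) = 0" .
    qed
  qed
  show "\<forall>\<^sub>F N in sequentially. \<forall>\<mu>\<in>BB (N + a). weight (PP N) (pp N) bimonomial \<mu> > 0" for a
    using eventually_ge_at_top[of "Suc a"]
  proof eventually_elim
    case (elim N)
    show ?case
      using quadrature_ratio(1)[OF quad, of _ N a 0] quadrature_ratio(1)[OF quad', of _ N a 0] elim
      unfolding weight_product by auto
  qed
  fix e :: "nat \<times> nat" and \<epsilon> :: real and a assume e: "e \<in> EE" and \<epsilon>: "\<epsilon> > 0"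
  then have e1: "fst e < Suc n" and e2: "snd e < Suc n'" by auto
  show "\<forall>\<^sub>F N in sequentially. \<forall>\<mu>\<in>BB (N + a).
      weight (PP N) (pp N) bimonomial (biraise e (biraise e \<mu>)) * weight (PP N) (pp N) bimonomial \<mu>
      \<le> (weight (PP N) (pp N) bimonomial (biraise e \<mu>))\<^sup>2 +
        \<epsilon> * weight (PP N) (pp N) bimonomial (biraise e \<mu>) * weight (PP N) (pp N) bimonomial \<mu>"
    using eventually_ge_at_top[of "Suc a"] eventually_small[OF zero_less_one, of 3] eventually_small[OF \<epsilon>, of 15]
  proof eventually_elim
    case (elim N)
    show ?case
    proof
      fix \<mu> assume "\<mu> \<in> BB (N + a)"
      then have \<mu>: "fst \<mu> \<in> multi_indices (Suc n) (N + a)" "snd \<mu> \<in> multi_indices (Suc n') (N + a)" by auto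
      note q = quadrature_ratio[OF quad \<mu>(1) e1 elim(1)] and q' = quadrature_ratio[OF quad' \<mu>(2) e2 elim(1)]
      have nn: "weight (I N) (x N) monom_val \<beta> \<ge> 0" "weight (I' N) (x' N) monom_val \<beta> \<ge> 0" for \<beta>
        by (simp_all add: weight_def sum_nonneg)
      show "weight (PP N) (pp N) bimonomial (biraise e (biraise e \<mu>)) * weight (PP N) (pp N) bimonomial \<mu>
        \<le> (weight (PP N) (pp N) bimonomial (biraise e \<mu>))\<^sup>2 +
        \<epsilon> * weight (PP N) (pp N) bimonomial (biraise e \<mu>) * weight (PP N) (pp N) bimonomial \<mu>"
        unfolding weight_product biraise_def fst_conv snd_conv
        by (rule gap_real[where \<eta> = "3 / real (Suc N)"])
          (use q(1-4) q'(1-4) nn elim(2,3) in simp_all)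
    qed
  qed
  show "\<forall>\<^sub>F N in sequentially. \<forall>\<mu>\<in>BB (Suc (N + a)) - biraise e ` BB (N + a).
      weight (PP N) (pp N) bimonomial (biraise e \<mu>) \<le> \<epsilon> * weight (PP N) (pp N) bimonomial \<mu>"
    using eventually_ge_at_top[of "Suc (Suc a)"] eventually_small[OF \<epsilon>, of 4]
  proof eventually_elim
    case (elim N)
    show ?case
    proof
      fix \<mu> assume m: "\<mu> \<in> BB (Suc (N + a)) - biraise e ` BB (N + a)"
      then have \<mu>: "fst \<mu> \<in> multi_indices (Suc n) (N + Suc a)" "snd \<mu> \<in> multi_indices (Suc n') (N + Suc a)" by auto
      note q = quadrature_ratio[OF quad \<mu>(1) e1 elim(1)] and q' = quadrature_ratio[OF quad' \<mu>(2) e2 elim(1)]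
      let ?A = "weight (I N) (x N) monom_val (fst \<mu>)" and ?A1 = "weight (I N) (x N) monom_val (raise (fst e) (fst \<mu>))"
      let ?B = "weight (I' N) (x' N) monom_val (snd \<mu>)" and ?B1 = "weight (I' N) (x' N) monom_val (raise (snd e) (snd \<mu>))"
      \<comment> \<open>If both exponents were positive, the bimonomial would be divisible by the
        coordinate e. A zero exponent makes one of the two weight ratios small, while the other is
        at most 2.\<close>
      have "fst \<mu> ! fst e = 0 \<or> snd \<mu> ! snd e = 0"
      proof (rule ccontr)
        assume *: "\<not> ?thesis"
        let ?\<alpha> = "(fst \<mu>)[fst e := fst \<mu> ! fst e - 1]" and ?\<beta> = "(snd \<mu>)[snd e := snd \<mu> ! snd e - 1]"
        have u1: "raise (fst e) ?\<alpha> = fst \<mu>" by (rule raise_pred) (use * \<mu> e1 in \<open>auto simp: multi_indices_def\<close>)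
        have u2: "raise (snd e) ?\<beta> = snd \<mu>" by (rule raise_pred) (use * \<mu> e2 in \<open>auto simp: multi_indices_def\<close>)
        note u = u1 u2
        have l: "fst e < length ?\<alpha>" "snd e < length ?\<beta>" using \<mu> e1 e2 by (auto simp: multi_indices_def)
        have "Suc (sum_list ?\<alpha>) = N + Suc a" "Suc (sum_list ?\<beta>) = N + Suc a"
          using sum_list_raise[OF l(1)] sum_list_raise[OF l(2)] \<mu> unfolding u by (auto simp: multi_indices_def)
        then have "(?\<alpha>, ?\<beta>) \<in> BB (N + a)" using \<mu> by (auto simp: multi_indices_def)
        moreover have "biraise e (?\<alpha>, ?\<beta>) = \<mu>" using u by (simp add: biraise_def)
        ultimately show False using m by (metis DiffE imageI)
      qed
      then have ab: "(?A1 / ?A) * (?B1 / ?B) \<le> \<epsilon>"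
      proof
        assume "fst \<mu> ! fst e = 0"
        then have "(?A1 / ?A) * (?B1 / ?B) \<le> 2 / real (Suc N) * 2"
          using q(1,2,5) q'(1-3) by (intro mult_mono) auto
        then show ?thesis using elim(2) by simp
      next
        assume "snd \<mu> ! snd e = 0"
        then have "(?A1 / ?A) * (?B1 / ?B) \<le> 2 * (2 / real (Suc N))"
          using q(1-3) q'(1,2,5) by (intro mult_mono) auto
        then show ?thesis using elim(2) by simp
      qed
      have "?A1 * ?B1 = (?A1 / ?A) * (?B1 / ?B) * (?A * ?B)" using q(1) q'(1) by simp
      also have "\<dots> \<le> \<epsilon> * (?A * ?B)" using ab q(1) q'(1) by (intro mult_right_mono) auto
      finally show "weight (PP N) (pp N) bimonomial (biraise e \<mu>) \<le> \<epsilon> * weight (PP N) (pp N) bimonomial \<mu>"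
        unfolding weight_product biraise_def fst_conv snd_conv .
    qed
  qed
qed

end

definition mat_prod :: "'i set \<Rightarrow> ('i \<Rightarrow> 'i \<Rightarrow> complex) \<Rightarrow> ('i \<Rightarrow> 'i \<Rightarrow> complex) \<Rightarrow> 'i \<Rightarrow> 'i \<Rightarrow> complex" where
  "mat_prod S K L a b = (\<Sum>c\<in>S. K a c * L c b)"

lemma mat_prod_assoc: "mat_prod S (mat_prod S K L) M a b = mat_prod S K (mat_prod S L M) a b"
proof -
  have "mat_prod S (mat_prod S K L) M a b = (\<Sum>d\<in>S. \<Sum>c\<in>S. K a c * L c d * M d b)"
    by (simp add: mat_prod_def sum_distrib_right)
  also have "\<dots> = (\<Sum>c\<in>S. \<Sum>d\<in>S. K a c * L c d * M d b)" by (rule sum.swap)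
  finally show ?thesis by (simp add: mat_prod_def sum_distrib_left mult_ac)
qed

lemma mat_prod_cong:
  assumes "\<And>c. c \<in> S \<Longrightarrow> K a c = K' a c" "\<And>c. c \<in> S \<Longrightarrow> L c b = L' c b"
  shows "mat_prod S K L a b = mat_prod S K' L' a b"
  unfolding mat_prod_def using assms by simp

lemma mat_prod_sum_left: "mat_prod S (\<lambda>a b. \<Sum>l\<in>A. w l * K l a b) L a b = (\<Sum>l\<in>A. w l * mat_prod S (K l) L a b)"
proof -
  have "mat_prod S (\<lambda>a b. \<Sum>l\<in>A. w l * K l a b) L a b = (\<Sum>c\<in>S. \<Sum>l\<in>A. w l * (K l a c * L c b))"
    unfolding mat_prod_def sum_distrib_right by (simp add: mult.assoc)
  also have "\<dots> = (\<Sum>l\<in>A. \<Sum>c\<in>S. w l * (K l a c * L c b))" by (rule sum.swap)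
  finally show ?thesis by (simp add: mat_prod_def sum_distrib_left)
qed

lemma mat_prod_sum_right: "mat_prod S K (\<lambda>a b. \<Sum>l\<in>A. w l * L l a b) a b = (\<Sum>l\<in>A. w l * mat_prod S K (L l) a b)"
proof -
  have "mat_prod S K (\<lambda>a b. \<Sum>l\<in>A. w l * L l a b) a b = (\<Sum>c\<in>S. \<Sum>l\<in>A. w l * (K a c * L l c b))"
    by (simp add: mat_prod_def sum_distrib_left mult_ac)
  also have "\<dots> = (\<Sum>l\<in>A. \<Sum>c\<in>S. w l * (K a c * L l c b))" by (rule sum.swap)
  finally show ?thesis by (simp add: mat_prod_def sum_distrib_left)
qed

subsection \<open>Bilinear forms on the two spheres\<close>

definition bilin :: "nat \<Rightarrow> nat \<Rightarrow> (nat \<Rightarrow> nat \<times> nat \<Rightarrow> complex) \<Rightarrow> nat \<Rightarrow> (nat \<Rightarrow> complex) \<times> (nat \<Rightarrow> complex) \<Rightarrow> complex" where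
  "bilin n n' cf l y = (\<Sum>e\<in>{..<Suc n} \<times> {..<Suc n'}. cf l e * coord e y)"

definition clifford :: "nat \<Rightarrow> nat \<Rightarrow> nat \<Rightarrow> (nat \<Rightarrow> nat \<times> nat \<Rightarrow> complex) \<Rightarrow> bool list \<Rightarrow> bool list \<Rightarrow> (nat \<Rightarrow> complex) \<times> (nat \<Rightarrow> complex) \<Rightarrow> complex" where
  "clifford n n' m cf a b y = (\<Sum>l<2*m+1. bilin n n' cf l y * gamma_mat m l a b)"

text \<open>The scalar to which the Clifford symbol squares, called \<open>la\<close> in
  \<open>clifford_symbol\<close>; \<open>sum_norm_sq\<close> below is \<open>l\<close>.\<close>

definition sum_sq :: "nat \<Rightarrow> nat \<Rightarrow> nat \<Rightarrow> (nat \<Rightarrow> nat \<times> nat \<Rightarrow> complex) \<Rightarrow> (nat \<Rightarrow> complex) \<times> (nat \<Rightarrow> complex) \<Rightarrow> complex" where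
  "sum_sq n n' m cf y = (\<Sum>l<2*m+1. (bilin n n' cf l y)\<^sup>2)"

definition sum_norm_sq :: "nat \<Rightarrow> nat \<Rightarrow> nat \<Rightarrow> (nat \<Rightarrow> nat \<times> nat \<Rightarrow> complex) \<Rightarrow> (nat \<Rightarrow> complex) \<times> (nat \<Rightarrow> complex) \<Rightarrow> real" where
  "sum_norm_sq n n' m cf y = (\<Sum>l<2*m+1. (cmod (bilin n n' cf l y))\<^sup>2)"

lemma clifford_anti_sum:
  fixes u v :: "nat \<Rightarrow> complex"
  assumes "a \<in> bit_lists m" "b \<in> bit_lists m"
  shows "(\<Sum>l<2*m+1. \<Sum>k<2*m+1. u l * v k * (mat_prod (bit_lists m) (gamma_mat m l) (gamma_mat m k) a b + mat_prod (bit_lists m) (gamma_mat m k) (gamma_mat m l) a b))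
    = 2 * (\<Sum>l<2*m+1. u l * v l) * kdelta a b"
proof -
  have "(\<Sum>l<2*m+1. \<Sum>k<2*m+1. u l * v k * (mat_prod (bit_lists m) (gamma_mat m l) (gamma_mat m k) a b + mat_prod (bit_lists m) (gamma_mat m k) (gamma_mat m l) a b))
    = (\<Sum>l<2*m+1. \<Sum>k<2*m+1. if k = l then u l * v l * (2 * kdelta a b) else 0)"
  proof (intro sum.cong refl)
    fix l k assume "l \<in> {..<2*m+1}" "k \<in> {..<2*m+1}"
    then have "mat_prod (bit_lists m) (gamma_mat m l) (gamma_mat m k) a b + mat_prod (bit_lists m) (gamma_mat m k) (gamma_mat m l) a b = (if l = k then 2 * kdelta a b else 0)"
      unfolding mat_prod_def using gamma_mat_anticommute[of l m k a b] assms by simp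
    then show "u l * v k * (mat_prod (bit_lists m) (gamma_mat m l) (gamma_mat m k) a b + mat_prod (bit_lists m) (gamma_mat m k) (gamma_mat m l) a b)
      = (if k = l then u l * v l * (2 * kdelta a b) else 0)" by simp
  qed
  also have "\<dots> = 2 * (\<Sum>l<2*m+1. u l * v l) * kdelta a b"
    by (simp add: sum_distrib_left sum_distrib_right mult_ac del: sum.lessThan_Suc)
  finally show ?thesis .
qed

lemma mat_prod_clifford:
  "mat_prod S (\<lambda>a b. \<Sum>l<q. u l * G l a b) (\<lambda>a b. \<Sum>k<q. v k * G k a b) a b = (\<Sum>l<q. \<Sum>k<q. u l * v k * mat_prod S (G l) (G k) a b)"
  unfolding mat_prod_sum_left mat_prod_sum_right by (simp add: sum_distrib_left mult_ac)

lemma clifford_adjoint: "cnj (clifford n n' m cf b a y) = (\<Sum>l<2*m+1. cnj (bilin n n' cf l y) * gamma_mat m l a b)"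
  unfolding clifford_def cnj_sum complex_cnj_mult by (intro sum.cong refl) (simp only: gamma_mat_hermitian[of m _ b a] complex_cnj_cnj)

text \<open>Each product is a double sum over pairs of forms. Adding the sum with the two indices
  exchanged produces anticommutators, of which only the diagonal ones survive.\<close>

lemma clifford_symbol_clifford:
  assumes "c > 0" "c \<le> (sum_norm_sq n n' m cf y)\<^sup>2 - (cmod (sum_sq n n' m cf y))\<^sup>2"
  shows "clifford_symbol (bit_lists m) (\<lambda>a b. clifford n n' m cf a b y) (sum_sq n n' m cf y) (sum_norm_sq n n' m cf y)"
proof
  let ?L = "\<lambda>l. bilin n n' cf l y" and ?q = "2*m+1"
  show "finite (bit_lists m)" by (rule finite_bit_lists)
  show "(\<Sum>c\<in>bit_lists m. clifford n n' m cf a c y * clifford n n' m cf c b y) = (if a = b then sum_sq n n' m cf y else 0)"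
    if "a \<in> bit_lists m" "b \<in> bit_lists m" for a b
  proof -
    have "(\<Sum>c\<in>bit_lists m. clifford n n' m cf a c y * clifford n n' m cf c b y) =
      mat_prod (bit_lists m) (\<lambda>a b. \<Sum>l<?q. ?L l * gamma_mat m l a b) (\<lambda>a b. \<Sum>l<?q. ?L l * gamma_mat m l a b) a b"
      by (simp only: mat_prod_def clifford_def)
    also have "\<dots> = (\<Sum>l<?q. \<Sum>k<?q. ?L l * ?L k * mat_prod (bit_lists m) (gamma_mat m l) (gamma_mat m k) a b)"
      by (rule mat_prod_clifford)
    finally have 1: "(\<Sum>c\<in>bit_lists m. clifford n n' m cf a c y * clifford n n' m cf c b y) =
      (\<Sum>l<?q. \<Sum>k<?q. ?L l * ?L k * mat_prod (bit_lists m) (gamma_mat m l) (gamma_mat m k) a b)" .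
    also have "\<dots> = (\<Sum>k<?q. \<Sum>l<?q. ?L l * ?L k * mat_prod (bit_lists m) (gamma_mat m l) (gamma_mat m k) a b)" by (rule sum.swap)
    finally have 2: "(\<Sum>c\<in>bit_lists m. clifford n n' m cf a c y * clifford n n' m cf c b y) =
      (\<Sum>l<?q. \<Sum>k<?q. ?L l * ?L k * mat_prod (bit_lists m) (gamma_mat m k) (gamma_mat m l) a b)"
      by (simp only: mult.commute)
    have "2 * (\<Sum>c\<in>bit_lists m. clifford n n' m cf a c y * clifford n n' m cf c b y) =
      (\<Sum>c\<in>bit_lists m. clifford n n' m cf a c y * clifford n n' m cf c b y) + (\<Sum>c\<in>bit_lists m. clifford n n' m cf a c y * clifford n n' m cf c b y)"
      by simp
    also have "\<dots> = (\<Sum>l<?q. \<Sum>k<?q. ?L l * ?L k * mat_prod (bit_lists m) (gamma_mat m l) (gamma_mat m k) a b) +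
      (\<Sum>l<?q. \<Sum>k<?q. ?L l * ?L k * mat_prod (bit_lists m) (gamma_mat m k) (gamma_mat m l) a b)"
      by (intro arg_cong2[where f = "(+)"] 1 2)
    also have "\<dots> = (\<Sum>l<?q. \<Sum>k<?q. ?L l * ?L k * (mat_prod (bit_lists m) (gamma_mat m l) (gamma_mat m k) a b + mat_prod (bit_lists m) (gamma_mat m k) (gamma_mat m l) a b))"
      by (simp only: sum.distrib distrib_left)
    also have "\<dots> = 2 * (if a = b then sum_sq n n' m cf y else 0)"
      unfolding clifford_anti_sum[OF that] by (simp add: sum_sq_def power2_eq_square kdelta_def del: sum.lessThan_Suc)
    finally show ?thesis by simp
  qed
  show "(\<Sum>c\<in>bit_lists m. clifford n n' m cf a c y * cnj (clifford n n' m cf b c y)) + (\<Sum>c\<in>bit_lists m. cnj (clifford n n' m cf c a y) * clifford n n' m cf c b y) =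
      (if a = b then of_real (2 * sum_norm_sq n n' m cf y) else 0)" if "a \<in> bit_lists m" "b \<in> bit_lists m" for a b
  proof -
    have "(\<Sum>c\<in>bit_lists m. clifford n n' m cf a c y * cnj (clifford n n' m cf b c y)) =
      mat_prod (bit_lists m) (\<lambda>a b. \<Sum>l<?q. ?L l * gamma_mat m l a b) (\<lambda>a b. \<Sum>l<?q. cnj (?L l) * gamma_mat m l a b) a b"
      unfolding mat_prod_def clifford_adjoint unfolding clifford_def ..
    then have 1: "(\<Sum>c\<in>bit_lists m. clifford n n' m cf a c y * cnj (clifford n n' m cf b c y)) =
      (\<Sum>l<?q. \<Sum>k<?q. ?L l * cnj (?L k) * mat_prod (bit_lists m) (gamma_mat m l) (gamma_mat m k) a b)"
      by (simp only: mat_prod_clifford)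
    have "(\<Sum>c\<in>bit_lists m. cnj (clifford n n' m cf c a y) * clifford n n' m cf c b y) =
      mat_prod (bit_lists m) (\<lambda>a b. \<Sum>l<?q. cnj (?L l) * gamma_mat m l a b) (\<lambda>a b. \<Sum>l<?q. ?L l * gamma_mat m l a b) a b"
      unfolding mat_prod_def clifford_adjoint unfolding clifford_def ..
    then have "(\<Sum>c\<in>bit_lists m. cnj (clifford n n' m cf c a y) * clifford n n' m cf c b y) =
      (\<Sum>k<?q. \<Sum>l<?q. cnj (?L k) * ?L l * mat_prod (bit_lists m) (gamma_mat m k) (gamma_mat m l) a b)"
      by (simp only: mat_prod_clifford)
    also have "\<dots> = (\<Sum>l<?q. \<Sum>k<?q. ?L l * cnj (?L k) * mat_prod (bit_lists m) (gamma_mat m k) (gamma_mat m l) a b)"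
      by (subst sum.swap) (simp only: mult.commute)
    finally have "(\<Sum>c\<in>bit_lists m. clifford n n' m cf a c y * cnj (clifford n n' m cf b c y)) + (\<Sum>c\<in>bit_lists m. cnj (clifford n n' m cf c a y) * clifford n n' m cf c b y) =
       (\<Sum>l<?q. \<Sum>k<?q. ?L l * cnj (?L k) * (mat_prod (bit_lists m) (gamma_mat m l) (gamma_mat m k) a b + mat_prod (bit_lists m) (gamma_mat m k) (gamma_mat m l) a b))"
      unfolding 1 by (simp only: sum.distrib distrib_left)
    also have "\<dots> = 2 * (\<Sum>l<?q. ?L l * cnj (?L l)) * kdelta a b" by (rule clifford_anti_sum[OF that])
    also have "(\<Sum>l<?q. ?L l * cnj (?L l)) = of_real (sum_norm_sq n n' m cf y)"
      unfolding sum_norm_sq_def of_real_sum by (intro sum.cong refl) (simp only: complex_norm_square)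
    finally show ?thesis by (simp add: kdelta_def)
  qed
  have "(cmod (sum_sq n n' m cf y))\<^sup>2 < (sum_norm_sq n n' m cf y)\<^sup>2" using assms by linarith
  then show "cmod (sum_sq n n' m cf y) < sum_norm_sq n n' m cf y"
    by (rule power2_less_imp_less) (simp add: sum_norm_sq_def sum_nonneg)
qed

locale two_spheres_forms = two_spheres +
  fixes m :: nat and cf :: "nat \<Rightarrow> nat \<times> nat \<Rightarrow> complex" and c0 :: real
  assumes c0: "c0 > 0"
    and bound: "y \<in> YY \<Longrightarrow> c0 \<le> (sum_norm_sq n n' m cf y)\<^sup>2 - (cmod (sum_sq n n' m cf y))\<^sup>2"
begin

lemma qsym_bilin: "qsym a (Suc a) (bilin n n' cf l)"
  unfolding bilin_def[abs_def] by (intro qsym_sum qsym_scale qsym_X)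

lemma qsym_cnj_bilin: "qsym (Suc a) a (\<lambda>y. cnj (bilin n n' cf l y))"
proof -
  have "qsym (Suc a) a (\<lambda>y. \<Sum>e\<in>EE. cnj (cf l e) * cnj (coord e y))"
    by (intro qsym_sum qsym_scale qsym_cnj_X)
  then show ?thesis by (simp add: bilin_def)
qed

sublocale toeplitz_clifford YY EE coord BB bimonomial biraise PP pp "bit_lists m" "clifford n n' m cf" "sum_sq n n' m cf" "sum_norm_sq n n' m cf" c0
proof (rule toeplitz_clifford.intro[OF toeplitz_axioms toeplitz_clifford_axioms.intro])
  show "clifford_symbol (bit_lists m) (\<lambda>a b. clifford n n' m cf a b y) (sum_sq n n' m cf y) (sum_norm_sq n n' m cf y)" if "y \<in> YY" for y
    by (rule clifford_symbol_clifford[OF c0 bound[OF that]])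
  show "qsym a (Suc a) (clifford n n' m cf s t)" for a s t
  proof -
    have "qsym a (Suc a) (\<lambda>y. \<Sum>l<2*m+1. gamma_mat m l s t * bilin n n' cf l y)"
      by (intro qsym_sum qsym_scale qsym_bilin)
    then show ?thesis by (simp add: clifford_def[abs_def] mult.commute del: sum.lessThan_Suc)
  qed
  show "qsym (Suc a) a (\<lambda>y. cnj (clifford n n' m cf s t y))" for a s t
  proof -
    have "qsym (Suc a) a (\<lambda>y. \<Sum>l<2*m+1. gamma_mat m l t s * cnj (bilin n n' cf l y))"
      by (intro qsym_sum qsym_scale qsym_cnj_bilin)
    then show ?thesis unfolding clifford_adjoint by (simp add: mult.commute del: sum.lessThan_Suc)
  qed
  show "qsym a a (\<lambda>y. of_real (sum_norm_sq n n' m cf y))" for a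
  proof -
    have "qsym a a (\<lambda>y. \<Sum>l<2*m+1. cnj (bilin n n' cf l y) * bilin n n' cf l y)"
      by (intro qsym_sum qsym_mult[OF qsym_cnj_bilin qsym_bilin])
    then show ?thesis by (simp add: sum_norm_sq_def cnj_mult_self del: sum.lessThan_Suc)
  qed
  show "c0 > 0" by (rule c0)
  show "c0 \<le> (sum_norm_sq n n' m cf y)\<^sup>2 - (cmod (sum_sq n n' m cf y))\<^sup>2" if "y \<in> YY" for y by (rule bound[OF that])
  show "finite (bit_lists m)" by (rule finite_bit_lists)
qed

lemma card_BB: "card (BB k) = ((k + n) choose n) * ((k + n') choose n')"
  by (simp add: card_multi_indices card_cartesian_product)

end

subsection \<open>Quaternionic symmetry\<close>

lemma mat_prod_cnj: "cnj (mat_prod S K L a b) = mat_prod S (\<lambda>a b. cnj (K a b)) (\<lambda>a b. cnj (L a b)) a b"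
  by (simp add: mat_prod_def)

lemma mat_prod_assoc_fun: "mat_prod S (mat_prod S K L) M = mat_prod S K (mat_prod S L M)"
  by (intro ext mat_prod_assoc)

lemma mat_prod_kdelta:
  assumes "a \<in> bit_lists m" "b \<in> bit_lists m"
  shows "mat_prod (bit_lists m) kdelta g a b = g a b" "mat_prod (bit_lists m) g kdelta a b = g a b"
  using kdelta_comp[OF assms] by (simp_all add: mat_prod_def)

lemma mat_prod_scale_left: "mat_prod S (\<lambda>a b. w * K a b) L a b = w * mat_prod S K L a b"
  by (simp add: mat_prod_def sum_distrib_left mult_ac)

lemma mat_prod_scale_right: "mat_prod S K (\<lambda>a b. w * L a b) a b = w * mat_prod S K L a b"
  by (simp add: mat_prod_def sum_distrib_left mult_ac)

text \<open>The factor \<open>gamma_mat m 0\<close> commutes with the zeroth matrix and anticommutes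
  with the others. This offsets the sign by which the zeroth form differs from the others under
  \<open>conj_swap\<close>.\<close>

definition quat_mat :: "nat \<Rightarrow> bool list \<Rightarrow> bool list \<Rightarrow> complex" where
  "quat_mat m = mat_prod (bit_lists m) (conj_mat m) (\<lambda>a b. cnj (gamma_mat m 0 a b))"

lemma gamma_mat_square:
  assumes "l < 2 * m + 1" "a \<in> bit_lists m" "b \<in> bit_lists m"
  shows "mat_prod (bit_lists m) (gamma_mat m l) (gamma_mat m l) a b = kdelta a b"
  using gamma_mat_anticommute[OF assms(1,1,2,3)] by (simp add: mat_prod_def)

lemma gamma_mat_swap:
  assumes "l < 2 * m + 1" "a \<in> bit_lists m" "b \<in> bit_lists m"
  shows "mat_prod (bit_lists m) (gamma_mat m 0) (gamma_mat m l) a b = (if l = 0 then 1 else -1) * mat_prod (bit_lists m) (gamma_mat m l) (gamma_mat m 0) a b"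
  using gamma_mat_anticommute[OF _ assms, of 0] by (auto simp: mat_prod_def eq_neg_iff_add_eq_0)

lemma quat_mat_eq:
  assumes "even m" "a \<in> bit_lists m" "b \<in> bit_lists m"
  shows "quat_mat m a b = mat_prod (bit_lists m) (gamma_mat m 0) (conj_mat m) a b"
  using conj_mat_gamma_mat[of 0 m a b] assms by (simp add: quat_mat_def mat_prod_def)

lemma quat_mat_gamma_mat:
  assumes "even m" "l < 2 * m + 1" "a \<in> bit_lists m" "b \<in> bit_lists m"
  shows "mat_prod (bit_lists m) (quat_mat m) (\<lambda>a b. cnj (gamma_mat m l a b)) a b = (if l = 0 then 1 else -1) * mat_prod (bit_lists m) (gamma_mat m l) (quat_mat m) a b"
proof -
  let ?M = "mat_prod (bit_lists m)" and ?g = "\<lambda>l a b. cnj (gamma_mat m l a b)" and ?e = "if l = 0 then 1 else (-1::complex)"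
  have "?M (quat_mat m) (?g l) a b = ?M (conj_mat m) (?M (?g 0) (?g l)) a b"
    by (simp add: quat_mat_def mat_prod_assoc)
  also have "\<dots> = ?M (conj_mat m) (\<lambda>a b. ?e * ?M (?g l) (?g 0) a b) a b"
  proof (rule mat_prod_cong)
    fix c assume c: "c \<in> bit_lists m"
    show "?M (?g 0) (?g l) c b = ?e * ?M (?g l) (?g 0) c b"
      using arg_cong[OF gamma_mat_swap[OF assms(2) c assms(4)], of cnj] by (auto simp: mat_prod_cnj)
  qed simp
  also have "\<dots> = ?e * ?M (?M (conj_mat m) (?g l)) (?g 0) a b"
    by (simp only: mat_prod_scale_right mat_prod_assoc)
  also have "?M (?M (conj_mat m) (?g l)) (?g 0) a b = ?M (?M (gamma_mat m l) (conj_mat m)) (?g 0) a b"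
    by (rule mat_prod_cong) (use conj_mat_gamma_mat[OF assms(2)] assms in \<open>simp_all add: mat_prod_def\<close>)
  also have "\<dots> = ?M (gamma_mat m l) (quat_mat m) a b"
    by (simp only: mat_prod_assoc quat_mat_def)
  finally show ?thesis .
qed

text \<open>For even m the two factors of \<open>quat_mat\<close> may be written in either order, so
  an inner pair of conjugates of \<open>gamma_mat m 0\<close> cancels and
  \<open>conj_mat_square\<close> gives the sign.\<close>

lemma quat_mat_square:
  assumes "m mod 4 = 2" "a \<in> bit_lists m" "b \<in> bit_lists m"
  shows "mat_prod (bit_lists m) (quat_mat m) (\<lambda>a b. cnj (quat_mat m a b)) a b = - kdelta a b"
proof -
  let ?M = "mat_prod (bit_lists m)" and ?g = "\<lambda>a b. cnj (gamma_mat m 0 a b)" and ?c = "\<lambda>a b. cnj (conj_mat m a b)"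
  have ev: "even m" using assms(1) by presburger
  have "?M (quat_mat m) (\<lambda>a b. cnj (quat_mat m a b)) a b = ?M (quat_mat m) (?M ?g ?c) a b"
    by (rule mat_prod_cong) (use assms quat_mat_eq[OF ev] in \<open>simp_all add: mat_prod_cnj\<close>)
  also have "\<dots> = ?M (?M (conj_mat m) (?M ?g ?g)) ?c a b"
    by (simp add: quat_mat_def mat_prod_assoc_fun)
  also have "\<dots> = ?M (conj_mat m) ?c a b"
  proof (rule mat_prod_cong)
    fix c assume c: "c \<in> bit_lists m"
    have "?M (conj_mat m) (?M ?g ?g) a c = ?M (conj_mat m) kdelta a c"
    proof (rule mat_prod_cong)
      fix d assume d: "d \<in> bit_lists m"
      show "?M ?g ?g d c = kdelta d c"
        using arg_cong[OF gamma_mat_square[of 0 m d c], of cnj] c d by (auto simp: mat_prod_cnj kdelta_def)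
    qed simp
    then show "?M (conj_mat m) (?M ?g ?g) a c = conj_mat m a c" using mat_prod_kdelta[OF assms(2) c] by simp
  qed simp
  also have "\<dots> = - kdelta a b" using conj_mat_square[OF assms(2,3)] assms(1) by (simp add: mat_prod_def)
  finally show ?thesis .
qed

lemma quat_mat_unitary:
  assumes "even m" "a \<in> bit_lists m" "b \<in> bit_lists m"
  shows "(\<Sum>c\<in>bit_lists m. cnj (quat_mat m c a) * quat_mat m c b) = kdelta a b"
proof -
  let ?M = "mat_prod (bit_lists m)" and ?c = "\<lambda>a b. cnj (conj_mat m b a)"
  have q: "cnj (quat_mat m c a) = ?M ?c (gamma_mat m 0) a c" if "c \<in> bit_lists m" for c
  proof -
    have "cnj (quat_mat m c a) = (\<Sum>d\<in>bit_lists m. cnj (gamma_mat m 0 c d) * cnj (conj_mat m d a))"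
      using quat_mat_eq[OF assms(1) that assms(2)] by (simp add: mat_prod_def)
    also have "\<dots> = (\<Sum>d\<in>bit_lists m. cnj (conj_mat m d a) * gamma_mat m 0 d c)"
      by (intro sum.cong refl) (subst gamma_mat_hermitian[of m 0 _ c], simp)
    finally show ?thesis by (simp add: mat_prod_def)
  qed
  have "(\<Sum>c\<in>bit_lists m. cnj (quat_mat m c a) * quat_mat m c b) = ?M (?M ?c (gamma_mat m 0)) (?M (gamma_mat m 0) (conj_mat m)) a b"
    unfolding mat_prod_def[of _ "?M ?c (gamma_mat m 0)"] using q quat_mat_eq[OF assms(1) _ assms(3)] by simp
  also have "\<dots> = ?M ?c (?M (?M (gamma_mat m 0) (gamma_mat m 0)) (conj_mat m)) a b"
    by (simp add: mat_prod_assoc_fun)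
  also have "\<dots> = ?M ?c (conj_mat m) a b"
  proof (rule mat_prod_cong)
    fix c assume c: "c \<in> bit_lists m"
    have "?M (?M (gamma_mat m 0) (gamma_mat m 0)) (conj_mat m) c b = ?M kdelta (conj_mat m) c b"
      by (rule mat_prod_cong) (simp_all add: gamma_mat_square c)
    then show "?M (?M (gamma_mat m 0) (gamma_mat m 0)) (conj_mat m) c b = conj_mat m c b" using mat_prod_kdelta[OF c assms(3)] by simp
  qed simp
  also have "\<dots> = kdelta a b" using conj_mat_unitary[OF assms(2,3)] by (simp add: mat_prod_def)
  finally show ?thesis .
qed

text \<open>A point (x, z) stands for the vectors x and y = cnj z; in these terms the map exchanges
  x and y.\<close>

definition conj_swap :: "(nat \<Rightarrow> complex) \<times> (nat \<Rightarrow> complex) \<Rightarrow> (nat \<Rightarrow> complex) \<times> (nat \<Rightarrow> complex)" where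
  "conj_swap y = (\<lambda>i. cnj (snd y i), \<lambda>i. cnj (fst y i))"

text \<open>For l = 0 the sign comes from the form and for the others from the matrix, so the whole
  Clifford symbol changes by the single sign -1.\<close>

lemma quat_mat_clifford:
  assumes "even m" "a \<in> bit_lists m" "b \<in> bit_lists m"
    and sym: "\<And>l. l < 2 * m + 1 \<Longrightarrow> bilin n n cf l (conj_swap y) = (if l = 0 then -1 else 1) * cnj (bilin n n cf l y)"
  shows "mat_prod (bit_lists m) (quat_mat m) (\<lambda>a b. cnj (clifford n n m cf a b (conj_swap y))) a b = - mat_prod (bit_lists m) (\<lambda>a b. clifford n n m cf a b y) (quat_mat m) a b"
    "mat_prod (bit_lists m) (quat_mat m) (\<lambda>a b. clifford n n m cf b a (conj_swap y)) a b = - mat_prod (bit_lists m) (\<lambda>a b. cnj (clifford n n m cf b a y)) (quat_mat m) a b"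
proof -
  let ?M = "mat_prod (bit_lists m)"
  have *: "?M (quat_mat m) (\<lambda>a b. \<Sum>l<2*m+1. ((if l = 0 then -1 else 1) * w l) * cnj (gamma_mat m l a b)) a b =
     - ?M (\<lambda>a b. \<Sum>l<2*m+1. w l * gamma_mat m l a b) (quat_mat m) a b" for w :: "nat \<Rightarrow> complex"
    unfolding mat_prod_sum_left mat_prod_sum_right sum_negf[symmetric]
    by (intro sum.cong refl) (use quat_mat_gamma_mat[OF assms(1) _ assms(2,3)] in simp)
  have 1: "cnj (clifford n n m cf a b (conj_swap y)) = (\<Sum>l<2*m+1. ((if l = 0 then -1 else 1) * bilin n n cf l y) * cnj (gamma_mat m l a b))" for a b
    unfolding clifford_def cnj_sum complex_cnj_mult by (intro sum.cong refl) (use sym in simp)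
  show "?M (quat_mat m) (\<lambda>a b. cnj (clifford n n m cf a b (conj_swap y))) a b = - ?M (\<lambda>a b. clifford n n m cf a b y) (quat_mat m) a b"
    unfolding 1 * by (simp only: clifford_def)
  have 2: "clifford n n m cf b a (conj_swap y) = (\<Sum>l<2*m+1. ((if l = 0 then -1 else 1) * cnj (bilin n n cf l y)) * cnj (gamma_mat m l a b))" for a b
    unfolding clifford_def by (intro sum.cong refl) (simp only: sym lessThan_iff gamma_mat_hermitian[of m _ b a])
  show "?M (quat_mat m) (\<lambda>a b. clifford n n m cf b a (conj_swap y)) a b = - ?M (\<lambda>a b. cnj (clifford n n m cf b a y)) (quat_mat m) a b"
    unfolding 2 * clifford_adjoint ..
qed

lemma sum_norm_sq_conj_swap:
  assumes "\<And>l. l < 2 * m + 1 \<Longrightarrow> bilin n n cf l (conj_swap y) = (if l = 0 then -1 else 1) * cnj (bilin n n cf l y)"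
  shows "sum_norm_sq n n m cf (conj_swap y) = sum_norm_sq n n m cf y"
  unfolding sum_norm_sq_def by (intro sum.cong refl) (use assms in \<open>simp add: norm_mult\<close>)

locale two_spheres_quat = two_spheres_forms n n I x I x m cf c0
  for n and I :: "nat \<Rightarrow> 'p set" and x m cf c0 +
  fixes \<tau> :: "nat \<Rightarrow> 'p \<Rightarrow> 'p"
  assumes m4: "m mod 4 = 2"
    and \<tau>: "bij_betw (\<tau> N) (I N) (I N)"
    and x_\<tau>: "p \<in> I N \<Longrightarrow> x N (\<tau> N p) = (\<lambda>i. cnj (x N p i))"
    and bilin_conj_swap: "l < 2 * m + 1 \<Longrightarrow> bilin n n cf l (conj_swap y) = (if l = 0 then -1 else 1) * cnj (bilin n n cf l y)"
begin

text \<open>Passing \<open>quat_mat\<close> through C and through its adjoint gives the sign -1 each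
  time, so the signs cancel in the product that defines \<open>OmS\<close>.\<close>

lemma quat_mat_OmS:
  assumes ab: "a \<in> bit_lists m" "b \<in> bit_lists m"
  shows "mat_prod (bit_lists m) (quat_mat m) (\<lambda>a b. cnj (OmS a b (conj_swap y))) a b = mat_prod (bit_lists m) (\<lambda>a b. OmS a b y) (quat_mat m) a b"
proof -
  let ?M = "mat_prod (bit_lists m)"
  have ev: "even m" using m4 by presburger
  let ?A = "\<lambda>y a b. cnj (clifford n n m cf b a y)" and ?C = "\<lambda>y a b. clifford n n m cf a b y"
  have O: "OmS a b y = of_real (sum_norm_sq n n m cf y) / 2 * kdelta a b - 1 / 2 * ?M (?A y) (?C y) a b" for a b y
    by (simp add: OmS_def kdelta_def mat_prod_def diff_divide_distrib)
  have L: "sum_norm_sq n n m cf (conj_swap y) = sum_norm_sq n n m cf y" by (rule sum_norm_sq_conj_swap) (rule bilin_conj_swap)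
  have O': "cnj (OmS a b (conj_swap y)) = of_real (sum_norm_sq n n m cf y) / 2 * kdelta a b - 1 / 2 * ?M (\<lambda>a b. ?C (conj_swap y) b a) (\<lambda>a b. cnj (?C (conj_swap y) a b)) a b" for a b
    unfolding O L complex_cnj_diff complex_cnj_mult mat_prod_cnj complex_cnj_cnj by (simp add: kdelta_def)
  have "?M (quat_mat m) (?M (\<lambda>a b. ?C (conj_swap y) b a) (\<lambda>a b. cnj (?C (conj_swap y) a b))) a b =
    ?M (?M (quat_mat m) (\<lambda>a b. ?C (conj_swap y) b a)) (\<lambda>a b. cnj (?C (conj_swap y) a b)) a b" by (simp only: mat_prod_assoc)
  also have "\<dots> = ?M (\<lambda>a b. - 1 * ?M (?A y) (quat_mat m) a b) (\<lambda>a b. cnj (?C (conj_swap y) a b)) a b"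
    by (rule mat_prod_cong) (use quat_mat_clifford(2)[OF ev _ _ bilin_conj_swap] ab in simp_all)
  also have "\<dots> = - ?M (?A y) (?M (quat_mat m) (\<lambda>a b. cnj (?C (conj_swap y) a b))) a b"
    unfolding mat_prod_scale_left by (simp add: mat_prod_assoc)
  also have "?M (?A y) (?M (quat_mat m) (\<lambda>a b. cnj (?C (conj_swap y) a b))) a b = ?M (?A y) (\<lambda>a b. - 1 * ?M (?C y) (quat_mat m) a b) a b"
    by (rule mat_prod_cong) (use quat_mat_clifford(1)[OF ev _ _ bilin_conj_swap] ab in simp_all)
  also have "- \<dots> = ?M (?M (?A y) (?C y)) (quat_mat m) a b"
    unfolding mat_prod_scale_right by (simp add: mat_prod_assoc)
  finally have *: "?M (quat_mat m) (?M (\<lambda>a b. ?C (conj_swap y) b a) (\<lambda>a b. cnj (?C (conj_swap y) a b))) a b = ?M (?M (?A y) (?C y)) (quat_mat m) a b" .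
  have "?M (quat_mat m) (\<lambda>a b. cnj (OmS a b (conj_swap y))) a b =
     of_real (sum_norm_sq n n m cf y) / 2 * ?M (quat_mat m) kdelta a b - 1 / 2 * ?M (quat_mat m) (?M (\<lambda>a b. ?C (conj_swap y) b a) (\<lambda>a b. cnj (?C (conj_swap y) a b))) a b"
    unfolding O' mat_prod_scale_right[symmetric] by (simp only: mat_prod_def right_diff_distrib sum_subtractf)
  also have "\<dots> = of_real (sum_norm_sq n n m cf y) / 2 * ?M kdelta (quat_mat m) a b - 1 / 2 * ?M (?M (?A y) (?C y)) (quat_mat m) a b"
    unfolding * mat_prod_kdelta[OF ab] ..
  also have "\<dots> = ?M (\<lambda>a b. OmS a b y) (quat_mat m) a b"
    unfolding O mat_prod_scale_left[symmetric] by (simp only: mat_prod_def left_diff_distrib sum_subtractf)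
  finally show ?thesis .
qed

text \<open>The antilinear map that sends a polynomial vector f to \<open>quat_mat\<close> times the
  conjugate of f at \<open>conj_swap\<close>; exchanging the two exponent lists realizes it on
  coefficients.\<close>

definition quat_map :: "(bool list \<times> (nat list \<times> nat list) \<Rightarrow> complex) \<Rightarrow> bool list \<times> (nat list \<times> nat list) \<Rightarrow> complex" where
  "quat_map u a = (\<Sum>t\<in>bit_lists m. quat_mat m (fst a) t * cnj (u (t, (snd (snd a), fst (snd a)))))"

lemma monom_val_cnj: "monom_val \<alpha> (\<lambda>i. cnj (z i)) = cnj (monom_val \<alpha> z)"
  by (simp add: monom_val_def)

lemma fld_quat_map: "fld N (\<lambda>_. d) (quat_map u) s y = (\<Sum>t\<in>bit_lists m. quat_mat m s t * cnj (fld N (\<lambda>_. d) u t (conj_swap y)))"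
proof -
  let ?B = "multi_indices (Suc n) (N + d)"
  have "fld N (\<lambda>_. d) (quat_map u) s y = (\<Sum>\<alpha>\<in>?B. \<Sum>\<beta>\<in>?B. (\<Sum>t\<in>bit_lists m. quat_mat m s t * cnj (u (t, (\<beta>, \<alpha>)))) * (monom_val \<alpha> (fst y) * monom_val \<beta> (snd y)))"
    by (simp add: fld_def ev_def quat_map_def bimonomial_def sum.cartesian_product split_beta)
  also have "\<dots> = (\<Sum>\<beta>\<in>?B. \<Sum>\<alpha>\<in>?B. \<Sum>t\<in>bit_lists m. quat_mat m s t * cnj (u (t, (\<beta>, \<alpha>)) * (monom_val \<beta> (fst (conj_swap y)) * monom_val \<alpha> (snd (conj_swap y)))))"
    by (subst sum.swap) (simp add: sum_distrib_left conj_swap_def monom_val_cnj mult_ac)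
  also have "\<dots> = (\<Sum>t\<in>bit_lists m. quat_mat m s t * cnj (fld N (\<lambda>_. d) u t (conj_swap y)))"
    unfolding fld_def ev_def bimonomial_def sum.cartesian_product' sum.swap[of _ _ "bit_lists m"]
    by (simp add: sum_distrib_left sum.swap[of _ "bit_lists m"] sum.cartesian_product')
  finally show ?thesis .
qed

text \<open>Pointwise, \<open>quat_mat\<close> is unitary and intertwines \<open>OmS\<close> with
  its conjugate at the exchanged point. The quadrature is invariant under the exchange, by \<tau>
  and because both factors use the same points.\<close>

lemma hform_quat_map: "hform (ix N (bit_lists m) (\<lambda>_. d)) (fm N OmS) (quat_map u) (quat_map v) = cnj (hform (ix N (bit_lists m) (\<lambda>_. d)) (fm N OmS) u v)"
proof -
  let ?S = "bit_lists m" and ?M = "mat_prod (bit_lists m)"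
  have ev: "even m" using m4 by presburger
  have pt: "(\<Sum>s\<in>?S. cnj (fld N (\<lambda>_. d) (quat_map u) s y) * (\<Sum>t\<in>?S. OmS s t y * fld N (\<lambda>_. d) (quat_map v) t y)) =
    cnj (\<Sum>s\<in>?S. cnj (fld N (\<lambda>_. d) u s (conj_swap y)) * (\<Sum>t\<in>?S. OmS s t (conj_swap y) * fld N (\<lambda>_. d) v t (conj_swap y)))" for y
  proof -
    \<comment> \<open>Vectors are treated as matrices with constant columns, so that the whole
      pairing becomes one product of matrices.\<close>
    let ?u = "\<lambda>s (_::bool list). fld N (\<lambda>_. d) u s (conj_swap y)" and ?v = "\<lambda>s (_::bool list). fld N (\<lambda>_. d) v s (conj_swap y)"
    let ?V = "quat_mat m" and ?e = "[]::bool list"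
    have 1: "?M (\<lambda>a b. OmS a b y) (?M ?V (\<lambda>a b. cnj (?v a b))) s ?e = ?M ?V (?M (\<lambda>a b. cnj (OmS a b (conj_swap y))) (\<lambda>a b. cnj (?v a b))) s ?e" if "s \<in> ?S" for s
      unfolding mat_prod_assoc[symmetric] by (rule mat_prod_cong) (use quat_mat_OmS that in simp_all)
    have 2: "?M (\<lambda>a b. cnj (?V b a)) ?V a b = kdelta a b" if "a \<in> ?S" "b \<in> ?S" for a b
      unfolding mat_prod_def by (rule quat_mat_unitary[OF ev that])
    let ?W = "?M (\<lambda>a b. cnj (OmS a b (conj_swap y))) (\<lambda>a b. cnj (?v a b))"
    have "(\<Sum>s\<in>?S. cnj (fld N (\<lambda>_. d) (quat_map u) s y) * (\<Sum>t\<in>?S. OmS s t y * fld N (\<lambda>_. d) (quat_map v) t y)) =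
      ?M (?M (\<lambda>a b. ?u b a) (\<lambda>a b. cnj (?V b a))) (?M (\<lambda>a b. OmS a b y) (?M ?V (\<lambda>a b. cnj (?v a b)))) ?e ?e"
      unfolding fld_quat_map by (simp add: mat_prod_def mult.commute)
    also have "\<dots> = ?M (?M (\<lambda>a b. ?u b a) (\<lambda>a b. cnj (?V b a))) (?M ?V ?W) ?e ?e"
      by (rule mat_prod_cong) (use 1 in simp_all)
    also have "\<dots> = ?M (\<lambda>a b. ?u b a) (?M (?M (\<lambda>a b. cnj (?V b a)) ?V) ?W) ?e ?e"
      by (simp only: mat_prod_assoc_fun)
    also have "\<dots> = ?M (\<lambda>a b. ?u b a) ?W ?e ?e"
    proof (rule mat_prod_cong)
      fix c assume c: "c \<in> ?S"
      have "?M (?M (\<lambda>a b. cnj (?V b a)) ?V) ?W c ?e = ?M kdelta ?W c ?e"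
        by (rule mat_prod_cong) (use 2 c in simp_all)
      also have "\<dots> = ?W c ?e"
        using c finite_bit_lists by (simp add: mat_prod_def[of _ kdelta] kdelta_def if_distrib[of "\<lambda>x. x * _"] cong: if_cong)
      finally show "?M (?M (\<lambda>a b. cnj (?V b a)) ?V) ?W c ?e = ?W c ?e" .
    qed simp
    also have "\<dots> = cnj (\<Sum>s\<in>?S. cnj (fld N (\<lambda>_. d) u s (conj_swap y)) * (\<Sum>t\<in>?S. OmS s t (conj_swap y) * fld N (\<lambda>_. d) v t (conj_swap y)))"
      by (simp add: mat_prod_def)
    finally show ?thesis .
  qed
  have bij: "bij_betw (\<lambda>p. (\<tau> N (snd p), \<tau> N (fst p))) (PP N) (PP N)"
  proof (rule bij_betw_byWitness[where f' = "\<lambda>p. (inv_into (I N) (\<tau> N) (snd p), inv_into (I N) (\<tau> N) (fst p))"])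
    show "\<forall>p\<in>PP N. (inv_into (I N) (\<tau> N) (snd (\<tau> N (snd p), \<tau> N (fst p))), inv_into (I N) (\<tau> N) (fst (\<tau> N (snd p), \<tau> N (fst p)))) = p"
      using bij_betw_inv_into_left[OF \<tau>[of N]] by auto
    show "\<forall>p\<in>PP N. (\<tau> N (snd (inv_into (I N) (\<tau> N) (snd p), inv_into (I N) (\<tau> N) (fst p))), \<tau> N (fst (inv_into (I N) (\<tau> N) (snd p), inv_into (I N) (\<tau> N) (fst p)))) = p"
      using bij_betw_inv_into_right[OF \<tau>[of N]] by auto
    show "(\<lambda>p. (\<tau> N (snd p), \<tau> N (fst p))) ` PP N \<subseteq> PP N"
      using bij_betwE[OF \<tau>[of N]] by auto
    show "(\<lambda>p. (inv_into (I N) (\<tau> N) (snd p), inv_into (I N) (\<tau> N) (fst p))) ` PP N \<subseteq> PP N"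
      using bij_betwE[OF bij_betw_inv_into[OF \<tau>[of N]]] by auto
  qed
  have fl: "pp N (\<tau> N (snd p), \<tau> N (fst p)) = conj_swap (pp N p)" if "p \<in> PP N" for p
    using that by (auto simp: conj_swap_def x_\<tau>)
  let ?F = "\<lambda>y. cnj (\<Sum>s\<in>?S. cnj (fld N (\<lambda>_. d) u s y) * (\<Sum>t\<in>?S. OmS s t y * fld N (\<lambda>_. d) v t y))"
  have "hform (ix N ?S (\<lambda>_. d)) (fm N OmS) (quat_map u) (quat_map v) = (\<Sum>p\<in>PP N. ?F (conj_swap (pp N p)))"
    unfolding hform_fm[OF finite_bit_lists] pt ..
  also have "\<dots> = (\<Sum>p\<in>PP N. ?F (pp N (\<tau> N (snd p), \<tau> N (fst p))))"
    by (intro sum.cong refl) (simp only: fl)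
  also have "\<dots> = (\<Sum>p\<in>PP N. ?F (pp N p))"
    by (rule sum.reindex_bij_betw[OF bij, of "\<lambda>p. ?F (pp N p)"])
  also have "\<dots> = cnj (hform (ix N ?S (\<lambda>_. d)) (fm N OmS) u v)"
    unfolding hform_fm[OF finite_bit_lists] cnj_sum ..
  finally show ?thesis .
qed

lemma quat_map_quat_map:
  assumes "a \<in> ix N (bit_lists m) dg"
  shows "quat_map (quat_map u) a = - u a"
proof -
  obtain s \<alpha> \<beta> where a: "a = (s, (\<alpha>, \<beta>))" "s \<in> bit_lists m" using assms by (auto simp: ix_def)
  let ?w = "\<lambda>(t::bool list) (_::bool list). u (t, (\<alpha>, \<beta>))"
  have "quat_map (quat_map u) a = mat_prod (bit_lists m) (quat_mat m) (mat_prod (bit_lists m) (\<lambda>a b. cnj (quat_mat m a b)) ?w) s []"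
    by (simp add: quat_map_def a mat_prod_def)
  also have "\<dots> = mat_prod (bit_lists m) (mat_prod (bit_lists m) (quat_mat m) (\<lambda>a b. cnj (quat_mat m a b))) ?w s []"
    by (simp only: mat_prod_assoc)
  also have "\<dots> = mat_prod (bit_lists m) (\<lambda>a b. -1 * kdelta a b) ?w s []"
    by (rule mat_prod_cong) (use quat_mat_square[OF m4 a(2)] in simp_all)
  also have "\<dots> = - u a"
    unfolding mat_prod_scale_left using a finite_bit_lists by (simp add: mat_prod_def kdelta_def if_distrib[of "\<lambda>x. x * _"] cong: if_cong)
  finally show ?thesis .
qed

lemma even_inertia:
  assumes "inertia (ix N (bit_lists m) (\<lambda>_. d)) (fm N OmS) k" "nondeg (ix N (bit_lists m) (\<lambda>_. d)) (fm N OmS)"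
  shows "even k"
  by (rule inertia_even[OF finite_ix[OF finite_bit_lists] hermitian_fm[OF symb_OmS] assms(2) hform_quat_map quat_map_quat_map assms(1)])

end

subsection \<open>Determination of the index\<close>

text \<open>Up to sign the finite difference of order s of g at j.\<close>

definition altsum :: "nat \<Rightarrow> (nat \<Rightarrow> real) \<Rightarrow> nat \<Rightarrow> real" where
  "altsum s g j = (\<Sum>i\<le>s. (-1) ^ i * real (s choose i) * g (j + i))"

lemma altsum_Suc: "altsum (Suc s) g j = altsum s (\<lambda>x. g x - g (Suc x)) j"
proof -
  have "altsum (Suc s) g j = g j + (\<Sum>i\<le>s. (-1) ^ Suc i * real ((s choose Suc i) + (s choose i)) * g (j + Suc i))"
    unfolding altsum_def sum.atMost_Suc_shift by (simp add: add.commute)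
  also have "\<dots> = (g j + (\<Sum>i\<le>s. (-1) ^ Suc i * real (s choose Suc i) * g (j + Suc i))) - (\<Sum>i\<le>s. (-1) ^ i * real (s choose i) * g (j + Suc i))"
    by (simp add: algebra_simps sum.distrib sum_subtractf sum_negf)
  also have "g j + (\<Sum>i\<le>s. (-1) ^ Suc i * real (s choose Suc i) * g (j + Suc i)) = (\<Sum>i\<le>Suc s. (-1) ^ i * real (s choose i) * g (j + i))"
    unfolding sum.atMost_Suc_shift by simp
  also have "\<dots> = (\<Sum>i\<le>s. (-1) ^ i * real (s choose i) * g (j + i))" by simp
  finally show ?thesis by (simp add: altsum_def algebra_simps sum_subtractf)
qed

lemma altsum_linear: "altsum s (\<lambda>x. \<Sum>i\<in>A. c i * g i x) j = (\<Sum>i\<in>A. c i * altsum s (g i) j)"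
  unfolding altsum_def sum_distrib_left by (subst sum.swap) (simp add: mult_ac)

lemma altsum_diff: "altsum s (\<lambda>x. f x - g x) j = altsum s f j - altsum s g j"
  by (simp add: altsum_def right_diff_distrib sum_subtractf)

lemma altsum_binomial: "k < s \<Longrightarrow> altsum s (\<lambda>x. real (x + a choose k)) j = 0"
proof (induction s arbitrary: k)
  case (Suc s)
  show ?case
  proof (cases k)
    case 0
    then show ?thesis unfolding altsum_Suc by (simp add: altsum_def)
  next
    case k: (Suc k')
    then have "altsum (Suc s) (\<lambda>x. real (x + a choose k)) j = altsum s (\<lambda>x. \<Sum>i\<in>{0::nat}. (- 1) * real (x + a choose k')) j"
      unfolding altsum_Suc by simp
    also have "\<dots> = 0" unfolding altsum_linear using Suc k by simp
    finally show ?thesis .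
  qed
qed simp

text \<open>The polynomial solution f of f x + f (x + 1) = (x + a choose k). With the difference
  operator \<Delta> the left side is (2 + \<Delta>) f; the inverse is a geometric series, finite
  here because \<Delta> lowers k by one.\<close>

definition half_sum :: "nat \<Rightarrow> nat \<Rightarrow> nat \<Rightarrow> real" where
  "half_sum a k x = (\<Sum>i\<le>k. (-1) ^ (k - i) * (1/2) ^ (k - i + 1) * real (x + a choose i))"

lemma half_sum_Suc: "half_sum a (Suc k) x = (real (x + a choose Suc k) - half_sum a k x) / 2"
proof -
  have "(\<Sum>i\<le>k. (-1) ^ (Suc k - i) * (1/2) ^ (Suc k - i + 1) * real (x + a choose i)) =
    (\<Sum>i\<le>k. - (1/2) * ((-1) ^ (k - i) * (1/2) ^ (k - i + 1) * real (x + a choose i)))"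
    by (intro sum.cong refl) (simp add: Suc_diff_le)
  then show ?thesis by (simp add: half_sum_def sum_distrib_left[symmetric] sum_divide_distrib[symmetric] sum_negf)
qed

lemma half_sum_add: "half_sum a k x + half_sum a k (Suc x) = real (x + a choose k)"
proof (induction k)
  case (Suc k)
  then show ?case unfolding half_sum_Suc by (simp add: field_simps)
qed (simp add: half_sum_def)

text \<open>The binomial theorem for (-2 + 1)^a; the sum is complete because a \<le> k.\<close>

lemma half_sum_0:
  assumes "a \<le> k"
  shows "half_sum a k 0 = (-1) ^ (k - a) * (1/2) ^ (k + 1)"
proof -
  have "half_sum a k 0 = (\<Sum>i\<le>k. (-1) ^ k * (1/2) ^ (k + 1) * (real (a choose i) * (-2) ^ i))"
    unfolding half_sum_def
  proof (intro sum.cong refl)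
    fix i assume i: "i \<in> {..k}"
    have A: "(-1::real) ^ k * (-1) ^ i = (-1) ^ (k - i)" using i by (simp add: minus_one_power_iff)
    have B: "(1/2::real) ^ (k - i + 1) = (1/2) ^ (k + 1) * 2 ^ i"
    proof -
      have "k + 1 = (k - i + 1) + i" using i by simp
      then have "(1/2::real) ^ (k + 1) * 2 ^ i = (1/2) ^ (k - i + 1) * ((1/2) ^ i * 2 ^ i)"
        by (metis power_add mult.assoc)
      then show ?thesis by (simp add: power_one_over)
    qed
    have C: "(-2::real) ^ i = (-1) ^ i * 2 ^ i" by (simp flip: power_mult_distrib)
    have "(-1) ^ k * (1/2) ^ (k + 1) * (real (a choose i) * (-2) ^ i) = ((-1) ^ k * (-1) ^ i) * ((1/2) ^ (k + 1) * 2 ^ i) * real (a choose i)"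
      unfolding C by (simp only: mult_ac)
    then show "(-1) ^ (k - i) * (1/2) ^ (k - i + 1) * real (0 + a choose i) =
      (-1) ^ k * (1/2) ^ (k + 1) * (real (a choose i) * (-2) ^ i)"
      unfolding A B[symmetric] by (simp only: add_0)
  qed
  also have "\<dots> = (-1) ^ k * (1/2) ^ (k + 1) * (\<Sum>i\<le>k. real (a choose i) * (-2) ^ i)"
    by (simp add: sum_distrib_left)
  also have "(\<Sum>i\<le>k. real (a choose i) * (-2) ^ i) = (\<Sum>i\<le>a. real (a choose i) * (-2) ^ i)"
    by (rule sum.mono_neutral_right) (use assms in auto)
  also have "\<dots> = (-2 + 1) ^ a" unfolding binomial_ring by simp
  also have "(-1) ^ k * (1/2) ^ (k + 1) * (-2 + 1) ^ a = (-1) ^ (k - a) * (1/2::real) ^ (k + 1)"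
    using assms by (simp add: minus_one_power_iff)
  finally show ?thesis .
qed

text \<open>Expands the product in the binomials \<open>(x + a) choose k\<close>, for which
  \<open>half_sum\<close> inverts the two-term recursion: Vandermonde for the first factor, then
  regrouping of (x choose i) * (x + a choose a).\<close>

lemma binomial_product:
  "((x + n) choose n) * ((x + a) choose a) = (\<Sum>i\<le>n. (n choose i) * ((a + i) choose i) * ((x + a) choose (a + i)))"
proof -
  have "(x + n) choose n = (\<Sum>i\<le>n. (x choose i) * (n choose (n - i)))"
    by (rule vandermonde[symmetric])
  also have "\<dots> = (\<Sum>i\<le>n. (n choose i) * (x choose i))"
    by (intro sum.cong refl) (simp flip: binomial_symmetric)
  finally have "((x + n) choose n) * ((x + a) choose a) = (\<Sum>i\<le>n. (n choose i) * ((x choose i) * ((x + a) choose a)))"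
    by (simp add: sum_distrib_left sum_distrib_right mult_ac)
  moreover have "(x choose i) * ((x + a) choose a) = ((a + i) choose i) * ((x + a) choose (a + i))" for i
  proof (cases "i \<le> x")
    case True
    then have "(x + a choose (a + i)) * (a + i choose a) = (x + a choose a) * (x choose i)"
      using choose_mult[of a "a + i" "x + a"] by simp
    then show ?thesis using binomial_symmetric[of a "a + i"] by (simp add: mult.commute)
  qed (simp add: binomial_eq_0)
  ultimately show ?thesis by (simp add: mult.assoc)
qed

text \<open>The polynomial solution of f x + f (x + 1) = dimension of bidegree (x, x). The number of
  positive squares is 2^m times it, once \<open>index_at_0\<close> has excluded an alternating
  error.\<close>

definition index_poly :: "nat \<Rightarrow> nat \<Rightarrow> nat \<Rightarrow> real" where
  "index_poly n a x = (\<Sum>i\<le>n. real ((n choose i) * ((a + i) choose i)) * half_sum a (a + i) x)"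

lemma index_poly_add: "index_poly n a x + index_poly n a (Suc x) = real (((x + n) choose n) * ((x + a) choose a))"
  unfolding index_poly_def sum.distrib[symmetric] distrib_left[symmetric] half_sum_add binomial_product by simp

lemma altsum_index_poly:
  assumes "n + a < s"
  shows "altsum s (index_poly n a) j = 0"
proof -
  have "altsum s (half_sum a k) j = 0" if "k < s" for k
  proof -
    have "altsum s (half_sum a k) j = (\<Sum>i\<le>k. (-1) ^ (k - i) * (1/2) ^ (k - i + 1) * altsum s (\<lambda>x. real (x + a choose i)) j)"
      unfolding half_sum_def[abs_def] altsum_linear ..
    also have "\<dots> = 0" using that by (intro sum.neutral) (auto simp: altsum_binomial)
    finally show ?thesis .
  qed
  then show ?thesis unfolding index_poly_def[abs_def] altsum_linear using assms by simp
qed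

section \<open>The value of the index polynomial at 0 and the descent to it\<close>

lemma coeff_linear_power_binomial: "coeff ([:1, c:] ^ k) i = of_nat (k choose i) * c ^ i" for c :: "'a::comm_ring_1"
proof -
  have "[:1, c:] ^ k = (monom c 1 + 1) ^ k" by (simp add: monom_altdef one_pCons)
  also have "\<dots> = (\<Sum>j\<le>k. of_nat (k choose j) * monom c 1 ^ j)" by (simp add: binomial_ring)
  also have "\<dots> = (\<Sum>j\<le>k. monom (of_nat (k choose j) * c ^ j) j)"
    by (simp add: monom_power of_nat_poly smult_monom)
  finally have "coeff ([:1, c:] ^ k) i = (\<Sum>j\<le>k. coeff (monom (of_nat (k choose j) * c ^ j) j) i)"
    by (simp add: coeff_sum)
  also have "\<dots> = of_nat (k choose i) * c ^ i"
    by (cases "i \<le> k") (auto simp: binomial_eq_0)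
  finally show ?thesis .
qed

text \<open>A value of a Krawtchouk polynomial. When n is a or a + 1 the powers of 1 + t and 1 - t
  combine to a power of 1 - t^2, which makes it explicit.\<close>

definition index_coeff :: "nat \<Rightarrow> nat \<Rightarrow> int" where
  "index_coeff n a = coeff ([:1, 1:] ^ a * [:1, -1:] ^ n) a"

text \<open>Write (a + i choose a) as a coefficient of (1 + t)^(a + i). The sum over i becomes (1 +
  t)^a (1 - (1 + t) / 2)^n, whose second base is (1 - t) / 2.\<close>

lemma index_poly_0: "2 ^ (n + a + 1) * index_poly n a 0 = real_of_int (index_coeff n a)"
proof -
  have "index_poly n a 0 = (1/2) ^ (a + 1) * (\<Sum>i\<le>n. real (n choose i) * (-1/2) ^ i * real ((a + i) choose a))"
    unfolding index_poly_def sum_distrib_left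
  proof (intro sum.cong refl)
    fix i
    have "(a + i choose i) = (a + i choose a)" using binomial_symmetric[of a "a + i"] by simp
    moreover have "(-1/2::real) ^ i = (-1) ^ i * (1/2) ^ i" by (simp flip: power_mult_distrib)
    ultimately show "real ((n choose i) * (a + i choose i)) * half_sum a (a + i) 0 =
      (1/2) ^ (a + 1) * (real (n choose i) * (-1/2) ^ i * real (a + i choose a))"
      by (simp add: half_sum_0 power_add)
  qed
  also have "(\<Sum>i\<le>n. real (n choose i) * (-1/2) ^ i * real ((a + i) choose a)) =
    coeff (\<Sum>i\<le>n. smult (real (n choose i) * (-1/2) ^ i) ([:1, 1:] ^ (a + i))) a"
    by (simp add: coeff_sum coeff_linear_power_binomial)
  also have "(\<Sum>i\<le>n. smult (real (n choose i) * (-1/2) ^ i) ([:1, 1:] ^ (a + i))) =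
    [:1, 1:] ^ a * (\<Sum>i\<le>n. of_nat (n choose i) * (smult (-1/2) [:1, 1:]) ^ i)"
    unfolding sum_distrib_left
  proof (intro sum.cong refl)
    fix i
    have "of_nat k * q = smult (real k) q" for k and q :: "real poly" by (simp add: of_nat_poly)
    then show "smult (real (n choose i) * (-1/2) ^ i) ([:1, 1:] ^ (a + i)) = [:1, 1:] ^ a * (of_nat (n choose i) * (smult (-1/2) [:1, 1:]) ^ i)"
      by (simp only: smult_power power_add smult_smult mult_smult_right) (simp only: mult.commute)
  qed
  also have "(\<Sum>i\<le>n. of_nat (n choose i) * (smult (-1/2) [:1, 1::real:]) ^ i) = (smult (-1/2) [:1, 1:] + 1) ^ n"
    by (simp add: binomial_ring)
  also have "smult (-1/2) [:1, 1:] + 1 = smult (1/2) [:1, -1::real:]" by (simp add: one_pCons)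
  also have "coeff ([:1, 1:] ^ a * smult (1/2) [:1, -1::real:] ^ n) a = (1/2) ^ n * coeff ([:1, 1:] ^ a * [:1, -1::real:] ^ n) a"
    by (simp only: smult_power mult_smult_right coeff_smult)
  also have "coeff ([:1, 1:] ^ a * [:1, -1::real:] ^ n) a = real_of_int (index_coeff n a)"
    unfolding index_coeff_def coeff_mult coeff_linear_power_binomial by simp
  finally show ?thesis by (simp add: power_add power_one_over)
qed

text \<open>Let e be the difference of z and the polynomial solution g. The recursion gives e j =
  (-1)^j * e 0, and since differences of order s kill g, the Koszul relation becomes 2 * e 0 * 2^s =
  0. So z agrees with g on the window, and g is followed down to 0.\<close>

theorem index_at_0:
  fixes z :: "nat \<Rightarrow> int" and q :: int and M :: nat
  assumes s: "n + a < s"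
    and rec: "\<And>j. j \<le> s \<Longrightarrow> z j + z (Suc j) = int (M * (((N + j + n) choose n) * ((N + j + a) choose a)))"
    and kos: "(\<Sum>i\<le>s. (-1) ^ i * int (s choose i) * (2 * z i - int (M * (((N + i + n) choose n) * ((N + i + a) choose a))))) = 0"
    and q: "\<And>j. j \<le> s \<Longrightarrow> q dvd z j"
  shows "\<exists>G. q dvd G \<and> int M * index_coeff n a = 2 ^ (n + a + 1) * G"
proof -
  define g where "g x = real M * index_poly n a x" for x
  define e where "e i = real_of_int (z i) - g (N + i)" for i
  have g_add: "g x + g (Suc x) = real (M * (((x + n) choose n) * ((x + a) choose a)))" for x
    unfolding g_def distrib_left[symmetric] index_poly_add by simp
  have g_alt: "altsum s g j = 0" for j
    using altsum_linear[of s "\<lambda>_. real M" "\<lambda>_. index_poly n a" "{0::nat}" j] altsum_index_poly[OF s]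
    by (simp add: g_def[abs_def])
  have e_Suc: "e (Suc j) = - e j" if "j \<le> s" for j
    using arg_cong[OF rec[OF that], of real_of_int] g_add[of "N + j"] by (simp add: e_def)
  have e_eq: "e j = (-1) ^ j * e 0" if "j \<le> s" for j
    using that by (induction j) (auto simp: e_Suc)
  have "0 = real_of_int (\<Sum>i\<le>s. (-1) ^ i * int (s choose i) * (2 * z i - int (M * (((N + i + n) choose n) * ((N + i + a) choose a)))))"
    unfolding kos by simp
  also have "\<dots> = (\<Sum>i\<le>s. (-1) ^ i * real (s choose i) * (2 * real_of_int (z i) - (g (N + i) + g (Suc (N + i)))))"
    unfolding g_add by simp
  also have "\<dots> = (\<Sum>i\<le>s. (-1) ^ i * real (s choose i) * (2 * e i) + (-1) ^ i * real (s choose i) * (g (N + i) - g (Suc (N + i))))"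
    unfolding e_def by (intro sum.cong refl) algebra
  also have "\<dots> = (\<Sum>i\<le>s. 2 * e 0 * real (s choose i)) + altsum (Suc s) g N"
  proof -
    have "(-1) ^ i * real (s choose i) * (2 * e i) = 2 * e 0 * real (s choose i)" if "i \<le> s" for i
      by (subst e_eq[OF that]) (simp add: minus_one_power_iff)
    then have "(\<Sum>i\<le>s. (-1) ^ i * real (s choose i) * (2 * e i)) = (\<Sum>i\<le>s. 2 * e 0 * real (s choose i))"
      by (intro sum.cong refl) auto
    then show ?thesis unfolding sum.distrib altsum_Suc by (simp add: altsum_def)
  qed
  also have "altsum (Suc s) g N = altsum s g N - altsum s (\<lambda>x. g (Suc x)) N"
    unfolding altsum_Suc by (rule altsum_diff)
  also have "altsum s (\<lambda>x. g (Suc x)) N = altsum s g (Suc N)" by (simp add: altsum_def)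
  also have "(\<Sum>i\<le>s. 2 * e 0 * real (s choose i)) = 2 * e 0 * 2 ^ s"
    unfolding sum_distrib_left[symmetric] of_nat_sum[symmetric] choose_row_sum by simp
  finally have "e 0 = 0" by (simp add: g_alt)
  then have zg: "real_of_int (z j) = g (N + j)" if "j \<le> s" for j
    using e_eq[OF that] by (simp add: e_def)
  \<comment> \<open>The vanishing difference of order s has leading coefficient 1, so
    \<open>g j\<close> is an integer combination of the next s values; integrality and divisibility
    by q descend from the window.\<close>
  have down: "\<exists>G. q dvd G \<and> real_of_int G = g j" if "j \<le> N + s" for j
    using that
  proof (induction "N + s - j" arbitrary: j rule: less_induct)
    case less
    show ?case
    proof (cases "N \<le> j")
      case True
      then have "q dvd z (j - N) \<and> real_of_int (z (j - N)) = g j"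
        using zg[of "j - N"] q[of "j - N"] less.prems by auto
      then show ?thesis by blast
    next
      case False
      have "\<exists>G. q dvd G \<and> real_of_int G = g (j + i)" if "i \<in> {1..s}" for i
        using less.hyps[of "j + i"] that False by auto
      then have "\<forall>i\<in>{1..s}. \<exists>G. q dvd G \<and> real_of_int G = g (j + i)" by blast
      from bchoice[OF this] obtain G where G': "\<forall>i\<in>{1..s}. q dvd G i \<and> real_of_int (G i) = g (j + i)" by blast
      then have G: "q dvd G i" "real_of_int (G i) = g (j + i)" if "i \<in> {1..s}" for i
        using that by blast+
      let ?G = "\<Sum>i\<in>{1..s}. (-1) ^ i * int (s choose i) * G i"
      have "0 = altsum s g j" using g_alt by simp
      also have "\<dots> = g j + (\<Sum>i\<in>{1..s}. (-1) ^ i * real (s choose i) * g (j + i))"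
        unfolding altsum_def atMost_atLeast0 by (subst sum.atLeast_Suc_atMost) auto
      also have "(\<Sum>i\<in>{1..s}. (-1) ^ i * real (s choose i) * g (j + i)) = real_of_int ?G"
        using G(2) by simp
      finally have "real_of_int (- ?G) = g j" by simp
      moreover have "q dvd - ?G" using G(1) by (auto intro!: dvd_sum dvd_mult)
      ultimately show ?thesis by blast
    qed
  qed
  obtain G where G: "q dvd G" "real_of_int G = g 0" using down[of 0] by auto
  have "real_of_int (int M * index_coeff n a) = real M * (2 ^ (n + a + 1) * index_poly n a 0)"
    unfolding index_poly_0 by simp
  also have "\<dots> = real_of_int (2 ^ (n + a + 1) * G)" using G(2) by (simp add: g_def)
  finally have "int M * index_coeff n a = 2 ^ (n + a + 1) * G" unfolding of_int_eq_iff .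
  then show ?thesis using G(1) by blast
qed

subsection \<open>Binary digits and central binomial coefficients\<close>

lemma finite_bits: "finite {k. bit (n::nat) k}"
proof (rule finite_subset)
  show "{k. bit n k} \<subseteq> {..<n}"
  proof
    fix k assume "k \<in> {k. bit n k}"
    then have "n div 2 ^ k \<noteq> 0" by (metis bit_iff_odd mem_Collect_eq even_zero)
    then have "2 ^ k \<le> n" by (simp add: div_eq_0_iff)
    then show "k \<in> {..<n}" by (simp add: less_le_trans[OF less_exp])
  qed
qed simp

lemma binary_ones_double: "binary_ones (2 * n) = binary_ones n"
proof -
  have "{k. bit (2 * n) k} = Suc ` {k. bit n k}"
  proof (intro set_eqI)
    fix k show "k \<in> {k. bit (2 * n) k} \<longleftrightarrow> k \<in> Suc ` {k. bit n k}"
      by (cases k) (auto simp: bit_0 bit_Suc)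
  qed
  then show ?thesis by (simp add: binary_ones_def card_image)
qed

lemma binary_ones_double_Suc: "binary_ones (Suc (2 * n)) = Suc (binary_ones n)"
proof -
  have "{k. bit (Suc (2 * n)) k} = insert 0 (Suc ` {k. bit n k})"
  proof (intro set_eqI)
    fix k show "k \<in> {k. bit (Suc (2 * n)) k} \<longleftrightarrow> k \<in> insert 0 (Suc ` {k. bit n k})"
      by (cases k) (auto simp: bit_0 bit_Suc)
  qed
  then show ?thesis by (simp add: binary_ones_def card_image finite_bits)
qed

lemma binary_ones_le: "binary_ones n \<le> n"
proof (induction n rule: less_induct)
  case (less n)
  consider "n = 0" | j where "n = 2 * j" "n \<noteq> 0" | j where "n = Suc (2 * j)"
    by (metis evenE oddE Suc_eq_plus1)
  then show ?case
  proof cases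
    case 1
    then show ?thesis by (simp add: binary_ones_def)
  next
    case 2
    then show ?thesis using less.IH[of j] by (simp add: binary_ones_double)
  next
    case 3
    then show ?thesis using less.IH[of j] by (simp add: binary_ones_double_Suc)
  qed
qed

text \<open>Adding 1 to k turns its trailing ones, whose number is the multiplicity of 2 in k + 1,
  into zeros and the zero above them into a one.\<close>

lemma binary_ones_Suc: "binary_ones (Suc k) + multiplicity 2 (Suc k) = Suc (binary_ones k)"
proof (induction k rule: less_induct)
  case (less k)
  show ?case
  proof (cases "even k")
    case True
    then obtain j where j: "k = 2 * j" by blast
    have "multiplicity 2 (Suc (2 * j)) = 0" by (rule not_dvd_imp_multiplicity_0) simp
    then show ?thesis unfolding j binary_ones_double binary_ones_double_Suc by simp
  next
    case False
    then obtain j where j: "k = Suc (2 * j)" using oddE by fastforce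
    have "multiplicity 2 (2 * Suc j) = Suc (multiplicity 2 (Suc j))"
      by (rule multiplicity_times_same) auto
    moreover have "Suc k = 2 * Suc j" using j by simp
    ultimately show ?thesis using less.IH[of j] binary_ones_double[of "Suc j"] j
      by (simp add: binary_ones_double_Suc)
  qed
qed

text \<open>From (k + 1) (2 k + 2 choose k + 1) = 2 (2 k + 1) (2 k choose k) the multiplicity
  changes by 1 minus that of k + 1, exactly as \<open>binary_ones\<close> does.\<close>

lemma multiplicity_central_binomial: "multiplicity 2 (2 * k choose k) = binary_ones k"
proof (induction k)
  case (Suc k)
  have p: "prime_elem (2::nat)" by simp
  have "Suc k * (2 * Suc k choose Suc k) = 2 * Suc (2 * k) * (2 * k choose k)"
  proof -
    have "Suc k * (Suc (Suc (2 * k)) choose Suc k) = Suc (Suc (2 * k)) * (Suc (2 * k) choose k)"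
      by (rule Suc_times_binomial)
    moreover have "Suc (2 * k) choose k = Suc (2 * k) choose Suc k"
    proof -
      have "Suc (2 * k) - k = Suc k" "k \<le> Suc (2 * k)" by simp_all
      then show ?thesis using binomial_symmetric[of k "Suc (2 * k)"] by simp
    qed
    moreover have "Suc (Suc (2 * k)) = 2 * Suc k" by simp
    moreover have "Suc k * (Suc (2 * k) choose Suc k) = Suc (2 * k) * (2 * k choose k)"
      by (rule Suc_times_binomial)
    ultimately show ?thesis by (metis mult.assoc)
  qed
  then have "multiplicity 2 (Suc k * (2 * Suc k choose Suc k)) = multiplicity 2 (2 * (Suc (2 * k) * (2 * k choose k)))"
    by (simp only: mult.assoc)
  also have "\<dots> = Suc (multiplicity 2 (Suc (2 * k) * (2 * k choose k)))"
    by (rule multiplicity_times_same) auto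
  also have "multiplicity 2 (Suc (2 * k) * (2 * k choose k)) = multiplicity 2 (Suc (2 * k)) + multiplicity 2 (2 * k choose k)"
    by (rule prime_elem_multiplicity_mult_distrib[OF p]) auto
  also have "multiplicity 2 (Suc (2 * k)) = 0" by (rule not_dvd_imp_multiplicity_0) simp
  also have "multiplicity 2 (Suc k * (2 * Suc k choose Suc k)) = multiplicity 2 (Suc k) + multiplicity 2 (2 * Suc k choose Suc k)"
    by (rule prime_elem_multiplicity_mult_distrib[OF p]) (auto simp del: binomial_Suc_Suc)
  finally have "multiplicity 2 (Suc k) + multiplicity 2 (2 * Suc k choose Suc k) = Suc (binary_ones k)"
    using Suc.IH by simp
  then show ?case using binary_ones_Suc[of k] by linarith
qed (simp add: binary_ones_def)

lemma not_dvd_multiplicity: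
  assumes "x \<noteq> 0" "multiplicity 2 x < k"
  shows "\<not> 2 ^ k dvd (x::nat)"
  using assms power_dvd_iff_le_multiplicity[of x 2 k] by auto

lemma coeff_even_power: "coeff ([:1, 0, -1:] ^ k) (2 * j) = (-1) ^ j * int (k choose j)"
    "coeff ([:1, 0, -1:] ^ k) (Suc (2 * j)) = (0::int)"
proof -
  have "[:1, 0, -1::int:] ^ k = (monom (-1) 2 + 1) ^ k"
    by (simp add: monom_altdef one_pCons numeral_2_eq_2)
  also have "\<dots> = (\<Sum>j\<le>k. of_nat (k choose j) * monom (-1) 2 ^ j)" by (simp add: binomial_ring)
  also have "\<dots> = (\<Sum>j\<le>k. monom (int (k choose j) * (-1) ^ j) (2 * j))"
    by (simp add: monom_power of_nat_poly smult_monom)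
  finally have *: "coeff ([:1, 0, -1:] ^ k) i = (\<Sum>j\<le>k. if 2 * j = i then int (k choose j) * (-1) ^ j else 0)" for i
    by (simp add: coeff_sum)
  show "coeff ([:1, 0, -1:] ^ k) (2 * j) = (-1) ^ j * int (k choose j)"
    unfolding * by (cases "j \<le> k") (auto simp: binomial_eq_0)
  have "2 * i \<noteq> Suc (2 * j)" for i by presburger
  then show "coeff ([:1, 0, -1:] ^ k) (Suc (2 * j)) = (0::int)"
    unfolding * by simp
qed

lemma index_coeff_same: "index_coeff n n = coeff ([:1, 0, -1:] ^ n) n"
  by (simp add: index_coeff_def flip: power_mult_distrib)

lemma index_coeff_Suc: "index_coeff (Suc n) n = coeff ([:1, 0, -1:] ^ n) n - (if n = 0 then 0 else coeff ([:1, 0, -1:] ^ n) (n - 1))"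
proof -
  have "index_coeff (Suc n) n = coeff ([:1, -1:] * ([:1, 1:] * [:1, -1:]) ^ n) n"
    unfolding index_coeff_def power_Suc power_mult_distrib by (simp only: mult_ac)
  also have "[:1, 1:] * [:1, -1:] = [:1, 0, -1::int:]" by simp
  finally have *: "index_coeff (Suc n) n = coeff ([:1, -1:] * [:1, 0, -1:] ^ n) n" .
  have "coeff ([:1, -1:] * p) n = coeff p n - (if n = 0 then 0 else coeff p (n - 1))" for p :: "int poly"
    by (cases n) (simp_all add: coeff_pCons)
  then show ?thesis unfolding * .
qed

text \<open>For n = 2 k the coefficient is, up to sign, (2 k choose k), and doubling k does not
  change the number of ones.\<close>

lemma not_dvd_index_coeff_same:
  assumes "even n"
  shows "\<not> 2 ^ Suc (binary_ones n) dvd index_coeff n n"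
proof -
  obtain k where k: "n = 2 * k" using assms by blast
  have "\<not> 2 ^ Suc (binary_ones k) dvd (2 * k choose k)"
    by (rule not_dvd_multiplicity) (simp_all add: multiplicity_central_binomial)
  then have "\<not> int (2 ^ Suc (binary_ones k)) dvd int (2 * k choose k)" unfolding int_dvd_int_iff .
  then show ?thesis
    unfolding index_coeff_same k coeff_even_power binary_ones_double by (simp add: dvd_minus_iff minus_one_power_iff)
qed

text \<open>After the factor (1 - t^2)^n is split off, 1 - t leaves one term of the right parity.
  For odd n = 2 k + 1 it is, up to sign, (2 k + 1 choose k), half of the central binomial
  coefficient of k + 1.\<close>

lemma not_dvd_index_coeff_Suc: "\<not> 2 ^ binary_ones (Suc n) dvd index_coeff (Suc n) n"
proof (cases "even n")
  case True
  then obtain k where k: "n = 2 * k" by blast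
  have "coeff ([:1, 0, -1:] ^ (2 * k)) (2 * k - 1) = (0::int)" if "k \<noteq> 0"
    using that coeff_even_power(2)[of "2 * k" "k - 1"] by (cases k) auto
  then have "index_coeff (Suc n) n = index_coeff n n" unfolding index_coeff_Suc index_coeff_same k by auto
  then show ?thesis using not_dvd_index_coeff_same[OF True] by (simp add: k binary_ones_double binary_ones_double_Suc)
next
  case False
  then obtain k where k: "n = Suc (2 * k)" using oddE by fastforce
  have "coeff ([:1, 0, -1:] ^ Suc (2 * k)) (Suc (2 * k)) = (0::int)" by (rule coeff_even_power)
  moreover have "coeff ([:1, 0, -1:] ^ Suc (2 * k)) (2 * k) = (-1) ^ k * int (Suc (2 * k) choose k)"
    by (rule coeff_even_power)
  ultimately have index_coeff: "index_coeff (Suc n) n = - ((-1) ^ k * int (Suc (2 * k) choose k))"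
    unfolding index_coeff_Suc k by simp
  have c: "2 * Suc k choose Suc k = 2 * (Suc (2 * k) choose k)"
    using binomial_symmetric[of k "Suc (2 * k)"] by (simp add: Suc_diff_le)
  have "multiplicity 2 (2 * (Suc (2 * k) choose k)) = Suc (multiplicity 2 (Suc (2 * k) choose k))"
    by (rule multiplicity_times_same) (auto simp del: binomial_Suc_Suc)
  then have "Suc (multiplicity 2 (Suc (2 * k) choose k)) = binary_ones (Suc k)"
    using multiplicity_central_binomial[of "Suc k"] unfolding c by simp
  then have "\<not> 2 ^ binary_ones (Suc k) dvd (Suc (2 * k) choose k)"
    by (intro not_dvd_multiplicity) (auto simp del: binomial_Suc_Suc)
  then have "\<not> int (2 ^ binary_ones (Suc k)) dvd int (Suc (2 * k) choose k)" unfolding int_dvd_int_iff .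
  moreover have "binary_ones (Suc n) = binary_ones (Suc k)"
    using binary_ones_double[of "Suc k"] by (simp add: k)
  ultimately show ?thesis unfolding index_coeff by (simp add: minus_one_power_iff del: binomial_Suc_Suc)
qed

subsection \<open>Nonexistence of elliptic families of forms\<close>

text \<open>The number q is 1 in general and 2 in the quaternionic case. The order s of the
  differences is the number of Segre coordinates, which exceeds the degree n + n' of the index
  polynomial.\<close>

lemma (in two_spheres_forms) index_divides:
  assumes q: "\<And>N a k. inertia (ix N (bit_lists m) (\<lambda>_. a)) (fm N OmS) k \<Longrightarrow> nondeg (ix N (bit_lists m) (\<lambda>_. a)) (fm N OmS) \<Longrightarrow> q dvd int k"
  shows "\<exists>G. q dvd G \<and> 2 ^ m * index_coeff n n' = 2 ^ (n + n' + 1) * G"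
proof -
  let ?s = "Suc n * Suc n'"
  have "card EE = ?s" by (simp add: card_cartesian_product)
  from window[OF this, of ?s] obtain N z where
    z: "\<And>a. a \<le> ?s \<Longrightarrow> inertia (ix N (bit_lists m) (\<lambda>_. a)) (fm N OmS) (z a) \<and> nondeg (ix N (bit_lists m) (\<lambda>_. a)) (fm N OmS) \<and>
      z a + z (Suc a) = card (bit_lists m) * card (BB (N + a))"
    and k: "(\<Sum>i\<le>?s. (-1)^i * int (?s choose i) * (2 * int (z i) - int (card (bit_lists m) * card (BB (N + i))))) = 0"
    by blast
  have "\<exists>G. q dvd G \<and> int (2 ^ m) * index_coeff n n' = 2 ^ (n + n' + 1) * G"
  proof (rule index_at_0[where s = ?s and z = "\<lambda>i. int (z i)" and N = N])
    show "n + n' < ?s" by simp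
    show "int (z j) + int (z (Suc j)) = int (2 ^ m * ((N + j + n choose n) * (N + j + n' choose n')))" if "j \<le> ?s" for j
    proof -
      have "z j + z (Suc j) = 2 ^ m * ((N + j + n choose n) * (N + j + n' choose n'))"
        using z[OF that] unfolding card_bit_lists card_BB by blast
      then show ?thesis by (metis of_nat_add)
    qed
    show "(\<Sum>i\<le>?s. (-1)^i * int (?s choose i) * (2 * int (z i) - int (2 ^ m * ((N + i + n choose n) * (N + i + n' choose n'))))) = 0"
      using k unfolding card_bit_lists card_BB .
    show "q dvd int (z j)" if "j \<le> ?s" for j using z[OF that] q by blast
  qed
  then show ?thesis by simp
qed

lemma quadratures:
  "\<exists>(I :: nat \<Rightarrow> (nat list \<times> (nat \<Rightarrow> nat)) set) x \<tau>. (\<forall>N. quadrature n (2 * N) (1 / real (Suc N)) (I N) (x N)) \<and>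
    (\<forall>N. bij_betw (\<tau> N) (I N) (I N)) \<and> (\<forall>N. \<forall>p\<in>I N. x N (\<tau> N p) = (\<lambda>i. cnj (x N p i)))"
proof -
  have "\<forall>N. \<exists>r. case r of (I :: (nat list \<times> (nat \<Rightarrow> nat)) set, x, \<tau>) \<Rightarrow> quadrature n (2 * N) (1 / real (Suc N)) I x \<and>
    bij_betw \<tau> I I \<and> (\<forall>p\<in>I. x (\<tau> p) = (\<lambda>i. cnj (x p i)))"
  proof
    fix N
    obtain I :: "(nat list \<times> (nat \<Rightarrow> nat)) set" and x \<tau> where h: "finite I"
      "\<forall>p\<in>I. (\<Sum>i<Suc n. (cmod (x p i))\<^sup>2) = 1"
      "\<forall>\<alpha> \<alpha>'. length \<alpha> = Suc n \<longrightarrow> length \<alpha>' = Suc n \<longrightarrow> sum_list \<alpha> \<le> 2 * N \<longrightarrow> sum_list \<alpha>' \<le> 2 * N \<longrightarrow> \<alpha> \<noteq> \<alpha>' \<longrightarrow>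
        (\<Sum>p\<in>I. cnj (monom_val \<alpha> (x p)) * monom_val \<alpha>' (x p)) = 0"
      "\<forall>\<alpha>. length \<alpha> = Suc n \<longrightarrow> sum_list \<alpha> \<le> 2 * N \<longrightarrow> weight I x monom_val \<alpha> > 0"
      "\<forall>\<alpha> i. length \<alpha> = Suc n \<longrightarrow> sum_list \<alpha> \<le> 2 * N \<longrightarrow> i < Suc n \<longrightarrow>
        \<bar>weight I x monom_val (raise i \<alpha>) / weight I x monom_val \<alpha> - real (Suc (\<alpha> ! i)) / real (sum_list \<alpha> + Suc n)\<bar> \<le> 1 / real (Suc N)"
      "bij_betw \<tau> I I" "\<forall>p\<in>I. \<forall>i. x (\<tau> p) i = cnj (x p i)"
      using sphere_quadrature[of "1 / real (Suc N)" n "2 * N"] by auto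
    have "quadrature n (2 * N) (1 / real (Suc N)) I x"
      unfolding quadrature_def usphere_def mem_Collect_eq using h(1-5) by blast
    then show "\<exists>r. case r of (I :: (nat list \<times> (nat \<Rightarrow> nat)) set, x, \<tau>) \<Rightarrow> quadrature n (2 * N) (1 / real (Suc N)) I x \<and>
        bij_betw \<tau> I I \<and> (\<forall>p\<in>I. x (\<tau> p) = (\<lambda>i. cnj (x p i)))"
      using h(6,7) by (intro exI[of _ "(I, x, \<tau>)"]) (auto simp: fun_eq_iff)
  qed
  then obtain r where r: "\<forall>N. case r N of (I :: (nat list \<times> (nat \<Rightarrow> nat)) set, x, \<tau>) \<Rightarrow> quadrature n (2 * N) (1 / real (Suc N)) I x \<and>
    bij_betw \<tau> I I \<and> (\<forall>p\<in>I. x (\<tau> p) = (\<lambda>i. cnj (x p i)))" by (rule choice[THEN exE])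
  show ?thesis
    by (rule exI[of _ "\<lambda>N. fst (r N)"], rule exI[of _ "\<lambda>N. fst (snd (r N))"], rule exI[of _ "\<lambda>N. snd (snd (r N))"])
      (use r in \<open>simp add: split_beta\<close>)
qed

text \<open>
  Extrapolated to degree 0, the index is \<open>2 ^ m / 2 ^ (n + n' + 1) * index_coeff n n'\<close>. In the next
  theorem its 2-adic valuation is \<open>-1\<close>; in the symmetric case it is 0, although the index is even.
\<close>

theorem no_elliptic_forms:
  assumes "m + binary_ones (Suc n) = 2 * Suc n" "c0 > 0"
    and bound: "\<And>y. y \<in> usphere (Suc n) \<times> usphere n \<Longrightarrow> c0 \<le> (sum_norm_sq (Suc n) n m cf y)\<^sup>2 - (cmod (sum_sq (Suc n) n m cf y))\<^sup>2"
  shows False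
proof -
  obtain I :: "nat \<Rightarrow> (nat list \<times> (nat \<Rightarrow> nat)) set" and x where q: "\<And>N. quadrature (Suc n) (2 * N) (1 / real (Suc N)) (I N) (x N)"
    using quadratures[of "Suc n"] by blast
  obtain I' :: "nat \<Rightarrow> (nat list \<times> (nat \<Rightarrow> nat)) set" and x' where q': "\<And>N. quadrature n (2 * N) (1 / real (Suc N)) (I' N) (x' N)"
    using quadratures[of n] by blast
  interpret two_spheres_forms "Suc n" n I x I' x' m cf c0
    by standard (use q q' assms in auto)
  obtain G where "2 ^ m * index_coeff (Suc n) n = 2 ^ (Suc n + n + 1) * G"
    using index_divides[of 1] by auto
  also have "Suc n + n + 1 = m + binary_ones (Suc n)" using assms(1) by simp
  finally have "index_coeff (Suc n) n = 2 ^ binary_ones (Suc n) * G" by (simp add: power_add)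
  then show False using not_dvd_index_coeff_Suc[of n] by simp
qed

theorem no_elliptic_symmetric_forms:
  assumes "m + binary_ones n = 2 * n + 1" "even n" "m mod 4 = 2" "c0 > 0"
    and bound: "\<And>y. y \<in> usphere n \<times> usphere n \<Longrightarrow> c0 \<le> (sum_norm_sq n n m cf y)\<^sup>2 - (cmod (sum_sq n n m cf y))\<^sup>2"
    and sym: "\<And>l y. l < 2 * m + 1 \<Longrightarrow> bilin n n cf l (conj_swap y) = (if l = 0 then -1 else 1) * cnj (bilin n n cf l y)"
  shows False
proof -
  obtain I :: "nat \<Rightarrow> (nat list \<times> (nat \<Rightarrow> nat)) set" and x \<tau> where q: "\<And>N. quadrature n (2 * N) (1 / real (Suc N)) (I N) (x N)"
    "\<And>N. bij_betw (\<tau> N) (I N) (I N)" "\<And>N p. p \<in> I N \<Longrightarrow> x N (\<tau> N p) = (\<lambda>i. cnj (x N p i))"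
    using quadratures[of n] by blast
  interpret two_spheres_quat n I x m cf c0 \<tau>
    by unfold_locales (fact q(1) q(2) assms(3,4) | erule bound | erule q(3) | erule sym)+
  have "\<exists>G. 2 dvd G \<and> 2 ^ m * index_coeff n n = 2 ^ (n + n + 1) * G"
    by (rule index_divides) (drule (1) even_inertia, simp)
  then obtain G where G: "2 dvd G" "2 ^ m * index_coeff n n = 2 ^ (n + n + 1) * G" by blast
  from G(1) obtain H where H: "G = 2 * H" by blast
  have "n + n + 1 = m + binary_ones n" using assms(1) by linarith
  with G(2) have "2 ^ m * index_coeff n n = 2 ^ (m + binary_ones n) * G" by (simp only:)
  then have "index_coeff n n = 2 ^ Suc (binary_ones n) * H" by (simp add: power_add H)
  then show False using not_dvd_index_coeff_same[OF assms(2)] by simp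
qed

subsection \<open>Rank of the Kronecker sum\<close>

lemma rank_one_ketbra:
  fixes A :: "complex ^ 'n ^ 'm"
  assumes "rank A = 1"
  obtains u v where "A = ketbra u v" "v \<noteq> 0"
proof -
  have "vec.dim (rows A) = 1" using assms unfolding row_rank_def_gen .
  with vec.basis_exists[of "rows A"] obtain B where B: "rows A \<subseteq> vec.span B" "vec.independent B" "card B = 1"
    by metis
  then obtain w where w: "B = {w}" by (auto simp: card_1_singleton_iff)
  have "\<exists>c. row i A = c *s w" for i
    using B(1) unfolding w vec.span_singleton by (auto simp: rows_def)
  then obtain c where c: "\<And>i. row i A = c i *s w" by metis
  show ?thesis
  proof
    show "A = ketbra (\<chi> i. c i) (\<chi> j. cnj (w $ j))"
      using c by (auto simp: ketbra_def vec_eq_iff row_def)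
    have "w \<noteq> 0" using B(2) w vec.dependent_zero by auto
    then show "(\<chi> j. cnj (w $ j)) \<noteq> 0" by (auto simp: vec_eq_iff)
  qed
qed

text \<open>Extend the family to a basis of all matrices; the coordinate functionals of its members
  are the dual family, written out through their values on matrix units.\<close>

lemma independent_family_dual:
  fixes M :: "'i \<Rightarrow> complex ^ 'n ^ 'm"
  assumes "independent_family I M"
  shows "\<exists>g. \<forall>i\<in>I. \<forall>j\<in>I. (\<Sum>a\<in>UNIV. \<Sum>b\<in>UNIV. g j a b * M i $ a $ b) = (if i = j then 1 else 0)"
proof -
  let ?E = "cmat.extend_basis (M ` I)"
  have ind: "cmat.independent (M ` I)" and inj: "inj_on M I"
    using assms by (auto simp: independent_family_def)
  have E: "cmat.independent ?E" "X \<in> cmat.span ?E" for X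
    using cmat.independent_extend_basis[OF ind] cmat.span_extend_basis[OF ind] by auto
  define U where "U a b = (\<chi> a' b'. if a' = a \<and> b' = b then 1 else (0::complex))" for a :: 'm and b :: 'n
  define f where "f j X = cmat.representation ?E X (M j)" for j X
  have exp: "X = (\<Sum>a\<in>UNIV. \<Sum>b\<in>UNIV. cscale (X $ a $ b) (U a b))" for X
  proof -
    have "(\<Sum>a\<in>UNIV. \<Sum>b\<in>UNIV. X $ a $ b * (if k = a \<and> l = b then 1 else 0)) = X $ k $ l" for k l
    proof -
      have "(\<Sum>a\<in>UNIV. \<Sum>b\<in>UNIV. X $ a $ b * (if k = a \<and> l = b then 1 else 0)) = (\<Sum>a\<in>UNIV. if k = a then X $ a $ l else 0)"
        by (intro sum.cong refl) (auto simp: if_distrib[of "\<lambda>x. _ * x"] cong: if_cong)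
      then show ?thesis by simp
    qed
    then show ?thesis by (simp add: vec_eq_iff cscale_def U_def)
  qed
  have lin: "f j X = (\<Sum>a\<in>UNIV. \<Sum>b\<in>UNIV. X $ a $ b * f j (U a b))" for j X
    unfolding f_def by (subst exp[of X])
      (simp add: cmat.representation_sum[OF E(1)] cmat.representation_scale[OF E(1)] E(2))
  show ?thesis
  proof (intro exI[of _ "\<lambda>j a b. f j (U a b)"] ballI)
    fix i j assume ij: "i \<in> I" "j \<in> I"
    have "M i \<in> ?E" using cmat.extend_basis_superset[OF ind] ij by auto
    then have "f j (M i) = (if i = j then 1 else 0)"
      using ij inj unfolding f_def cmat.representation_basis[OF E(1) \<open>M i \<in> ?E\<close>] by (auto dest: inj_onD)
    then show "(\<Sum>a\<in>UNIV. \<Sum>b\<in>UNIV. f j (U a b) * M i $ a $ b) = (if i = j then 1 else 0)"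
      using lin[of j "M i"] by (simp add: mult.commute)
  qed
qed

text \<open>Reindexed, the matrix is a sum of outer products of the vectorized
  \<open>ketbra (v i) (v i)\<close> with the vectorized \<open>ketbra (u i) (u i)\<close>.
  Independence of the u family makes the vectors \<open>q i\<close> independent, and that of the v
  family makes the rows span them.\<close>

lemma rank_kron_sum:
  fixes u :: "nat \<Rightarrow> complex ^ 'k" and v :: "nat \<Rightarrow> complex ^ 'h"
  assumes u: "independent_family {..<r} (\<lambda>i. ketbra (u i) (u i))"
    and v: "independent_family {..<r} (\<lambda>i. ketbra (v i) (v i))"
  shows "rank (\<Sum>i<r. kron (transpose (ketbra (u i) (v i))) (adj (ketbra (u i) (v i)))) = r"
proof -
  obtain f where "\<forall>i\<in>{..<r}. \<forall>j\<in>{..<r}. (\<Sum>a\<in>UNIV. \<Sum>b\<in>UNIV. f j a b * ketbra (u i) (u i) $ a $ b) = (if i = j then 1 else 0)"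
    using independent_family_dual[OF u] by (elim exE)
  then have f: "(\<Sum>a\<in>UNIV. \<Sum>b\<in>UNIV. f j a b * ketbra (u i) (u i) $ a $ b) = (if i = j then 1 else 0)" if "i < r" "j < r" for i j
    using that by blast
  obtain g where "\<forall>i\<in>{..<r}. \<forall>j\<in>{..<r}. (\<Sum>a\<in>UNIV. \<Sum>b\<in>UNIV. g j a b * ketbra (v i) (v i) $ a $ b) = (if i = j then 1 else 0)"
    using independent_family_dual[OF v] by (elim exE)
  then have g: "(\<Sum>a\<in>UNIV. \<Sum>b\<in>UNIV. g j a b * ketbra (v i) (v i) $ a $ b) = (if i = j then 1 else 0)" if "i < r" "j < r" for i j
    using that by blast
  define q where "q i = (\<chi> b. u i $ fst b * cnj (u i $ snd b))" for i
  define M where "M = (\<Sum>i<r. kron (transpose (ketbra (u i) (v i))) (adj (ketbra (u i) (v i))))"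
  have row: "row c M = (\<Sum>i<r. (v i $ snd c * cnj (v i $ fst c)) *s q i)" for c
    by (simp add: vec_eq_iff row_def M_def kron_def q_def ketbra_def adj_def transpose_def mult_ac)
  have q_sum: "(\<Sum>b\<in>UNIV. f j (fst b) (snd b) * q i $ b) = (if i = j then 1 else 0)" if "i < r" "j < r" for i j
    unfolding f[OF that, symmetric] sum.cartesian_product by (simp add: q_def ketbra_def split_beta)
  have inj: "inj_on q {..<r}"
  proof (rule inj_onI)
    fix i j assume ij: "i \<in> {..<r}" "j \<in> {..<r}" "q i = q j"
    then have "(if i = j then 1 else 0) = (\<Sum>b\<in>UNIV. f j (fst b) (snd b) * q j $ b)"
      using q_sum[of i j] by simp
    also have "\<dots> = 1" using q_sum[of j j] ij by simp
    finally show "i = j" by (simp split: if_splits)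
  qed
  have ind: "vec.independent (q ` {..<r})"
  proof
    assume "vec.dependent (q ` {..<r})"
    then obtain c i where ci: "i < r" "c (q i) \<noteq> 0" "(\<Sum>x\<in>q ` {..<r}. c x *s x) = 0"
      by (subst (asm) vec.dependent_finite) auto
    have "0 = (\<Sum>b\<in>UNIV. f i (fst b) (snd b) * (\<Sum>x\<in>q ` {..<r}. c x *s x) $ b)" using ci(3) by simp
    also have "\<dots> = (\<Sum>b\<in>UNIV. \<Sum>k<r. c (q k) * (f i (fst b) (snd b) * q k $ b))"
      by (simp add: sum.reindex[OF inj] sum_distrib_left mult_ac)
    also have "\<dots> = (\<Sum>k<r. c (q k) * (\<Sum>b\<in>UNIV. f i (fst b) (snd b) * q k $ b))"
      by (subst sum.swap) (simp add: sum_distrib_left)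
    also have "\<dots> = (\<Sum>k<r. if k = i then c (q k) else 0)"
      by (intro sum.cong refl) (use q_sum ci(1) in auto)
    also have "\<dots> = c (q i)" using ci(1) by simp
    finally show False using ci(2) by simp
  qed
  have sp1: "rows M \<subseteq> vec.span (q ` {..<r})"
    unfolding rows_def row by (auto intro!: vec.span_sum vec.span_scale intro: vec.span_base)
  have sp2: "q ` {..<r} \<subseteq> vec.span (rows M)"
  proof
    fix x assume "x \<in> q ` {..<r}"
    then obtain j where j: "j < r" "x = q j" by auto
    \<comment> \<open>The dual functional of the v family isolates \<open>q j\<close>. The
      components of c are exchanged because the row coefficient is the entry (snd c, fst c) of
      \<open>ketbra (v i) (v i)\<close>.\<close>
    have "(\<Sum>c\<in>UNIV. g j (snd c) (fst c) *s row c M) = (\<Sum>c\<in>UNIV. \<Sum>i<r. (g j (snd c) (fst c) * (v i $ snd c * cnj (v i $ fst c))) *s q i)"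
      unfolding row vec.scale_sum_right by simp
    also have "\<dots> = (\<Sum>i<r. (\<Sum>c\<in>UNIV. g j (snd c) (fst c) * (v i $ snd c * cnj (v i $ fst c))) *s q i)"
      unfolding vec.scale_sum_left by (rule sum.swap)
    also have "\<dots> = (\<Sum>i<r. if i = j then q i else 0)"
    proof (intro sum.cong refl)
      fix i assume "i \<in> {..<r}"
      then have i: "i < r" by simp
      have "(\<Sum>c\<in>UNIV. g j (snd c) (fst c) * (v i $ snd c * cnj (v i $ fst c))) =
        (\<Sum>a\<in>UNIV. \<Sum>b\<in>UNIV. g j a b * ketbra (v i) (v i) $ a $ b)"
        by (subst sum.swap, subst sum.cartesian_product) (simp add: ketbra_def split_beta)
      then show "(\<Sum>c\<in>UNIV. g j (snd c) (fst c) * (v i $ snd c * cnj (v i $ fst c))) *s q i = (if i = j then q i else 0)"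
        using g[OF i j(1)] by simp
    qed
    also have "\<dots> = q j" using j(1) by simp
    finally have "x = (\<Sum>c\<in>UNIV. g j (snd c) (fst c) *s row c M)" using j(2) by simp
    also have "\<dots> \<in> vec.span (rows M)"
      by (intro vec.span_sum vec.span_scale vec.span_base) (auto simp: rows_def)
    finally show "x \<in> vec.span (rows M)" .
  qed
  have "vec.span (rows M) = vec.span (q ` {..<r})"
    using sp1 sp2 by (simp add: vec.span_eq)
  then have "vec.dim (rows M) = vec.dim (q ` {..<r})"
    by (metis vec.dim_span)
  also have "\<dots> = card (q ` {..<r})" by (rule vec.dim_eq_card_independent[OF ind])
  also have "\<dots> = r" using inj by (simp add: card_image)
  finally show ?thesis unfolding row_rank_def_gen M_def .
qed

subsection \<open>Phase retrieval by rank-one Kraus operators\<close>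

lemma trace_ketbra: "trace (ketbra x y ** M) = cinner y (M *v x)"
proof -
  have "trace (ketbra x y ** M) = (\<Sum>i\<in>UNIV. \<Sum>k\<in>UNIV. x $ i * cnj (y $ k) * M $ k $ i)"
    by (simp add: trace_def matrix_matrix_mult_def ketbra_def)
  also have "\<dots> = cinner y (M *v x)"
    by (subst sum.swap) (simp add: cinner_def matrix_vector_mult_def sum_distrib_left mult_ac)
  finally show ?thesis .
qed

lemma cinner_scale_left: "cinner (c *s x) y = cnj c * cinner x y"
  by (simp add: cinner_def sum_distrib_left mult_ac)

lemma cinner_scale_right: "cinner x (c *s y) = c * cinner x y"
  by (simp add: cinner_def sum_distrib_left mult_ac)

lemma cinner_add_right: "cinner x (y + z) = cinner x y + cinner x z"
  by (simp add: cinner_def algebra_simps sum.distrib)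

lemma cinner_minus_right: "cinner x (- y) = - cinner x y"
  by (simp add: cinner_def sum_negf)

lemma cinner_commute: "cinner y x = cnj (cinner x y)"
  by (simp add: cinner_def mult.commute)

lemma cinner_sum_left: "cinner (\<Sum>i\<in>I. f i) y = (\<Sum>i\<in>I. cinner (f i) y)"
  by (simp add: cinner_def sum_distrib_right) (rule sum.swap)

lemma cinner_sum_right: "cinner y (\<Sum>i\<in>I. f i) = (\<Sum>i\<in>I. cinner y (f i))"
  by (simp add: cinner_def sum_distrib_left) (rule sum.swap)

lemma norm_cinner: "of_real ((norm x)\<^sup>2) = cinner x x"
proof -
  have "(norm x)\<^sup>2 = (\<Sum>i\<in>UNIV. (cmod (x $ i))\<^sup>2)"
    by (simp add: norm_vec_def L2_set_def sum_nonneg)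
  then show ?thesis by (simp add: cinner_def cnj_mult_self)
qed

text \<open>Every outcome depends on x only through the moduli of
  \<open>cinner (v i) x\<close>.\<close>

lemma trace_hs_adjoint_rank_one:
  assumes "kraus_rep \<Phi> r A" "\<And>i. i < r \<Longrightarrow> A i = ketbra (u i) (v i)"
  shows "trace (ketbra x x ** hs_adjoint \<Phi> F) = (\<Sum>i<r. of_real ((cmod (cinner (v i) x))\<^sup>2) * cinner (u i) (F *v u i))"
proof -
  have "trace (ketbra x x ** hs_adjoint \<Phi> F) = (\<Sum>i<r. trace (ketbra x x ** (adj (A i) ** F ** A i)))"
    unfolding hs_adjoint_kraus[OF assms(1)] by (simp add: matrix_mult_sum_right trace_sum)
  also have "\<dots> = (\<Sum>i<r. of_real ((cmod (cinner (v i) x))\<^sup>2) * cinner (u i) (F *v u i))"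
  proof (intro sum.cong refl)
    fix i assume "i \<in> {..<r}"
    then have A: "A i *v x = cinner (v i) x *s u i" using assms(2) by (simp add: ketbra_apply)
    have "trace (ketbra x x ** (adj (A i) ** F ** A i)) = cinner x ((adj (A i) ** F ** A i) *v x)"
      by (rule trace_ketbra)
    also have "\<dots> = cinner x (adj (A i) *v (F *v (A i *v x)))"
      by (simp add: matrix_vector_mul_assoc matrix_mul_assoc)
    also have "\<dots> = cinner (A i *v x) (F *v (A i *v x))"
      by (simp add: cinner_adj[of x])
    also have "\<dots> = (cnj (cinner (v i) x) * cinner (v i) x) * cinner (u i) (F *v u i)"
      unfolding A by (simp add: vector_scalar_commute cinner_scale_left cinner_scale_right)
    finally show "trace (ketbra x x ** (adj (A i) ** F ** A i)) = of_real ((cmod (cinner (v i) x))\<^sup>2) * cinner (u i) (F *v u i)"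
      unfolding cnj_mult_self .
  qed
  finally show ?thesis .
qed

text \<open>The case of the identity in place of F. The moduli of \<open>cinner (v i) x\<close> thus
  determine the norm of x, which permits the normalization in
  \<open>phase_retrievable_forms\<close>.\<close>

lemma norm_trace_preserving:
  assumes "quantum_channel \<Phi>" "kraus_rep \<Phi> r A" "\<And>i. i < r \<Longrightarrow> A i = ketbra (u i) (v i)"
  shows "(norm x)\<^sup>2 = (\<Sum>i<r. (cmod (cinner (v i) x))\<^sup>2 * (norm (u i))\<^sup>2)"
proof -
  have adj: "adj (ketbra x x) = ketbra x x" by (simp add: adj_def ketbra_def transpose_def vec_eq_iff mult.commute)
  have "trace (ketbra x x ** hs_adjoint \<Phi> (mat 1)) = trace (\<Phi> (ketbra x x))"
  proof -
    have "trace (ketbra x x ** hs_adjoint \<Phi> (mat 1)) = (\<Sum>i<r. trace (ketbra x x ** (adj (A i) ** A i)))"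
      unfolding hs_adjoint_kraus[OF assms(2)] by (simp add: matrix_mult_sum_right trace_sum)
    also have "\<dots> = (\<Sum>i<r. trace (A i ** ketbra x x ** adj (A i)))"
      by (intro sum.cong refl) (metis trace_mul_sym matrix_mul_assoc)
    also have "\<dots> = trace (\<Phi> (ketbra x x))"
      using assms(2) by (simp add: kraus_rep_def trace_sum)
    finally show ?thesis .
  qed
  also have "\<dots> = trace (ketbra x x ** mat 1)" using assms(1) by (simp add: quantum_channel_def)
  also have "\<dots> = of_real ((norm x)\<^sup>2)" unfolding trace_ketbra norm_cinner by simp
  finally have "of_real ((norm x)\<^sup>2) = (\<Sum>i<r. of_real ((cmod (cinner (v i) x))\<^sup>2) * cinner (u i) (mat 1 *v u i))"
    by (subst (asm) trace_hs_adjoint_rank_one[OF assms(2,3)]) simp_all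
  also have "\<dots> = of_real (\<Sum>i<r. (cmod (cinner (v i) x))\<^sup>2 * (norm (u i))\<^sup>2)"
    by (simp only: matrix_vector_mul_lid norm_cinner[symmetric] of_real_mult of_real_sum)
  finally show ?thesis unfolding of_real_eq_iff .
qed

lemma ketbra_scale: "ketbra (c *s x) (d *s y) = cscale (c * cnj d) (ketbra x y)"
  by (simp add: ketbra_def cscale_def vec_eq_iff)

text \<open>By polarization x + y and x - y have the same moduli, hence the same norm and, once
  normalized, the same outcomes. Phase retrieval makes their projections equal, so the Hermitian
  part of \<open>ketbra x y\<close> vanishes. As \<open>cinner x y\<close> is real, x or y must be
  0.\<close>

theorem phase_retrievable_forms:
  assumes qc: "quantum_channel \<Phi>" and kr: "kraus_rep \<Phi> r A" and A: "\<And>i. i < r \<Longrightarrow> A i = ketbra (u i) (v i)"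
    and pr: "phase_retrievable \<Phi>"
    and re: "\<And>i. i < r \<Longrightarrow> Re (cinner (v i) x * cnj (cinner (v i) y)) = 0"
    and im: "Im (cinner x y) = 0"
  shows "x = 0 \<or> y = 0"
proof (rule ccontr)
  assume ne: "\<not> (x = 0 \<or> y = 0)"
  define p where "p = x + y"
  define q where "q = x - y"
  have pq: "(cmod (cinner (v i) p))\<^sup>2 = (cmod (cinner (v i) q))\<^sup>2" if "i < r" for i
  proof -
    have q: "cinner (v i) q = cinner (v i) x - cinner (v i) y"
      unfolding q_def using cinner_add_right[of "v i" x "- y"] by (simp add: cinner_minus_right)
    show ?thesis
      using re[OF that] unfolding q p_def cinner_add_right cmod_power2 by (simp add: power2_eq_square algebra_simps)
  qed
  have "(norm p)\<^sup>2 = (norm q)\<^sup>2"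
  proof -
    have "(norm z)\<^sup>2 = (\<Sum>i<r. (cmod (cinner (v i) z))\<^sup>2 * (norm (u i))\<^sup>2)" for z
      by (rule norm_trace_preserving[OF qc kr]) (rule A)
    then show ?thesis using pq by simp
  qed
  then have npq: "norm p = norm q" by simp
  have "norm p \<noteq> 0"
  proof
    assume "norm p = 0"
    then have "p = 0" "q = 0" using npq by simp_all
    then have "p + q = 0" by simp
    then have "2 *s x = 0" by (simp add: p_def q_def vec_eq_iff)
    then show False using ne by (simp add: vec_eq_iff)
  qed
  define s where "s = complex_of_real (1 / norm p)"
  have s: "s \<noteq> 0" using \<open>norm p \<noteq> 0\<close> by (simp add: s_def)
  have nrm: "norm (s *s z) = 1" if "norm z = norm p" for z :: "complex ^ 'a"
  proof -
    have "complex_of_real ((norm (s *s z))\<^sup>2) = cnj s * s * of_real ((norm z)\<^sup>2)"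
      unfolding norm_cinner by (simp add: cinner_scale_left cinner_scale_right)
    also have "\<dots> = of_real ((1 / norm p)\<^sup>2 * (norm p)\<^sup>2)"
      using that by (simp add: s_def power2_eq_square)
    finally have "(norm (s *s z))\<^sup>2 = (1 / norm p)\<^sup>2 * (norm p)\<^sup>2" unfolding of_real_eq_iff .
    also have "\<dots> = 1" using \<open>norm p \<noteq> 0\<close> by (simp add: power_divide)
    finally show ?thesis using power2_eq_1_iff norm_ge_zero by (metis abs_norm_cancel abs_1 power2_eq_iff_nonneg one_power2 zero_le_one)
  qed
  obtain N :: nat and F where F': "\<forall>x y. norm x = 1 \<longrightarrow> norm y = 1 \<longrightarrow>
      (\<forall>j<N. trace (ketbra x x ** hs_adjoint \<Phi> (F j)) = trace (ketbra y y ** hs_adjoint \<Phi> (F j))) \<longrightarrow> ketbra x x = ketbra y y"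
    using pr unfolding phase_retrievable_def by blast
  have "ketbra (s *s p) (s *s p) = ketbra (s *s q) (s *s q)"
  proof (rule F'[rule_format])
    show "norm (s *s p) = 1" "norm (s *s q) = 1" using nrm npq by simp_all
    have tr: "trace (ketbra z z ** hs_adjoint \<Phi> G) = (\<Sum>i<r. of_real ((cmod (cinner (v i) z))\<^sup>2) * cinner (u i) (G *v u i))" for z G
      by (rule trace_hs_adjoint_rank_one[OF kr]) (rule A)
    show "trace (ketbra (s *s p) (s *s p) ** hs_adjoint \<Phi> (F j)) = trace (ketbra (s *s q) (s *s q) ** hs_adjoint \<Phi> (F j))" for j
      unfolding tr cinner_scale_right norm_mult power_mult_distrib using pq by simp
  qed
  then have kb: "ketbra p p = ketbra q q"
    using s unfolding ketbra_scale by (simp add: cscale_def vec_eq_iff)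
  have xy: "x $ i * cnj (y $ j) + y $ i * cnj (x $ j) = 0" for i j
  proof -
    have "p $ i * cnj (p $ j) = q $ i * cnj (q $ j)" using kb by (simp add: ketbra_def vec_eq_iff)
    then have "2 * (x $ i * cnj (y $ j) + y $ i * cnj (x $ j)) = 0"
      unfolding p_def q_def by (simp add: algebra_simps)
    then show ?thesis unfolding mult_eq_0_iff by simp
  qed
  \<comment> \<open>This is where the extra form enters: for x = \<i> y the identity
    \<open>xy\<close> holds with x and y nonzero, but then \<open>cinner x y\<close> is not
    real.\<close>
  define t where "t = Re (cinner x y)"
  have t: "cinner x y = of_real t" using im by (simp add: t_def complex_eq_iff)
  \<comment> \<open>Apply the matrix identity \<open>xy\<close> to the vector y.\<close>
  have tx: "of_real ((norm y)\<^sup>2) * x $ i = - of_real t * y $ i" for i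
  proof -
    have "0 = (\<Sum>j\<in>UNIV. (x $ i * cnj (y $ j) + y $ i * cnj (x $ j)) * y $ j)" unfolding xy by simp
    also have "\<dots> = x $ i * cinner y y + y $ i * cinner x y"
      by (simp add: cinner_def sum_distrib_left sum.distrib algebra_simps)
    finally have "x $ i * of_real ((norm y)\<^sup>2) + y $ i * of_real t = 0" unfolding t norm_cinner by simp
    then show ?thesis by (simp add: mult.commute eq_neg_iff_add_eq_0)
  qed
  have "y $ i * cnj (y $ i) * of_real t = 0" for i
  proof -
    have "0 = of_real ((norm y)\<^sup>2) * (x $ i * cnj (y $ i) + y $ i * cnj (x $ i))" unfolding xy by simp
    also have "\<dots> = (of_real ((norm y)\<^sup>2) * x $ i) * cnj (y $ i) + y $ i * cnj (of_real ((norm y)\<^sup>2) * x $ i)"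
      by (simp add: algebra_simps)
    also have "\<dots> = - 2 * (y $ i * cnj (y $ i) * of_real t)"
      unfolding tx by (simp add: algebra_simps)
    finally show ?thesis by simp
  qed
  moreover have "\<exists>i. y $ i \<noteq> 0" using ne by (auto simp: vec_eq_iff)
  ultimately have "t = 0" by auto
  then have "x $ i = 0" for i using tx[of i] ne by simp
  then show False using ne by (simp add: vec_eq_iff)
qed

subsection \<open>Ellipticity from nonvanishing real parts\<close>

lemma norm_sum_sq_less:
  assumes ne: "\<And>y. y \<in> usphere n \<times> usphere n' \<Longrightarrow> \<exists>l<2 * m + 1. Re (bilin n n' cf l y) \<noteq> 0"
    and y: "y \<in> usphere n \<times> usphere n'"
  shows "cmod (sum_sq n n' m cf y) < sum_norm_sq n n' m cf y"
proof (rule ccontr)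
  assume "\<not> ?thesis"
  moreover have "cmod (sum_sq n n' m cf y) \<le> sum_norm_sq n n' m cf y"
    unfolding sum_sq_def sum_norm_sq_def by (rule order_trans[OF norm_sum]) (simp add: norm_power del: sum.lessThan_Suc)
  ultimately have eq: "cmod (sum_sq n n' m cf y) = sum_norm_sq n n' m cf y" by simp
  obtain x z where xz: "y = (x, z)" "x \<in> usphere n" "z \<in> usphere n'" using y by auto
  define a where "a = sum_sq n n' m cf y"
  \<comment> \<open>A phase with c^2 a = - |a|; multiplying x by it multiplies every form by c. If a
    = 0, then by \<open>eq\<close> all forms vanish and any phase will do.\<close>
  define c where "c = (if a = 0 then 1 else \<i> / csqrt (a / of_real (cmod a)))"
  have c2: "c\<^sup>2 * a = - of_real (cmod a)"
  proof (cases "a = 0")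
    case False
    have "c\<^sup>2 = - 1 / (a / of_real (cmod a))"
      using False by (simp only: c_def if_False power_divide power2_csqrt power2_i)
    then show ?thesis using False by simp
  qed simp
  have c1: "cmod c = 1"
  proof (cases "a = 0")
    case False
    have "cmod (csqrt (a / of_real (cmod a))) = 1"
      using False by (simp add: norm_divide)
    then show ?thesis using False by (simp add: c_def norm_divide)
  qed (simp add: c_def)
  define y' where "y' = (\<lambda>i. c * x i, z)"
  have y': "y' \<in> usphere n \<times> usphere n'"
    using xz c1 by (simp add: y'_def usphere_def norm_mult)
  have L: "bilin n n' cf l y' = c * bilin n n' cf l y" for l
    by (simp add: bilin_def coord_def y'_def xz sum_distrib_left mult_ac del: sum.lessThan_Suc)
  \<comment> \<open>From 2 (Re w)^2 = Re (w^2) + |w|^2, summed over the forms; the choice of c makes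
    the right side 0.\<close>
  have "(\<Sum>l<2*m+1. 2 * (Re (bilin n n' cf l y'))\<^sup>2) = Re (c\<^sup>2 * a) + cmod a"
  proof -
    have "(\<Sum>l<2*m+1. 2 * (Re (bilin n n' cf l y'))\<^sup>2) = (\<Sum>l<2*m+1. Re ((bilin n n' cf l y')\<^sup>2) + (cmod (bilin n n' cf l y'))\<^sup>2)"
    proof (intro sum.cong refl)
      show "2 * (Re (bilin n n' cf l y'))\<^sup>2 = Re ((bilin n n' cf l y')\<^sup>2) + (cmod (bilin n n' cf l y'))\<^sup>2" for l
        unfolding cmod_power2 by (simp add: power2_eq_square)
    qed
    also have "\<dots> = Re (\<Sum>l<2*m+1. (bilin n n' cf l y')\<^sup>2) + (\<Sum>l<2*m+1. (cmod (bilin n n' cf l y'))\<^sup>2)"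
      by (simp only: sum.distrib Re_sum)
    also have "(\<Sum>l<2*m+1. (bilin n n' cf l y')\<^sup>2) = c\<^sup>2 * a"
      by (simp add: L a_def sum_sq_def power_mult_distrib sum_distrib_left del: sum.lessThan_Suc)
    also have "(\<Sum>l<2*m+1. (cmod (bilin n n' cf l y'))\<^sup>2) = cmod a"
      unfolding a_def eq sum_norm_sq_def L norm_mult c1 by simp
    finally show ?thesis .
  qed
  also have "\<dots> = 0" unfolding c2 by simp
  finally have "\<forall>l\<in>{..<2*m+1}. 2 * (Re (bilin n n' cf l y'))\<^sup>2 = 0"
    by (subst (asm) sum_nonneg_eq_0_iff) simp_all
  then have "2 * (Re (bilin n n' cf l y'))\<^sup>2 = 0" if "l < 2 * m + 1" for l
    using that by blast
  then have "Re (bilin n n' cf l y') = 0" if "l < 2 * m + 1" for l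
    using that by simp
  then show False using ne[OF y'] by blast
qed

text \<open>Tychonoff for functions on \<open>nat\<close>: the first n + 1 coordinates lie in a
  disc, and the others are fixed at 0.\<close>

lemma compact_usphere: "compact (usphere n \<inter> {x. \<forall>i. n < i \<longrightarrow> x i = 0})"
proof -
  let ?S = "\<lambda>i. if i < Suc n then cball 0 1 else {0::complex}"
  have "compactin (product_topology (\<lambda>_. euclidean) UNIV) (PiE UNIV ?S)"
    unfolding compactin_PiE by (auto simp: compactin_euclidean_iff)
  then have 1: "compact (PiE UNIV ?S)"
    by (simp add: euclidean_product_topology compactin_euclidean_iff)
  have "continuous_on UNIV (\<lambda>x. \<Sum>i<Suc n. (cmod (x i))\<^sup>2)"
    by (intro continuous_intros continuous_on_product_coordinates)
  then have 2: "closed (usphere n)"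
    unfolding usphere_def by (intro closed_Collect_eq) (auto intro: continuous_intros)
  have "usphere n \<inter> {x. \<forall>i. n < i \<longrightarrow> x i = 0} = PiE UNIV ?S \<inter> usphere n"
  proof (intro equalityI subsetI)
    fix x assume x: "x \<in> usphere n \<inter> {x. \<forall>i. n < i \<longrightarrow> x i = 0}"
    have "cmod (x i) \<le> 1" if "i < Suc n" for i
    proof -
      have "(cmod (x i))\<^sup>2 \<le> (\<Sum>i<Suc n. (cmod (x i))\<^sup>2)"
        by (rule member_le_sum) (use that in auto)
      then show ?thesis using x by (simp add: usphere_def power_le_one_iff abs_square_le_1 del: sum.lessThan_Suc)
    qed
    then show "x \<in> PiE UNIV ?S \<inter> usphere n" using x by (auto simp: PiE_UNIV_domain)
  next
    fix x assume x: "x \<in> PiE UNIV ?S \<inter> usphere n"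
    then have "x i \<in> ?S i" for i by blast
    then have "x i = 0" if "n < i" for i using that by (metis not_less_eq singletonD)
    then show "x \<in> usphere n \<inter> {x. \<forall>i. n < i \<longrightarrow> x i = 0}" using x by blast
  qed
  then show ?thesis using compact_Int_closed[OF 1 2] by simp
qed

text \<open>Compactness turns the strict inequality of \<open>norm_sum_sq_less\<close> into a
  uniform gap. The forms see only the leading coordinates, so a point may be replaced by its
  truncation.\<close>

lemma forms_bound:
  assumes "\<And>y. y \<in> usphere n \<times> usphere n' \<Longrightarrow> \<exists>l<2 * m + 1. Re (bilin n n' cf l y) \<noteq> 0"
  shows "\<exists>c0>0. \<forall>y\<in>usphere n \<times> usphere n'. c0 \<le> (sum_norm_sq n n' m cf y)\<^sup>2 - (cmod (sum_sq n n' m cf y))\<^sup>2"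
proof -
  let ?K = "\<lambda>n. usphere n \<inter> {x. \<forall>i. n < i \<longrightarrow> x i = 0}"
  let ?F = "\<lambda>y. (sum_norm_sq n n' m cf y)\<^sup>2 - (cmod (sum_sq n n' m cf y))\<^sup>2"
  define tr where "tr n x = (\<lambda>i. if i \<le> n then x i else (0::complex))" for n :: nat and x
  have tr: "tr k x \<in> ?K k" if "x \<in> usphere k" for k x
    using that by (simp add: usphere_def tr_def)
  have L: "bilin n n' cf l (tr n x, tr n' z) = bilin n n' cf l (x, z)" for l x z
    unfolding bilin_def by (intro sum.cong refl) (auto simp: coord_def tr_def)
  have F: "?F (tr n x, tr n' z) = ?F (x, z)" for x z
    unfolding sum_sq_def sum_norm_sq_def L ..
  have cont: "continuous_on (?K n \<times> ?K n') (bilin n n' cf l)" for l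
  proof -
    have "continuous_on S (\<lambda>y. fst y i)" "continuous_on S (\<lambda>y. snd y i)"
      for S :: "((nat \<Rightarrow> complex) \<times> (nat \<Rightarrow> complex)) set" and i
      by (rule continuous_on_product_then_coordinatewise, intro continuous_intros)+
    then show ?thesis unfolding bilin_def[abs_def] coord_def by (intro continuous_intros)
  qed
  have contF: "continuous_on (?K n \<times> ?K n') ?F"
    unfolding sum_sq_def sum_norm_sq_def by (intro continuous_intros cont)
  have "\<exists>c0>0. \<forall>y\<in>?K n \<times> ?K n'. c0 \<le> ?F y"
  proof (cases "?K n \<times> ?K n' = {}")
    case False
    obtain y0 where y0: "y0 \<in> ?K n \<times> ?K n'" "\<And>y. y \<in> ?K n \<times> ?K n' \<Longrightarrow> ?F y0 \<le> ?F y"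
      using continuous_attains_inf[OF compact_Times[OF compact_usphere compact_usphere] False contF] by blast
    have "cmod (sum_sq n n' m cf y0) < sum_norm_sq n n' m cf y0"
      by (rule norm_sum_sq_less[OF assms]) (use y0 in auto)
    then have "?F y0 > 0" by (simp add: power_strict_mono)
    then show ?thesis using y0(2) by blast
  next
    case True
    show ?thesis unfolding True by (auto intro: exI[of _ 1])
  qed
  then obtain c0 where c0: "c0 > 0" "\<And>y. y \<in> ?K n \<times> ?K n' \<Longrightarrow> c0 \<le> ?F y" by blast
  have "c0 \<le> ?F y" if yy: "y \<in> usphere n \<times> usphere n'" for y
  proof -
    obtain x z where y: "y = (x, z)" "x \<in> usphere n" "z \<in> usphere n'" using yy by auto
    have "c0 \<le> ?F (tr n x, tr n' z)" by (rule c0(2)) (use tr y in blast)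
    then show ?thesis unfolding F y(1) .
  qed
  then show ?thesis using c0(1) by blast
qed

subsection \<open>The forms of a rank-one Kraus representation\<close>

abbreviation lin_comb :: "nat \<Rightarrow> (nat \<Rightarrow> complex) \<Rightarrow> (nat \<Rightarrow> complex ^ 'h) \<Rightarrow> complex ^ 'h" where
  "lin_comb n x b \<equiv> \<Sum>j<Suc n. x j *s b j"

lemma bilin_product:
  assumes "\<And>j k. cf l (j, k) = cinner w (b j) * cnj (cinner w (t k))"
  shows "bilin n n' cf l y = cinner w (lin_comb n (fst y) b) * cnj (cinner w (lin_comb n' (\<lambda>k. cnj (snd y k)) t))"
proof -
  have "bilin n n' cf l y = (\<Sum>j<Suc n. \<Sum>k<Suc n'. (fst y j * cinner w (b j)) * (snd y k * cnj (cinner w (t k))))"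
    unfolding bilin_def sum.cartesian_product by (intro sum.cong refl) (auto simp: assms coord_def)
  also have "\<dots> = (\<Sum>j<Suc n. fst y j * cinner w (b j)) * (\<Sum>k<Suc n'. snd y k * cnj (cinner w (t k)))"
    by (rule sum_product[symmetric])
  finally show ?thesis
    unfolding cinner_sum_right cinner_scale_right cnj_sum complex_cnj_mult complex_cnj_cnj .
qed

lemma bilin_inner:
  assumes "\<And>j k. cf l (j, k) = - \<i> * cnj (cinner (b j) (t k))"
  shows "bilin n n' cf l y = - \<i> * cnj (cinner (lin_comb n (fst y) b) (lin_comb n' (\<lambda>k. cnj (snd y k)) t))"
proof -
  have "bilin n n' cf l y = (\<Sum>j<Suc n. \<Sum>k<Suc n'. - \<i> * (fst y j * (snd y k * cnj (cinner (b j) (t k)))))"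
    unfolding bilin_def sum.cartesian_product by (intro sum.cong refl) (auto simp: assms coord_def)
  also have "\<dots> = - \<i> * (\<Sum>j<Suc n. fst y j * (\<Sum>k<Suc n'. snd y k * cnj (cinner (b j) (t k))))"
    by (simp only: sum_distrib_left)
  also have "(\<Sum>j<Suc n. fst y j * (\<Sum>k<Suc n'. snd y k * cnj (cinner (b j) (t k)))) =
      cnj (cinner (lin_comb n (fst y) b) (lin_comb n' (\<lambda>k. cnj (snd y k)) t))"
    unfolding cinner_sum_left cinner_scale_left unfolding cinner_sum_right cinner_scale_right cnj_sum complex_cnj_mult complex_cnj_cnj ..
  finally show ?thesis .
qed

lemma bilin_zero: "(\<And>j k. cf l (j, k) = 0) \<Longrightarrow> bilin n n' cf l y = 0"
  unfolding bilin_def by (intro sum.neutral) auto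

lemma lin_comb_nonzero:
  assumes b: "\<And>j k. j < Suc n \<Longrightarrow> k < Suc n \<Longrightarrow> b j $ e k = (if j = k then 1 else 0)"
    and x: "x \<in> usphere n"
  shows "lin_comb n x b \<noteq> 0"
proof
  assume 0: "lin_comb n x b = 0"
  have "x k = 0" if k: "k < Suc n" for k
  proof -
    have "0 = lin_comb n x b $ e k" unfolding 0 by simp
    also have "\<dots> = (\<Sum>j<Suc n. x j * b j $ e k)" by (simp del: sum.lessThan_Suc)
    also have "\<dots> = (\<Sum>j<Suc n. if j = k then x j else 0)"
      by (intro sum.cong refl) (use b k in auto)
    also have "\<dots> = x k" using k by (simp del: sum.lessThan_Suc)
    finally show ?thesis by simp
  qed
  then have "(\<Sum>i<Suc n. (cmod (x i))\<^sup>2) = 0" by (intro sum.neutral) auto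
  then show False using x by (simp add: usphere_def del: sum.lessThan_Suc)
qed

text \<open>Listing a prescribed coordinate last lets the remaining n serve as coordinates on a
  hyperplane.\<close>

lemma ex_enumeration:
  fixes i0 :: "'h::finite"
  assumes "CARD('h) = Suc n"
  obtains e :: "nat \<Rightarrow> 'h" where "inj_on e {..<Suc n}" "e n = i0"
proof -
  have "card (UNIV - {i0}) = n" using assms by simp
  with ex_bij_betw_nat_finite[of "UNIV - {i0}"] obtain h where h: "bij_betw h {0..<n} (UNIV - {i0})" by auto
  show ?thesis
  proof
    show "inj_on (h(n := i0)) {..<Suc n}"
      using h by (auto simp: inj_on_def bij_betw_def less_Suc_eq)
    show "(h(n := i0)) n = i0" by simp
  qed
qed

text \<open>
  The form of \<open>v 0\<close> vanishes because the second argument is restricted to the orthogonal complement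
  of \<open>v 0\<close>. Its place is taken by a form whose real part is \<open>Im (cinner x y)\<close>.
\<close>

theorem too_few_forms:
  fixes v :: "nat \<Rightarrow> complex ^ 'h"
  assumes key: "\<And>x y. (\<And>i. i < r \<Longrightarrow> Re (cinner (v i) x * cnj (cinner (v i) y)) = 0) \<Longrightarrow> Im (cinner x y) = 0 \<Longrightarrow> x = 0 \<or> y = 0"
    and d: "CARD('h) = Suc (Suc n)" and v0: "v 0 \<noteq> 0"
    and m: "m + binary_ones (Suc n) = 2 * Suc n" and r: "r \<le> 2 * m + 1"
  shows False
proof -
  obtain i0 where i0: "v 0 $ i0 \<noteq> 0" using v0 by (auto simp: vec_eq_iff)
  obtain e where e: "inj_on e {..<Suc (Suc n)}" "e (Suc n) = i0"
    by (rule ex_enumeration[OF d])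
  define b where "b j = axis (e j) (1::complex)" for j
  \<comment> \<open>A basis of the orthogonal complement of \<open>v 0\<close>: unit vectors
    corrected in the coordinate \<open>i0\<close>, where \<open>v 0\<close> does not vanish.\<close>
  define t where "t k = b k - (cnj (v 0 $ e k) / cnj (v 0 $ i0)) *s axis i0 1" for k
  have b: "b j $ e k = (if j = k then 1 else 0)" if "j < Suc (Suc n)" "k < Suc (Suc n)" for j k
    using that e(1) by (auto simp: b_def axis_def dest: inj_onD)
  have t: "t j $ e k = (if j = k then 1 else 0)" if "j < Suc n" "k < Suc n" for j k
  proof -
    have "e k \<noteq> i0" using that e by (metis inj_onD lessThan_iff less_SucI less_irrefl lessI)
    then show ?thesis using b[of j k] that by (simp add: t_def axis_def)
  qed
  have cax: "cinner w (axis i 1) = cnj (w $ i)" for w :: "complex ^ 'h" and i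
    by (simp add: cinner_def axis_def if_distrib[of "\<lambda>x. _ * x"] cong: if_cong)
  have vt: "cinner (v 0) (t k) = 0" for k
  proof -
    have "cinner (v 0) (t k) = cinner (v 0) (b k) + cinner (v 0) (- ((cnj (v 0 $ e k) / cnj (v 0 $ i0)) *s axis i0 1))"
      unfolding t_def diff_conv_add_uminus by (rule cinner_add_right)
    then show ?thesis using i0 by (simp add: cinner_minus_right cinner_scale_right cax b_def)
  qed
  \<comment> \<open>Coefficients as forms in x and z = cnj y. The zeroth form has real part - Im
    (cinner x y); from r on, zeros fill up the odd number 2 m + 1 of Clifford matrices.\<close>
  define cf where "cf l jk = (if l = 0 then - \<i> * cnj (cinner (b (fst jk)) (t (snd jk)))
    else if l < r then cinner (v l) (b (fst jk)) * cnj (cinner (v l) (t (snd jk))) else 0)" for l :: nat and jk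
  have "\<exists>l<2 * m + 1. Re (bilin (Suc n) n cf l y) \<noteq> 0" if y: "y \<in> usphere (Suc n) \<times> usphere n" for y
  proof (rule ccontr)
    assume "\<not> ?thesis"
    then have re: "Re (bilin (Suc n) n cf l y) = 0" if "l < 2 * m + 1" for l using that by blast
    let ?X = "lin_comb (Suc n) (fst y) b" and ?Y = "lin_comb n (\<lambda>k. cnj (snd y k)) t"
    have "?X \<noteq> 0" by (rule lin_comb_nonzero[OF b]) (use y in auto)
    moreover have "?Y \<noteq> 0" by (rule lin_comb_nonzero[OF t]) (use y in \<open>auto simp: usphere_def\<close>)
    moreover have "?X = 0 \<or> ?Y = 0"
    proof (rule key)
      have "bilin (Suc n) n cf 0 y = - \<i> * cnj (cinner ?X ?Y)"
        by (rule bilin_inner) (simp add: cf_def)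
      then show "Im (cinner ?X ?Y) = 0" using re[of 0] by simp
      fix i assume i: "i < r"
      show "Re (cinner (v i) ?X * cnj (cinner (v i) ?Y)) = 0"
      proof (cases "i = 0")
        case True
        then show ?thesis by (simp only: cinner_sum_right cinner_scale_right vt) simp
      next
        case False
        have "bilin (Suc n) n cf i y = cinner (v i) ?X * cnj (cinner (v i) ?Y)"
          by (rule bilin_product) (use False i in \<open>simp add: cf_def\<close>)
        then show ?thesis using re[of i] i r by simp
      qed
    qed
    ultimately show False by blast
  qed
  from forms_bound[of "Suc n" n m cf, OF this] obtain c0 where c0: "c0 > 0"
    "\<forall>y\<in>usphere (Suc n) \<times> usphere n. c0 \<le> (sum_norm_sq (Suc n) n m cf y)\<^sup>2 - (cmod (sum_sq (Suc n) n m cf y))\<^sup>2" by blast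
  show False by (rule no_elliptic_forms[OF m c0(1)]) (use c0(2) in blast)
qed

text \<open>Restricting only one argument to the complement of \<open>v 0\<close> would break the
  exchange symmetry. So no form is discarded: the extra form takes the index 0 and the Kraus vectors
  are shifted by one, which is why r \<le> 2 m here.\<close>

theorem too_few_symmetric_forms:
  fixes v :: "nat \<Rightarrow> complex ^ 'h"
  assumes key: "\<And>x y. (\<And>i. i < r \<Longrightarrow> Re (cinner (v i) x * cnj (cinner (v i) y)) = 0) \<Longrightarrow> Im (cinner x y) = 0 \<Longrightarrow> x = 0 \<or> y = 0"
    and d: "CARD('h) = Suc n" "even n"
    and m: "m + binary_ones n = 2 * n + 1" "m mod 4 = 2" and r: "r \<le> 2 * m"
  shows False
proof -
  obtain e :: "nat \<Rightarrow> 'h" where e: "inj_on e {..<Suc n}"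
    by (rule ex_enumeration[OF d(1)])
  define b where "b j = axis (e j) (1::complex)" for j
  have b: "b j $ e k = (if j = k then 1 else 0)" if "j < Suc n" "k < Suc n" for j k
    using that e by (auto simp: b_def axis_def dest: inj_onD)
  define cf where "cf l jk = (if l = 0 then - \<i> * cnj (cinner (b (fst jk)) (b (snd jk)))
    else if l \<le> r then cinner (v (l - 1)) (b (fst jk)) * cnj (cinner (v (l - 1)) (b (snd jk))) else 0)" for l :: nat and jk
  let ?X = "\<lambda>y. lin_comb n (fst y) b" and ?Y = "\<lambda>y. lin_comb n (\<lambda>k. cnj (snd y k)) b"
  have L0: "bilin n n cf 0 y = - \<i> * cnj (cinner (?X y) (?Y y))" for y
    by (rule bilin_inner) (simp add: cf_def)
  have Li: "bilin n n cf (Suc i) y = cinner (v i) (?X y) * cnj (cinner (v i) (?Y y))" if "i < r" for i y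
    by (rule bilin_product) (use that in \<open>simp add: cf_def\<close>)
  have Lz: "bilin n n cf l y = 0" if "r < l" for l y
    by (rule bilin_zero) (use that in \<open>simp add: cf_def\<close>)
  have fl: "?X (conj_swap y) = ?Y y" "?Y (conj_swap y) = ?X y" for y by (simp_all add: conj_swap_def)
  have sym: "bilin n n cf l (conj_swap y) = (if l = 0 then -1 else 1) * cnj (bilin n n cf l y)" for l y
  proof -
    consider "l = 0" | i where "l = Suc i" "i < r" | "r < l" by (metis not0_implies_Suc not_less_eq)
    then show ?thesis
    proof cases
      case 1
      have "cnj (cinner (?Y y) (?X y)) = cinner (?X y) (?Y y)" by (rule cinner_commute[symmetric])
      then show ?thesis unfolding 1 L0 fl by (simp del: sum.lessThan_Suc)
    next
      case 2
      then show ?thesis unfolding 2(1) Li[OF 2(2)] fl by simp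
    next
      case 3
      then show ?thesis unfolding Lz[OF 3] by simp
    qed
  qed
  have "\<exists>l<2 * m + 1. Re (bilin n n cf l y) \<noteq> 0" if y: "y \<in> usphere n \<times> usphere n" for y
  proof (rule ccontr)
    assume "\<not> ?thesis"
    then have re: "Re (bilin n n cf l y) = 0" if "l < 2 * m + 1" for l using that by blast
    have "?X y \<noteq> 0" by (rule lin_comb_nonzero[OF b]) (use y in auto)
    moreover have "?Y y \<noteq> 0" by (rule lin_comb_nonzero[OF b]) (use y in \<open>auto simp: usphere_def\<close>)
    moreover have "?X y = 0 \<or> ?Y y = 0"
    proof (rule key)
      show "Im (cinner (?X y) (?Y y)) = 0" using re[of 0] unfolding L0 by simp
      fix i assume i: "i < r"
      then show "Re (cinner (v i) (?X y) * cnj (cinner (v i) (?Y y))) = 0"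
        using re[of "Suc i"] r unfolding Li[OF i] by simp
    qed
    ultimately show False by blast
  qed
  from forms_bound[of n n m cf, OF this] obtain c0 where c0: "c0 > 0"
    "\<forall>y\<in>usphere n \<times> usphere n. c0 \<le> (sum_norm_sq n n m cf y)\<^sup>2 - (cmod (sum_sq n n m cf y))\<^sup>2" by blast
  show False by (rule no_elliptic_symmetric_forms[OF m(1) d(2) m(2) c0(1) _ sym]) (use c0(2) in blast)
qed

theorem corollary8:
  fixes \<Phi> :: "complex ^ 'h ^ 'h \<Rightarrow> complex ^ 'k ^ 'k"
  assumes "CARD('h) > 1"
    and "entanglement_breaking \<Phi>"
  shows "(ebr \<Phi> \<le> N_bound CARD('h) \<longrightarrow> \<not> phase_retrievable \<Phi>) \<and>
    (\<forall>(A :: nat \<Rightarrow> complex ^ 'h ^ 'k) (u :: nat \<Rightarrow> complex ^ 'k) (v :: nat \<Rightarrow> complex ^ 'h).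
       rank_one_kraus_rep \<Phi> (ebr \<Phi>) A \<and>
       (\<forall>i<ebr \<Phi>. A i = ketbra (u i) (v i)) \<and>
       independent_family {..<ebr \<Phi>} (\<lambda>i. ketbra (u i) (u i)) \<and>
       independent_family {..<ebr \<Phi>} (\<lambda>i. ketbra (v i) (v i)) \<longrightarrow>
       rank (\<Sum>i<ebr \<Phi>. kron (transpose (A i)) (adj (A i))) = (\<Sum>i<ebr \<Phi>. (rank (A i))\<^sup>2) \<and>
       (\<Sum>i<ebr \<Phi>. (rank (A i))\<^sup>2) = ebr \<Phi>)"
proof (intro conjI impI allI)
  let ?r = "ebr \<Phi>" and ?d = "CARD('h)"
  assume le: "?r \<le> N_bound ?d"
  have qc: "quantum_channel \<Phi>" using assms(2) by (simp add: entanglement_breaking_def)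
  have "\<exists>A. rank_one_kraus_rep \<Phi> ?r A"
    unfolding ebr_def by (rule LeastI_ex) (use assms(2) in \<open>simp add: entanglement_breaking_def\<close>)
  then obtain A where A: "kraus_rep \<Phi> ?r A" "\<And>i. i < ?r \<Longrightarrow> rank (A i) = 1"
    unfolding rank_one_kraus_rep_def by blast
  have "\<forall>i. \<exists>uv. i < ?r \<longrightarrow> A i = ketbra (fst uv) (snd uv) \<and> snd uv \<noteq> 0"
  proof
    fix i
    show "\<exists>uv. i < ?r \<longrightarrow> A i = ketbra (fst uv) (snd uv) \<and> snd uv \<noteq> 0"
    proof (cases "i < ?r")
      case True
      obtain a b where "A i = ketbra a b" "b \<noteq> 0" by (rule rank_one_ketbra[OF A(2)[OF True]])
      then show ?thesis by (intro exI[of _ "(a, b)"]) simp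
    qed simp
  qed
  then obtain uv where uv: "\<forall>i. i < ?r \<longrightarrow> A i = ketbra (fst (uv i)) (snd (uv i)) \<and> snd (uv i) \<noteq> 0"
    by (rule choice[THEN exE])
  define v where "v i = snd (uv i)" for i
  have Auv: "A i = ketbra (fst (uv i)) (v i)" if "i < ?r" for i using uv that by (simp add: v_def)
  \<comment> \<open>Trace preservation excludes an empty Kraus family, so \<open>v 0\<close> exists
    and can be used to cut down the second sphere.\<close>
  have r: "?r \<noteq> 0"
  proof
    assume "?r = 0"
    then have "(norm x)\<^sup>2 = 0" for x :: "complex ^ 'h"
      using norm_trace_preserving[OF qc A(1), of "\<lambda>i. fst (uv i)" v x] by simp
    from this[of "axis undefined 1"] show False by (simp add: axis_eq_0_iff)
  qed
  then have v0: "v 0 \<noteq> 0" using uv by (simp add: v_def)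
  obtain n where n: "?d = Suc (Suc n)" using less_imp_Suc_add[OF assms(1)] by auto
  define \<alpha> where "\<alpha> = binary_ones (Suc n)"
  have \<alpha>: "\<alpha> \<le> Suc n" unfolding \<alpha>_def by (rule binary_ones_le)
  have N: "N_bound ?d = (if odd ?d \<and> \<alpha> mod 4 = 3 then 4 * Suc n - 2 * \<alpha> + 2
      else if odd ?d \<and> \<alpha> mod 4 = 2 then 4 * Suc n - 2 * \<alpha> + 1 else 4 * Suc n - 2 * \<alpha>)"
  proof -
    have "?d - 1 = Suc n" "2 * (2 * ?d - 2) = 4 * Suc n" using n by simp_all
    then show ?thesis by (simp only: N_bound_def Let_def \<alpha>_def)
  qed
  show "\<not> phase_retrievable \<Phi>"
  proof
    assume pr: "phase_retrievable \<Phi>"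
    have key: "x = 0 \<or> y = 0" if "\<And>i. i < ?r \<Longrightarrow> Re (cinner (v i) x * cnj (cinner (v i) y)) = 0" "Im (cinner x y) = 0" for x y :: "complex ^ 'h"
      by (rule phase_retrievable_forms[OF qc A(1) _ pr _ that(2)]) (erule Auv, erule that(1))
    show False
    proof (cases "odd ?d \<and> \<alpha> mod 4 = 3")
      case True
      \<comment> \<open>Here 2 m is the bound N(d). As d - 1 is even and \<alpha> mod 4 = 3, this m
        is 2 modulo 4.\<close>
      define m where "m = 2 * Suc n + 1 - \<alpha>"
      have m: "m + \<alpha> = 2 * Suc n + 1" using \<alpha> by (simp add: m_def)
      show False
      proof (rule too_few_symmetric_forms[of ?r v])
        show "x = 0 \<or> y = 0" if "\<And>i. i < ?r \<Longrightarrow> Re (cinner (v i) x * cnj (cinner (v i) y)) = 0" "Im (cinner x y) = 0" for x y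
          by (rule key[OF that])
        show "?d = Suc (Suc n)" by (rule n)
        show "even (Suc n)" using True n by simp
        show "m + binary_ones (Suc n) = 2 * Suc n + 1" using m unfolding \<alpha>_def .
        have "odd n" "\<alpha> mod 4 = 3" using True n by simp_all
        then obtain k j where "n = 2 * k + 1" "\<alpha> = 4 * j + 3"
          by (metis oddE mult_div_mod_eq)
        then have "m + 4 * j = 4 * k + 2" using m by simp
        then show "m mod 4 = 2" by presburger
        have "?r \<le> 4 * Suc n - 2 * \<alpha> + 2" using le True unfolding N by simp
        then show "?r \<le> 2 * m" using m \<alpha> by arith
      qed
    next
      case False
      define m where "m = 2 * Suc n - \<alpha>"
      show False
      proof (rule too_few_forms[of ?r v])
        show "m + binary_ones (Suc n) = 2 * Suc n" using \<alpha> by (simp add: m_def flip: \<alpha>_def)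
        \<comment> \<open>Both remaining values of \<open>N_bound\<close> are at most 2 m + 1; for
          odd d with \<alpha> mod 4 = 2 the value is equal to it.\<close>
        have "?r \<le> 4 * Suc n - 2 * \<alpha> + 1" using le False unfolding N by (auto split: if_splits)
        then show "?r \<le> 2 * m + 1" using \<alpha> unfolding m_def by arith
        show "x = 0 \<or> y = 0" if "\<And>i. i < ?r \<Longrightarrow> Re (cinner (v i) x * cnj (cinner (v i) y)) = 0" "Im (cinner x y) = 0" for x y
          by (rule key[OF that])
        show "?d = Suc (Suc n)" by (rule n)
        show "v 0 \<noteq> 0" by (rule v0)
      qed
    qed
  qed
next
  fix A :: "nat \<Rightarrow> complex ^ 'h ^ 'k" and u :: "nat \<Rightarrow> complex ^ 'k" and v :: "nat \<Rightarrow> complex ^ 'h"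
  let ?r = "ebr \<Phi>"
  assume *: "rank_one_kraus_rep \<Phi> ?r A \<and> (\<forall>i<?r. A i = ketbra (u i) (v i)) \<and>
    independent_family {..<?r} (\<lambda>i. ketbra (u i) (u i)) \<and> independent_family {..<?r} (\<lambda>i. ketbra (v i) (v i))"
  have "rank (A i) = 1" if "i < ?r" for i using * that unfolding rank_one_kraus_rep_def by blast
  then show s: "(\<Sum>i<?r. (rank (A i))\<^sup>2) = ?r" by simp
  have "(\<Sum>i<?r. kron (transpose (A i)) (adj (A i))) = (\<Sum>i<?r. kron (transpose (ketbra (u i) (v i))) (adj (ketbra (u i) (v i))))"
    by (intro sum.cong refl) (use * in simp)
  then show "rank (\<Sum>i<?r. kron (transpose (A i)) (adj (A i))) = (\<Sum>i<?r. (rank (A i))\<^sup>2)"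
    unfolding s using rank_kron_sum[of ?r u v] * by simp
qed

end
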